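(* Let $w$ be a (non-empty) binary word of length $n-1$. (a) There is an explicit bijection $\mathrm{Tree}(w)^{*}\to \mathrm{Tree}(w^{*})$ that preserves additional node structure, and the weights of leaves. (b) There is a weight-preserving bijection $\mathrm{Res}(w)^{*}\to \mathrm{Res}(w^{*})$ respecting additional node structure. (c) The Laurent polynomial $x_w^{*}$ is a cluster variable in $\mathcal A(\Sigma)_{w^{*}}$, and $x_w^{*}=x_{w^{*}}$. (d) There are explicit isomorphisms of distributive lattices $\mathbb P_w\xrightarrow{\sim}\mathbb L_{w^{*}}$, $\mathbb A_w\xrightarrow{\sim}\mathbb B_{w^{*}}$, $\mathbb T_w\xrightarrow{\sim}\mathbb S_{w^{*}}$ respecting the additional structure of each lattice. Together with isomorphisms (pairwise mutually inverse in the two directions) between any two of $\mathbb P_w,\mathbb A_w,\mathbb T_w$ and between any two of $\mathbb L_{w^{*}},\mathbb B_{w^{*}},\mathbb S_{w^{*}}$, they form a commutative (prism-shaped) diagram with triangular faces $\{\mathbb P_w,\mathbb A_w,\mathbb T_w\}$ and $\{\mathbb L_{w^*},\mathbb B_{w^*},\mathbb S_{w^*}\}$. Namely, corresponding nodes in the six posets have the same weight, except that the node weights of $\mathbb T_w$ have an additional factor $\frac{1}{x_1x_2\cdots x_n}$ not present in the node weights of the other five. (e) The cluster variable $x_w$ can be written as $$x_w=\frac{1}{x_1\cdots x_n}\sum_{L\in\mathbb L_{w^{*}}}x_L=\frac{1}{x_1\cdots x_n}\sum_{B\in\mathbb B_{w^{*}}}x_B=\frac{1}{x_1\cdots x_n}\sum_{S\in\mathbb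 S_{w^{*}}}x_S .$$ (f) There are isomorphisms of distributive lattices $D_w\cong\mathcal I(C_w)\cong\mathbb P_w$ and $D_{w^{*}}\cong\mathcal I(C_w^{*})\cong\mathbb L_w$. Thus $\mathbb P_w$ and $\mathbb L_w$ are dual to one another in the sense of distributive lattices, i.e. $\mathbb P_w\cong D_w$ and $\mathbb L_w\cong D_{w^*}$.
   Context: **Words.** A word $w=w_1\cdots w_{n-1}$ is a string over $\{a,b\}$. With $a^*=b$, $b^*=a$, the dual word is $w^*=w_1^*w_2w_3^*w_4w_5^*\cdots$ (every odd-indexed letter is switched). **Triangulated polygon $\Sigma_w$.** $\Sigma$ is an $(n+3)$-gon. $\Sigma_w=[\Delta_0,\dots,\Delta_n]$ is built from oriented triangles with edge labels in $\{1,\dots,2n+3\}$; consecutive triangles $\Delta_{i-1},\Delta_i$ are glued along their common edge labelled $i$ ($1\le i\le n$). In clockwise cyclic order the labels are: $\Delta_0:(1,2n,2n+1)$; for $1\le i\le n-1$, $\Delta_i:(i,n+i,i+1)$ if $w_i=a$ and $\Delta_i:(i,i+1,n+i)$ if $w_i=b$; $\Delta_n:(n,2n+2,2n+3)$ if $n-1$ is odd or $w$ ends in $aa$ or $bb$, and $\Delta_n:(n,2n+3,2n+2)$ if $n-1$ is even and $w$ ends in $ab$ or $ba$. The triangulation $\Delta_w$ consists of all these edges; $\delta_i$ is the edge labelled $i$; $\delta_1,\dots,\delta_n$ are the internal diagonals, the others are boundary segments. The quiver $Q_w$ has nodes $1,\dots,2n+3$ (nodes $>n$ frozen) and clockwise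 $3$-cycles inside each triangle. $\mathcal A(\Sigma)_w$ is the (type $A_n$) cluster algebra with initial seed $((x_1,\dots,x_{2n+3}),Q_w)$; its cluster variables correspond to the arcs of $\Sigma$, and flips to seed mutations. Let $a$ be the vertex of $\Delta_0$ not on $\delta_1$, $b$ the vertex of $\Delta_n$ not on $\delta_n$; $\gamma_w$ is the oriented arc from $a$ to $b$ (it crosses all $\delta_i$) and $x_w$ is its cluster variable. For each internal diagonal, $l_i$ (resp. $r_i$) is the endpoint of $\delta_i$ to the left (resp. right) of $\gamma_w$. **Triangle map.** Let $\nabla_i$ be $\Delta_i$ with reversed orientation (same labels). The triangle map sends $[\Delta_0,\Delta_1,\Delta_2,\Delta_3,\dots]$ to $\Sigma_w^*=[\Delta_0,\nabla_1,\Delta_2,\nabla_3,\dots]$, which is $\Sigma_{w^*}$. An edge labelled $i$ in $\Sigma_w^*$ again carries the variable $x_i$. It induces a bijection of angles, and sends an arc of $\Sigma_w$ passing through $\Delta_i,\dots,\Delta_j$ that starts at the vertex of an angle of $\Delta_i$ and ends at the vertex of an angle of $\Delta_j$ to the arc joining the vertices of the corresponding angles and passing through the corresponding triangles. "Respecting additional node structure" for diagrams means corresponding under the triangle map. **Resolutions.** Let $p_i=\gamma_w\cap\delta_i$. Resolving at $p_i$ means replacing the crossing, in a small neighbourhood of $p_i$, by a pair of non-crossing smooth curves in one of the two possible ways. $\mathrm{Res}(w)$ is the set of diagrams obtained by choosing a resolution at each $p_i$. Each resulting curve with distinct endpoints is replaced by the edge of $\Delta_w$ isotopic to it, each closed loop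 by $\varnothing$; the weight $x_r$ is the product of the variables of the resulting edges, with $x_\varnothing=0$. $\mathrm{Tree}(w)$ is the set of binary trees with root the diagram $\gamma_w\subset\Sigma_w$, obtained by repeatedly choosing an unresolved intersection point in each node; the two children are the two resolutions; one halts when all intersection points are resolved. Nodes are weighted by the product of the cluster variables of their arcs (0 if there is a closed loop). **Dual resolutions.** Choose $m_i\in\mathrm{int}(\Delta_i)\cap\gamma_w$, $0\le i\le n$, and let $\gamma_i$ be the part of $\gamma_w$ between $m_{i-1}$ and $m_i$. A slide of $\gamma_w$ at $p_i$: isotope $\gamma_w$, fixing $\gamma_w-\gamma_i$, moving $p_i$ to one of the two endpoints of $\delta_i$ (so that the two halves of $\gamma_i$ meet no arc and have no self-intersection), then delete $\delta_i$. $\mathrm{Res}(w)^*$ is the set of diagrams obtained by choosing a slide at every $p_i$; curves with distinct endpoints are replaced by the edge of $\Delta_w$ with the same endpoints, closed curves by $\varnothing$; weights $x_{r^*}$ are as before. $\mathrm{Tree}(w)^*$ is the set of binary trees with root $\gamma_w\subset\Sigma_w$ obtained by repeatedly choosing an intersection point and taking the two slides as children, halting when a loop is created or all slides are performed. Define $x_w^*=\frac1{x_1\cdots x_n}\sum_{r^*\in\mathrm{Res}(w)^*}x_{r^*}$. **Snake graph $G_w$.** It consists of unit squares (tiles) $T_1,\dots,T_n$ in $\mathbb Z^2$; $T_1$ has SW corner $(0,0)$. Tile $T_i$ with its diagonal of slope $-1$ (NW to SE, labelled $i$) is the image of $[\Delta_{i-1},\Delta_i]$ with $\Delta_{i-1}$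 as the SW half and $\Delta_i$ as the NE half, orientation-preserving for $i$ odd and orientation-reversing for $i$ even; for $T_1$ the vertex $a$ goes to $(0,0)$. $T_{i+1}$ is glued to $T_i$ along the edge labelled $n+i$ (so above or to the right of $T_i$). Deleting the diagonals gives the edge-labelled graph $G_w$. A boundary edge is an edge not shared by two tiles. **$\mathbb P_w$**: perfect matchings of $G_w$, weight $x_P=\prod_{e\in P}x_e$. Minimal element $P_-$: the matching using only boundary edges and containing the S edge of $T_1$. A twist at $T_i$ replaces two opposite edges of $T_i$ lying in $P$ by the other two edges of $T_i$; it is an up-twist if $i$ is odd and horizontal edges are replaced by vertical ones, or $i$ is even and vertical are replaced by horizontal. $P_2$ covers $P_1$ if obtained by one up-twist. **$\mathbb A_w$**: perfect matchings of angles: selections of one angle in each $\Delta_0,\dots,\Delta_n$ such that each angle is at an endpoint of some internal diagonal and no two angles are at the same vertex of $\Sigma$. The weight of an angle is the variable of the opposite edge of its triangle; weight of a matching is the product. A twist at $\delta_i$ replaces two selected angles (one in $\Delta_{i-1}$, one in $\Delta_i$) at opposite endpoints of $\delta_i$ by the other two angles of $\Delta_{i-1},\Delta_i$ at the endpoints of $\delta_i$; it is an up-twist if the angle of $\Delta_i$ moves from $r_i$ to $l_i$ and that of $\Delta_{i-1}$ from $l_i$ to $r_i$. $A_2$ covers $A_1$ if obtained by one up-twist. **$\mathbb T_w$**: $T$-paths: paths $(T_1,\dots,T_{l})$ of edges of $\Delta_w$ from $a$ to $b$ with $l$ odd, odd-indexed edges coloured blue, even-indexed edges red, all edges distinct,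 every red edge crossing $\gamma_w$, and the crossing points of the red edges with $\gamma_w$ occurring along $\gamma_w$ from $a$ to $b$ in the order of the path. Weight: product of variables of blue edges divided by product of variables of red edges. A twist at $\delta_i$ colours two opposite sides of the quadrilateral $[\Delta_{i-1},\Delta_i]$ blue and the other two red (a red and a blue colour on the same edge cancel; an uncoloured boundary edge may not become red). Let $u_{i-1},d_{i-1}$ (resp. $u_i,d_i$) be the edges of $\Delta_{i-1}$ (resp. $\Delta_i$) other than $\delta_i$, $u$ adjacent to $l_i$ and $d$ adjacent to $r_i$; an up-twist colours $d_{i-1},u_i$ red and $d_i,u_{i-1}$ blue. Covering relation: one up-twist. **$\mathbb L_w$**: lattice paths in $G_w$ with $n+1$ unit steps right or up from the SW vertex of $T_1$ to the NE vertex of $T_n$; weight is the product of variables of its edges. $L_2$ covers $L_1$ if obtained by replacing the S and E edges of one tile by its W and N edges. **$\mathbb B_w$**: lattice paths of angles: selections of one angle in each $\Delta_0,\dots,\Delta_n$, each at an endpoint of an internal diagonal, such that at every vertex of $\Sigma$ other than $a,b$ the number of selected angles has the same parity as the number of triangles containing that vertex. Weight: product over angles of the variable of the opposite edge. A flip at $\delta_i$ replaces two selected angles of $\Delta_{i-1},\Delta_i$ at the same endpoint of $\delta_i$ by the two angles at the other endpoint; up-flip: from $l_i$ to $r_i$ if $i$ is odd, from $r_i$ to $l_i$ if $i$ is even. Covering relation: one up-flip. **$\mathbb S_w$**: $S$-paths: paths from $a$ to $b$ consisting of $n+1$ (ordered, not necessarily distinct) edges of $\Delta_w$ with at least one edge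 from each $\Delta_i$; weight is the product of variables. A flip at $\delta_i$ replaces two edges of the path that are sides of the quadrilateral $[\Delta_{i-1},\Delta_i]$ and meet at an endpoint of $\delta_i$ by the other two sides; up-flip: from sides at $r_i$ to sides at $l_i$ if $i$ odd, from sides at $l_i$ to sides at $r_i$ if $i$ even. Covering relation: one up-flip. (The minimal $S$-path starts with $\delta_{2n}$, the maximal one with $\delta_{2n+1}$.) **Distributive lattices.** $C_w$ is the poset on $\{1,\dots,n\}$ with covering relations $i+1\lessdot i$ if $w_i=a$, $i\lessdot i+1$ if $w_i=b$; $C_w^*$ is obtained by reversing the relations for odd $i$ (so $C_w^*=C_{w^*}$). $\mathcal I(C)$ is the lattice of order ideals of $C$; $D_w=\mathcal I(C_w)$, and the distributive lattice dual to $D_w$ is $D_{w^*}$.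
   Formalization: In (a) Tree(w)* and Tree(w* ) use the same halting rule (both variants proved, a loop being a closed curve crossing no diagonal), since different rules give different counts for n≥4; S-paths must have their k-th edge in Δ_k, since otherwise w=aab has an extra path (8,1,1,3,10). *)

theory Defs
  imports
    Complex_Main
    "HOL-Library.FSet"
    "HOL-Library.Poly_Mapping"
    "HOL-Computational_Algebra.Fraction_Field"
    "HOL-Algebra.Lattice"
begin

section \<open>The ambient field\<close>

text \<open>The field of rational functions over the rationals in the variables
  \<open>X 1, X 2, \<dots>\<close>: the fraction field of the polynomial ring \<open>(nat \<Rightarrow>\<^sub>0 nat) \<Rightarrow>\<^sub>0 rat\<close>.\<close>

type_synonym ratfun = "((nat \<Rightarrow>\<^sub>0 nat) \<Rightarrow>\<^sub>0 rat) fract"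

definition X :: "nat \<Rightarrow> ratfun" where
  "X i = Fract (Poly_Mapping.single (Poly_Mapping.single i 1) 1) 1"


section \<open>Words\<close>

datatype letter = LA | LB

type_synonym word = "letter list"

fun switch :: "letter \<Rightarrow> letter" where
  "switch LA = LB"
| "switch LB = LA"

text \<open>The letter \<open>w\<^sub>i\<close> is \<open>w ! (i - 1)\<close>, so odd-indexed letters sit at even list positions.\<close>

definition dual :: "word \<Rightarrow> word" where
  "dual w = map (\<lambda>j. if even j then switch (w ! j) else w ! j) [0..<length w]"

text \<open>The number \<open>n\<close> of internal diagonals; \<open>w\<close> has length \<open>n - 1\<close>.\<close>

definition rank :: "word \<Rightarrow> nat" where
  "rank w = length w + 1"


section \<open>The triangulated polygon\<close>

text \<open>Edge labels of the triangle number \<open>k\<close> in clockwise cyclic order.\<close>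

definition tri :: "word \<Rightarrow> nat \<Rightarrow> nat \<times> nat \<times> nat" where
  "tri w k = (let n = rank w in
     if k = 0 then (1, 2 * n, 2 * n + 1)
     else if k < n then
       (if w ! (k - 1) = LA then (k, n + k, k + 1) else (k, k + 1, n + k))
     else if odd (length w) \<or> w ! (length w - 2) = w ! (length w - 1)
       then (n, 2 * n + 2, 2 * n + 3)
       else (n, 2 * n + 3, 2 * n + 2))"

definition tri_edges :: "word \<Rightarrow> nat \<Rightarrow> nat set" where
  "tri_edges w k = (case tri w k of (x, y, z) \<Rightarrow> {x, y, z})"

text \<open>The edges following and preceding the edge \<open>e\<close> of the triangle \<open>k\<close> clockwise.\<close>

definition nxt :: "word \<Rightarrow> nat \<Rightarrow> nat \<Rightarrow> nat" where
  "nxt w k e = (case tri w k of (x, y, z) \<Rightarrow> if e = x then y else if e = y then z else x)"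

definition prv :: "word \<Rightarrow> nat \<Rightarrow> nat \<Rightarrow> nat" where
  "prv w k e = (case tri w k of (x, y, z) \<Rightarrow> if e = x then z else if e = y then x else y)"

text \<open>An angle \<open>(k, e)\<close> is the angle of the triangle \<open>k\<close> opposite to its edge \<open>e\<close>.  A vertex of
  the polygon is the class of all angles that meet there after gluing.\<close>

type_synonym angle = "nat \<times> nat"
type_synonym vertex = "angle set"

text \<open>Triangles \<open>i - 1\<close> and \<open>i\<close> are both oriented clockwise and lie on different sides of
  \<open>\<delta>\<^sub>i\<close>, so the starting point of \<open>\<delta>\<^sub>i\<close> in one of them is its end point in the other.
  The starting point of \<open>e\<close> is opposite to \<open>nxt e\<close>, the end point is opposite to \<open>prv e\<close>.\<close>

definition glue :: "word \<Rightarrow> (angle \<times> angle) set" where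
  "glue w = (\<Union>i\<in>{1..rank w}.
     {((i - 1, nxt w (i - 1) i), (i, prv w i i)),
      ((i - 1, prv w (i - 1) i), (i, nxt w i i))})"

definition vertex_at :: "word \<Rightarrow> angle \<Rightarrow> vertex" where
  "vertex_at w \<alpha> = (glue w \<union> (glue w)\<inverse>)\<^sup>* `` {\<alpha>}"

definition vertices :: "word \<Rightarrow> vertex set" where
  "vertices w = {vertex_at w (k, e) | k e. k \<le> rank w \<and> e \<in> tri_edges w k}"

text \<open>The set of the two end points of the edge labelled \<open>e\<close>.\<close>

definition ends :: "word \<Rightarrow> nat \<Rightarrow> vertex set" where
  "ends w e = {vertex_at w (k, f) | k f.
     k \<le> rank w \<and> e \<in> tri_edges w k \<and> f \<in> tri_edges w k \<and> f \<noteq> e}"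

text \<open>The end points of \<open>\<gamma>\<^sub>w\<close>.\<close>

definition vertex_a :: "word \<Rightarrow> vertex" where
  "vertex_a w = vertex_at w (0, 1)"

definition vertex_b :: "word \<Rightarrow> vertex" where
  "vertex_b w = vertex_at w (rank w, rank w)"

text \<open>\<open>\<gamma>\<^sub>w\<close> leaves the triangle \<open>i - 1\<close> through \<open>\<delta>\<^sub>i\<close>; seen in that direction the clockwise
  boundary of the triangle traverses \<open>\<delta>\<^sub>i\<close> from left to right.\<close>

definition left_end :: "word \<Rightarrow> nat \<Rightarrow> vertex" where
  "left_end w i = vertex_at w (i - 1, nxt w (i - 1) i)"

definition right_end :: "word \<Rightarrow> nat \<Rightarrow> vertex" where
  "right_end w i = vertex_at w (i - 1, prv w (i - 1) i)"

definition angle_at :: "word \<Rightarrow> nat \<Rightarrow> vertex \<Rightarrow> angle" where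
  "angle_at w k v = (k, THE e. e \<in> tri_edges w k \<and> vertex_at w (k, e) = v)"


section \<open>The cluster algebra\<close>

text \<open>A quiver on the nodes \<open>1, \<dots>, 2 n + 3\<close> without loops and 2-cycles is given by the numbers
  (arrows from \<open>i\<close> to \<open>j\<close>) minus (arrows from \<open>j\<close> to \<open>i\<close>).\<close>

definition arrows :: "word \<Rightarrow> nat \<Rightarrow> nat \<Rightarrow> nat" where
  "arrows w i j = card {k. k \<le> rank w \<and> i \<in> tri_edges w k \<and> j = nxt w k i}"

definition quiver :: "word \<Rightarrow> nat \<Rightarrow> nat \<Rightarrow> int" where
  "quiver w i j = int (arrows w i j) - int (arrows w j i)"

definition mutate_quiver :: "nat \<Rightarrow> (nat \<Rightarrow> nat \<Rightarrow> int) \<Rightarrow> (nat \<Rightarrow> nat \<Rightarrow> int)" where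
  "mutate_quiver k Q = (\<lambda>i j. if i = k \<or> j = k then - Q i j
     else Q i j + max 0 (Q i k) * max 0 (Q k j) - max 0 (Q j k) * max 0 (Q k i))"

definition mutate_vars ::
    "nat \<Rightarrow> nat \<Rightarrow> (nat \<Rightarrow> ratfun) \<Rightarrow> (nat \<Rightarrow> nat \<Rightarrow> int) \<Rightarrow> (nat \<Rightarrow> ratfun)" where
  "mutate_vars m k x Q = x(k :=
     ((\<Prod>i\<in>{1..m}. x i ^ nat (Q i k)) + (\<Prod>i\<in>{1..m}. x i ^ nat (Q k i))) / x k)"

inductive seed :: "word \<Rightarrow> (nat \<Rightarrow> ratfun) \<Rightarrow> (nat \<Rightarrow> nat \<Rightarrow> int) \<Rightarrow> bool" for w where
  initial: "seed w X (quiver w)"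
| mutation: "seed w x Q \<Longrightarrow> k \<in> {1..rank w} \<Longrightarrow>
    seed w (mutate_vars (2 * rank w + 3) k x Q) (mutate_quiver k Q)"

definition cluster_variables :: "word \<Rightarrow> ratfun set" where
  "cluster_variables w = {x k | x Q k. seed w x Q \<and> k \<in> {1..rank w}}"

text \<open>A labelled triangulation assigns to each label an arc, given by its two end points.  In a
  triangulated polygon three pairwise joined vertices always bound a triangle, so the flip of
  the arc \<open>{p, q}\<close> is the arc \<open>{r, s}\<close> joining the two common neighbours of \<open>p\<close> and \<open>q\<close>.\<close>

definition flip :: "word \<Rightarrow> nat \<Rightarrow> (nat \<Rightarrow> vertex set) \<Rightarrow> (nat \<Rightarrow> vertex set) \<Rightarrow> bool" where
  "flip w k T T' \<longleftrightarrow> (\<exists>p q r s. T k = {p, q} \<and> p \<noteq> q \<and> r \<noteq> s \<and>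
     {p, r} \<in> T ` {1..2 * rank w + 3} \<and> {q, r} \<in> T ` {1..2 * rank w + 3} \<and>
     {p, s} \<in> T ` {1..2 * rank w + 3} \<and> {q, s} \<in> T ` {1..2 * rank w + 3} \<and>
     T' = T(k := {r, s}))"

inductive triangulated_seed ::
    "word \<Rightarrow> (nat \<Rightarrow> vertex set) \<Rightarrow> (nat \<Rightarrow> ratfun) \<Rightarrow> (nat \<Rightarrow> nat \<Rightarrow> int) \<Rightarrow> bool" for w where
  initial: "triangulated_seed w (ends w) X (quiver w)"
| mutation: "triangulated_seed w T x Q \<Longrightarrow> k \<in> {1..rank w} \<Longrightarrow> flip w k T T' \<Longrightarrow>
    triangulated_seed w T' (mutate_vars (2 * rank w + 3) k x Q) (mutate_quiver k Q)"

text \<open>The (cluster or frozen) variable of an arc or boundary segment.\<close>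

definition arc_variable :: "word \<Rightarrow> vertex set \<Rightarrow> ratfun" where
  "arc_variable w c = (THE z. \<exists>T x Q k. triangulated_seed w T x Q \<and>
     k \<in> {1..2 * rank w + 3} \<and> T k = c \<and> z = x k)"

definition x_word :: "word \<Rightarrow> ratfun" where
  "x_word w = arc_variable w {vertex_a w, vertex_b w}"

text \<open>The product \<open>x\<^sub>1 \<cdots> x\<^sub>n\<close>.\<close>

definition x_diagonals :: "word \<Rightarrow> ratfun" where
  "x_diagonals w = (\<Prod>i\<in>{1..rank w}. X i)"


section \<open>The triangle map\<close>

text \<open>Labels are kept by the triangle map, so the angle of the triangle \<open>k\<close> opposite to \<open>e\<close> goes to
  the angle of the (possibly reversed) triangle \<open>k\<close> opposite to \<open>e\<close>.  On vertices the map is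
  only defined relative to a triangle.\<close>

definition tri_angle :: "angle \<Rightarrow> angle" where
  "tri_angle \<alpha> = \<alpha>"

definition tri_vertex :: "word \<Rightarrow> nat \<Rightarrow> vertex \<Rightarrow> vertex" where
  "tri_vertex w k v = vertex_at (dual w) (tri_angle (angle_at w k v))"


section \<open>Resolutions and dual resolutions\<close>

text \<open>The curve \<open>(p, j, k, q)\<close> passes through the triangles \<open>j, \<dots>, k\<close>, starting at the vertex \<open>p\<close>
  of the first and ending at the vertex \<open>q\<close> of the last of them; it crosses exactly
  \<open>\<delta>\<^sub>j\<^sub>+\<^sub>1, \<dots>, \<delta>\<^sub>k\<close>.  Up to isotopy and up to the edges of the triangulation away from the
  unresolved crossings, a diagram \<open>(U, C)\<close> consists of the set \<open>U\<close> of the indices of the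
  crossings that are still unresolved and of the set \<open>C\<close> of the curves into which \<open>\<gamma>\<^sub>w\<close> has
  been cut.\<close>

type_synonym curve = "vertex \<times> nat \<times> nat \<times> vertex"
type_synonym diagram = "nat set \<times> curve set"

definition gamma_diagram :: "word \<Rightarrow> diagram" where
  "gamma_diagram w = ({1..rank w}, {(vertex_a w, 0, rank w, vertex_b w)})"

text \<open>Cut the curve crossing \<open>\<delta>\<^sub>i\<close> at \<open>p\<^sub>i\<close>, pulling the part before \<open>p\<^sub>i\<close> to the end point \<open>v\<close> and
  the part after \<open>p\<^sub>i\<close> to the end point \<open>v'\<close> of \<open>\<delta>\<^sub>i\<close>.\<close>

definition cut :: "nat \<Rightarrow> vertex \<Rightarrow> vertex \<Rightarrow> diagram \<Rightarrow> diagram" where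
  "cut i v v' D = (fst D - {i},
     {(p, j, k, q) | p j k q. (p, j, k, q) \<in> snd D \<and> \<not> (j < i \<and> i \<le> k)} \<union>
     {(p, j, i - 1, v) | p j k q. (p, j, k, q) \<in> snd D \<and> j < i \<and> i \<le> k} \<union>
     {(v', i, k, q) | p j k q. (p, j, k, q) \<in> snd D \<and> j < i \<and> i \<le> k})"

datatype side = Lft | Rgt

fun opposite :: "side \<Rightarrow> side" where
  "opposite Lft = Rgt"
| "opposite Rgt = Lft"

definition diag_end :: "word \<Rightarrow> nat \<Rightarrow> side \<Rightarrow> vertex" where
  "diag_end w i s = (case s of Lft \<Rightarrow> left_end w i | Rgt \<Rightarrow> right_end w i)"

text \<open>Smoothing the crossing at \<open>p\<^sub>i\<close> joins the two halves of \<open>\<gamma>\<^sub>w\<close> to the two different halves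
  of \<open>\<delta>\<^sub>i\<close>, in one of two ways.\<close>

definition resolve :: "word \<Rightarrow> nat \<Rightarrow> side \<Rightarrow> diagram \<Rightarrow> diagram" where
  "resolve w i s = cut i (diag_end w i s) (diag_end w i (opposite s))"

text \<open>Sliding \<open>p\<^sub>i\<close> to an end point of \<open>\<delta>\<^sub>i\<close> moves both halves of \<open>\<gamma>\<^sub>w\<close> to the same end point.\<close>

definition slide :: "word \<Rightarrow> nat \<Rightarrow> side \<Rightarrow> diagram \<Rightarrow> diagram" where
  "slide w i s = cut i (diag_end w i s) (diag_end w i s)"

definition Res :: "word \<Rightarrow> diagram set" where
  "Res w = {fold (\<lambda>i. resolve w i (c i)) [1..<rank w + 1] (gamma_diagram w) | c. True}"

definition Res_dual :: "word \<Rightarrow> diagram set" where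
  "Res_dual w = {fold (\<lambda>i. slide w i (c i)) [1..<rank w + 1] (gamma_diagram w) | c. True}"

text \<open>Replace every curve with distinct end points by the edge of the triangulation with the same
  end points, and give a closed curve the weight 0.\<close>

definition curve_weight :: "word \<Rightarrow> curve \<Rightarrow> ratfun" where
  "curve_weight w c = (case c of (p, j, k, q) \<Rightarrow>
     if p = q then 0 else X (THE e. e \<in> {1..2 * rank w + 3} \<and> ends w e = {p, q}))"

definition res_weight :: "word \<Rightarrow> diagram \<Rightarrow> ratfun" where
  "res_weight w r = (\<Prod>c\<in>snd r. curve_weight w c)"

definition x_dual :: "word \<Rightarrow> ratfun" where
  "x_dual w = 1 / x_diagonals w * (\<Sum>r\<in>Res_dual w. res_weight w r)"

definition tri_curve :: "word \<Rightarrow> curve \<Rightarrow> curve" where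
  "tri_curve w c = (case c of (p, j, k, q) \<Rightarrow> (tri_vertex w j p, j, k, tri_vertex w k q))"

definition tri_diagram :: "word \<Rightarrow> diagram \<Rightarrow> diagram" where
  "tri_diagram w D = (fst D, tri_curve w ` snd D)"

text \<open>Trees whose nodes are diagrams; the children of a node are not ordered.\<close>

datatype 'd dtree = DNode (tree_root: 'd) (children: "'d dtree fset")

primrec leaves :: "'d dtree \<Rightarrow> 'd set" where
  "leaves (DNode D ts) = (if ts = {||} then {D} else \<Union> (fset (leaves |`| ts)))"

text \<open>Every branch ends when no crossing is left.  If \<open>h\<close> holds, it also ends as soon as a loop has
  been split off, that is, a closed curve that does not cross any diagonal.  A closed curve that
  still crosses a diagonal is not a loop in this sense: sliding the remaining crossings may
  turn it into non-closed curves.\<close>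

definition halted :: "bool \<Rightarrow> diagram \<Rightarrow> bool" where
  "halted h D \<longleftrightarrow> fst D = {} \<or> h \<and> (\<exists>p i. (p, i, i, p) \<in> snd D)"

inductive_set diagram_trees ::
    "bool \<Rightarrow> (nat \<Rightarrow> side \<Rightarrow> diagram \<Rightarrow> diagram) \<Rightarrow> diagram dtree set"
  for h :: bool and f :: "nat \<Rightarrow> side \<Rightarrow> diagram \<Rightarrow> diagram" where
  leaf: "halted h D \<Longrightarrow> DNode D {||} \<in> diagram_trees h f"
| node: "\<not> halted h D \<Longrightarrow> i \<in> fst D \<Longrightarrow>
    t \<in> diagram_trees h f \<Longrightarrow> tree_root t = f i Lft D \<Longrightarrow>
    t' \<in> diagram_trees h f \<Longrightarrow> tree_root t' = f i Rgt D \<Longrightarrow>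
    DNode D {|t, t'|} \<in> diagram_trees h f"

definition Tree :: "bool \<Rightarrow> word \<Rightarrow> diagram dtree set" where
  "Tree h w = {t \<in> diagram_trees h (resolve w). tree_root t = gamma_diagram w}"

definition Tree_dual :: "bool \<Rightarrow> word \<Rightarrow> diagram dtree set" where
  "Tree_dual h w = {t \<in> diagram_trees h (slide w). tree_root t = gamma_diagram w}"

text \<open>The arcs of a diagram are its curves and the diagonals still to be resolved.\<close>

definition node_weight :: "word \<Rightarrow> diagram \<Rightarrow> ratfun" where
  "node_weight w D =
     (if \<exists>p j k. (p, j, k, p) \<in> snd D then 0
      else (\<Prod>(p, j, k, q)\<in>snd D. arc_variable w {p, q}) * (\<Prod>i\<in>fst D. X i))"


section \<open>The snake graph\<close>

datatype compass = North | East | South | West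

type_synonym point = "int \<times> int"

text \<open>The labels of the sides of the tile \<open>T\<^sub>i\<close>.  Clockwise, the SW half of a tile has the sides
  (diagonal, S, W) and the NE half has the sides (diagonal, N, E).\<close>

definition side_label :: "word \<Rightarrow> nat \<Rightarrow> compass \<Rightarrow> nat" where
  "side_label w i d = (case d of
       South \<Rightarrow> if odd i then nxt w (i - 1) i else prv w (i - 1) i
     | West \<Rightarrow> if odd i then prv w (i - 1) i else nxt w (i - 1) i
     | North \<Rightarrow> if odd i then nxt w i i else prv w i i
     | East \<Rightarrow> if odd i then prv w i i else nxt w i i)"

text \<open>The SW corner of the tile \<open>T\<^sub>i\<close>, for \<open>i \<ge> 1\<close>.\<close>

primrec tile_pos :: "word \<Rightarrow> nat \<Rightarrow> point" where
  "tile_pos w 0 = (0, 0)"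
| "tile_pos w (Suc i) =
     (if i = 0 then (0, 0)
      else let (x, y) = tile_pos w i in
        if side_label w i North = rank w + i then (x, y + 1) else (x + 1, y))"

definition tile_edge :: "word \<Rightarrow> nat \<Rightarrow> compass \<Rightarrow> point set" where
  "tile_edge w i d = (let (x, y) = tile_pos w i in case d of
       South \<Rightarrow> {(x, y), (x + 1, y)}
     | West \<Rightarrow> {(x, y), (x, y + 1)}
     | North \<Rightarrow> {(x, y + 1), (x + 1, y + 1)}
     | East \<Rightarrow> {(x + 1, y), (x + 1, y + 1)})"

definition snake_edges :: "word \<Rightarrow> point set set" where
  "snake_edges w = {tile_edge w i d | i d. i \<in> {1..rank w}}"

definition edge_label :: "word \<Rightarrow> point set \<Rightarrow> nat" where
  "edge_label w E = (THE e. \<exists>i d. i \<in> {1..rank w} \<and> E = tile_edge w i d \<and> e = side_label w i d)"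

text \<open>The edge of the snake graph that is the image of the edge \<open>e\<close> of the triangle \<open>k\<close>, where
  \<open>(k, e)\<close> is also the angle opposite to it.  The triangle \<open>k\<close> is the NE half of \<open>T\<^sub>k\<close> and the
  SW half of \<open>T\<^sub>k\<^sub>+\<^sub>1\<close>.\<close>

definition snake_edge :: "word \<Rightarrow> angle \<Rightarrow> point set" where
  "snake_edge w \<alpha> = (THE E. \<exists>i d. i \<in> {1..rank w} \<and> E = tile_edge w i d \<and>
     side_label w i d = snd \<alpha> \<and>
     (i = fst \<alpha> \<and> d \<in> {North, East} \<or> i = fst \<alpha> + 1 \<and> d \<in> {South, West}))"


section \<open>Lattices\<close>

definition distributive_lattice :: "'a gorder \<Rightarrow> bool" where
  "distributive_lattice L \<longleftrightarrow> lattice L \<and>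
     (\<forall>x\<in>carrier L. \<forall>y\<in>carrier L. \<forall>z\<in>carrier L.
        x \<sqinter>\<^bsub>L\<^esub> (y \<squnion>\<^bsub>L\<^esub> z) = (x \<sqinter>\<^bsub>L\<^esub> y) \<squnion>\<^bsub>L\<^esub> (x \<sqinter>\<^bsub>L\<^esub> z))"

definition lattice_iso :: "'a gorder \<Rightarrow> 'b gorder \<Rightarrow> ('a \<Rightarrow> 'b) \<Rightarrow> bool" where
  "lattice_iso L M f \<longleftrightarrow> distributive_lattice L \<and> distributive_lattice M \<and>
     bij_betw f (carrier L) (carrier M) \<and>
     (\<forall>x\<in>carrier L. \<forall>y\<in>carrier L.
        (x \<sqsubseteq>\<^bsub>L\<^esub> y \<longleftrightarrow> f x \<sqsubseteq>\<^bsub>M\<^esub> f y) \<and>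
        f (x \<squnion>\<^bsub>L\<^esub> y) = f x \<squnion>\<^bsub>M\<^esub> f y \<and> f (x \<sqinter>\<^bsub>L\<^esub> y) = f x \<sqinter>\<^bsub>M\<^esub> f y)"

definition isomorphic_lattices :: "'a gorder \<Rightarrow> 'b gorder \<Rightarrow> bool" where
  "isomorphic_lattices L M \<longleftrightarrow> (\<exists>f. lattice_iso L M f)"

text \<open>The poset on \<open>A\<close> generated by the covering relations in \<open>R\<close>, where \<open>(x, y) \<in> R\<close> means that
  \<open>y\<close> covers \<open>x\<close>.\<close>

definition cover_poset :: "'a set \<Rightarrow> ('a \<times> 'a) set \<Rightarrow> 'a gorder" where
  "cover_poset A R = \<lparr>carrier = A, eq = (=), le = (\<lambda>x y. (x, y) \<in> (R \<inter> A \<times> A)\<^sup>*)\<rparr>"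

definition order_ideals :: "'a gorder \<Rightarrow> 'a set gorder" where
  "order_ideals C = \<lparr>carrier = {I. I \<subseteq> carrier C \<and>
        (\<forall>x\<in>I. \<forall>y\<in>carrier C. y \<sqsubseteq>\<^bsub>C\<^esub> x \<longrightarrow> y \<in> I)},
     eq = (=), le = (\<subseteq>)\<rparr>"

definition word_covers :: "word \<Rightarrow> nat \<Rightarrow> nat \<times> nat" where
  "word_covers w i = (if w ! (i - 1) = LA then (i + 1, i) else (i, i + 1))"

definition C_poset :: "word \<Rightarrow> nat gorder" where
  "C_poset w = cover_poset {1..rank w} {word_covers w i | i. i \<in> {1..<rank w}}"

definition C_star_poset :: "word \<Rightarrow> nat gorder" where
  "C_star_poset w = cover_poset {1..rank w}
     {if odd i then prod.swap (word_covers w i) else word_covers w i | i. i \<in> {1..<rank w}}"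

definition D_lattice :: "word \<Rightarrow> nat set gorder" where
  "D_lattice w = order_ideals (C_poset w)"


section \<open>Expansion posets\<close>

text \<open>\<open>up E i\<close> is the relation of being obtained by one up-twist, up-flip, or upward tile move at
  \<open>T\<^sub>i\<close> or \<open>\<delta>\<^sub>i\<close>.\<close>

record 'a expansion =
  nodes :: "'a set"
  up :: "nat \<Rightarrow> ('a \<times> 'a) set"
  weight :: "'a \<Rightarrow> ratfun"

definition lattice_of :: "word \<Rightarrow> 'a expansion \<Rightarrow> 'a gorder" where
  "lattice_of w E = cover_poset (nodes E) (\<Union>i\<in>{1..rank w}. up E i)"

text \<open>Isomorphisms that also match the up-moves at each index; \<open>n\<close> is the same for \<open>w\<close> and
  its dual.\<close>

definition expansion_iso :: "word \<Rightarrow> 'a expansion \<Rightarrow> word \<Rightarrow> 'b expansion \<Rightarrow> ('a \<Rightarrow> 'b) \<Rightarrow> bool" where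
  "expansion_iso w E w' F f \<longleftrightarrow> lattice_iso (lattice_of w E) (lattice_of w' F) f \<and>
     (\<forall>i\<in>{1..rank w}. \<forall>x\<in>nodes E. \<forall>y\<in>nodes E. (x, y) \<in> up E i \<longleftrightarrow> (f x, f y) \<in> up F i)"

definition inverse_expansion_isos ::
    "word \<Rightarrow> 'a expansion \<Rightarrow> 'b expansion \<Rightarrow> ('a \<Rightarrow> 'b) \<Rightarrow> ('b \<Rightarrow> 'a) \<Rightarrow> bool" where
  "inverse_expansion_isos w E F f g \<longleftrightarrow> expansion_iso w E w F f \<and> expansion_iso w F w E g \<and>
     (\<forall>x\<in>nodes E. g (f x) = x) \<and> (\<forall>y\<in>nodes F. f (g y) = y)"


subsection \<open>Perfect matchings of the snake graph\<close>

definition perfect_matching :: "word \<Rightarrow> point set set \<Rightarrow> bool" where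
  "perfect_matching w P \<longleftrightarrow> P \<subseteq> snake_edges w \<and>
     (\<forall>v\<in>\<Union>(snake_edges w). \<exists>!e. e \<in> P \<and> v \<in> e)"

definition PM_twist :: "word \<Rightarrow> nat \<Rightarrow> (point set set \<times> point set set) set" where
  "PM_twist w i = (let
       H = {tile_edge w i South, tile_edge w i North};
       V = {tile_edge w i West, tile_edge w i East}
     in if odd i then {(P, (P - H) \<union> V) | P. H \<subseteq> P} else {(P, (P - V) \<union> H) | P. V \<subseteq> P})"

definition PM :: "word \<Rightarrow> point set set expansion" where
  "PM w = \<lparr>nodes = {P. perfect_matching w P},
     up = PM_twist w,
     weight = (\<lambda>P. \<Prod>e\<in>P. X (edge_label w e))\<rparr>"


subsection \<open>Lattice paths in the snake graph\<close>

text \<open>A lattice path is the list of the points it visits.\<close>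

definition lattice_path :: "word \<Rightarrow> point list \<Rightarrow> bool" where
  "lattice_path w L \<longleftrightarrow> length L = rank w + 2 \<and> hd L = (0, 0) \<and>
     (let (x, y) = tile_pos w (rank w) in last L = (x + 1, y + 1)) \<and>
     (\<forall>k < rank w + 1. {L ! k, L ! (k + 1)} \<in> snake_edges w \<and>
        (let (x, y) = L ! k in L ! (k + 1) = (x + 1, y) \<or> L ! (k + 1) = (x, y + 1)))"

definition path_edges :: "point list \<Rightarrow> point set set" where
  "path_edges L = {{L ! k, L ! (k + 1)} | k. k + 1 < length L}"

definition LP_move :: "word \<Rightarrow> nat \<Rightarrow> (point list \<times> point list) set" where
  "LP_move w i = (let
       SE = {tile_edge w i South, tile_edge w i East};
       WN = {tile_edge w i West, tile_edge w i North}
     in {(L, L'). SE \<subseteq> path_edges L \<and> path_edges L' = (path_edges L - SE) \<union> WN})"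

definition LP :: "word \<Rightarrow> point list expansion" where
  "LP w = \<lparr>nodes = {L. lattice_path w L},
     up = LP_move w,
     weight = (\<lambda>L. \<Prod>e\<in>path_edges L. X (edge_label w e))\<rparr>"


subsection \<open>Selections of angles\<close>

definition angles :: "word \<Rightarrow> angle set" where
  "angles w = {(k, e). k \<le> rank w \<and> e \<in> tri_edges w k \<and>
     (\<exists>i\<in>{1..rank w}. vertex_at w (k, e) \<in> ends w i)}"

definition angle_selection :: "word \<Rightarrow> angle set \<Rightarrow> bool" where
  "angle_selection w A \<longleftrightarrow> A \<subseteq> angles w \<and> (\<forall>k\<le>rank w. \<exists>!e. (k, e) \<in> A)"

definition angle_weight :: "angle set \<Rightarrow> ratfun" where
  "angle_weight A = (\<Prod>(k, e)\<in>A. X e)"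

text \<open>Replace the angles of the triangles \<open>i - 1\<close> and \<open>i\<close> at \<open>p\<close> and \<open>q\<close> by those at \<open>p'\<close>
  and \<open>q'\<close>.\<close>

definition angle_exchange ::
    "word \<Rightarrow> nat \<Rightarrow> vertex \<Rightarrow> vertex \<Rightarrow> vertex \<Rightarrow> vertex \<Rightarrow> (angle set \<times> angle set) set" where
  "angle_exchange w i p q p' q' =
     {(A, (A - {angle_at w (i - 1) p, angle_at w i q}) \<union> {angle_at w (i - 1) p', angle_at w i q'})
       | A. {angle_at w (i - 1) p, angle_at w i q} \<subseteq> A}"

definition AM :: "word \<Rightarrow> angle set expansion" where
  "AM w = \<lparr>nodes = {A. angle_selection w A \<and> inj_on (vertex_at w) A},
     up = (\<lambda>i. let l = left_end w i; r = right_end w i in angle_exchange w i l r r l),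
     weight = angle_weight\<rparr>"

definition AP :: "word \<Rightarrow> angle set expansion" where
  "AP w = \<lparr>nodes = {B. angle_selection w B \<and>
       (\<forall>v\<in>vertices w - {vertex_a w, vertex_b w}.
          even (card {\<alpha> \<in> B. vertex_at w \<alpha> = v}) \<longleftrightarrow>
          even (card {k. k \<le> rank w \<and> (\<exists>e\<in>tri_edges w k. vertex_at w (k, e) = v)}))},
     up = (\<lambda>i. let l = left_end w i; r = right_end w i in
       if odd i then angle_exchange w i l l r r else angle_exchange w i r r l l),
     weight = angle_weight\<rparr>"


subsection \<open>Paths in the triangulation\<close>

text \<open>A path from \<open>a\<close> to \<open>b\<close>, given by the labels of its edges; \<open>vs\<close> are the visited vertices.\<close>

definition edge_path :: "word \<Rightarrow> nat list \<Rightarrow> bool" where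
  "edge_path w es \<longleftrightarrow> set es \<subseteq> {1..2 * rank w + 3} \<and>
     (\<exists>vs. length vs = length es + 1 \<and> hd vs = vertex_a w \<and> last vs = vertex_b w \<and>
        (\<forall>j<length es. ends w (es ! j) = {vs ! j, vs ! (j + 1)}))"

text \<open>Of the two sides of the triangle \<open>k \<in> {i - 1, i}\<close> other than \<open>\<delta>\<^sub>i\<close>, the one at
  \<open>l\<^sub>i\<close> (\<open>u\<^sub>k\<close>) and the one at \<open>r\<^sub>i\<close> (\<open>d\<^sub>k\<close>).\<close>

definition u_side :: "word \<Rightarrow> nat \<Rightarrow> nat \<Rightarrow> nat" where
  "u_side w i k = (THE e. e \<in> tri_edges w k - {i} \<and> left_end w i \<in> ends w e)"

definition d_side :: "word \<Rightarrow> nat \<Rightarrow> nat \<Rightarrow> nat" where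
  "d_side w i k = (THE e. e \<in> tri_edges w k - {i} \<and> right_end w i \<in> ends w e)"

text \<open>The \<open>j\<close>-th edge of a T-path is \<open>T ! (j - 1)\<close>, so blue edges sit at even list positions.  The
  edges crossing \<open>\<gamma>\<^sub>w\<close> are \<open>\<delta>\<^sub>1, \<dots>, \<delta>\<^sub>n\<close>, in this order along \<open>\<gamma>\<^sub>w\<close>.\<close>

definition T_path :: "word \<Rightarrow> nat list \<Rightarrow> bool" where
  "T_path w T \<longleftrightarrow> edge_path w T \<and> odd (length T) \<and> distinct T \<and>
     (\<forall>j<length T. odd j \<longrightarrow> T ! j \<in> {1..rank w}) \<and>
     (\<forall>j<length T. \<forall>k<length T. odd j \<and> odd k \<and> j < k \<longrightarrow> T ! j < T ! k)"

text \<open>1 for blue, -1 for red, 0 for uncoloured edges.\<close>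

definition colour :: "nat list \<Rightarrow> nat \<Rightarrow> int" where
  "colour T e = int (card {j. j < length T \<and> even j \<and> T ! j = e})
              - int (card {j. j < length T \<and> odd j \<and> T ! j = e})"

definition TP_twist :: "word \<Rightarrow> nat \<Rightarrow> (nat list \<times> nat list) set" where
  "TP_twist w i = {(T, T'). \<forall>e. colour T' e = colour T e
     + of_bool (e \<in> {d_side w i i, u_side w i (i - 1)})
     - of_bool (e \<in> {d_side w i (i - 1), u_side w i i})}"

definition TP :: "word \<Rightarrow> nat list expansion" where
  "TP w = \<lparr>nodes = {T. T_path w T},
     up = TP_twist w,
     weight = (\<lambda>T. (\<Prod>j\<in>{j. j < length T \<and> even j}. X (T ! j)) /
                   (\<Prod>j\<in>{j. j < length T \<and> odd j}. X (T ! j)))\<rparr>"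

text \<open>The \<open>n + 1\<close> edges of an S-path come from the triangles \<open>0, \<dots>, n\<close> in this order.  Merely asking
  for one edge from each triangle, in any order, would admit further paths when \<open>n \<ge> 4\<close>.\<close>

definition S_path :: "word \<Rightarrow> nat list \<Rightarrow> bool" where
  "S_path w S \<longleftrightarrow> edge_path w S \<and> length S = rank w + 1 \<and> (\<forall>k\<le>rank w. S ! k \<in> tri_edges w k)"

definition SP_flip :: "word \<Rightarrow> nat \<Rightarrow> (nat list \<times> nat list) set" where
  "SP_flip w i = (let
       ds = [d_side w i (i - 1), d_side w i i];
       us = [u_side w i (i - 1), u_side w i i]
     in if odd i then {(xs @ ds @ ys, xs @ us @ ys) | xs ys. True}
        else {(xs @ us @ ys, xs @ ds @ ys) | xs ys. True})"

definition SP :: "word \<Rightarrow> nat list expansion" where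
  "SP w = \<lparr>nodes = {S. S_path w S},
     up = SP_flip w,
     weight = (\<lambda>S. \<Prod>j<length S. X (S ! j))\<rparr>"

end

theory Submission
  imports Defs
begin

text \<open>
  Every object in the theorem is governed by a choice of a side for each diagonal, that is, by a set \<open>I\<close> of
  diagonals for which the left end point is chosen.  Resolving the crossings of the arc accordingly leaves one
  curve in each triangle \<open>k\<close>.  It starts at the end point of the diagonal \<open>k\<close> that was not chosen, ends at the
  chosen end point of the diagonal \<open>k + 1\<close>, and is either isotopic to an edge of the triangle, or a loop at the
  vertex shared by the two diagonals.  There are no loops if and only if \<open>I\<close> is an order ideal of \<open>C_poset w\<close>
  (\<open>carrier_order_ideals\<close>), and then \<open>selected w I k\<close> is the label of the edge in the triangle \<open>k\<close>.

  The triangle map reflects every other triangle.  A slide pulls both parts of the arc to the same end point of a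
  diagonal, and exactly one of the two triangles at this diagonal is reflected, so that slides for \<open>w\<close> become
  resolutions for the dual word (\<open>slide_step\<close>).  The map is an involution on the diagrams that occur, which yields
  the bijections between trees and between sets of resolutions.  Weights are preserved because a curve inside one
  triangle is an edge, and edges keep their labels (\<open>tri_curve_edge\<close>).  Read in the polygon of \<open>w\<close>, the selections
  for the dual word are the sequences of edges in which each edge starts where the preceding one ends.

  All six posets are therefore families of sequences of labels, one label in each triangle, indexed by order
  ideals, and their up-moves at \<open>i\<close> insert \<open>i\<close> into the ideal (\<open>modelled\<close>).  Matchings and lattice paths in the snake
  graph consist of the edges drawn for the selected labels, selections of angles consist of the opposite angles, an
  S-path is the sequence of labels itself, and a T-path arises from the path that crosses all diagonals between the
  selected edges by cancelling steps that are taken back at once.  The main work is to show that these constructions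
  reach every element of the posets; each time, a condition such as injectivity, parity or connectedness forces the
  end points of consecutive edges, because one vertex of each diagonal belongs to no later triangle
  (\<open>dead_vertex\<close>).  The isomorphisms match elements with the same index, so they commute, and corresponding weights
  are the same product of variables.

  The expansion formula rests on lambda lengths: the vertices get vectors in the plane whose determinants along the
  edges of the triangulation are the initial variables.  The Pluecker relation for these determinants is the exchange
  relation of a flip (\<open>ptolemy\<close>, \<open>chords_flip\<close>), so every arc has a variable independent of the flips leading to it
  (\<open>arc_variable_eq\<close>).  The sum of the weights of all resolutions then telescopes by the Ptolemy relations of the fan
  at \<open>a\<close> (\<open>sum_resolutions\<close>).  Loops contribute 0, so only order ideals remain (\<open>x_word_expansion\<close>).
\<close>

section \<open>Words, triangles and the edges met by the arc\<close>

lemma opposite_opposite [simp]: "opposite (opposite s) = s"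
  by (cases s) auto

lemma opposite_neq [simp]: "opposite s \<noteq> s" "s \<noteq> opposite s"
  by (cases s; simp)+

lemma neq_iff_opposite: "s \<noteq> t \<longleftrightarrow> s = opposite t"
  by (cases s; cases t) auto

lemma opposite_eq_iff [simp]: "opposite s = opposite t \<longleftrightarrow> s = t"
  by (cases s; cases t) auto

lemma UNIV_side: "(UNIV :: side set) = {Lft, Rgt}"
  using side.exhaust by auto

lemma switch_switch [simp]: "switch (switch c) = c"
  by (cases c) auto

lemma switch_LA_iff [simp]: "switch c = LA \<longleftrightarrow> c \<noteq> LA"
  by (cases c) auto

lemma length_dual [simp]: "length (dual w) = length w"
  by (simp add: dual_def)

lemma rank_dual [simp]: "rank (dual w) = rank w"
  by (simp add: rank_def)

lemma nth_dual: "j < length w \<Longrightarrow> dual w ! j = (if even j then switch (w ! j) else w ! j)"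
  by (simp add: dual_def)

lemma dual_dual [simp]: "dual (dual w) = w"
  by (rule nth_equalityI) (auto simp: nth_dual)

lemma dual_Nil_iff [simp]: "dual w = [] \<longleftrightarrow> w = []"
  by (simp flip: length_0_conv)

text \<open>The diagonals \<open>k\<close> and \<open>k + 1\<close> are two sides of the triangle \<open>k\<close>; \<open>shared w k\<close> tells on which side of
  the arc from \<open>a\<close> to \<open>b\<close> their common end point lies.\<close>

definition shared :: "word \<Rightarrow> nat \<Rightarrow> side" where
  "shared w k = (if w ! (k - 1) = LA then Rgt else Lft)"

text \<open>The sides, other than the diagonal \<open>i\<close>, of the triangles \<open>i - 1\<close> and \<open>i\<close>, named by the end point of the
  diagonal at which they are attached.\<close>

definition side_before :: "word \<Rightarrow> nat \<Rightarrow> side \<Rightarrow> nat" where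
  "side_before w i s = (case s of Lft \<Rightarrow> prv w (i - 1) i | Rgt \<Rightarrow> nxt w (i - 1) i)"

definition side_after :: "word \<Rightarrow> nat \<Rightarrow> side \<Rightarrow> nat" where
  "side_after w i s = (case s of Lft \<Rightarrow> nxt w i i | Rgt \<Rightarrow> prv w i i)"

text \<open>The label of the edge of the triangle \<open>k\<close> that joins the end point on side \<open>s\<close> of the diagonal \<open>k\<close>
  to the end point on side \<open>t\<close> of the diagonal \<open>k + 1\<close>, where the vertices \<open>a\<close> and \<open>b\<close> serve as both
  end points of degenerate diagonals \<open>0\<close> and \<open>n + 1\<close>.  Such an edge exists unless both end points are the
  vertex shared by the two diagonals, which is what \<open>joinable\<close> expresses.\<close>

definition join :: "word \<Rightarrow> nat \<Rightarrow> side \<Rightarrow> side \<Rightarrow> nat" where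
  "join w k s t = (if k = rank w then side_after w k s
     else if 0 < k \<and> s = shared w k then k + 1
     else side_before w (k + 1) t)"

definition joinable :: "word \<Rightarrow> nat \<Rightarrow> side \<Rightarrow> side \<Rightarrow> bool" where
  "joinable w k s t \<longleftrightarrow> (0 < k \<and> k < rank w \<longrightarrow> s \<noteq> shared w k \<or> t \<noteq> shared w k)"

locale nonempty_word =
  fixes w :: word
  assumes nonempty: "w \<noteq> []"
begin

abbreviation n :: nat where "n \<equiv> rank w"

lemma rank_ge_2: "2 \<le> n"
  using nonempty by (cases w) (auto simp: rank_def)

lemma nonempty_dual: "nonempty_word (dual w)"
  using nonempty by (simp add: nonempty_word_def)

lemma tri_0: "tri w 0 = (1, 2 * n, 2 * n + 1)"
  by (simp add: tri_def Let_def)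

lemma tri_mid: "0 < k \<Longrightarrow> k < n \<Longrightarrow>
    tri w k = (if shared w k = Rgt then (k, n + k, k + 1) else (k, k + 1, n + k))"
  by (simp add: tri_def Let_def shared_def)

lemma tri_last_cases:
  obtains "tri w n = (n, 2 * n + 2, 2 * n + 3)" | "tri w n = (n, 2 * n + 3, 2 * n + 2)"
  using rank_ge_2 by (fastforce simp: tri_def Let_def split: if_splits)

lemmas nxt_0 = nxt_def[of w 0, unfolded tri_0] and prv_0 = prv_def[of w 0, unfolded tri_0]

lemma tri_edges_0: "tri_edges w 0 = {1, 2 * n, 2 * n + 1}"
  by (simp add: tri_edges_def tri_0)

lemma tri_edges_mid: "0 < k \<Longrightarrow> k < n \<Longrightarrow> tri_edges w k = {k, k + 1, n + k}"
  by (auto simp: tri_edges_def tri_mid)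

lemma tri_edges_last: "tri_edges w n = {n, 2 * n + 2, 2 * n + 3}"
  by (rule tri_last_cases) (auto simp: tri_edges_def)

lemmas tri_edges = tri_edges_0 tri_edges_mid tri_edges_last

lemma nxt_mid: "0 < k \<Longrightarrow> k < n \<Longrightarrow>
   nxt w k e = (if shared w k = Rgt then (if e = k then n + k else if e = n + k then k + 1 else k)
     else (if e = k then k + 1 else if e = k + 1 then n + k else k))"
  by (auto simp: nxt_def tri_mid)

lemma prv_mid: "0 < k \<Longrightarrow> k < n \<Longrightarrow>
   prv w k e = (if shared w k = Rgt then (if e = k then k + 1 else if e = n + k then k else n + k)
     else (if e = k then n + k else if e = k + 1 then k else k + 1))"
  by (auto simp: prv_def tri_mid)

lemma nxt_in_tri_edges: "k \<le> n \<Longrightarrow> nxt w k e \<in> tri_edges w k"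
  by (auto simp: nxt_def tri_edges_def split: prod.splits)

lemma prv_in_tri_edges: "k \<le> n \<Longrightarrow> prv w k e \<in> tri_edges w k"
  by (auto simp: prv_def tri_edges_def split: prod.splits)

lemma tri_distinct: "k \<le> n \<Longrightarrow> tri w k = (x, y, z) \<Longrightarrow> x \<noteq> y \<and> y \<noteq> z \<and> z \<noteq> x"
  by (insert rank_ge_2; rule tri_last_cases; cases "k = 0"; cases "k = n")
    (auto simp: tri_0 tri_mid split: if_splits)

lemma nxt_prv_distinct: "k \<le> n \<Longrightarrow> e \<in> tri_edges w k \<Longrightarrow>
    nxt w k e \<noteq> e \<and> prv w k e \<noteq> e \<and> nxt w k e \<noteq> prv w k e"
  by (cases "tri w k") (auto simp: nxt_def prv_def tri_edges_def dest: tri_distinct)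

lemma tri_edges_nxt_prv: "k \<le> n \<Longrightarrow> e \<in> tri_edges w k \<Longrightarrow> tri_edges w k = {e, nxt w k e, prv w k e}"
  by (auto simp: nxt_def prv_def tri_edges_def split: prod.splits)

lemma diagonal_in_tri_edges: "k \<le> n \<Longrightarrow> 0 < k \<Longrightarrow> k \<in> tri_edges w k"
    "k < n \<Longrightarrow> Suc k \<in> tri_edges w k"
  by (cases "k = 0"; cases "k = n"; use rank_ge_2 in \<open>force simp: tri_edges\<close>)+

lemma side_before_1: "side_before w 1 Lft = 2 * n + 1" "side_before w 1 Rgt = 2 * n"
    "side_before w (Suc 0) Lft = 2 * n + 1" "side_before w (Suc 0) Rgt = 2 * n"
  using rank_ge_2 by (auto simp: side_before_def nxt_0 prv_0)

lemma side_before_Suc: "0 < k \<Longrightarrow> k < n \<Longrightarrow>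
    side_before w (Suc k) t = (if t = shared w k then k else n + k)"
  using rank_ge_2 by (cases t; cases "shared w k") (auto simp: side_before_def nxt_mid prv_mid)

lemma side_after_mid: "0 < k \<Longrightarrow> k < n \<Longrightarrow>
    side_after w k s = (if s = shared w k then k + 1 else n + k)"
  using rank_ge_2 by (cases s; cases "shared w k") (auto simp: side_after_def nxt_mid prv_mid)

lemma side_after_last_cases:
  obtains "side_after w n Lft = 2 * n + 2" "side_after w n Rgt = 2 * n + 3"
  | "side_after w n Lft = 2 * n + 3" "side_after w n Rgt = 2 * n + 2"
  by (rule tri_last_cases) (auto simp: side_after_def nxt_def prv_def)

lemma join_0: "join w 0 s t = (if t = Lft then 2 * n + 1 else 2 * n)"
  using rank_ge_2 by (cases t) (auto simp: join_def side_before_1)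

lemma join_mid: "0 < k \<Longrightarrow> k < n \<Longrightarrow>
    join w k s t = (if s = shared w k then k + 1 else if t = shared w k then k else n + k)"
  by (auto simp: join_def side_before_Suc)

lemma join_last: "join w n s t = side_after w n s"
  by (simp add: join_def)

lemma join_in_tri_edges: "k \<le> n \<Longrightarrow> join w k s t \<in> tri_edges w k"
  by (insert rank_ge_2; rule side_after_last_cases; cases s; cases "k = 0"; cases "k = n")
    (auto simp: tri_edges join_0 join_mid join_last)

lemma joinable_0 [simp]: "joinable w 0 s t" and joinable_last [simp]: "joinable w n s t"
  by (auto simp: joinable_def)

lemma joinable_mid: "0 < k \<Longrightarrow> k < n \<Longrightarrow> joinable w k s t \<longleftrightarrow> s \<noteq> shared w k \<or> t \<noteq> shared w k"
  by (auto simp: joinable_def)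

text \<open>Of the four pairs of end points of the diagonals bounding an inner triangle, the one consisting of the
  shared vertex twice is excluded, and the other three correspond to the edges of the triangle.  In the first and
  the last triangle, \<open>a\<close> or \<open>b\<close> replaces both end points of the missing diagonal, whose side is thus
  undetermined.\<close>

lemma join_cancel:
  assumes "k \<le> n" "joinable w k s t" "joinable w k s' t'" "join w k s t = join w k s' t'"
  shows "0 < k \<Longrightarrow> s = s'" "k < n \<Longrightarrow> t = t'"
proof -
  consider "k = 0" | "0 < k" "k < n" | "k = n" using assms(1) by linarith
  then have "(0 < k \<longrightarrow> s = s') \<and> (k < n \<longrightarrow> t = t')"
  proof cases
    case 1 then show ?thesis using assms(4) by (cases t; cases t'; simp add: join_0)
  next
    case 2 then show ?thesis using assms(2-4)
      by (cases "shared w k"; cases s; cases s'; cases t; cases t'; simp add: join_mid joinable_mid)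
  next
    case 3 then show ?thesis using assms(4)
      by (rule_tac side_after_last_cases; cases s; cases s'; simp add: join_last)
  qed
  then show "0 < k \<Longrightarrow> s = s'" "k < n \<Longrightarrow> t = t'" by auto
qed

lemma exists_join:
  assumes "k \<le> n" "e \<in> tri_edges w k" "k = 0 \<longrightarrow> e \<noteq> 1" "k = n \<longrightarrow> e \<noteq> n"
  obtains s t where "joinable w k s t" "join w k s t = e"
proof -
  consider "k = 0" | "0 < k" "k < n" | "k = n" using assms(1) by linarith
  then have "\<exists>s t. joinable w k s t \<and> join w k s t = e"
  proof cases
    case 1 then show ?thesis using assms by (auto simp: tri_edges join_0)
  next
    case 2
    let ?s = "shared w k"
    have "joinable w k ?s (opposite ?s)" "joinable w k (opposite ?s) ?s"
      "joinable w k (opposite ?s) (opposite ?s)" using 2 by (auto simp: joinable_mid)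
    moreover have "e \<in> {join w k ?s (opposite ?s), join w k (opposite ?s) ?s,
       join w k (opposite ?s) (opposite ?s)}" using assms(2) 2 by (auto simp: tri_edges join_mid)
    ultimately show ?thesis by blast
  next
    case 3 then show ?thesis using assms
      by (rule_tac side_after_last_cases) (auto simp: tri_edges join_last)
  qed
  then show ?thesis using that by blast
qed

lemma tri_edges_disjoint: "j < k \<Longrightarrow> k \<le> n \<Longrightarrow> e \<in> tri_edges w j \<Longrightarrow> e \<in> tri_edges w k \<Longrightarrow>
    e = k \<and> k = Suc j"
  using rank_ge_2 by (cases "j = 0"; cases "k = n") (auto simp: tri_edges)

lemma tri_edges_range: "k \<le> n \<Longrightarrow> e \<in> tri_edges w k \<Longrightarrow> e \<in> {1..2 * n + 3}"
  using rank_ge_2 by (cases "k = 0"; cases "k = n") (auto simp: tri_edges)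

lemma exists_tri_edges: assumes "e \<in> {1..2 * n + 3}"
  obtains k where "k \<le> n" "e \<in> tri_edges w k"
proof -
  consider "e \<le> n" | "n < e" "e < 2 * n" | "2 * n \<le> e" "e \<le> 2 * n + 1" | "2 * n + 2 \<le> e"
    using assms by fastforce
  then show ?thesis
  proof cases
    case 1 then show ?thesis using that[of e] diagonal_in_tri_edges(1)[of e] assms by auto
  next
    case 2 then show ?thesis using that[of "e - n"] by (auto simp: tri_edges)
  next
    case 3 then have "e = 2 * n \<or> e = 2 * n + 1" by linarith
    then show ?thesis using that[of 0] by (auto simp: tri_edges)
  next
    case 4 then have "e = 2 * n + 2 \<or> e = 2 * n + 3" using assms by auto
    then show ?thesis using that[of n] by (auto simp: tri_edges)
  qed
qed

end

subsection \<open>The dual word\<close>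

lemma shared_dual: "0 < k \<Longrightarrow> k < rank w \<Longrightarrow>
    shared (dual w) k = (if odd k then opposite (shared w k) else shared w k)"
  by (auto simp: shared_def nth_dual rank_def)

context nonempty_word
begin

text \<open>The last triangle is oriented in such a way that it is reversed exactly if its number is odd, like all
  other triangles.\<close>

lemma tri_dual:
  assumes "k \<le> n" "tri w k = (x, y, z)"
  shows "tri (dual w) k = (if odd k then (x, z, y) else (x, y, z))"
proof -
  consider "k = 0" | "0 < k" "k < n" | "k = n" using assms(1) by linarith
  then show ?thesis
  proof cases
    case 1 then show ?thesis using assms(2) by (simp add: tri_0 nonempty_word.tri_0[OF nonempty_dual])
  next
    case 2 then show ?thesis using assms(2)
      by (cases "shared w k")
        (auto simp: tri_mid nonempty_word.tri_mid[OF nonempty_dual] shared_dual split: if_splits)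
  next
    case 3
    have *: "even (length w) \<Longrightarrow>
        dual w ! (length w - 2) = dual w ! (length w - 1) \<longleftrightarrow> w ! (length w - 2) \<noteq> w ! (length w - 1)"
      using nonempty by (cases "w ! (length w - 2)"; cases "w ! (length w - 1)")
        (auto simp: nth_dual)
    show ?thesis using assms(2) 3 * by (auto simp: tri_def rank_def Let_def split: if_splits)
  qed
qed

lemma tri_edges_dual: "k \<le> n \<Longrightarrow> tri_edges (dual w) k = tri_edges w k"
  by (cases "tri w k") (auto simp: tri_edges_def tri_dual)

lemma nxt_dual: "k \<le> n \<Longrightarrow> e \<in> tri_edges w k \<Longrightarrow>
     nxt (dual w) k e = (if odd k then prv w k e else nxt w k e)"
  by (cases "tri w k") (auto simp: tri_edges_def nxt_def prv_def tri_dual dest: tri_distinct)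

lemma prv_dual: "k \<le> n \<Longrightarrow> e \<in> tri_edges w k \<Longrightarrow>
     prv (dual w) k e = (if odd k then nxt w k e else prv w k e)"
  by (cases "tri w k") (auto simp: tri_edges_def nxt_def prv_def tri_dual dest: tri_distinct)

lemma side_before_dual: "0 < i \<Longrightarrow> i \<le> n \<Longrightarrow>
    side_before (dual w) i s = side_before w i (if odd i then s else opposite s)"
  using diagonal_in_tri_edges(2)[of "i - 1"]
  by (cases s) (auto simp: side_before_def nxt_dual prv_dual)

lemma side_after_dual: "0 < i \<Longrightarrow> i \<le> n \<Longrightarrow>
    side_after (dual w) i s = side_after w i (if odd i then opposite s else s)"
  using diagonal_in_tri_edges(1)[of "i"]
  by (cases s) (auto simp: side_after_def nxt_dual prv_dual)

lemma join_dual: "k \<le> n \<Longrightarrow>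
    join (dual w) k s t = (if odd k then join w k (opposite s) (opposite t) else join w k s t)"
  using rank_ge_2 by (cases "k = 0"; cases "k = n")
   (auto simp: join_def shared_dual side_before_dual side_after_dual, (metis neq_iff_opposite)+)

lemma joinable_dual: "k \<le> n \<Longrightarrow>
    joinable (dual w) k s t = (if odd k then joinable w k (opposite s) (opposite t) else joinable w k s t)"
  by (auto simp: joinable_def shared_dual; metis neq_iff_opposite)

end

section \<open>Coordinates for the vertices of the polygon\<close>

text \<open>Cutting the polygon open next to \<open>b\<close> turns the cyclic order of its vertices into a linear order.  The
  vertex \<open>a\<close> gets the coordinate 0; the vertex that the triangle \<open>k > 0\<close> adds to the triangles before it gets
  \<open>- (k + 1)\<close> or \<open>k + 1\<close>, depending on the side of the arc it lies on.  The value \<open>pt w k s\<close> is the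
  coordinate of the end point on side \<open>s\<close> of the diagonal \<open>k\<close>, where the vertices \<open>a\<close> and \<open>b\<close> again count as
  degenerate diagonals \<open>0\<close> and \<open>n + 1\<close>.\<close>

fun pt :: "word \<Rightarrow> nat \<Rightarrow> side \<Rightarrow> int" where
  "pt w 0 s = 0"
| "pt w (Suc k) s = (if k = rank w then int (Suc k)
     else if 0 < k \<and> s = shared w k then pt w k s
     else if s = Lft then - int (Suc k) else int (Suc k))"

definition positions :: "word \<Rightarrow> int set" where
  "positions w = {pt w k s | k s. k \<le> rank w + 1}"

definition angle_pos :: "word \<Rightarrow> angle \<Rightarrow> int" where
  "angle_pos w \<alpha> = (case \<alpha> of (k, e) \<Rightarrow>
     if k = 0 then (if e = 1 then 0 else if e = 2 * rank w then - 1 else 1)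
     else if e = k then pt w (Suc k) (opposite (shared w k))
     else if e = prv w k k then pt w k Lft else pt w k Rgt)"

text \<open>The vertex with a given coordinate, represented by the first angle at it.\<close>

definition vert :: "word \<Rightarrow> int \<Rightarrow> vertex" where
  "vert w p = vertex_at w
     (if p = 0 then (0, 1) else if p = - 1 then (0, 2 * rank w) else if p = 1 then (0, 2 * rank w + 1)
      else (nat \<bar>p\<bar> - 1, nat \<bar>p\<bar> - 1))"

definition valid_angle :: "word \<Rightarrow> angle \<Rightarrow> bool" where
  "valid_angle w \<alpha> \<longleftrightarrow> fst \<alpha> \<le> rank w \<and> snd \<alpha> \<in> tri_edges w (fst \<alpha>)"

definition edge_pos :: "word \<Rightarrow> nat \<Rightarrow> nat \<Rightarrow> int set" where
  "edge_pos w k e = (\<lambda>f. angle_pos w (k, f)) ` (tri_edges w k - {e})"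

lemma vertex_at_glue:
  assumes "(\<alpha>, \<beta>) \<in> glue w" shows "vertex_at w \<alpha> = vertex_at w \<beta>"
proof -
  let ?R = "glue w \<union> (glue w)\<inverse>"
  have "(\<alpha>, \<beta>) \<in> ?R" "(\<beta>, \<alpha>) \<in> ?R" using assms by auto
  then show ?thesis unfolding vertex_at_def
    by (auto intro: converse_rtrancl_into_rtrancl)
qed

context nonempty_word
begin

lemma pt_bounds: "0 < k \<Longrightarrow> k \<le> n \<Longrightarrow>
   pt w k Lft < 0 \<and> - int k \<le> pt w k Lft \<and> 0 < pt w k Rgt \<and> pt w k Rgt \<le> int k"
proof (induction k)
  case (Suc k) then show ?case by (cases "k = 0") (auto split: if_splits)
qed simp

lemma pt_last [simp]: "pt w (Suc n) s = int n + 1"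
  by simp

lemma pt_1 [simp]: "pt w (Suc 0) Lft = - 1" "pt w (Suc 0) Rgt = 1"
  using rank_ge_2 by auto

lemma pt_shared: "0 < k \<Longrightarrow> k < n \<Longrightarrow> pt w (Suc k) (shared w k) = pt w k (shared w k)"
  by simp

lemma pt_new: "0 < k \<Longrightarrow> k < n \<Longrightarrow>
   pt w (Suc k) (opposite (shared w k)) = (if shared w k = Rgt then - int (Suc k) else int (Suc k))"
  by (cases "shared w k") auto

lemma pt_mono:
  assumes "0 < j" "j \<le> k" "k \<le> n"
  shows "pt w k Lft \<le> pt w j Lft \<and> pt w j Rgt \<le> pt w k Rgt"
  using assms(2,3)
proof (induction k rule: dec_induct)
  case (step k)
  then show ?case using pt_bounds[of k] assms(1) by auto
qed auto

text \<open>The coordinates within the interval cut off by the diagonal \<open>k\<close> are those of the vertices before it.\<close>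

lemma pt_outside:
  assumes "0 < j" "j \<le> k" "k \<le> n + 1"
  shows "pt w k s \<le> pt w j Lft \<or> pt w j Rgt \<le> pt w k s"
proof (cases "k = n + 1")
  case True then show ?thesis using pt_bounds[of j] assms by (cases "j = n + 1") auto
next
  case False then show ?thesis using pt_mono[OF assms(1,2)] assms by (cases s) auto
qed

lemma pt_inside:
  assumes "0 < k" "j \<le> k" "k \<le> n"
  shows "pt w k Lft \<le> pt w j s \<and> pt w j s \<le> pt w k Rgt"
proof (cases "j = 0")
  case True then show ?thesis using pt_bounds[of k] assms by auto
next
  case False then show ?thesis using pt_mono[of j k] pt_bounds[of j] pt_bounds[of k] assms by (cases s) auto
qed

lemma pt_in_positions: "k \<le> n + 1 \<Longrightarrow> pt w k s \<in> positions w"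
  by (auto simp: positions_def)

lemma finite_positions: "finite (positions w)"
proof -
  have "positions w = (\<lambda>(k, s). pt w k s) ` ({..n + 1} \<times> {Lft, Rgt})"
    unfolding positions_def using UNIV_side by (auto simp: image_def)
  then show ?thesis by simp
qed

lemma angle_pos_after:
  assumes "0 < k" "k \<le> n"
  shows "angle_pos w (k, k) = pt w (Suc k) (opposite (shared w k))"
    "angle_pos w (k, prv w k k) = pt w k Lft" "angle_pos w (k, nxt w k k) = pt w k Rgt"
  using nxt_prv_distinct[of k k] diagonal_in_tri_edges(1)[of k] assms by (auto simp: angle_pos_def)

lemma angle_pos_before:
  assumes "k < n"
  shows "angle_pos w (k, nxt w k (Suc k)) = pt w (Suc k) Lft"
    "angle_pos w (k, prv w k (Suc k)) = pt w (Suc k) Rgt"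
    "angle_pos w (k, Suc k) = pt w k (if shared w k = Lft then Rgt else Lft)"
  using assms rank_ge_2
  by (cases "k = 0"; cases "shared w k"; simp add: angle_pos_def nxt_0 prv_0 nxt_mid prv_mid)+

lemma angle_pos_0: "angle_pos w (0, 1) = 0" "angle_pos w (0, Suc 0) = 0"
   "angle_pos w (0, 2 * n) = - 1" "angle_pos w (0, Suc (2 * n)) = 1"
  using rank_ge_2 by (auto simp: angle_pos_def)

lemma angle_pos_cases:
  assumes "k \<le> n" "e \<in> tri_edges w k"
  obtains "k = 0" "e = 1" | "k = 0" "e = 2 * n" | "k = 0" "e = 2 * n + 1"
    | "0 < k" "e = k" | "0 < k" "e = prv w k k" | "0 < k" "e = nxt w k k"
  using assms tri_edges_nxt_prv[of k k] diagonal_in_tri_edges(1)[of k] tri_edges_0 by (cases "k = 0") auto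

lemma angle_pos_in_positions: "valid_angle w \<alpha> \<Longrightarrow> angle_pos w \<alpha> \<in> positions w"
proof -
  assume "valid_angle w \<alpha>"
  then obtain k e where *: "\<alpha> = (k, e)" "k \<le> n" "e \<in> tri_edges w k"
    by (cases \<alpha>) (auto simp: valid_angle_def)
  from *(2,3) show ?thesis
    by (rule angle_pos_cases) (use *(1,2) rank_ge_2 pt_in_positions[of 0 Lft] pt_in_positions[of 1 Lft]
      pt_in_positions[of 1 Rgt] pt_in_positions[of k] pt_in_positions[of "Suc k"] in
      \<open>simp_all add: angle_pos_0 angle_pos_after del: pt.simps(2)\<close>)
qed

lemma valid_angle_glue:
  assumes "(\<alpha>, \<beta>) \<in> glue w"
  shows "valid_angle w \<alpha> \<and> valid_angle w \<beta> \<and> angle_pos w \<alpha> = angle_pos w \<beta>"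
proof -
  obtain i where i: "i \<in> {1..n}" "(\<alpha>, \<beta>) = ((i - 1, nxt w (i - 1) i), (i, prv w i i)) \<or>
      (\<alpha>, \<beta>) = ((i - 1, prv w (i - 1) i), (i, nxt w i i))"
    using assms by (auto simp: glue_def)
  then show ?thesis
    using angle_pos_before[of "i - 1"] angle_pos_after[of i]
    by (auto simp: valid_angle_def nxt_in_tri_edges prv_in_tri_edges simp del: pt.simps(2))
qed

lemma vertex_at_invariant:
  assumes "\<beta> \<in> vertex_at w \<alpha>" "valid_angle w \<alpha>"
  shows "valid_angle w \<beta> \<and> angle_pos w \<beta> = angle_pos w \<alpha>"
proof -
  have "(\<alpha>, \<beta>) \<in> (glue w \<union> (glue w)\<inverse>)\<^sup>*" using assms(1) by (simp add: vertex_at_def)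
  then show ?thesis
    by (induction rule: rtrancl_induct) (use assms(2) valid_angle_glue in auto)
qed

lemma glue_intros:
  assumes "k < n"
  shows "((k, nxt w k (Suc k)), (Suc k, prv w (Suc k) (Suc k))) \<in> glue w"
    "((k, prv w k (Suc k)), (Suc k, nxt w (Suc k) (Suc k))) \<in> glue w"
  using assms by (auto simp: glue_def intro!: bexI[of _ "Suc k"])

lemma vertex_at_eq_vert:
  "k \<le> n \<Longrightarrow> e \<in> tri_edges w k \<Longrightarrow> vertex_at w (k, e) = vert w (angle_pos w (k, e))"
proof (induction k arbitrary: e)
  case 0
  then show ?case using rank_ge_2 by (auto simp: tri_edges_0 angle_pos_0 vert_def)
next
  case (Suc k)
  from Suc.prems show ?case
  proof (rule angle_pos_cases)
    assume "e = Suc k"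
    then show ?thesis using Suc.prems rank_ge_2
      by (cases "shared w (Suc k)") (auto simp: angle_pos_after vert_def nat_add_distrib)
  next
    assume *: "e = prv w (Suc k) (Suc k)"
    have "vertex_at w (Suc k, e) = vertex_at w (k, nxt w k (Suc k))"
      using vertex_at_glue[OF glue_intros(1)[of k]] Suc.prems * by simp
    also have "\<dots> = vert w (angle_pos w (k, nxt w k (Suc k)))"
      using Suc by (simp add: nxt_in_tri_edges)
    finally show ?thesis using Suc.prems by (simp add: * angle_pos_before angle_pos_after del: pt.simps(2))
  next
    assume *: "e = nxt w (Suc k) (Suc k)"
    have "vertex_at w (Suc k, e) = vertex_at w (k, prv w k (Suc k))"
      using vertex_at_glue[OF glue_intros(2)[of k]] Suc.prems * by simp
    also have "\<dots> = vert w (angle_pos w (k, prv w k (Suc k)))"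
      using Suc by (simp add: prv_in_tri_edges)
    finally show ?thesis using Suc.prems by (simp add: * angle_pos_before angle_pos_after del: pt.simps(2))
  qed auto
qed

lemma diag_end_eq: "0 < i \<Longrightarrow> i \<le> n \<Longrightarrow> diag_end w i s = vert w (pt w i s)"
  using angle_pos_before[of "i - 1"]
  by (cases s) (auto simp: diag_end_def left_end_def right_end_def vertex_at_eq_vert nxt_in_tri_edges
    prv_in_tri_edges simp del: pt.simps(2))

lemma vertex_a_eq: "vertex_a w = vert w 0"
  by (simp add: vertex_a_def vertex_at_eq_vert tri_edges_0 angle_pos_0)

lemma vertex_b_eq: "vertex_b w = vert w (int n + 1)"
  using rank_ge_2 by (simp add: add.commute vertex_b_def vertex_at_eq_vert tri_edges_last angle_pos_after)

lemma positions_angle: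
  assumes "p \<in> positions w"
  obtains k e where "k \<le> n" "e \<in> tri_edges w k" "angle_pos w (k, e) = p"
proof -
  obtain k s where k: "p = pt w k s" "k \<le> n + 1" using assms by (auto simp: positions_def)
  consider "k = 0" | "0 < k" "k \<le> n" | "k = Suc n" using k(2) by fastforce
  then show thesis
  proof cases
    case 1 then show ?thesis using that[of 0 1] k by (simp add: tri_edges_0 angle_pos_0)
  next
    case 2 then show ?thesis
      using that[of k "prv w k k"] that[of k "nxt w k k"] k(1) angle_pos_after[of k]
        nxt_in_tri_edges[of k k] prv_in_tri_edges[of k k] by (cases s) simp_all
  next
    case 3 then show ?thesis using that[of n n] k rank_ge_2 by (simp add: tri_edges_last angle_pos_after)
  qed
qed

text \<open>Gluing preserves coordinates, so they can be read off from the class of an angle.\<close>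

lemma inj_vert: "inj_on (vert w) (positions w)"
proof (rule inj_onI)
  fix p q assume "p \<in> positions w" "q \<in> positions w" and eq: "vert w p = vert w q"
  then obtain k e j f where *: "k \<le> n" "e \<in> tri_edges w k" "angle_pos w (k, e) = p"
    "j \<le> n" "f \<in> tri_edges w j" "angle_pos w (j, f) = q" by (metis positions_angle)
  have "vertex_at w (k, e) = vertex_at w (j, f)" using * eq by (simp add: vertex_at_eq_vert)
  then have "(j, f) \<in> vertex_at w (k, e)" by (simp add: vertex_at_def)
  then show "p = q" using vertex_at_invariant[of "(j, f)" "(k, e)"] * by (simp add: valid_angle_def)
qed

lemma vert_eq_iff: "p \<in> positions w \<Longrightarrow> q \<in> positions w \<Longrightarrow> vert w p = vert w q \<longleftrightarrow> p = q"
  using inj_vert by (auto dest: inj_onD)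

lemma vertices_eq: "vertices w = vert w ` positions w"
proof
  show "vertices w \<subseteq> vert w ` positions w"
    using angle_pos_in_positions by (auto simp: vertices_def vertex_at_eq_vert valid_angle_def)
  show "vert w ` positions w \<subseteq> vertices w"
  proof
    fix v assume "v \<in> vert w ` positions w"
    then obtain p where p: "p \<in> positions w" "v = vert w p" by blast
    obtain k e where "k \<le> n" "e \<in> tri_edges w k" "angle_pos w (k, e) = p"
      using p(1) by (rule positions_angle)
    then show "v \<in> vertices w" unfolding vertices_def
      by (intro CollectI exI[of _ k] exI[of _ e]) (simp add: p(2) vertex_at_eq_vert)
  qed
qed

subsection \<open>End points of edges\<close>

lemma edge_pos_after: "0 < k \<Longrightarrow> k \<le> n \<Longrightarrow> edge_pos w k k = {pt w k Lft, pt w k Rgt}"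
  using nxt_prv_distinct[of k k] tri_edges_nxt_prv[of k k] diagonal_in_tri_edges(1)[of k]
  by (auto simp: edge_pos_def angle_pos_after)

lemma edge_pos_before: "k < n \<Longrightarrow> edge_pos w k (Suc k) = {pt w (Suc k) Lft, pt w (Suc k) Rgt}"
  using nxt_prv_distinct[of k "Suc k"] tri_edges_nxt_prv[of k "Suc k"] diagonal_in_tri_edges(2)[of k]
  by (auto simp: edge_pos_def angle_pos_before simp del: pt.simps(2))

lemma edge_pos_unique: "j \<le> n \<Longrightarrow> k \<le> n \<Longrightarrow> e \<in> tri_edges w j \<Longrightarrow> e \<in> tri_edges w k \<Longrightarrow>
    edge_pos w j e = edge_pos w k e"
proof (induction j k rule: linorder_wlog)
  case (le j k) then show ?case using tri_edges_disjoint[of j k e]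
    by (cases "j = k") (auto simp: edge_pos_after edge_pos_before simp del: pt.simps(2))
qed auto

lemma edge_pos_join:
  assumes "k \<le> n" "joinable w k s t"
  shows "edge_pos w k (join w k s t) = {pt w k s, pt w (Suc k) t}"
proof -
  consider "k = 0" | "0 < k" "k < n" | "k = n" using assms(1) by linarith
  then show ?thesis
  proof cases
    case 1
    then show ?thesis using rank_ge_2 by (cases t) (auto simp: edge_pos_def join_0 tri_edges_0 angle_pos_0 insert_Diff_if)
  next
    case 2
    have "edge_pos w k (n + k) = {pt w k (opposite (shared w k)), pt w (Suc k) (opposite (shared w k))}"
      using 2 by (cases "shared w k")
       (auto simp: edge_pos_def tri_edges angle_pos_after angle_pos_before[simplified] nxt_mid prv_mid
         angle_pos_after[simplified] insert_Diff_if simp del: pt.simps(2))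
    moreover have "UNIV = {shared w k, opposite (shared w k)}"
       using UNIV_side by (cases "shared w k") auto
    ultimately show ?thesis
      using assms(2) 2 edge_pos_after[of k] edge_pos_before[of k] pt_shared[of k]
      by (cases "shared w k"; cases s; cases t)
         (auto simp: join_mid joinable_mid simp del: pt.simps(2))
  next
    case 3
    have "edge_pos w n (nxt w n n) = {pt w n Lft, pt w (Suc n) t}"
      "edge_pos w n (prv w n n) = {pt w n Rgt, pt w (Suc n) t}"
      using nxt_prv_distinct[of n n] tri_edges_nxt_prv[of n n] diagonal_in_tri_edges(1)[of n] rank_ge_2
      by (auto simp: edge_pos_def angle_pos_after insert_Diff_if)
    then show ?thesis using 3 by (cases s) (auto simp: join_last side_after_def)
  qed
qed

lemma ends_eq: "k \<le> n \<Longrightarrow> e \<in> tri_edges w k \<Longrightarrow> ends w e = vert w ` edge_pos w k e"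
proof -
  assume *: "k \<le> n" "e \<in> tri_edges w k"
  have "ends w e = vert w ` (\<Union>j\<in>{j. j \<le> n \<and> e \<in> tri_edges w j}. edge_pos w j e)"
  proof (intro subset_antisym subsetI)
    fix v assume "v \<in> ends w e"
    then obtain j f where "v = vertex_at w (j, f)" "j \<le> n" "e \<in> tri_edges w j" "f \<in> tri_edges w j - {e}"
      by (auto simp: ends_def)
    then show "v \<in> vert w ` (\<Union>j\<in>{j. j \<le> n \<and> e \<in> tri_edges w j}. edge_pos w j e)"
      by (auto simp: edge_pos_def vertex_at_eq_vert)
  next
    fix v assume "v \<in> vert w ` (\<Union>j\<in>{j. j \<le> n \<and> e \<in> tri_edges w j}. edge_pos w j e)"
    then obtain j f where "v = vert w (angle_pos w (j, f))" "j \<le> n" "e \<in> tri_edges w j"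
      "f \<in> tri_edges w j" "f \<noteq> e" by (auto simp: edge_pos_def)
    then show "v \<in> ends w e" unfolding ends_def
      by (intro CollectI exI[of _ j] exI[of _ f]) (simp add: vertex_at_eq_vert)
  qed
  also have "(\<Union>j\<in>{j. j \<le> n \<and> e \<in> tri_edges w j}. edge_pos w j e) = edge_pos w k e"
    using * edge_pos_unique by blast
  finally show ?thesis .
qed

lemma ends_join: "k \<le> n \<Longrightarrow> joinable w k s t \<Longrightarrow>
    ends w (join w k s t) = {vert w (pt w k s), vert w (pt w (Suc k) t)}"
  using ends_eq[OF _ join_in_tri_edges] edge_pos_join by simp

lemma ends_diagonal: "0 < i \<Longrightarrow> i \<le> n \<Longrightarrow> ends w i = {vert w (pt w i Lft), vert w (pt w i Rgt)}"
  using ends_eq[OF _ diagonal_in_tri_edges(1)] edge_pos_after by simp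

lemma edge_pos_subset: "k \<le> n \<Longrightarrow> edge_pos w k e \<subseteq> positions w"
  using angle_pos_in_positions by (auto simp: edge_pos_def valid_angle_def)

lemma edge_pos_cases:
  assumes "k \<le> n" "e \<in> tri_edges w k"
  obtains (diagonal) "0 < e" "e \<le> n" "edge_pos w k e = {pt w e Lft, pt w e Rgt}"
  | (first) s where "e = side_before w 1 s" "edge_pos w k e = {0, pt w 1 s}" "k = 0"
  | (boundary) s where "0 < k" "k < n" "e = n + k" "s = opposite (shared w k)"
      "edge_pos w k e = {pt w k s, pt w (Suc k) s}"
  | (last) s where "e = side_after w n s" "edge_pos w k e = {pt w n s, int n + 1}" "k = n"
proof -
  have "e = k \<and> 0 < k \<or> e = Suc k \<and> k < n \<or> 0 < k \<and> k < n \<and> e = n + k \<or>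
     k = 0 \<and> e \<in> {side_before w 1 Lft, side_before w 1 Rgt} \<or>
     k = n \<and> e \<in> {side_after w n Lft, side_after w n Rgt}"
    using assms rank_ge_2 tri_edges_nxt_prv[of n n] diagonal_in_tri_edges(1)[of n]
    by (cases "k = 0"; cases "k = n") (auto simp: tri_edges_0 tri_edges_mid side_before_1 side_after_def)
  then consider "e = k" "0 < k" | "e = Suc k" "k < n" | "0 < k" "k < n" "e = n + k"
    | s where "k = 0" "e = side_before w 1 s" | s where "k = n" "e = side_after w n s"
    by (metis insert_iff empty_iff)
  then show ?thesis
  proof cases
    case 1 then show ?thesis using assms edge_pos_after by (intro diagonal) auto
  next
    case 2 then show ?thesis using assms edge_pos_before
      by (intro diagonal) (auto simp del: pt.simps(2))
  next
    case 3
    let ?s = "opposite (shared w k)"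
    have "edge_pos w k (join w k ?s ?s) = {pt w k ?s, pt w (Suc k) ?s}"
      using 3 by (intro edge_pos_join) (auto simp: joinable_mid)
    then show ?thesis using 3 by (intro boundary[of ?s]) (auto simp: join_mid simp del: pt.simps(2))
  next
    case (4 s)
    have "edge_pos w 0 (join w 0 s s) = {pt w 0 s, pt w 1 s}" using edge_pos_join[of 0 s s] by simp
    moreover have "join w 0 s s = e" using 4 rank_ge_2 by (simp add: join_def)
    ultimately show ?thesis using 4 by (intro first[of s]) simp_all
  next
    case (5 s)
    have "edge_pos w n (join w n s s) = {pt w n s, pt w (Suc n) s}" using edge_pos_join[of n s s] by simp
    then show ?thesis using 5 by (intro last[of s]) (simp_all add: join_last add.commute)
  qed
qed

text \<open>Numbers that recover the label of an edge from the coordinates of its end points. A diagonal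
  joins opposite sides of the arc, and a boundary segment does so only if it contains \<open>b\<close>;
  the largest absolute value tells which triangle added the later of the two end points.\<close>

definition edge_code :: "int set \<Rightarrow> int \<times> int \<times> int" where
  "edge_code A = (Max (abs ` A), \<Prod>x\<in>A. sgn x, \<Sum>x\<in>A. sgn x)"

lemma edge_code_doubleton: "x \<noteq> y \<Longrightarrow>
    edge_code {x, y} = (max \<bar>x\<bar> \<bar>y\<bar>, sgn x * sgn y, sgn x + sgn y)"
  by (simp add: edge_code_def)

lemma pt_diagonal_max: "0 < e \<Longrightarrow> e \<le> n \<Longrightarrow> max \<bar>pt w e Lft\<bar> \<bar>pt w e Rgt\<bar> = int e"
  using pt_bounds[of "e - 1"] pt_bounds[of e] by (cases e; cases "e = 1"; cases "shared w (e - 1)") auto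

lemma edge_pos_code:
  assumes "k \<le> n" "e \<in> tri_edges w k"
  shows "edge_code (edge_pos w k e) =
    (if e \<le> n then (int e, - 1, 0)
     else if e < 2 * n then (int (e - n) + 1, 1, if shared w (e - n) = Lft then 2 else - 2)
     else if e \<le> 2 * n + 1 then (1, 0, if e = 2 * n then 1 else - 1)
     else (int n + 1, if e = side_after w n Lft then (- 1, 0) else (1, 2)))"
  using assms
proof (cases rule: edge_pos_cases)
  case diagonal then show ?thesis using pt_bounds[of e] pt_diagonal_max[of e]
    by (auto simp: edge_code_doubleton)
next
  case (first s) then show ?thesis using rank_ge_2
    by (cases s) (auto simp: edge_code_doubleton side_before_1)
next
  case (boundary s)
  have b: "\<bar>pt w k s\<bar> \<le> int k" "pt w (Suc k) s = (if shared w k = Rgt then - int (Suc k) else int (Suc k))"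
    "if shared w k = Rgt then pt w k s < 0 else pt w k s > 0"
    using pt_bounds[of k] pt_new[of k] boundary by (cases "shared w k"; auto)+
  then have "pt w k s \<noteq> pt w (Suc k) s" by auto
  then show ?thesis using b boundary(1,2,3,5)
    by (cases "shared w k") (auto simp: edge_code_doubleton max_def simp del: pt.simps(2))
next
  case (last s)
  have "pt w n s \<noteq> int n + 1" using pt_bounds[of n] rank_ge_2 by (cases s) auto
  then show ?thesis using last rank_ge_2 pt_bounds[of n]
    by (rule_tac side_after_last_cases; cases s) (auto simp: edge_code_doubleton)
qed

lemma edge_pos_inject:
  assumes "j \<le> n" "k \<le> n" "e \<in> tri_edges w j" "f \<in> tri_edges w k" "edge_pos w j e = edge_pos w k f"
  shows "e = f"
proof -
  have "e \<in> {1..2 * n + 3}" "f \<in> {1..2 * n + 3}" using assms tri_edges_range by auto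
  then show ?thesis
    using edge_pos_code[OF assms(1,3)] edge_pos_code[OF assms(2,4)] assms(5)
    by (rule_tac side_after_last_cases) (auto split: if_splits)
qed

lemma ends_inject:
  assumes "e \<in> {1..2 * n + 3}" "f \<in> {1..2 * n + 3}" "ends w e = ends w f"
  shows "e = f"
proof -
  obtain j k where *: "j \<le> n" "e \<in> tri_edges w j" "k \<le> n" "f \<in> tri_edges w k"
    using assms(1,2) by (metis exists_tri_edges)
  then have "vert w ` edge_pos w j e = vert w ` edge_pos w k f" using assms(3) ends_eq by metis
  then have "edge_pos w j e = edge_pos w k f"
    using inj_vert edge_pos_subset * by (metis inj_on_image_eq_iff)
  then show ?thesis using edge_pos_inject * by blast
qed

lemma pt_step_neq: "k \<le> n \<Longrightarrow> joinable w k s t \<Longrightarrow> pt w k s \<noteq> pt w (Suc k) t"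
  using pt_bounds[of k] pt_bounds[of "Suc k"]
  by (cases "k = 0"; cases "k = n"; cases s; cases t; cases "shared w k")
    (auto simp: joinable_mid)

lemma pt_side_cancel: "0 < k \<Longrightarrow> k \<le> n \<Longrightarrow> pt w k s = pt w k t \<longleftrightarrow> s = t"
  using pt_bounds[of k] by (cases s; cases t) auto

end

section \<open>Positive rational functions\<close>

text \<open>Division by a cluster variable is harmless because all cluster variables are quotients of non-zero
  polynomials with non-negative coefficients, a class that exchange relations cannot leave.\<close>

definition nonneg_poly :: "((nat \<Rightarrow>\<^sub>0 nat) \<Rightarrow>\<^sub>0 rat) \<Rightarrow> bool" where
  "nonneg_poly f \<longleftrightarrow> f \<noteq> 0 \<and> (\<forall>m. 0 \<le> Poly_Mapping.lookup f m)"

definition positive :: "ratfun \<Rightarrow> bool" where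
  "positive z \<longleftrightarrow> (\<exists>f g. z = Fract f g \<and> nonneg_poly f \<and> nonneg_poly g)"

lemma nonneg_poly_add: "nonneg_poly f \<Longrightarrow> nonneg_poly g \<Longrightarrow> nonneg_poly (f + g)"
  unfolding nonneg_poly_def
  by (metis add_nonneg_eq_0_iff add_nonneg_nonneg lookup_add lookup_zero poly_mapping_eqI)

lemma nonneg_poly_mult:
  assumes "nonneg_poly f" "nonneg_poly g" shows "nonneg_poly (f * g)"
proof -
  have "0 \<le> Poly_Mapping.lookup (f * g) m" for m
    using assms by (auto simp: nonneg_poly_def lookup_mult prod_fun_def Sum_any.expand_set when_def
        intro!: sum_nonneg mult_nonneg_nonneg)
  then show ?thesis using assms by (auto simp: nonneg_poly_def)
qed

lemma nonneg_poly_1: "nonneg_poly 1"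
  by (auto simp: nonneg_poly_def lookup_one when_def)

lemma positive_neq_0: "positive z \<Longrightarrow> z \<noteq> 0"
  by (auto simp: positive_def nonneg_poly_def fract_expand eq_fract)

lemma positive_add: "positive y \<Longrightarrow> positive z \<Longrightarrow> positive (y + z)"
  unfolding positive_def by (metis add_fract nonneg_poly_add nonneg_poly_def nonneg_poly_mult)

lemma positive_mult: "positive y \<Longrightarrow> positive z \<Longrightarrow> positive (y * z)"
  unfolding positive_def by (metis mult_fract nonneg_poly_mult)

lemma positive_divide: "positive y \<Longrightarrow> positive z \<Longrightarrow> positive (y / z)"
  unfolding positive_def by (metis divide_fract nonneg_poly_mult)

lemma positive_X: "positive (X i)"
proof -
  let ?x = "Poly_Mapping.single (Poly_Mapping.single i 1) 1 :: (nat \<Rightarrow>\<^sub>0 nat) \<Rightarrow>\<^sub>0 rat"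
  have "?x \<noteq> 0" by (metis lookup_single_eq lookup_zero zero_neq_one)
  then have "nonneg_poly ?x" by (auto simp: nonneg_poly_def lookup_single when_def)
  then show ?thesis unfolding positive_def X_def using nonneg_poly_1 by blast
qed

lemma X_neq_0 [simp]: "X i \<noteq> 0"
  by (intro positive_neq_0 positive_X)

section \<open>Triangulations by chords\<close>

text \<open>Chords of a polygon whose vertices are integers, placed on a circle so that walking clockwise
  decreases them; \<open>turn x y z\<close> means that \<open>x\<close>, \<open>y\<close>, \<open>z\<close> are in clockwise order.\<close>

definition turn :: "int \<Rightarrow> int \<Rightarrow> int \<Rightarrow> bool" where
  "turn x y z \<longleftrightarrow> z < y \<and> y < x \<or> x < z \<and> z < y \<or> y < x \<and> x < z"

lemma turn_rotate: "turn x y z \<Longrightarrow> turn y z x"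
  by (auto simp: turn_def)

lemma turn_total: "x \<noteq> y \<Longrightarrow> y \<noteq> z \<Longrightarrow> z \<noteq> x \<Longrightarrow> turn x y z \<or> turn x z y"
  by (auto simp: turn_def)

lemma turn_asym: "turn x y z \<Longrightarrow> \<not> turn x z y"
  by (auto simp: turn_def)

lemma turn_distinct: "turn x y z \<Longrightarrow> x \<noteq> y \<and> y \<noteq> z \<and> z \<noteq> x"
  by (auto simp: turn_def)

lemma turn_trans: "turn a b c \<Longrightarrow> turn a c d \<Longrightarrow> turn a b d \<and> turn b c d"
  by (auto simp: turn_def)

definition noncrossing :: "int set set \<Rightarrow> bool" where
  "noncrossing E \<longleftrightarrow> (\<forall>a b c d. turn a c b \<longrightarrow> turn b d a \<longrightarrow> {a, b} \<in> E \<longrightarrow> {c, d} \<notin> E)"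

lemma noncrossingD: "noncrossing E \<Longrightarrow> turn a c b \<Longrightarrow> turn b d a \<Longrightarrow> {a, b} \<in> E \<Longrightarrow> {c, d} \<in> E \<Longrightarrow> False"
  unfolding noncrossing_def by blast

text \<open>Of two such vertices on the same side of the chord, one is cut off from an end point of the
  chord by an edge at the other.\<close>

lemma apex_unique:
  assumes "noncrossing E" "turn a c b" "turn a d b" "{a, c} \<in> E" "{c, b} \<in> E" "{a, d} \<in> E" "{d, b} \<in> E"
  shows "c = d"
proof (rule ccontr)
  assume "c \<noteq> d"
  then consider "turn a c d" | "turn a d c" using turn_total turn_distinct assms by metis
  then show False
  proof cases
    case 1 then show False
      using noncrossingD[OF assms(1) 1 turn_rotate[OF assms(3)]] assms by (simp add: insert_commute)
  next
    case 2 then show False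
      using noncrossingD[OF assms(1) 2 turn_rotate[OF assms(2)]] assms by (simp add: insert_commute)
  qed
qed

lemma two_apexes:
  assumes "noncrossing E" "p \<noteq> q" "r \<noteq> s" "r \<notin> {p, q}" "s \<notin> {p, q}"
    "{p, r} \<in> E" "{q, r} \<in> E" "{p, s} \<in> E" "{q, s} \<in> E"
  shows "turn p r q \<and> turn q s p \<or> turn p s q \<and> turn q r p"
proof -
  have "turn p r q \<or> turn p q r" "turn p s q \<or> turn p q s" using turn_total assms by auto
  moreover have "\<not> (turn p r q \<and> turn p s q)"
    using apex_unique[of E p r q s] assms by (auto simp: insert_commute)
  moreover have "\<not> (turn p q r \<and> turn p q s)"
    using apex_unique[of E q r p s] assms turn_rotate by (auto simp: insert_commute)
  ultimately show ?thesis using turn_rotate by blast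
qed

text \<open>In a triangulation, three pairwise joined vertices bound a triangle. Hence these are the
  arrows of its quiver: the chord \<open>j\<close> follows the chord \<open>i\<close> clockwise in a
  triangle.\<close>

definition arrow :: "nat set \<Rightarrow> (nat \<Rightarrow> int set) \<Rightarrow> nat \<Rightarrow> nat \<Rightarrow> bool" where
  "arrow M A i j \<longleftrightarrow> (\<exists>x y z. turn x y z \<and> A i = {x, y} \<and> A j = {y, z} \<and> {x, z} \<in> A ` M)"

lemma arrowI: "turn x y z \<Longrightarrow> A i = {x, y} \<Longrightarrow> A j = {y, z} \<Longrightarrow> {x, z} \<in> A ` M \<Longrightarrow> arrow M A i j"
  unfolding arrow_def by blast

text \<open>A diagonal \<open>{p, q}\<close> of a triangulation together with the two triangles at it, and
  the result of replacing it by the other diagonal \<open>{r, s}\<close> of their union.\<close>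

locale quadrilateral =
  fixes M :: "nat set" and A :: "nat \<Rightarrow> int set" and p q r s :: int and k \<alpha> \<beta> \<gamma> \<delta> :: nat
  assumes noncrossing: "noncrossing (A ` M)"
    and inj: "inj_on A M"
    and labels: "k \<in> M" "\<alpha> \<in> M" "\<beta> \<in> M" "\<gamma> \<in> M" "\<delta> \<in> M"
    and turns: "turn p r q" "turn q s p"
    and arcs: "A k = {p, q}" "A \<alpha> = {p, r}" "A \<beta> = {r, q}" "A \<gamma> = {q, s}" "A \<delta> = {s, p}"
begin

abbreviation A' :: "nat \<Rightarrow> int set" where "A' \<equiv> A(k := {r, s})"

lemma distinct_vertices: "p \<noteq> q" "p \<noteq> r" "p \<noteq> s" "q \<noteq> r" "q \<noteq> s" "r \<noteq> s"
  using turns by (auto simp: turn_def)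

lemma turns': "turn r q s" "turn s p r"
  using turns by (auto simp: turn_def)

lemma distinct_labels: "distinct [k, \<alpha>, \<beta>, \<gamma>, \<delta>]"
  using arcs distinct_vertices by (auto simp: doubleton_eq_iff)

lemma A_eq_iff: "i \<in> M \<Longrightarrow> A i = {p, q} \<longleftrightarrow> i = k" "i \<in> M \<Longrightarrow> A i = {p, r} \<longleftrightarrow> i = \<alpha>"
   "i \<in> M \<Longrightarrow> A i = {r, q} \<longleftrightarrow> i = \<beta>" "i \<in> M \<Longrightarrow> A i = {q, s} \<longleftrightarrow> i = \<gamma>" "i \<in> M \<Longrightarrow> A i = {s, p} \<longleftrightarrow> i = \<delta>"
   "i \<in> M \<Longrightarrow> A i \<noteq> {r, s}"
proof -
  show "i \<in> M \<Longrightarrow> A i \<noteq> {r, s}"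
    using noncrossingD[OF noncrossing turns] arcs labels by (metis image_eqI)
qed (use inj labels arcs in \<open>metis inj_onD\<close>)+

lemma apexes:
  assumes "{p, t} \<in> A ` M" "{q, t} \<in> A ` M" "t \<noteq> p" "t \<noteq> q"
  shows "t = r \<or> t = s"
proof -
  have E: "{p, r} \<in> A ` M" "{r, q} \<in> A ` M" "{q, s} \<in> A ` M" "{s, p} \<in> A ` M"
    using arcs labels by (metis image_eqI)+
  consider "turn p t q" | "turn q t p" using turn_total[of p q t] assms distinct_vertices turn_rotate by metis
  then show ?thesis
  proof cases
    case 1 then show ?thesis using apex_unique[OF noncrossing turns(1) 1] E assms
      by (simp add: insert_commute)
  next
    case 2 then show ?thesis using apex_unique[OF noncrossing turns(2) 2] E assms
      by (simp add: insert_commute)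
  qed
qed

text \<open>Each end point of a chord crossing the new diagonal is \<open>p\<close> or \<open>q\<close>, for otherwise it is cut off by a side
  of the quadrilateral, and the chord crosses this side.\<close>

lemma crossing_new:
  assumes "turn r c s" "turn s d r" "{c, d} \<in> A ` M"
  shows "{c, d} = {p, q}"
proof -
  have E: "{p, r} \<in> A ` M" "{r, q} \<in> A ` M" "{q, s} \<in> A ` M" "{s, p} \<in> A ` M"
    using arcs labels by (metis image_eqI)+
  have "c = q"
  proof (rule ccontr)
    assume "c \<noteq> q"
    then have "turn r c q \<or> turn r q c" using turn_total turn_distinct assms(1) distinct_vertices by metis
    moreover have "turn r q d \<and> turn q s d" using turn_trans turns'(1) turn_rotate[OF turn_rotate[OF assms(2)]] by blast
    moreover have "turn r q c \<Longrightarrow> turn q c s" using turn_trans assms(1) by blast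
    ultimately consider "turn r c q" "turn q d r" | "turn q c s" "turn s d q"
      using turn_rotate by blast
    then show False
      using noncrossingD[OF noncrossing _ _ E(2) assms(3)] noncrossingD[OF noncrossing _ _ E(3) assms(3)]
      by cases auto
  qed
  moreover have "d = p"
  proof (rule ccontr)
    have E': "{d, c} \<in> A ` M" using assms(3) by (simp add: insert_commute)
    assume "d \<noteq> p"
    then have "turn s d p \<or> turn s p d" using turn_total turn_distinct assms(2) distinct_vertices by metis
    moreover have "turn s p c \<and> turn p r c" using turn_trans turns'(2) turn_rotate[OF turn_rotate[OF assms(1)]] by blast
    moreover have "turn s p d \<Longrightarrow> turn p d r" using turn_trans assms(2) by blast
    ultimately consider "turn s d p" "turn p c s" | "turn p d r" "turn r c p"
      using turn_rotate by blast
    then show False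
      using noncrossingD[OF noncrossing _ _ E(4) E'] noncrossingD[OF noncrossing _ _ E(1) E']
      by cases auto
  qed
  ultimately show ?thesis by auto
qed

lemma image_A': "A' ` M = A ` M - {{p, q}} \<union> {{r, s}}"
proof -
  have "A ` (M - {k}) = A ` M - {{p, q}}"
    using inj_on_image_set_diff[OF inj, of M "{k}"] labels(1) arcs(1) by simp
  then show ?thesis using labels(1) by (simp only: fun_upd_image if_True Un_insert_right sup_bot_right)
qed

lemma noncrossing_flip: "noncrossing (A' ` M)"
  unfolding noncrossing_def
proof (intro allI impI notI)
  fix a b c d assume t: "turn a c b" "turn b d a" and ab: "{a, b} \<in> A' ` M" and cd: "{c, d} \<in> A' ` M"
  have new: "B \<in> A' ` M \<Longrightarrow> B = {r, s} \<or> B \<in> A ` M \<and> B \<noteq> {p, q}" for B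
    unfolding image_A' by blast
  have dist: "{a, b} \<noteq> {c, d}" using t by (auto simp: turn_def doubleton_eq_iff)
  consider "{a, b} = {r, s}" "{c, d} \<in> A ` M" "{c, d} \<noteq> {p, q}"
    | "{c, d} = {r, s}" "{a, b} \<in> A ` M" "{a, b} \<noteq> {p, q}"
    | "{a, b} \<in> A ` M" "{c, d} \<in> A ` M" using new[OF ab] new[OF cd] dist by metis
  then show False
  proof cases
    case 1
    then consider "a = r" "b = s" | "a = s" "b = r" by (auto simp: doubleton_eq_iff)
    then show False
      by cases (use crossing_new[of c d] crossing_new[of d c] t 1 in \<open>auto simp: insert_commute\<close>)
  next
    case 2
    have t': "turn c b d" "turn d a c" using t by (auto simp: turn_def)
    consider "c = r" "d = s" | "c = s" "d = r" using 2 by (auto simp: doubleton_eq_iff)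
    then show False
      by cases (use crossing_new[of a b] crossing_new[of b a] t' 2 in \<open>auto simp: insert_commute\<close>)
  next
    case 3 then show False using noncrossingD[OF noncrossing t] by blast
  qed
qed

lemma inj_flip: "inj_on A' M"
  using inj A_eq_iff(6) by (auto simp: inj_on_def)

text \<open>The arrows in triangles that do not contain the flipped diagonal, which are the same before
  and after the flip.\<close>

definition common :: "nat \<Rightarrow> nat \<Rightarrow> bool" where
  "common i j \<longleftrightarrow> (\<exists>x y z. turn x y z \<and> A i = {x, y} \<and> A j = {y, z} \<and> {x, z} \<in> A ` M - {{p, q}})"

lemma commonI: "turn x y z \<Longrightarrow> A i = {x, y} \<Longrightarrow> A j = {y, z} \<Longrightarrow> {x, z} \<in> A ` M \<Longrightarrow> {x, z} \<noteq> {p, q} \<Longrightarrow>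
    common i j"
  unfolding common_def by (intro exI conjI DiffI) simp_all

lemma commonE:
  assumes "common i j"
  obtains x y z where "turn x y z" "A i = {x, y}" "A j = {y, z}" "{x, z} \<in> A ` M - {{p, q}}"
  using assms unfolding common_def by (elim exE conjE)

lemma arrow_to_k: "i \<in> M \<Longrightarrow> arrow M A i k \<longleftrightarrow> i = \<beta> \<or> i = \<delta>"
proof
  assume i: "i \<in> M" "arrow M A i k"
  then obtain x y z where *: "turn x y z" "A i = {x, y}" "{p, q} = {y, z}" "{x, z} \<in> A ` M"
    by (auto simp: arrow_def arcs)
  have xy: "{x, y} \<in> A ` M" using * i by (metis image_eqI)
  have d: "x \<noteq> p" "x \<noteq> q" using *(1,3) turn_distinct by (metis insert_iff singletonD)+
  have "x = r \<or> x = s" using *(3,4) xy d by (intro apexes) (auto simp: doubleton_eq_iff insert_commute)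
  moreover have "x = r \<Longrightarrow> y = q" "x = s \<Longrightarrow> y = p"
    using *(1,3) turns turn_asym turn_rotate unfolding doubleton_eq_iff by metis+
  ultimately have "A i = {r, q} \<or> A i = {s, p}" using *(2) by auto
  then show "i = \<beta> \<or> i = \<delta>" using i A_eq_iff by auto
next
  have "{p, r} \<in> A ` M" "{q, s} \<in> A ` M" using arcs labels by (metis image_eqI)+
  moreover have "turn r q p" "turn s p q" using turns turn_rotate by blast+
  moreover assume "i = \<beta> \<or> i = \<delta>"
  ultimately show "arrow M A i k"
    using arrowI[of r q p A i k M] arrowI[of s p q A i k M] arcs by (auto simp: insert_commute)
qed

lemma arrow_from_k: "j \<in> M \<Longrightarrow> arrow M A k j \<longleftrightarrow> j = \<alpha> \<or> j = \<gamma>"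
proof
  assume i: "j \<in> M" "arrow M A k j"
  then obtain x y z where *: "turn x y z" "A j = {y, z}" "{p, q} = {x, y}" "{x, z} \<in> A ` M"
    by (auto simp: arrow_def arcs)
  have xy: "{y, z} \<in> A ` M" using * i by (metis image_eqI)
  have d: "z \<noteq> p" "z \<noteq> q" using *(1,3) turn_distinct by (metis insert_iff singletonD)+
  have "z = r \<or> z = s" using *(3,4) xy d by (intro apexes) (auto simp: doubleton_eq_iff insert_commute)
  moreover have "z = r \<Longrightarrow> y = p" "z = s \<Longrightarrow> y = q"
    using *(1,3) turns turn_asym turn_rotate unfolding doubleton_eq_iff by metis+
  ultimately have "A j = {p, r} \<or> A j = {q, s}" using *(2) by auto
  then show "j = \<alpha> \<or> j = \<gamma>" using i A_eq_iff by auto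
next
  have "{r, q} \<in> A ` M" "{s, p} \<in> A ` M" using arcs labels by (metis image_eqI)+
  moreover have "turn q p r" "turn p q s" using turns turn_rotate by blast+
  moreover assume "j = \<alpha> \<or> j = \<gamma>"
  ultimately show "arrow M A k j"
    using arrowI[of q p r A k j M] arrowI[of p q s A k j M] arcs by (auto simp: insert_commute)
qed

lemma arrow_old:
  assumes "i \<in> M" "j \<in> M" "i \<noteq> k" "j \<noteq> k"
  shows "arrow M A i j \<longleftrightarrow> common i j \<or> i = \<alpha> \<and> j = \<beta> \<or> i = \<gamma> \<and> j = \<delta>" (is "_ = ?R")
    and "\<not> common \<alpha> \<beta>" "\<not> common \<gamma> \<delta>"
proof -
  have pq: "{p, q} \<in> A ` M" using arcs(1) labels(1) by (metis image_eqI)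
  have *: "i = \<alpha> \<and> j = \<beta> \<or> i = \<gamma> \<and> j = \<delta>"
    if t: "turn x y z" "A i = {x, y}" "A j = {y, z}" "{x, z} = {p, q}" for x y z
  proof -
    have "{x, y} \<in> A ` M" "{y, z} \<in> A ` M" using t assms(1,2) by (metis image_eqI)+
    then have "y = r \<or> y = s" using t(1,4) turn_distinct[OF t(1)]
      by (intro apexes) (auto simp: doubleton_eq_iff insert_commute)
    moreover have "y = r \<Longrightarrow> x = p \<and> z = q" "y = s \<Longrightarrow> x = q \<and> z = p"
      using t(1,4) turns turn_asym turn_rotate unfolding doubleton_eq_iff by metis+
    ultimately have "A i = {p, r} \<and> A j = {r, q} \<or> A i = {q, s} \<and> A j = {s, p}" using t(2,3) by auto
    then show ?thesis using assms A_eq_iff by auto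
  qed
  show "arrow M A i j \<longleftrightarrow> ?R"
  proof
    assume "arrow M A i j"
    then obtain x y z where t: "turn x y z" "A i = {x, y}" "A j = {y, z}" "{x, z} \<in> A ` M"
      by (auto simp: arrow_def)
    show ?R
    proof (cases "{x, z} = {p, q}")
      case True then show ?thesis using *[OF t(1-3)] by simp
    next
      case False then have "common i j" using commonI[OF t] by simp
      then show ?thesis by simp
    qed
  next
    assume ?R then show "arrow M A i j"
    proof (elim disjE conjE)
      assume "common i j"
      then obtain x y z where t: "turn x y z" "A i = {x, y}" "A j = {y, z}" "{x, z} \<in> A ` M - {{p, q}}"
        by (rule commonE)
      show ?thesis using arrowI[OF t(1-3) DiffD1[OF t(4)]] .
    next
      assume "i = \<alpha>" "j = \<beta>" then show ?thesis using arrowI[OF turns(1)] arcs pq by simp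
    next
      assume "i = \<gamma>" "j = \<delta>" then show ?thesis using arrowI[OF turns(2)] arcs pq
        by (simp add: insert_commute)
    qed
  qed
  show "\<not> common \<alpha> \<beta>" "\<not> common \<gamma> \<delta>"
    using distinct_vertices unfolding common_def arcs by (auto simp: doubleton_eq_iff)
qed

lemma arrow_new:
  assumes "i \<in> M" "j \<in> M" "i \<noteq> k" "j \<noteq> k"
  shows "arrow M A' i j \<longleftrightarrow> common i j \<or> i = \<beta> \<and> j = \<gamma> \<or> i = \<delta> \<and> j = \<alpha>" (is "_ = ?R")
    and "\<not> common \<beta> \<gamma>" "\<not> common \<delta> \<alpha>"
proof -
  have rs: "{r, s} \<in> A' ` M" "{r, s} \<notin> A ` M" using labels(1) A_eq_iff(6) by auto
  have sub: "A ` M - {{p, q}} \<subseteq> A' ` M" unfolding image_A' by (rule Un_upper1)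
  have A': "A' i = A i" "A' j = A j" using assms by auto
  have *: "i = \<beta> \<and> j = \<gamma> \<or> i = \<delta> \<and> j = \<alpha>"
    if t: "turn x y z" "A i = {x, y}" "A j = {y, z}" "{x, z} = {r, s}" for x y z
  proof -
    have E: "{x, y} \<in> A ` M" "{y, z} \<in> A ` M" using t assms(1,2) by (metis image_eqI)+
    have E': "{p, q} \<in> A ` M" "{q, p} \<in> A ` M"  using arcs(1) labels(1) by (metis image_eqI insert_commute)+
    have "y = p \<or> y = q"
    proof (rule ccontr)
      assume "\<not> (y = p \<or> y = q)"
      moreover have "y \<noteq> r" "y \<noteq> s" using t(1,4) turn_distinct[OF t(1)] by (auto simp: doubleton_eq_iff)
      ultimately consider "turn p y q" | "turn q y p" using turn_total distinct_vertices turn_rotate by metis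
      then show False
      proof cases
        case 1
        have "{y, s} \<in> A ` M" using E t(4) by (auto simp: doubleton_eq_iff insert_commute)
        then show False using noncrossingD[OF noncrossing 1 turns(2) E'(1)] by blast
      next
        case 2
        have "{y, r} \<in> A ` M" using E t(4) by (auto simp: doubleton_eq_iff insert_commute)
        then show False using noncrossingD[OF noncrossing 2 turns(1) E'(2)] by blast
      qed
    qed
    moreover have "y = q \<Longrightarrow> x = r \<and> z = s" "y = p \<Longrightarrow> x = s \<and> z = r"
      using t(1,4) turns' turn_asym turn_rotate unfolding doubleton_eq_iff by metis+
    ultimately have "A i = {r, q} \<and> A j = {q, s} \<or> A i = {s, p} \<and> A j = {p, r}" using t(2,3) by auto
    then show ?thesis using assms A_eq_iff by auto
  qed
  show "arrow M A' i j \<longleftrightarrow> ?R"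
  proof
    assume "arrow M A' i j"
    then obtain x y z where "turn x y z" "A i = {x, y}" "A j = {y, z}" "{x, z} \<in> A' ` M"
      unfolding arrow_def A' by blast
    note t = this
    show ?R
    proof (cases "{x, z} = {r, s}")
      case True then show ?thesis using *[OF t(1-3)] by simp
    next
      case False then have "{x, z} \<in> A ` M" "{x, z} \<noteq> {p, q}" using t(4) unfolding image_A' by simp_all
      then have "common i j" using commonI[OF t(1-3)] by simp
      then show ?thesis by simp
    qed
  next
    assume ?R then show "arrow M A' i j"
    proof (elim disjE conjE)
      assume "common i j"
      then obtain x y z where t: "turn x y z" "A' i = {x, y}" "A' j = {y, z}" "{x, z} \<in> A ` M - {{p, q}}"
        unfolding A' by (rule commonE)
      show ?thesis using arrowI[OF t(1-3) subsetD[OF sub t(4)]] .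
    next
      assume "i = \<beta>" "j = \<gamma>" then show ?thesis using arrowI[OF turns'(1)] arcs rs(1) A' by metis
    next
      assume "i = \<delta>" "j = \<alpha>" then show ?thesis using arrowI[OF turns'(2)] arcs rs(1) A'
        by (metis insert_commute)
    qed
  qed
  show "\<not> common \<beta> \<gamma>" "\<not> common \<delta> \<alpha>"
    using distinct_vertices rs(2) unfolding common_def arcs by (auto simp: doubleton_eq_iff insert_commute)
qed

text \<open>The roles of the diagonals and of the sides are rotated, so that the arrows at
  \<open>k\<close> after the flip need no separate proof.\<close>

lemma flipped: "quadrilateral M A' r s q p k \<beta> \<gamma> \<delta> \<alpha>"
  using noncrossing_flip inj_flip labels turns' arcs distinct_labels
  by unfold_locales (auto simp: insert_commute)

lemma Q_k:
  assumes "\<And>i j. i \<in> M \<Longrightarrow> j \<in> M \<Longrightarrow> Q i j = (of_bool (arrow M A i j) - of_bool (arrow M A j i) :: int)"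
    and "i \<in> M"
  shows "Q i k = of_bool (i = \<beta> \<or> i = \<delta>) - of_bool (i = \<alpha> \<or> i = \<gamma>)"
    "Q k i = of_bool (i = \<alpha> \<or> i = \<gamma>) - of_bool (i = \<beta> \<or> i = \<delta>)"
  using assms(1)[OF assms(2) labels(1)] assms(1)[OF labels(1) assms(2)] assms(2)
  by (simp_all add: arrow_to_k arrow_from_k)

text \<open>The paths of length two through \<open>k\<close> lead from \<open>\<beta>\<close> and
  \<open>\<delta>\<close> to \<open>\<alpha>\<close> and \<open>\<gamma>\<close>. Two of the four arrows
  that they add cancel the arrows of the old triangles from \<open>\<alpha>\<close> to
  \<open>\<beta>\<close> and from \<open>\<gamma>\<close> to \<open>\<delta>\<close>, and the other two
  are those of the new triangles from \<open>\<beta>\<close> to \<open>\<gamma>\<close> and from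
  \<open>\<delta>\<close> to \<open>\<alpha>\<close>.\<close>

lemma mutate_quiver_eq:
  assumes Q: "\<And>i j. i \<in> M \<Longrightarrow> j \<in> M \<Longrightarrow> Q i j = of_bool (arrow M A i j) - of_bool (arrow M A j i)"
    and ij: "i \<in> M" "j \<in> M"
  shows "mutate_quiver k Q i j = of_bool (arrow M A' i j) - of_bool (arrow M A' j i)"
proof -
  interpret F: quadrilateral M A' r s q p k \<beta> \<gamma> \<delta> \<alpha> by (rule flipped)
  have m: "max 0 (Q i k) = of_bool (i = \<beta> \<or> i = \<delta>)" "max 0 (Q k i) = of_bool (i = \<alpha> \<or> i = \<gamma>)"
    if "i \<in> M" for i
    using Q_k[OF Q that] distinct_labels by auto
  show ?thesis
  proof (cases "i = k \<or> j = k")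
    case True
    then show ?thesis
      using Q_k[OF Q ij(1)] Q_k[OF Q ij(2)] ij
      by (auto simp: mutate_quiver_def F.arrow_to_k F.arrow_from_k)
  next
    case False
    note nk = this
    let ?b = "\<lambda>i j. of_bool (i = j) :: int"
    have sum2: "of_bool (C \<or> P \<and> P' \<or> R \<and> R') = of_bool C + of_bool P * of_bool P' + (of_bool R * of_bool R' :: int)"
      if "\<not> (C \<and> P \<and> P')" "\<not> (C \<and> R \<and> R')" "\<not> (P \<and> R)" for C P P' R R' using that by auto
    have no: "\<not> common \<alpha> \<beta>" "\<not> common \<gamma> \<delta>" "\<not> common \<beta> \<gamma>" "\<not> common \<delta> \<alpha>"
      using nk ij arrow_old(2,3) arrow_new(2,3) by blast+
    have d: "\<alpha> \<noteq> \<beta>" "\<alpha> \<noteq> \<gamma>" "\<alpha> \<noteq> \<delta>" "\<beta> \<noteq> \<gamma>" "\<beta> \<noteq> \<delta>" "\<gamma> \<noteq> \<delta>" using distinct_labels by auto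
    have eq: "mutate_quiver k Q i j = of_bool (arrow M A i j) - of_bool (arrow M A j i)
        + (?b i \<beta> + ?b i \<delta>) * (?b j \<alpha> + ?b j \<gamma>) - (?b j \<beta> + ?b j \<delta>) * (?b i \<alpha> + ?b i \<gamma>)"
    proof -
      have *: "of_bool (i = x \<or> i = y) = ?b i x + ?b i y" if "x \<noteq> y" for i x y :: nat using that by auto
      show ?thesis using nk unfolding mutate_quiver_def m[OF ij(1)] m[OF ij(2)] Q[OF ij]
        by (simp only: if_False *[OF d(2)] *[OF d(5)])
    qed
    have old: "of_bool (arrow M A i j) = of_bool (common i j) + ?b i \<alpha> * ?b j \<beta> + ?b i \<gamma> * ?b j \<delta>"
      if "i \<in> M" "j \<in> M" "i \<noteq> k" "j \<noteq> k" for i j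
      unfolding arrow_old(1)[OF that] by (rule sum2) (use no(1,2) d in metis)+
    have new: "of_bool (arrow M A' i j) = of_bool (common i j) + ?b i \<beta> * ?b j \<gamma> + ?b i \<delta> * ?b j \<alpha>"
      if "i \<in> M" "j \<in> M" "i \<noteq> k" "j \<noteq> k" for i j
      unfolding arrow_new(1)[OF that] by (rule sum2) (use no(3,4) d in metis)+
    have "i \<noteq> k" "j \<noteq> k" using nk by auto
    then show ?thesis
      unfolding eq using old[of i j] old[of j i] new[of i j] new[of j i] ij by (simp add: algebra_simps)
  qed
qed

lemma mutate_product_to:
  assumes Q: "\<And>i j. i \<in> M \<Longrightarrow> j \<in> M \<Longrightarrow> Q i j = of_bool (arrow M A i j) - of_bool (arrow M A j i)"
    and "finite M"
  shows "(\<Prod>i\<in>M. x i ^ nat (Q i k)) = x \<beta> * (x \<delta> :: ratfun)"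
    and "(\<Prod>i\<in>M. x i ^ nat (Q k i)) = x \<alpha> * x \<gamma>"
proof -
  have m: "nat (Q i k) = of_bool (i = \<beta> \<or> i = \<delta>)" "nat (Q k i) = of_bool (i = \<alpha> \<or> i = \<gamma>)" if "i \<in> M" for i
    using Q_k[OF Q that] distinct_labels by auto
  have "(\<Prod>i\<in>M. x i ^ nat (Q i k)) = (\<Prod>i\<in>M. if i \<in> {\<beta>, \<delta>} then x i else 1)"
    by (intro prod.cong) (auto simp: m)
  also have "\<dots> = prod x {\<beta>, \<delta>}"
    using prod.inter_restrict[of M x "{\<beta>, \<delta>}"] assms(2) labels by (auto simp: Int_absorb1)
  finally show "(\<Prod>i\<in>M. x i ^ nat (Q i k)) = x \<beta> * x \<delta>" using distinct_labels by simp
  have "(\<Prod>i\<in>M. x i ^ nat (Q k i)) = (\<Prod>i\<in>M. if i \<in> {\<alpha>, \<gamma>} then x i else 1)"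
    by (intro prod.cong) (auto simp: m)
  also have "\<dots> = prod x {\<alpha>, \<gamma>}"
    using prod.inter_restrict[of M x "{\<alpha>, \<gamma>}"] assms(2) labels by (auto simp: Int_absorb1)
  finally show "(\<Prod>i\<in>M. x i ^ nat (Q k i)) = x \<alpha> * x \<gamma>" using distinct_labels by simp
qed

end

section \<open>Lambda lengths\<close>

text \<open>Every vertex gets a vector in the plane over the field of rational functions, chosen so that the
  determinants along the edges of the triangulation are the initial variables: each triangle determines the
  vector of its new vertex from those of the two old ones.  Exchange relations for determinants are then
  Pluecker relations, which gives every chord a variable that does not depend on any sequence of flips.
  The value \<open>side_vec w k s\<close> is the vector of the vertex at \<open>pt w k s\<close>.\<close>

fun side_vec :: "word \<Rightarrow> nat \<Rightarrow> side \<Rightarrow> ratfun \<times> ratfun" where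
  "side_vec w 0 s = (1, 0)"
| "side_vec w (Suc k) s =
     (if k = 0 then (case s of Lft \<Rightarrow> (X 1 / X (side_before w 1 Rgt), - X (side_before w 1 Lft))
        | Rgt \<Rightarrow> (0, X (side_before w 1 Rgt)))
      else if k < rank w \<and> s = shared w k then side_vec w k s
      else let (a, b) = side_vec w k Lft; (c, d) = side_vec w k Rgt;
          l = X (side_after w k Lft); r = X (side_after w k Rgt);
          \<sigma> = (if k < rank w \<and> shared w k = Rgt then 1 else - 1) in
        (\<sigma> * (r * a - l * c) / X k, \<sigma> * (r * b - l * d) / X k))"

definition vec :: "word \<Rightarrow> int \<Rightarrow> ratfun \<times> ratfun" where
  "vec w p = side_vec w (nat \<bar>p\<bar>) (if p < 0 then Lft else Rgt)"

fun det2 :: "ratfun \<times> ratfun \<Rightarrow> ratfun \<times> ratfun \<Rightarrow> ratfun" where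
  "det2 (a, b) (c, d) = a * d - b * c"

definition lambda_length :: "word \<Rightarrow> int set \<Rightarrow> ratfun" where
  "lambda_length w A = det2 (vec w (Min A)) (vec w (Max A))"

lemma lambda_length_less: "p < q \<Longrightarrow> lambda_length w {p, q} = det2 (vec w p) (vec w q)"
  by (simp add: lambda_length_def)

lemma lambda_length_greater: "p < q \<Longrightarrow> lambda_length w {q, p} = det2 (vec w p) (vec w q)"
  by (simp add: lambda_length_def)

text \<open>The relation behind all exchange relations.\<close>

lemma pluecker: "det2 a c * det2 b d = det2 a b * det2 c d + det2 b c * det2 a d"
  by (cases a; cases b; cases c; cases d) (simp add: algebra_simps)

lemma ptolemy:
  assumes "turn p r q" "turn q s p"
  shows "lambda_length w {p, q} * lambda_length w {r, s} =
    lambda_length w {r, q} * lambda_length w {s, p} + lambda_length w {p, r} * lambda_length w {q, s}"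
proof -
  consider "s < q" "q < r" "r < p" | "q < r" "r < p" "p < s" | "r < p" "p < s" "s < q" | "p < s" "s < q" "q < r"
    using assms unfolding turn_def by linarith
  then show ?thesis
    by cases (use pluecker[of "vec w s" "vec w r" "vec w q" "vec w p"]
      pluecker[of "vec w q" "vec w p" "vec w r" "vec w s"]
      pluecker[of "vec w r" "vec w s" "vec w p" "vec w q"]
      pluecker[of "vec w p" "vec w q" "vec w s" "vec w r"] in
      \<open>simp_all add: lambda_length_less lambda_length_greater algebra_simps\<close>)
qed

context nonempty_word
begin

lemma vec_pt: "k \<le> n + 1 \<Longrightarrow> vec w (pt w k s) = side_vec w k s"
proof (induction k)
  case 0 then show ?case by (simp add: vec_def)
next
  case (Suc k)
  show ?case
  proof (cases "0 < k \<and> k < n \<and> s = shared w k")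
    case True then show ?thesis using Suc by auto
  next
    case False
    show ?thesis
    proof (cases "k = n")
      case True then show ?thesis using rank_ge_2 by (simp add: vec_def nat_add_distrib)
    next
      case F: False
      then have "pt w (Suc k) s = (if s = Lft then - int (Suc k) else int (Suc k))"
        using False Suc.prems rank_ge_2 by auto
      moreover have "nat (1 + int k) = Suc k" "nat (int k + 1) = Suc k" by simp_all
      ultimately show ?thesis by (cases s) (simp_all add: vec_def del: side_vec.simps pt.simps)
    qed
  qed
qed

text \<open>The recursion for the new vector is Cramer's rule for two prescribed determinants. The sign,
  which depends on the side of the new vertex, turns the determinants of vectors sorted by coordinates
  into the variables themselves.\<close>

lemma det_side_after:
  assumes k: "0 < k" "k \<le> n" and t: "k < n \<Longrightarrow> t = opposite (shared w k)"
    and d: "det2 (side_vec w k Lft) (side_vec w k Rgt) = X k"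
  shows "if k < n \<and> shared w k = Rgt
    then det2 (side_vec w (Suc k) t) (side_vec w k s) = X (side_after w k s)
    else det2 (side_vec w k s) (side_vec w (Suc k) t) = X (side_after w k s)"
proof -
  obtain a b c e where v: "side_vec w k Lft = (a, b)" "side_vec w k Rgt = (c, e)" by fastforce
  let ?l = "X (side_after w k Lft)" and ?r = "X (side_after w k Rgt)"
  let ?\<sigma> = "if k < n \<and> shared w k = Rgt then 1 else - 1 :: ratfun"
  define x where "x = (?r * a - ?l * c) / X k"
  define y where "y = (?r * b - ?l * e) / X k"
  have u: "side_vec w (Suc k) t = (?\<sigma> * x, ?\<sigma> * y)"
    using k t v by (auto simp: Let_def x_def y_def)
  have X_k: "X k = a * e - b * c" using d v by simp
  have "x * b - y * a = ?l * ((a * e - b * c) / X k)" "x * e - y * c = ?r * ((a * e - b * c) / X k)"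
    by (simp_all add: x_def y_def field_simps)
  then have "x * b - y * a = ?l" "x * e - y * c = ?r" by (simp_all flip: X_k)
  then show ?thesis unfolding u v by (cases s) (auto simp: v algebra_simps)
qed

lemma det_diagonal: "0 < k \<Longrightarrow> k \<le> n \<Longrightarrow> det2 (side_vec w k Lft) (side_vec w k Rgt) = X k"
proof (induction k)
  case (Suc k)
  show ?case
  proof (cases "k = 0")
    case False
    then have sh: "side_vec w (Suc k) (shared w k) = side_vec w k (shared w k)" using Suc.prems by simp
    have "side_after w k (shared w k) = Suc k" using False Suc.prems by (simp add: side_after_mid)
    moreover have "det2 (side_vec w k Lft) (side_vec w k Rgt) = X k" using Suc False by simp
    ultimately show ?thesis
      using det_side_after[of k "opposite (shared w k)" "shared w k"] Suc.prems False sh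
      by (cases "shared w k") (simp_all del: side_vec.simps)
  qed simp
qed simp

lemma lambda_length_diagonal: "0 < k \<Longrightarrow> k \<le> n \<Longrightarrow> lambda_length w {pt w k Lft, pt w k Rgt} = X k"
  using pt_bounds[of k] det_diagonal[of k] by (simp add: lambda_length_less vec_pt)

lemma lambda_length_side_after:
  assumes k: "0 < k" "k \<le> n" and t: "k < n \<Longrightarrow> t = opposite (shared w k)"
  shows "lambda_length w {pt w k s, pt w (Suc k) t} = X (side_after w k s)"
proof (cases "k < n \<and> shared w k = Rgt")
  case True
  then have "pt w (Suc k) t < pt w k s" using t k pt_bounds[of k] pt_new[of k]
    by (cases s) (auto simp del: pt.simps)
  then show ?thesis using det_side_after[OF k t det_diagonal, of s] k True
    by (simp add: lambda_length_greater vec_pt del: pt.simps side_vec.simps)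
next
  case False
  have "pt w k s < pt w (Suc k) t"
  proof (cases "k = n")
    case True then show ?thesis using pt_bounds[of k] k by (cases s) auto
  next
    case F: False
    then have "t = Rgt" "shared w k = Lft" using t False k by (cases "shared w k"; auto)+
    then show ?thesis using pt_bounds[of k] pt_new[of k] F k by (cases s) (auto simp del: pt.simps)
  qed
  then show ?thesis using det_side_after[OF k t det_diagonal, of s] k False
    by (auto simp add: lambda_length_less vec_pt simp del: pt.simps side_vec.simps)
qed

lemma lambda_length_join:
  assumes "k \<le> n" "joinable w k s t"
  shows "lambda_length w {pt w k s, pt w (Suc k) t} = X (join w k s t)"
proof (cases "k = 0")
  case True
  have "vec w (- 1) = side_vec w 1 Lft" "vec w 1 = side_vec w 1 Rgt" "vec w 0 = (1, 0)"
    by (simp_all add: vec_def)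
  then show ?thesis using True rank_ge_2
    by (cases t) (simp_all add: lambda_length_less lambda_length_greater join_def del: pt.simps(2))
next
  case False
  show ?thesis
  proof (cases "k < n \<and> t = shared w k")
    case True
    then have s: "s = opposite (shared w k)" using assms False neq_iff_opposite by (auto simp: joinable_mid)
    have "{pt w k s, pt w (Suc k) t} = {pt w k Lft, pt w k Rgt}"
      using s True False pt_shared[of k] by (cases "shared w k") (auto simp del: pt.simps)
    then show ?thesis using lambda_length_diagonal[of k] True s False by (simp add: join_mid del: pt.simps)
  next
    case F: False
    then have "k < n \<Longrightarrow> t = opposite (shared w k)" using neq_iff_opposite by blast
    moreover have "join w k s t = side_after w k s" using F False assms
      by (cases "k = n") (auto simp: join_last join_mid side_after_mid)
    ultimately show ?thesis using lambda_length_side_after[of k t s] False assms by simp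
  qed
qed

section \<open>Cluster variables of arcs\<close>

text \<open>A diagonal is an edge of two triangles; its end points have the same coordinates in both of
  them (\<open>edge_pos_unique\<close>).\<close>

definition init_arc :: "nat \<Rightarrow> int set" where
  "init_arc e = edge_pos w (SOME k. k \<le> n \<and> e \<in> tri_edges w k) e"

abbreviation labels :: "nat set" where "labels \<equiv> {1..2 * n + 3}"

lemma init_arc_eq: "k \<le> n \<Longrightarrow> e \<in> tri_edges w k \<Longrightarrow> init_arc e = edge_pos w k e"
  unfolding init_arc_def
  by (metis (mono_tags, lifting) edge_pos_unique someI_ex)

lemma init_arc_join: "k \<le> n \<Longrightarrow> joinable w k s t \<Longrightarrow> init_arc (join w k s t) = {pt w k s, pt w (Suc k) t}"
  using init_arc_eq join_in_tri_edges edge_pos_join by simp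

lemma init_arc_diagonal: "0 < i \<Longrightarrow> i \<le> n \<Longrightarrow> init_arc i = {pt w i Lft, pt w i Rgt}"
  using init_arc_eq[OF _ diagonal_in_tri_edges(1)] edge_pos_after by simp

lemma ends_init_arc: "e \<in> labels \<Longrightarrow> ends w e = vert w ` init_arc e"
  by (metis ends_eq exists_tri_edges init_arc_eq)

lemma init_arc_subset: "e \<in> labels \<Longrightarrow> init_arc e \<subseteq> positions w"
  by (metis edge_pos_subset exists_tri_edges init_arc_eq)

lemma inj_init_arc: "inj_on init_arc labels"
  by (rule inj_onI) (metis edge_pos_inject exists_tri_edges init_arc_eq)

text \<open>In the triangle \<open>0\<close>, the diagonal \<open>1\<close> does not start at \<open>a\<close>, but it joins two consecutive diagonals when it
  is seen as an edge of the triangle \<open>1\<close>; similarly, the diagonal \<open>n\<close> has to be seen in the triangle \<open>n - 1\<close>.\<close>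

lemma label_join:
  assumes "e \<in> labels"
  obtains k s t where "k \<le> n" "joinable w k s t" "join w k s t = e"
proof -
  obtain k where k: "k \<le> n" "e \<in> tri_edges w k" using assms by (rule exists_tri_edges)
  consider "k = 0" "e = 1" | "k = n" "e = n" | "k = 0 \<longrightarrow> e \<noteq> 1" "k = n \<longrightarrow> e \<noteq> n" by blast
  then obtain j where "j \<le> n" "e \<in> tri_edges w j" "j = 0 \<longrightarrow> e \<noteq> 1" "j = n \<longrightarrow> e \<noteq> n"
  proof cases
    case 1 then show ?thesis using that[of 1] rank_ge_2 by (auto simp: tri_edges)
  next
    case 2 then show ?thesis using that[of "n - 1"] rank_ge_2 diagonal_in_tri_edges(2)[of "n - 1"] by auto
  next
    case 3 then show ?thesis using that[of k] k by blast
  qed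
  then show ?thesis using exists_join that by metis
qed

lemma init_arc_doubleton:
  assumes "e \<in> labels" shows "\<exists>p q. p \<noteq> q \<and> init_arc e = {p, q}"
  using assms by (rule label_join) (metis init_arc_join pt_step_neq)

lemma lambda_length_init_arc:
  assumes "e \<in> labels" shows "lambda_length w (init_arc e) = X e"
  using assms by (rule label_join) (metis init_arc_join lambda_length_join)

lemma join_in_labels: "k \<le> n \<Longrightarrow> join w k s t \<in> labels"
  using tri_edges_range join_in_tri_edges by blast

text \<open>All other chords of the initial triangulation are boundary segments joining neighbours in the linear
  order of the coordinates.  Crossings and triangles in the initial triangulation are
  controlled by this.\<close>

lemma init_arc_not_consecutive:
  assumes "e \<in> labels" "init_arc e = {p, q}" "p < m" "m < q" "m \<in> positions w"
  shows "0 < e \<and> e \<le> n \<and> p = pt w e Lft \<and> q = pt w e Rgt \<or>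
    e = side_after w n Lft \<and> p = pt w n Lft \<and> q = int n + 1"
proof -
  obtain k where k: "k \<le> n" "e \<in> tri_edges w k" using assms(1) by (rule exists_tri_edges)
  obtain j u where ju: "m = pt w j u" "j \<le> n + 1" using assms(5) by (auto simp: positions_def)
  have pq: "edge_pos w k e = {p, q}" using assms(2) init_arc_eq[OF k] by simp
  from k show ?thesis
  proof (cases rule: edge_pos_cases)
    case diagonal
    then have "p = pt w e Lft" "q = pt w e Rgt"
      using pq assms(3,4) pt_bounds[of e] by (auto simp: doubleton_eq_iff)
    then show ?thesis using diagonal by simp
  next
    case (first s)
    then have False
      using pq assms(3,4) pt_1 by (cases s) (auto simp: doubleton_eq_iff simp del: pt.simps)
    then show ?thesis ..
  next
    case (boundary s)
    have "p = pt w k s \<and> q = pt w (Suc k) s \<or> p = pt w (Suc k) s \<and> q = pt w k s"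
      using pq boundary by (auto simp: doubleton_eq_iff simp del: pt.simps)
    then have False
    proof (cases "j \<le> k")
      case True
      then show ?thesis using pt_inside[of k j u] boundary ju assms(3,4) pt_new[of k] pt_bounds[of k]
          \<open>p = _ \<and> _ \<or> _\<close> by (cases "shared w k") (auto simp del: pt.simps)
    next
      case F: False
      then show ?thesis using pt_outside[of "Suc k" j u] pt_outside[of k j u] boundary ju assms(3,4) pt_bounds[of "Suc k"] pt_bounds[of k]
          \<open>p = _ \<and> _ \<or> _\<close> by (cases "shared w k") (auto simp del: pt.simps)
    qed
    then show ?thesis ..
  next
    case (last s)
    have pq': "p = pt w n s" "q = int n + 1" using pq last assms(3,4) pt_bounds[of n] rank_ge_2
      by (cases s; auto simp: doubleton_eq_iff)+
    moreover have "s = Lft"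
    proof (rule ccontr)
      assume "s \<noteq> Lft"
      then have "s = Rgt" by (cases s) auto
      then show False using pq' assms(3,4) pt_inside[of n j u] ju rank_ge_2 by (cases "j = n + 1") auto
    qed
    ultimately show ?thesis using last by simp
  qed
qed

end

text \<open>Two crossing chords interlace in the linear order, possibly after exchanging the chords or
  their ends.\<close>

lemma noncrossing_linear:
  assumes "\<And>p q r s. p < r \<Longrightarrow> r < q \<Longrightarrow> q < s \<Longrightarrow> {p, q} \<in> E \<Longrightarrow> {r, s} \<in> E \<Longrightarrow> False"
  shows "noncrossing E"
  unfolding noncrossing_def
proof (intro allI impI notI)
  fix a b c d assume t: "turn a c b" "turn b d a" and E: "{a, b} \<in> E" "{c, d} \<in> E"
  then have E': "{b, a} \<in> E" "{d, c} \<in> E" by (simp_all add: insert_commute)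
  consider "a < d" "d < b" "b < c" | "b < c" "c < a" "a < d" | "c < a" "a < d" "d < b" | "d < b" "b < c" "c < a"
    using t unfolding turn_def by linarith
  then show False
    by cases (use assms[of a d b c] assms[of b c a d] assms[of c a d b] assms[of d b c a] E E' in simp_all)
qed

text \<open>Pulls back one end point of a chord along the passage from coordinates to vertices, when the
  other one is known.\<close>

lemma cut_doubleton:
  assumes "inj_on f P" "B \<subseteq> P" "p \<in> P" "f ` B = {f p, v}"
  obtains r where "r \<in> P" "B = {p, r}" "v = f r"
proof -
  have "v \<in> f ` B" using assms(4) by simp
  then obtain r where r: "r \<in> B" "v = f r" by blast
  then have "f ` B = f ` {p, r}" using assms(4) by simp
  then have "B = {p, r}" using assms(1-3) r
    by (metis empty_subsetI inj_on_image_eq_iff insert_subset subsetD)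
  then show ?thesis using that r assms(2) by blast
qed

context nonempty_word
begin

subsection \<open>The initial triangulation\<close>

lemma positions_bounds: "p \<in> positions w \<Longrightarrow> pt w n Lft \<le> p \<and> p \<le> int n + 1"
proof -
  assume "p \<in> positions w"
  then obtain j u where j: "p = pt w j u" "j \<le> n + 1" by (auto simp: positions_def)
  show ?thesis
  proof (cases "j = n + 1")
    case True then show ?thesis using j pt_bounds[of n] rank_ge_2 by auto
  next
    case False then show ?thesis using j pt_inside[of n j u] pt_bounds[of n] rank_ge_2 by auto
  qed
qed

lemma positions_right: "p \<in> positions w \<Longrightarrow> pt w n Rgt < p \<Longrightarrow> p = int n + 1"
proof -
  assume p: "p \<in> positions w" "pt w n Rgt < p"
  then obtain j u where j: "p = pt w j u" "j \<le> n + 1" by (auto simp: positions_def)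
  then have "\<not> j \<le> n" using pt_inside[of n j u] p(2) rank_ge_2 by auto
  then have "j = Suc n" using j by simp
  then show ?thesis using j(1) by simp
qed

lemma init_arc_in_positions: "e \<in> labels \<Longrightarrow> init_arc e = {p, q} \<Longrightarrow> p \<in> positions w \<and> q \<in> positions w"
  using init_arc_subset[of e] by auto

lemma noncrossing_init: "noncrossing (init_arc ` labels)"
proof (rule noncrossing_linear)
  fix p q r s assume lt: "p < r" "r < q" "q < s"
    and "{p, q} \<in> init_arc ` labels" "{r, s} \<in> init_arc ` labels"
  then obtain e f where ef: "e \<in> labels" "f \<in> labels" "init_arc e = {p, q}" "init_arc f = {r, s}"
    by (elim imageE) simp
  have pos: "p \<in> positions w" "q \<in> positions w" "r \<in> positions w" "s \<in> positions w"
    using ef init_arc_in_positions by metis+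
  have e: "0 < e \<and> e \<le> n \<and> p = pt w e Lft \<and> q = pt w e Rgt"
    using init_arc_not_consecutive[OF ef(1,3) lt(1,2) pos(3)] positions_bounds[OF pos(4)] lt by auto
  have f: "0 < f \<and> f \<le> n \<and> r = pt w f Lft \<and> s = pt w f Rgt"
    using init_arc_not_consecutive[OF ef(2,4) lt(2,3) pos(2)] positions_bounds[OF pos(1)] lt by auto
  show False
    using pt_mono[of e f] pt_mono[of f e] e f lt by (cases "e \<le> f") auto
qed

text \<open>Three pairwise joined vertices bound a triangle: the longest of the three chords is the diagonal
  through which the arc from \<open>a\<close> to \<open>b\<close> leaves that triangle, unless this is the last one.\<close>

lemma init_triangle_sorted:
  assumes lt: "x < y" "y < z"
    and E: "{x, y} \<in> init_arc ` labels" "{y, z} \<in> init_arc ` labels" "{x, z} \<in> init_arc ` labels"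
  shows "\<exists>k\<le>n. {x, y, z} = (\<lambda>e. angle_pos w (k, e)) ` tri_edges w k"
proof -
  obtain e f g where e: "e \<in> labels" "init_arc e = {x, z}" and f: "f \<in> labels" "init_arc f = {y, z}"
    and g: "g \<in> labels" "init_arc g = {x, y}" using E by (elim imageE) simp
  have pos: "x \<in> positions w" "y \<in> positions w" "z \<in> positions w" using e f init_arc_in_positions by metis+
  from init_arc_not_consecutive[OF e lt pos(2)] show ?thesis
  proof (elim disjE conjE)
    assume d: "0 < e" "e \<le> n" "x = pt w e Lft" "z = pt w e Rgt"
    define k where "k = e - 1"
    have k: "e = Suc k" "k < n" using d by (auto simp: k_def)
    obtain j u where j: "y = pt w j u" "j \<le> n + 1" using pos(2) by (auto simp: positions_def)
    have jk: "j \<le> k" using pt_outside[of e j u] j d lt k by (cases "j \<le> k") auto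
    have y: "y = pt w k (opposite (shared w k))"
    proof (cases "k = 0")
      case True then show ?thesis using jk j by simp
    next
      case False
      have inside: "pt w k Lft \<le> y" "y \<le> pt w k Rgt" using pt_inside[of k j u] j jk False k by auto
      have mono: "pt w i Lft \<le> pt w e Lft" "pt w e Rgt \<le> pt w i Rgt" if "e \<le> i" "i \<le> n" for i
        using pt_mono[of e i] d that by auto
      show ?thesis
      proof (cases "shared w k")
        case Lft
        have new: "pt w e Rgt = int (Suc k)" using pt_new[of k] False k Lft by simp
        have "\<not> y < pt w k Rgt"
        proof
          assume l: "y < pt w k Rgt"
          have "pt w k Rgt < z" using new d pt_bounds[of k] False k by auto
          moreover have "pt w k Rgt \<in> positions w" using k by (intro pt_in_positions) simp
          ultimately have "0 < f \<and> f \<le> n \<and> y = pt w f Lft \<and> z = pt w f Rgt \<or> y = pt w n Lft"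
            using init_arc_not_consecutive[OF f l] by blast
          then show False
          proof (elim disjE conjE)
            assume *: "0 < f" "f \<le> n" "y = pt w f Lft" "z = pt w f Rgt"
            then have "int (Suc k) \<le> int f" using pt_bounds[of f] new d by auto
            then show False using mono[of f] * d lt k by auto
          next
            assume "y = pt w n Lft" then show False using positions_bounds[OF pos(1)] lt by auto
          qed
        qed
        then show ?thesis using inside Lft by simp
      next
        case Rgt
        have new: "pt w e Lft = - int (Suc k)" using pt_new[of k] False k Rgt by simp
        have "\<not> pt w k Lft < y"
        proof
          assume l: "pt w k Lft < y"
          have "x < pt w k Lft" using new d pt_bounds[of k] False k by auto
          moreover have "pt w k Lft \<in> positions w" using k by (intro pt_in_positions) simp
          ultimately have "0 < g \<and> g \<le> n \<and> x = pt w g Lft \<and> y = pt w g Rgt \<or> y = int n + 1"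
            using init_arc_not_consecutive[OF g _ l] by blast
          then show False
          proof (elim disjE conjE)
            assume *: "0 < g" "g \<le> n" "x = pt w g Lft" "y = pt w g Rgt"
            then have "int (Suc k) \<le> int g" using pt_bounds[of g] new d by auto
            then show False using mono[of g] * d lt k by auto
          next
            assume "y = int n + 1" then show False using positions_bounds[OF pos(3)] lt by auto
          qed
        qed
        then show ?thesis using inside Rgt by simp
      qed
    qed
    have "(\<lambda>e. angle_pos w (k, e)) ` tri_edges w k = {y, x, z}"
      using tri_edges_nxt_prv[of k "Suc k"] diagonal_in_tri_edges(2)[of k] k y d angle_pos_before[of k]
      by (cases "shared w k") (simp_all del: pt.simps)
    then show ?thesis using k by (intro exI[of _ k]) auto
  next
    assume d: "x = pt w n Lft" "z = int n + 1"
    have "\<not> y < pt w n Rgt"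
    proof
      assume l: "y < pt w n Rgt"
      have "pt w n Rgt < z" using pt_bounds[of n] d rank_ge_2 by auto
      moreover have "pt w n Rgt \<in> positions w" by (intro pt_in_positions) simp
      ultimately have "0 < f \<and> f \<le> n \<and> z = pt w f Rgt \<or> y = pt w n Lft"
        using init_arc_not_consecutive[OF f l] by blast
      then show False using pt_bounds[of f] d lt by auto
    qed
    moreover have "\<not> pt w n Rgt < y" using positions_right[OF pos(2)] lt d by auto
    ultimately have y: "y = pt w n Rgt" by simp
    have "(\<lambda>e. angle_pos w (n, e)) ` tri_edges w n = {z, y, x}"
      using tri_edges_nxt_prv[of n n] diagonal_in_tri_edges(1)[of n] y d angle_pos_after[of n] rank_ge_2
      by (simp add: add.commute)
    then show ?thesis by (intro exI[of _ n]) auto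
  qed
qed

lemma nxt_nxt: "k \<le> n \<Longrightarrow> e \<in> tri_edges w k \<Longrightarrow> nxt w k (nxt w k e) = prv w k e \<and> prv w k (nxt w k e) = e \<and>
    nxt w k (prv w k e) = e \<and> prv w k (prv w k e) = nxt w k e"
  by (cases "tri w k") (auto simp: tri_edges_def nxt_def prv_def dest: tri_distinct)

lemma triangle_turn:
  assumes "k \<le> n" "e \<in> tri_edges w k"
  shows "turn (angle_pos w (k, nxt w k e)) (angle_pos w (k, prv w k e)) (angle_pos w (k, e))"
proof -
  obtain d where d: "d \<in> tri_edges w k"
    "turn (angle_pos w (k, nxt w k d)) (angle_pos w (k, prv w k d)) (angle_pos w (k, d))"
  proof (cases "k = 0")
    case True
    then show ?thesis using that[of 1] rank_ge_2
      by (auto simp: tri_edges_0 nxt_0 prv_0 angle_pos_def turn_def)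
  next
    case False
    have "turn (pt w k Rgt) (pt w k Lft) (pt w (Suc k) (opposite (shared w k)))"
    proof (cases "k = n")
      case True then show ?thesis using pt_bounds[of n] rank_ge_2 by (auto simp: turn_def)
    next
      case F: False
      then show ?thesis using pt_bounds[of k] pt_new[of k] False assms(1)
        by (cases "shared w k") (auto simp: turn_def simp del: pt.simps(2))
    qed
    then show ?thesis using that[of k] assms(1) False diagonal_in_tri_edges(1)[of k]
      by (simp add: angle_pos_after del: pt.simps)
  qed
  have "e = d \<or> e = nxt w k d \<or> e = prv w k d" using tri_edges_nxt_prv[OF assms(1) d(1)] assms(2) by simp
  then show ?thesis using nxt_nxt[OF assms(1) d(1)] d(2) turn_rotate by auto
qed

lemma init_triangle:
  assumes t: "turn x y z"
    and E: "{x, y} \<in> init_arc ` labels" "{y, z} \<in> init_arc ` labels" "{x, z} \<in> init_arc ` labels"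
  obtains k e where "k \<le> n" "e \<in> tri_edges w k"
    "x = angle_pos w (k, nxt w k e)" "y = angle_pos w (k, prv w k e)" "z = angle_pos w (k, e)"
proof -
  have E': "{y, x} \<in> init_arc ` labels" "{z, y} \<in> init_arc ` labels" "{z, x} \<in> init_arc ` labels"
    using E by (simp_all add: insert_commute)
  have "z < y \<and> y < x \<or> x < z \<and> z < y \<or> y < x \<and> x < z" using t by (simp add: turn_def)
  then have "\<exists>k\<le>n. {x, y, z} = (\<lambda>e. angle_pos w (k, e)) ` tri_edges w k"
  proof (elim disjE conjE)
    assume "z < y" "y < x"
    then show ?thesis using init_triangle_sorted[of z y x] E' by (simp add: insert_commute)
  next
    assume "x < z" "z < y"
    then show ?thesis using init_triangle_sorted[of x z y] E E' by (simp add: insert_commute)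
  next
    assume "y < x" "x < z"
    then show ?thesis using init_triangle_sorted[of y x z] E E' by (simp add: insert_commute)
  qed
  then obtain k where k: "k \<le> n" "{x, y, z} = (\<lambda>e. angle_pos w (k, e)) ` tri_edges w k" by blast
  then obtain e where e: "e \<in> tri_edges w k" "z = angle_pos w (k, e)" by blast
  let ?x = "angle_pos w (k, nxt w k e)" and ?y = "angle_pos w (k, prv w k e)"
  have t': "turn ?x ?y z" using triangle_turn[OF k(1) e(1)] e(2) by simp
  have "{x, y, z} = {z, ?x, ?y}" using k(2) tri_edges_nxt_prv[OF k(1) e(1)] e(2) by simp
  moreover have "x \<noteq> z" "y \<noteq> z" "?x \<noteq> z" "?y \<noteq> z" "x \<noteq> y" using turn_distinct[OF t] turn_distinct[OF t'] by auto
  ultimately have "x = ?x \<and> y = ?y \<or> x = ?y \<and> y = ?x" by auto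
  moreover have "\<not> (x = ?y \<and> y = ?x)" using t t' turn_asym turn_rotate by metis
  ultimately show ?thesis using that k(1) e by blast
qed

lemma init_arc_triangle:
  assumes "k \<le> n" "e \<in> tri_edges w k"
  shows "init_arc e = {angle_pos w (k, nxt w k e), angle_pos w (k, prv w k e)}"
proof -
  have "tri_edges w k - {e} = {nxt w k e, prv w k e}"
    unfolding tri_edges_nxt_prv[OF assms] using nxt_prv_distinct[OF assms] by auto
  then show ?thesis using init_arc_eq[OF assms] by (simp add: edge_pos_def)
qed

lemma arrow_init_iff:
  assumes "i \<in> labels" "j \<in> labels"
  shows "arrow labels init_arc i j \<longleftrightarrow> (\<exists>k\<le>n. i \<in> tri_edges w k \<and> j = nxt w k i)"
proof
  assume "arrow labels init_arc i j"
  then obtain x y z where *: "turn x y z" "init_arc i = {x, y}" "init_arc j = {y, z}" "{x, z} \<in> init_arc ` labels"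
    by (auto simp: arrow_def)
  then have "{x, y} \<in> init_arc ` labels" "{y, z} \<in> init_arc ` labels" using assms by (metis image_eqI)+
  from *(1) this *(4) obtain k e where k: "k \<le> n" "e \<in> tri_edges w k"
    "x = angle_pos w (k, nxt w k e)" "y = angle_pos w (k, prv w k e)" "z = angle_pos w (k, e)"
    by (rule init_triangle)
  have e': "nxt w k e \<in> tri_edges w k" using k(1) by (rule nxt_in_tri_edges)
  have "init_arc i = init_arc e" using * k by (simp add: init_arc_triangle)
  moreover have "init_arc j = init_arc (nxt w k e)"
    using * k init_arc_triangle[OF k(1) e'] nxt_nxt[OF k(1,2)] by simp
  moreover have "e \<in> labels" "nxt w k e \<in> labels" using k e' tri_edges_range by blast+
  ultimately have "i = e" "j = nxt w k e" using inj_init_arc assms by (auto dest: inj_onD)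
  then show "\<exists>k\<le>n. i \<in> tri_edges w k \<and> j = nxt w k i" using k by blast
next
  assume "\<exists>k\<le>n. i \<in> tri_edges w k \<and> j = nxt w k i"
  then obtain k where k: "k \<le> n" "i \<in> tri_edges w k" "j = nxt w k i" by blast
  let ?p = "prv w k i"
  have in_tri: "j \<in> tri_edges w k" "?p \<in> tri_edges w k" using k nxt_in_tri_edges prv_in_tri_edges by auto
  have "init_arc ?p = {angle_pos w (k, nxt w k i), angle_pos w (k, i)}"
    using init_arc_triangle[OF k(1) in_tri(2)] nxt_nxt[OF k(1,2)] by (simp add: insert_commute)
  moreover have "?p \<in> labels" using in_tri k tri_edges_range by blast
  ultimately have "{angle_pos w (k, nxt w k i), angle_pos w (k, i)} \<in> init_arc ` labels" by (metis image_eqI)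
  then show "arrow labels init_arc i j"
    using triangle_turn[OF k(1,2)] init_arc_triangle[OF k(1,2)] init_arc_triangle[OF k(1) in_tri(1)]
      nxt_nxt[OF k(1,2)] k(3) by (intro arrowI) simp_all
qed

lemma quiver_init:
  assumes "i \<in> labels" "j \<in> labels"
  shows "quiver w i j = of_bool (arrow labels init_arc i j) - of_bool (arrow labels init_arc j i)"
proof -
  have *: "int (arrows w i j) = of_bool (arrow labels init_arc i j)" if "i \<in> labels" "j \<in> labels" for i j
  proof (cases "\<exists>k\<le>n. i \<in> tri_edges w k \<and> j = nxt w k i")
    case True
    then obtain k where k: "k \<le> n" "i \<in> tri_edges w k" "j = nxt w k i" by blast
    have "k' = k" if k': "k' \<le> n" "i \<in> tri_edges w k'" "j = nxt w k' i" for k'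
    proof (rule ccontr)
      assume "k' \<noteq> k"
      then have "k' < k \<or> k < k'" by auto
      moreover have "j \<in> tri_edges w k" "j \<in> tri_edges w k'"
        using nxt_in_tri_edges[OF k(1), of i] nxt_in_tri_edges[OF k'(1), of i] k(3) k'(3) by simp_all
      ultimately have "i = j" using tri_edges_disjoint k k' by metis
      then show False using nxt_prv_distinct[OF k(1,2)] k(3) by simp
    qed
    then have *: "{k. k \<le> n \<and> i \<in> tri_edges w k \<and> j = nxt w k i} = {k}" using k by blast
    show ?thesis unfolding arrows_def * arrow_init_iff[OF that] using True by simp
  next
    case False
    then have *: "{k. k \<le> n \<and> i \<in> tri_edges w k \<and> j = nxt w k i} = {}" by blast
    show ?thesis unfolding arrows_def * arrow_init_iff[OF that] using False by simp
  qed
  show ?thesis using assms by (simp add: quiver_def *)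
qed

subsection \<open>Flips and mutations\<close>

text \<open>The invariant of the seeds reached by flips: the cluster variables are the lambda lengths of
  the chords, and the quiver is the one of the triangulation. Positivity permits the division in the
  exchange relations.\<close>

definition chords_of_seed ::
    "(nat \<Rightarrow> int set) \<Rightarrow> (nat \<Rightarrow> vertex set) \<Rightarrow> (nat \<Rightarrow> ratfun) \<Rightarrow> (nat \<Rightarrow> nat \<Rightarrow> int) \<Rightarrow> bool" where
  "chords_of_seed A T x Q \<longleftrightarrow>
     (\<forall>k\<in>labels. T k = vert w ` A k \<and> A k \<subseteq> positions w \<and> (\<exists>p q. p \<noteq> q \<and> A k = {p, q})
        \<and> x k = lambda_length w (A k) \<and> positive (x k)) \<and>
     inj_on A labels \<and> noncrossing (A ` labels) \<and>
     (\<forall>i\<in>labels. \<forall>j\<in>labels. Q i j = of_bool (arrow labels A i j) - of_bool (arrow labels A j i))"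

lemma chordsD:
  assumes "chords_of_seed A T x Q" "k \<in> labels"
  shows "T k = vert w ` A k" "A k \<subseteq> positions w" "\<exists>p q. p \<noteq> q \<and> A k = {p, q}"
    "x k = lambda_length w (A k)" "positive (x k)"
proof -
  have *: "T k = vert w ` A k \<and> A k \<subseteq> positions w \<and> (\<exists>p q. p \<noteq> q \<and> A k = {p, q})
        \<and> x k = lambda_length w (A k) \<and> positive (x k)"
    using assms(1) unfolding chords_of_seed_def by (elim conjE) (rule bspec[OF _ assms(2)])
  show "T k = vert w ` A k" "A k \<subseteq> positions w" "\<exists>p q. p \<noteq> q \<and> A k = {p, q}"
    "x k = lambda_length w (A k)" "positive (x k)"
    by (insert *; elim conjE; assumption)+
qed

lemma chords_quiver:
  assumes "chords_of_seed A T x Q"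
  shows "i \<in> labels \<Longrightarrow> j \<in> labels \<Longrightarrow> Q i j = of_bool (arrow labels A i j) - of_bool (arrow labels A j i)"
    "inj_on A labels" "noncrossing (A ` labels)"
  using assms unfolding chords_of_seed_def by (simp_all del: atLeastAtMost_iff)

lemma chords_initial: "chords_of_seed init_arc (ends w) X (quiver w)"
  using inj_init_arc noncrossing_init
  by (simp add: chords_of_seed_def ends_init_arc init_arc_subset init_arc_doubleton lambda_length_init_arc
      positive_X quiver_init del: atLeastAtMost_iff)

text \<open>The exchange relation at \<open>k\<close> is the Ptolemy relation of the
  quadrilateral.\<close>

lemma chords_flip:
  assumes inv: "chords_of_seed A T x Q" and k: "k \<in> {1..n}"
    and quad: "quadrilateral labels A p q r s k \<alpha> \<beta> \<gamma> \<delta>"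
    and pos: "r \<in> positions w" "s \<in> positions w"
  shows "chords_of_seed (A(k := {r, s})) (T(k := {vert w r, vert w s}))
    (mutate_vars (2 * n + 3) k x Q) (mutate_quiver k Q)"
proof -
  interpret quadrilateral labels A p q r s k \<alpha> \<beta> \<gamma> \<delta> by (rule quad)
  have Q: "Q i j = of_bool (arrow labels A i j) - of_bool (arrow labels A j i)" if "i \<in> labels" "j \<in> labels" for i j
    using chords_quiver(1)[OF inv that] .
  have x: "x i = lambda_length w (A i)" "positive (x i)" if "i \<in> labels" for i
    using chordsD(4,5)[OF inv that] .
  have k_label: "k \<in> labels" by (rule labels(1))
  define y where "y = (x \<beta> * x \<delta> + x \<alpha> * x \<gamma>) / x k"
  have mut: "mutate_vars (2 * n + 3) k x Q = x(k := y)"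
    unfolding mutate_vars_def y_def
    using mutate_product_to[where Q = Q and x = x, OF Q finite_atLeastAtMost] by simp
  have "lambda_length w {p, q} * lambda_length w {r, s} = x \<beta> * x \<delta> + x \<alpha> * x \<gamma>"
    using ptolemy[OF turns, of w] x(1)[OF labels(2)] x(1)[OF labels(3)] x(1)[OF labels(4)] x(1)[OF labels(5)]
    by (simp add: arcs)
  then have y: "y = lambda_length w {r, s}"
    using positive_neq_0[OF x(2)[OF k_label]] x(1)[OF k_label] arcs(1) by (simp add: y_def field_simps)
  have "positive y" unfolding y_def
    by (intro positive_divide positive_add positive_mult x labels)
  then have "(T(k := {vert w r, vert w s})) i = vert w ` A' i \<and> A' i \<subseteq> positions w \<and>
      (\<exists>p q. p \<noteq> q \<and> A' i = {p, q}) \<and> (x(k := y)) i = lambda_length w (A' i) \<and> positive ((x(k := y)) i)"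
    if "i \<in> labels" for i
    using chordsD[OF inv that] pos distinct_vertices(6) y by (cases "i = k") auto
  note chords = this
  show ?thesis unfolding chords_of_seed_def mut
  proof (intro conjI[OF _ conjI[OF inj_flip conjI[OF noncrossing_flip]]] ballI)
    fix i j assume "i \<in> labels" "j \<in> labels"
    then show "mutate_quiver k Q i j = of_bool (arrow labels A' i j) - of_bool (arrow labels A' j i)"
      using mutate_quiver_eq[where Q = Q, OF Q] by blast
  qed (rule chords)
qed

text \<open>A flip is described by vertices; since the triangulation has no crossings, the two vertices
  joined to both ends of the old diagonal lie on different sides of it.\<close>

lemma chords_mutation:
  assumes inv: "chords_of_seed A T x Q" and k: "k \<in> {1..n}" and flip: "flip w k T T'"
  shows "\<exists>A'. chords_of_seed A' T' (mutate_vars (2 * n + 3) k x Q) (mutate_quiver k Q)"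
proof -
  note T = chordsD(1-3)[OF inv]
  have k_label: "k \<in> labels" using k by auto
  obtain u v y z where f: "T k = {u, v}" "u \<noteq> v" "y \<noteq> z" "{u, y} \<in> T ` labels" "{v, y} \<in> T ` labels"
    "{u, z} \<in> T ` labels" "{v, z} \<in> T ` labels" "T' = T(k := {y, z})"
    using flip unfolding flip_def by blast
  obtain p where p: "p \<in> positions w" "u = vert w p"
    using T(1,2)[OF k_label] f(1) by (metis imageE insertI1 subsetD)
  obtain q where q: "q \<in> positions w" "A k = {p, q}" "v = vert w q"
    using cut_doubleton[OF inj_vert T(2)[OF k_label] p(1)] T(1)[OF k_label] f(1) p(2) by metis
  have pq: "p \<noteq> q" using f(2) p q by auto
  have chord: "\<exists>r. r \<in> positions w \<and> c = vert w r \<and> {t, r} \<in> A ` labels \<and> t \<noteq> r"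
    if tc: "{vert w t, c} \<in> T ` labels" "t \<in> positions w" for t c
  proof -
    obtain i where i: "i \<in> labels" "{vert w t, c} = T i" using tc(1) by (elim imageE) simp
    obtain r where r: "r \<in> positions w" "A i = {t, r}" "c = vert w r"
      using cut_doubleton[OF inj_vert T(2)[OF i(1)] tc(2)] T(1)[OF i(1)] i(2) by metis
    then have "t \<noteq> r" using T(3)[OF i(1)] by auto
    then show ?thesis using r i(1) by (metis image_eqI)
  qed
  obtain r where r: "r \<in> positions w" "y = vert w r" "{p, r} \<in> A ` labels" "p \<noteq> r"
    using chord[of p y] f(4) p by blast
  obtain s where s: "s \<in> positions w" "z = vert w s" "{p, s} \<in> A ` labels" "p \<noteq> s"
    using chord[of p z] f(6) p by blast
  have r': "{q, r} \<in> A ` labels" "q \<noteq> r" using chord[of q y] f(5) q(1,3) r(1,2) vert_eq_iff by metis+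
  have s': "{q, s} \<in> A ` labels" "q \<noteq> s" using chord[of q z] f(7) q(1,3) s(1,2) vert_eq_iff by metis+
  have rs: "r \<noteq> s" using f(3) r(2) s(2) by auto
  obtain \<alpha> \<beta> \<gamma> \<delta> where l: "\<alpha> \<in> labels" "A \<alpha> = {p, r}" "\<beta> \<in> labels" "A \<beta> = {q, r}"
    "\<gamma> \<in> labels" "A \<gamma> = {q, s}" "\<delta> \<in> labels" "A \<delta> = {p, s}"
    using r(3) r'(1) s(3) s'(1) by (elim imageE) simp
  note nc = chords_quiver(3,2)[OF inv]
  have "turn p r q \<and> turn q s p \<or> turn p s q \<and> turn q r p"
    using two_apexes[OF nc(1) pq rs] r r' s s' by auto
  then show ?thesis
  proof
    assume "turn p r q \<and> turn q s p"
    then have "quadrilateral labels A p q r s k \<alpha> \<beta> \<gamma> \<delta>"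
      using nc l k_label q(2) by unfold_locales (simp_all add: insert_commute del: atLeastAtMost_iff)
    from chords_flip[OF inv k this r(1) s(1)] show ?thesis using f(8) r(2) s(2) by blast
  next
    assume "turn p s q \<and> turn q r p"
    then have "quadrilateral labels A p q s r k \<delta> \<gamma> \<beta> \<alpha>"
      using nc l k_label q(2) by unfold_locales (simp_all add: insert_commute del: atLeastAtMost_iff)
    from chords_flip[OF inv k this s(1) r(1)] show ?thesis using f(8) r(2) s(2)
      by (metis insert_commute)
  qed
qed

lemma triangulated_seed_chords: "triangulated_seed w T x Q \<Longrightarrow> \<exists>A. chords_of_seed A T x Q"
proof (induction rule: triangulated_seed.induct)
  case initial then show ?case using chords_initial by blast
next
  case (mutation T x Q k T') then show ?case using chords_mutation by blast
qed

lemma triangulated_seed_variable: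
  assumes "triangulated_seed w T x Q" "k \<in> labels" "T k = vert w ` B" "B \<subseteq> positions w"
  shows "x k = lambda_length w B"
proof -
  obtain A where "chords_of_seed A T x Q" using triangulated_seed_chords assms(1) by blast
  note * = chordsD[OF this assms(2)]
  have "B = A k" using * assms(3,4) inj_vert by (metis inj_on_image_eq_iff)
  then show ?thesis using *(4) by simp
qed

text \<open>The lambda length of a chord does not refer to a seed, so all seeds assign the same variable
  to it.\<close>

theorem arc_variable_eq:
  assumes "triangulated_seed w T x Q" "k \<in> labels" "T k = vert w ` B" "B \<subseteq> positions w"
  shows "arc_variable w (vert w ` B) = lambda_length w B"
  unfolding arc_variable_def
proof (rule the_equality)
  show "\<exists>T x Q k. triangulated_seed w T x Q \<and> k \<in> labels \<and> T k = vert w ` B \<and> lambda_length w B = x k"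
    using assms triangulated_seed_variable by metis
next
  fix z assume "\<exists>T x Q k. triangulated_seed w T x Q \<and> k \<in> labels \<and> T k = vert w ` B \<and> z = x k"
  then obtain T x Q k where "triangulated_seed w T x Q" "k \<in> labels" "T k = vert w ` B" "z = x k"
    by (elim exE conjE)
  then show "z = lambda_length w B" using triangulated_seed_variable assms(4) by simp
qed

lemma arc_variable_ends: assumes "e \<in> labels" shows "arc_variable w (ends w e) = X e"
  using arc_variable_eq[OF triangulated_seed.initial assms ends_init_arc[OF assms] init_arc_subset[OF assms]]
  by (simp only: ends_init_arc[OF assms] lambda_length_init_arc[OF assms])

subsection \<open>The arc from a to b\<close>

lemma init_arc_side_after:
  assumes "0 < k" "k \<le> n" "k < n \<Longrightarrow> t = opposite (shared w k)"
  shows "side_after w k s \<in> labels" "init_arc (side_after w k s) = {pt w k s, pt w (Suc k) t}"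
proof -
  have j: "joinable w k s t" "join w k s t = side_after w k s"
    using assms by (auto simp: joinable_def join_def side_after_mid side_before_Suc)
  show "side_after w k s \<in> labels" "init_arc (side_after w k s) = {pt w k s, pt w (Suc k) t}"
    using join_in_labels[OF assms(2), of s t] init_arc_join[OF assms(2) j(1)] unfolding j(2) by simp_all
qed

lemma side_after_greater: "0 < k \<Longrightarrow> k \<le> n \<Longrightarrow> k < side_after w k s"
  by (cases "k = n"; rule side_after_last_cases; cases s) (auto simp: side_after_mid)

text \<open>Flipping the diagonals \<open>1, \<dots>, n\<close> one after the other produces the arcs from \<open>a\<close> to the vertices added by
  the triangles \<open>1, \<dots>, n\<close>; the last of them is \<open>b\<close>.\<close>

lemma fan:
  "i \<le> n \<Longrightarrow> \<exists>T x Q. triangulated_seed w T x Q \<and> (\<forall>j\<in>labels. i < j \<longrightarrow> T j = ends w j) \<and>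
     (0 < i \<longrightarrow> T i = {vert w 0, vert w (pt w (Suc i) (opposite (shared w i)))}) \<and>
     (i < n \<longrightarrow> (\<forall>s. {vert w 0, vert w (pt w (Suc i) s)} \<in> T ` labels))"
proof (induction i)
  case 0
  have "{vert w 0, vert w (pt w (Suc 0) s)} \<in> ends w ` labels" for s
    using ends_join[of 0 s s] join_in_labels[of 0 s s] by (metis image_eqI joinable_0 le0 pt.simps(1))
  then show ?case using triangulated_seed.initial by blast
next
  case (Suc i)
  then obtain T x Q where T: "triangulated_seed w T x Q" "\<And>j. j \<in> labels \<Longrightarrow> i < j \<Longrightarrow> T j = ends w j"
    "\<And>s. {vert w 0, vert w (pt w (Suc i) s)} \<in> T ` labels" by auto
  let ?k = "Suc i" and ?t = "opposite (shared w (Suc i))"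
  let ?new = "pt w (Suc ?k) ?t"
  let ?T' = "T(?k := {vert w 0, vert w ?new})"
  have k: "?k \<in> labels" "?k \<in> {1..n}" using Suc.prems by auto
  have pos: "0 \<in> positions w" "?new \<in> positions w" "pt w ?k s \<in> positions w" for s
    using Suc.prems pt_in_positions[of 0 Lft] pt_in_positions[of "Suc ?k"] pt_in_positions[of ?k]
    by (simp_all del: pt.simps(2))
  have new0: "?new \<noteq> 0" "pt w ?k s \<noteq> 0" for s
    using pt_bounds[of ?k] pt_bounds[of "Suc ?k"] Suc.prems
    by (cases "?k = n"; cases s; cases ?t; auto simp del: pt.simps(2); simp)+
  have T_k: "T ?k = {vert w (pt w ?k Lft), vert w (pt w ?k Rgt)}"
    using T(2)[OF k(1)] ends_diagonal[of ?k] Suc.prems by simp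
  have side: "{vert w (pt w ?k s), vert w ?new} \<in> T ` labels" for s
  proof -
    have l: "side_after w ?k s \<in> labels" "init_arc (side_after w ?k s) = {pt w ?k s, ?new}"
      using init_arc_side_after[of ?k ?t s] Suc.prems by auto
    have "T (side_after w ?k s) = ends w (side_after w ?k s)"
      using T(2)[OF l(1)] side_after_greater[of ?k s] Suc.prems by simp
    also have "\<dots> = {vert w (pt w ?k s), vert w ?new}" using ends_init_arc[OF l(1)] l(2) by simp
    finally show ?thesis using l(1) by (metis image_eqI)
  qed
  have "flip w ?k T ?T'" unfolding flip_def
  proof (intro exI conjI)
    show "T ?k = {vert w (pt w ?k Lft), vert w (pt w ?k Rgt)}" by (rule T_k)
    show "vert w (pt w ?k Lft) \<noteq> vert w (pt w ?k Rgt)"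
      using pt_bounds[of ?k] Suc.prems vert_eq_iff pos by (metis less_trans not_less_iff_gr_or_eq zero_less_Suc)
    show "vert w 0 \<noteq> vert w ?new" using vert_eq_iff pos new0 by metis
    show "{vert w (pt w ?k Lft), vert w 0} \<in> T ` labels" "{vert w (pt w ?k Rgt), vert w 0} \<in> T ` labels"
      using T(3) by (metis insert_commute)+
  qed (use side in blast)+
  then have seed: "triangulated_seed w ?T' (mutate_vars (2 * n + 3) ?k x Q) (mutate_quiver ?k Q)"
    using T(1) k(2) triangulated_seed.mutation by blast
  \<comment> \<open>The new vertex has just been joined to \<open>a\<close>, and the other end point of
    the next diagonal was joined before.\<close>
  have next_arcs: "{vert w 0, vert w (pt w (Suc ?k) s)} \<in> ?T' ` labels" if "?k < n" for s
  proof (cases "s = ?t")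
    case True then show ?thesis using k(1) by (intro image_eqI[of _ _ ?k]) auto
  next
    case False
    then have s: "s = shared w ?k" using neq_iff_opposite[of s ?t] by simp
    obtain j where j: "j \<in> labels" "T j = {vert w 0, vert w (pt w ?k s)}" using T(3)[of s] by (metis imageE)
    have "vert w 0 \<notin> T ?k" using T_k vert_eq_iff pos new0 by (metis insertE singletonD)
    then have "j \<noteq> ?k" using j(2) by auto
    then show ?thesis using j pt_shared[of ?k] that s by (intro image_eqI[of _ _ j]) (simp_all del: pt.simps)
  qed
  show ?case
  proof (intro exI conjI)
    show "triangulated_seed w ?T' (mutate_vars (2 * n + 3) ?k x Q) (mutate_quiver ?k Q)" by (rule seed)
    show "\<forall>j\<in>labels. ?k < j \<longrightarrow> ?T' j = ends w j" using T(2) by auto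
    show "?k < n \<longrightarrow> (\<forall>s. {vert w 0, vert w (pt w (Suc ?k) s)} \<in> ?T' ` labels)" using next_arcs by blast
  qed simp
qed

lemma triangulated_seed_imp_seed: "triangulated_seed w T x Q \<Longrightarrow> seed w x Q"
  by (induction rule: triangulated_seed.induct) (auto intro: seed.intros)

theorem x_word_eq: "x_word w = lambda_length w {0, int n + 1}"
  and x_word_cluster_variable: "x_word w \<in> cluster_variables w"
proof -
  obtain T x Q where T: "triangulated_seed w T x Q" "T n = {vert w 0, vert w (int n + 1)}"
    using fan[of n] rank_ge_2 by (auto simp: add.commute)
  have n: "n \<in> labels" "n \<in> {1..n}" using rank_ge_2 by auto
  have pos: "{0, int n + 1} \<subseteq> positions w"
    using pt_in_positions[of 0 Lft] pt_in_positions[of "Suc n" Lft] by (simp add: add.commute)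
  have T': "T n = vert w ` {0, int n + 1}" using T(2) by simp
  show x: "x_word w = lambda_length w {0, int n + 1}"
    using arc_variable_eq[OF T(1) n(1) T' pos] by (simp add: x_word_def vertex_a_eq vertex_b_eq)
  show "x_word w \<in> cluster_variables w"
    unfolding x cluster_variables_def triangulated_seed_variable[OF T(1) n(1) T' pos, symmetric]
    using triangulated_seed_imp_seed[OF T(1)] n(2) by blast
qed

end

section \<open>Lattices of order ideals\<close>

lemma lattice_by_operations:
  fixes L :: "'a gorder" (structure)
  assumes po: "partial_order L"
    and join: "\<And>x y. x \<in> carrier L \<Longrightarrow> y \<in> carrier L \<Longrightarrow>
      j x y \<in> carrier L \<and> x \<sqsubseteq> j x y \<and> y \<sqsubseteq> j x y \<and> (\<forall>z\<in>carrier L. x \<sqsubseteq> z \<longrightarrow> y \<sqsubseteq> z \<longrightarrow> j x y \<sqsubseteq> z)"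
    and meet: "\<And>x y. x \<in> carrier L \<Longrightarrow> y \<in> carrier L \<Longrightarrow>
      m x y \<in> carrier L \<and> m x y \<sqsubseteq> x \<and> m x y \<sqsubseteq> y \<and> (\<forall>z\<in>carrier L. z \<sqsubseteq> x \<longrightarrow> z \<sqsubseteq> y \<longrightarrow> z \<sqsubseteq> m x y)"
  shows "lattice L"
    and "\<And>x y. x \<in> carrier L \<Longrightarrow> y \<in> carrier L \<Longrightarrow> x \<squnion> y = j x y \<and> x \<sqinter> y = m x y"
proof -
  interpret partial_order L by (rule po)
  have least: "least L (j x y) (Upper L {x, y})" and greatest: "greatest L (m x y) (Lower L {x, y})"
    if "x \<in> carrier L" "y \<in> carrier L" for x y
    using join[OF that] meet[OF that] that by (auto simp: least_def greatest_def Upper_def Lower_def)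
  show "lattice L" by unfold_locales (use least greatest in blast)+
  fix x y assume xy: "x \<in> carrier L" "y \<in> carrier L"
  have lub: "s = j x y" if "least L s (Upper L {x, y})" for s
    using that least[OF xy] unfolding least_def by (intro le_antisym) blast+
  have 1: "x \<squnion> y = j x y" unfolding Lattice.join_def Lattice.sup_def
    by (rule some_equality, rule least[OF xy], rule lub)
  have glb: "s = m x y" if "greatest L s (Lower L {x, y})" for s
    using that greatest[OF xy] unfolding greatest_def by (intro le_antisym) blast+
  have 2: "x \<sqinter> y = m x y" unfolding Lattice.meet_def Lattice.inf_def
    by (rule some_equality, rule greatest[OF xy], rule glb)
  from 1 2 show "x \<squnion> y = j x y \<and> x \<sqinter> y = m x y" ..
qed

text \<open>Joins and meets, and hence distributivity, are determined by the order.\<close>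

lemma lattice_iso_order_iso:
  fixes L :: "'a gorder" and M :: "'b gorder"
  assumes L: "distributive_lattice L" and eq: "eq M = (=)"
    and bij: "bij_betw f (carrier L) (carrier M)"
    and le: "\<And>x y. x \<in> carrier L \<Longrightarrow> y \<in> carrier L \<Longrightarrow> x \<sqsubseteq>\<^bsub>L\<^esub> y \<longleftrightarrow> f x \<sqsubseteq>\<^bsub>M\<^esub> f y"
  shows "lattice_iso L M f"
proof -
  interpret L: lattice L using L by (simp add: distributive_lattice_def)
  define g where "g = inv_into (carrier L) f"
  have g: "g y \<in> carrier L" "f (g y) = y" if "y \<in> carrier M" for y
    using that bij unfolding g_def by (auto simp: bij_betw_def inv_into_into f_inv_into_f)
  have gf: "g (f x) = x" if "x \<in> carrier L" for x
    using that bij unfolding g_def by (auto simp: bij_betw_def)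
  have f: "f x \<in> carrier M" if "x \<in> carrier L" for x using that bij by (auto simp: bij_betw_def)
  have le': "x \<sqsubseteq>\<^bsub>M\<^esub> y \<longleftrightarrow> g x \<sqsubseteq>\<^bsub>L\<^esub> g y" if "x \<in> carrier M" "y \<in> carrier M" for x y
    using le[of "g x" "g y"] g that by simp
  have po: "partial_order M"
  proof unfold_locales
    fix x y assume xy: "x \<in> carrier M" "y \<in> carrier M" "x \<sqsubseteq>\<^bsub>M\<^esub> y" "y \<sqsubseteq>\<^bsub>M\<^esub> x"
    then have "g x \<sqsubseteq>\<^bsub>L\<^esub> g y" "g y \<sqsubseteq>\<^bsub>L\<^esub> g x" using le' by auto
    then have "g x = g y" using L.le_antisym g(1)[OF xy(1)] g(1)[OF xy(2)] by auto
    then show "x .=\<^bsub>M\<^esub> y" using g xy eq by metis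
  next
    fix x y z assume "x \<sqsubseteq>\<^bsub>M\<^esub> y" "y \<sqsubseteq>\<^bsub>M\<^esub> z" "x \<in> carrier M" "y \<in> carrier M" "z \<in> carrier M"
    then show "x \<sqsubseteq>\<^bsub>M\<^esub> z" using le' L.le_trans[of "g x" "g y" "g z"] g(1) by auto
  qed (use le' g eq in auto)
  have join: "f (g x \<squnion>\<^bsub>L\<^esub> g y) \<in> carrier M \<and> x \<sqsubseteq>\<^bsub>M\<^esub> f (g x \<squnion>\<^bsub>L\<^esub> g y) \<and> y \<sqsubseteq>\<^bsub>M\<^esub> f (g x \<squnion>\<^bsub>L\<^esub> g y) \<and>
      (\<forall>z\<in>carrier M. x \<sqsubseteq>\<^bsub>M\<^esub> z \<longrightarrow> y \<sqsubseteq>\<^bsub>M\<^esub> z \<longrightarrow> f (g x \<squnion>\<^bsub>L\<^esub> g y) \<sqsubseteq>\<^bsub>M\<^esub> z)"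
    if "x \<in> carrier M" "y \<in> carrier M" for x y
    using that g by (auto simp: le' f gf L.join_left L.join_right intro!: L.join_le)
  have meet: "f (g x \<sqinter>\<^bsub>L\<^esub> g y) \<in> carrier M \<and> f (g x \<sqinter>\<^bsub>L\<^esub> g y) \<sqsubseteq>\<^bsub>M\<^esub> x \<and> f (g x \<sqinter>\<^bsub>L\<^esub> g y) \<sqsubseteq>\<^bsub>M\<^esub> y \<and>
      (\<forall>z\<in>carrier M. z \<sqsubseteq>\<^bsub>M\<^esub> x \<longrightarrow> z \<sqsubseteq>\<^bsub>M\<^esub> y \<longrightarrow> z \<sqsubseteq>\<^bsub>M\<^esub> f (g x \<sqinter>\<^bsub>L\<^esub> g y))"
    if "x \<in> carrier M" "y \<in> carrier M" for x y
    using that g by (auto simp: le' f gf L.meet_left L.meet_right intro!: L.meet_le)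
  note M = lattice_by_operations[of M, OF po join meet]
  have ops: "f (x \<squnion>\<^bsub>L\<^esub> y) = f x \<squnion>\<^bsub>M\<^esub> f y" "f (x \<sqinter>\<^bsub>L\<^esub> y) = f x \<sqinter>\<^bsub>M\<^esub> f y"
    if "x \<in> carrier L" "y \<in> carrier L" for x y
    using M(2)[of "f x" "f y"] that f gf by auto
  have "distributive_lattice M" unfolding distributive_lattice_def
  proof (intro conjI ballI)
    show "lattice M" by (rule M(1))
    fix x y z assume C: "x \<in> carrier M" "y \<in> carrier M" "z \<in> carrier M"
    then have "g x \<sqinter>\<^bsub>L\<^esub> (g y \<squnion>\<^bsub>L\<^esub> g z) = (g x \<sqinter>\<^bsub>L\<^esub> g y) \<squnion>\<^bsub>L\<^esub> (g x \<sqinter>\<^bsub>L\<^esub> g z)"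
      using L g(1)[OF C(1)] g(1)[OF C(2)] g(1)[OF C(3)] unfolding distributive_lattice_def by simp
    then have "f (g x \<sqinter>\<^bsub>L\<^esub> (g y \<squnion>\<^bsub>L\<^esub> g z)) = f ((g x \<sqinter>\<^bsub>L\<^esub> g y) \<squnion>\<^bsub>L\<^esub> (g x \<sqinter>\<^bsub>L\<^esub> g z))" by simp
    then show "x \<sqinter>\<^bsub>M\<^esub> (y \<squnion>\<^bsub>M\<^esub> z) = (x \<sqinter>\<^bsub>M\<^esub> y) \<squnion>\<^bsub>M\<^esub> (x \<sqinter>\<^bsub>M\<^esub> z)"
      using C g by (simp add: ops)
  qed
  then show ?thesis using L bij le ops by (simp add: lattice_iso_def)
qed

lemma order_ideals_distributive: "distributive_lattice (order_ideals C)"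
proof -
  let ?D = "order_ideals C"
  have po: "partial_order ?D" by unfold_locales (auto simp: order_ideals_def)
  note D = lattice_by_operations[of ?D "(\<union>)" "(\<inter>)", OF po]
  have ops: "lattice ?D" "\<And>x y. x \<in> carrier ?D \<Longrightarrow> y \<in> carrier ?D \<Longrightarrow> x \<squnion>\<^bsub>?D\<^esub> y = x \<union> y \<and> x \<sqinter>\<^bsub>?D\<^esub> y = x \<inter> y"
    by (rule D; auto simp: order_ideals_def)+
  have "x \<union> y \<in> carrier ?D \<and> x \<inter> y \<in> carrier ?D" if "x \<in> carrier ?D" "y \<in> carrier ?D" for x y
    using that by (auto simp: order_ideals_def)
  then show ?thesis using ops by (auto simp: distributive_lattice_def)
qed

text \<open>The side of the arc assigned to a diagonal by a set of diagonals, and the edges selected in the triangles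
  when the resolution at each diagonal joins the part of the arc before it to the assigned end point and
  the part after it to the other one.\<close>

definition side_of :: "nat set \<Rightarrow> nat \<Rightarrow> side" where
  "side_of I i = (if i \<in> I then Lft else Rgt)"

definition selected :: "word \<Rightarrow> nat set \<Rightarrow> nat \<Rightarrow> nat" where
  "selected w I k = join w k (opposite (side_of I k)) (side_of I (Suc k))"

text \<open>The sets for which such an edge exists in every triangle are the order ideals of \<open>C_poset w\<close>.\<close>

definition ideals :: "word \<Rightarrow> nat set set" where
  "ideals w = {I. I \<subseteq> {1..rank w} \<and> (\<forall>k. joinable w k (opposite (side_of I k)) (side_of I (Suc k)))}"

lemma carrier_order_ideals: "carrier (order_ideals (C_poset w)) = ideals w"
proof -
  let ?R = "{word_covers w i | i. i \<in> {1..<rank w}} \<inter> {1..rank w} \<times> {1..rank w}"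
  have R: "(x, y) \<in> ?R \<longleftrightarrow> (\<exists>k. 0 < k \<and> k < rank w \<and> (if shared w k = Rgt then x = Suc k \<and> y = k else x = k \<and> y = Suc k))" for x y
    by (force simp: word_covers_def shared_def split: if_splits)
  have "(\<forall>x\<in>I. \<forall>y\<in>{1..rank w}. (y, x) \<in> ?R\<^sup>* \<longrightarrow> y \<in> I) \<longleftrightarrow>
      (\<forall>k. joinable w k (opposite (side_of I k)) (side_of I (Suc k)))" (is "?L \<longleftrightarrow> ?J")
    if I: "I \<subseteq> {1..rank w}" for I
  proof
    assume L: ?L
    have step: "(y, x) \<in> ?R \<Longrightarrow> x \<in> I \<Longrightarrow> y \<in> I" for x y using L by blast
    have "shared w k = Rgt \<Longrightarrow> k \<in> I \<Longrightarrow> Suc k \<in> I" "shared w k = Lft \<Longrightarrow> Suc k \<in> I \<Longrightarrow> k \<in> I"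
      if "0 < k" "k < rank w" for k
    proof -
      assume "shared w k = Rgt"
      then have "(Suc k, k) \<in> ?R" unfolding R using that by (intro exI[of _ k]) simp
      then show "k \<in> I \<Longrightarrow> Suc k \<in> I" by (rule step)
    next
      assume "shared w k = Lft"
      then have "(k, Suc k) \<in> ?R" unfolding R using that by (intro exI[of _ k]) simp
      then show "Suc k \<in> I \<Longrightarrow> k \<in> I" by (rule step)
    qed
    then show ?J by (intro allI, case_tac "shared w k") (auto simp: joinable_def side_of_def)
  next
    assume J: ?J
    have step: "y \<in> I" if yx: "(y, x) \<in> ?R" and x: "x \<in> I" for x y
    proof -
      obtain k where k: "0 < k" "k < rank w" "if shared w k = Rgt then y = Suc k \<and> x = k else y = k \<and> x = Suc k"
        using iffD1[OF R yx] by (elim exE conjE)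
      then show ?thesis using J[rule_format, of k] x unfolding joinable_def side_of_def
        by (cases "shared w k") (auto split: if_splits)
    qed
    have "(y, x) \<in> ?R\<^sup>* \<Longrightarrow> x \<in> I \<Longrightarrow> y \<in> I" for x y
      by (induction rule: converse_rtrancl_induct) (use step in auto)
    then show ?L by blast
  qed
  then show ?thesis unfolding ideals_def order_ideals_def C_poset_def cover_poset_def by auto
qed

lemma C_star_poset_eq: "C_star_poset w = C_poset (dual w)"
proof -
  have "(if odd i then prod.swap (word_covers w i) else word_covers w i) = word_covers (dual w) i"
    if "i \<in> {1..<rank w}" for i
    using that by (auto simp: word_covers_def nth_dual rank_def)
  then have "{if odd i then prod.swap (word_covers w i) else word_covers w i | i. i \<in> {1..<rank w}} =
      {word_covers (dual w) i | i. i \<in> {1..<rank w}}"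
    unfolding Setcompr_eq_image by (rule image_cong[OF refl])
  then show ?thesis by (simp add: C_star_poset_def C_poset_def)
qed

text \<open>The Hasse diagram of \<open>C_poset w\<close> is a path, hence it carries a height function.\<close>

primrec height :: "word \<Rightarrow> nat \<Rightarrow> int" where
  "height w 0 = 0"
| "height w (Suc k) = height w k + (if shared w k = Rgt then - 1 else 1)"

text \<open>An element of minimal height in the difference has no covered neighbour outside of the smaller
  ideal.\<close>

lemma ideal_insert:
  assumes "I \<in> ideals w" "J \<in> ideals w" "I \<subset> J"
  obtains i where "i \<in> J" "i \<notin> I" "insert i I \<in> ideals w"
proof -
  have fin: "finite (J - I)" using assms(2) finite_subset[of J "{1..rank w}"] by (auto simp: ideals_def)
  have ne: "J - I \<noteq> {}" using assms(3) by blast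
  obtain i where i: "i \<in> J - I" "\<And>k. k \<in> J - I \<Longrightarrow> height w i \<le> height w k"
    using ex_is_arg_min_if_finite[OF fin ne, of "height w"] by (auto simp: is_arg_min_linorder)
  have "joinable w k (opposite (side_of (insert i I) k)) (side_of (insert i I) (Suc k))" for k
  proof -
    have "joinable w k (opposite (side_of I k)) (side_of I (Suc k))"
      "joinable w k (opposite (side_of J k)) (side_of J (Suc k))" using assms by (auto simp: ideals_def)
    then show ?thesis using i(1) i(2)[of k] i(2)[of "Suc k"] assms(3)
      unfolding joinable_def side_of_def by (cases "shared w k") (auto split: if_splits)
  qed
  then show ?thesis using that[of i] i(1) assms(1,2) by (auto simp: ideals_def)
qed

text \<open>All expansion posets of \<open>w\<close> and its dual arise in one way: their elements are indexed by order ideals,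
  and the up-move at \<open>i\<close> inserts \<open>i\<close> into the ideal.\<close>

definition modelled :: "word \<Rightarrow> 'a expansion \<Rightarrow> (nat set \<Rightarrow> 'a) \<Rightarrow> bool" where
  "modelled w E \<Phi> \<longleftrightarrow> bij_betw \<Phi> (ideals w) (nodes E) \<and>
     (\<forall>i\<in>{1..rank w}. \<forall>I\<in>ideals w. \<forall>J\<in>ideals w.
        (\<Phi> I, \<Phi> J) \<in> up E i \<longleftrightarrow> i \<notin> I \<and> J = insert i I)"

text \<open>Between two nested ideals, elements can be inserted one at a time.\<close>

lemma modelled_le:
  assumes E: "modelled w E \<Phi>" and v: "rank v = rank w" and IJ: "I \<in> ideals w" "J \<in> ideals w"
  shows "I \<subseteq> J \<longleftrightarrow> \<Phi> I \<sqsubseteq>\<^bsub>lattice_of v E\<^esub> \<Phi> J"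
proof -
  have bij: "bij_betw \<Phi> (ideals w) (nodes E)" using E by (simp add: modelled_def)
  let ?R = "(\<Union>i\<in>{1..rank w}. up E i) \<inter> nodes E \<times> nodes E"
  have step: "(\<Phi> I, \<Phi> J) \<in> ?R \<longleftrightarrow> (\<exists>i\<in>{1..rank w}. i \<notin> I \<and> J = insert i I)"
    if "I \<in> ideals w" "J \<in> ideals w" for I J
    using that E bij by (auto simp: modelled_def bij_betw_def)
  have "I \<subseteq> J \<Longrightarrow> (\<Phi> I, \<Phi> J) \<in> ?R\<^sup>*"
    using IJ
  proof (induction "card (J - I)" arbitrary: I rule: less_induct)
    case less
    have fin: "finite J" using less.prems finite_subset[of J "{1..rank w}"] by (auto simp: ideals_def)
    show ?case
    proof (cases "I = J")
      case False
      then obtain i where i: "i \<in> J" "i \<notin> I" "insert i I \<in> ideals w"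
        using ideal_insert less.prems by (metis psubsetI)
      have "J - insert i I \<subset> J - I" using i by blast
      then have "card (J - insert i I) < card (J - I)" using fin by (simp add: psubset_card_mono)
      then have "(\<Phi> (insert i I), \<Phi> J) \<in> ?R\<^sup>*" using less i by auto
      moreover have "i \<in> {1..rank w}" using i(1) less.prems(3) by (auto simp: ideals_def)
      then have "(\<Phi> I, \<Phi> (insert i I)) \<in> ?R" using step less.prems i by blast
      ultimately show ?thesis by (rule converse_rtrancl_into_rtrancl[rotated])
    qed simp
  qed
  moreover have "I \<subseteq> J" if "(\<Phi> I, \<Phi> J) \<in> ?R\<^sup>*"
  proof -
    have "x \<in> nodes E \<Longrightarrow> (x, y) \<in> ?R\<^sup>* \<Longrightarrow> \<forall>I J. I \<in> ideals w \<longrightarrow> J \<in> ideals w \<longrightarrow> x = \<Phi> I \<longrightarrow> y = \<Phi> J \<longrightarrow> I \<subseteq> J" for x y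
    proof (rotate_tac 1, induction rule: rtrancl_induct)
      case base then show ?case using bij by (auto simp: bij_betw_def dest: inj_onD)
    next
      case (step y z)
      obtain K where K: "K \<in> ideals w" "y = \<Phi> K" using step.hyps(2) bij by (auto simp: bij_betw_def)
      show ?case
      proof (intro allI impI)
        fix I J assume *: "I \<in> ideals w" "J \<in> ideals w" "x = \<Phi> I" "z = \<Phi> J"
        then have "K \<subseteq> J" using step.hyps(2) K \<open>\<And>J I. _ \<Longrightarrow> _ \<Longrightarrow> ((\<Phi> I, \<Phi> J) \<in> ?R) = _\<close> by blast
        moreover have "I \<subseteq> K" using step.IH step.prems * K by blast
        ultimately show "I \<subseteq> J" by blast
      qed
    qed
    then show ?thesis using that IJ bij by (metis bij_betwE)
  qed
  ultimately show ?thesis by (auto simp: lattice_of_def cover_poset_def v)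
qed

lemma modelled_lattice_iso:
  assumes E: "modelled w E \<Phi>" and v: "rank v = rank w"
  shows "lattice_iso (order_ideals (C_poset w)) (lattice_of v E) \<Phi>"
proof (rule lattice_iso_order_iso)
  show "bij_betw \<Phi> (carrier (order_ideals (C_poset w))) (carrier (lattice_of v E))"
    using E by (simp add: carrier_order_ideals modelled_def lattice_of_def cover_poset_def)
  show "I \<sqsubseteq>\<^bsub>order_ideals (C_poset w)\<^esub> J \<longleftrightarrow> \<Phi> I \<sqsubseteq>\<^bsub>lattice_of v E\<^esub> \<Phi> J"
    if "I \<in> carrier (order_ideals (C_poset w))" "J \<in> carrier (order_ideals (C_poset w))" for I J
    using modelled_le[OF E v] that unfolding carrier_order_ideals by (simp add: order_ideals_def)
qed (auto simp: order_ideals_distributive lattice_of_def cover_poset_def)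

lemma modelled_distributive:
  "modelled w E \<Phi> \<Longrightarrow> rank v = rank w \<Longrightarrow> distributive_lattice (lattice_of v E)"
  using modelled_lattice_iso[of w E \<Phi> v] by (simp add: lattice_iso_def)

definition transfer_index :: "word \<Rightarrow> (nat set \<Rightarrow> 'a) \<Rightarrow> (nat set \<Rightarrow> 'b) \<Rightarrow> 'a \<Rightarrow> 'b" where
  "transfer_index w \<Phi> \<Psi> = \<Psi> \<circ> inv_into (ideals w) \<Phi>"

lemma transfer_index_eq:
  "modelled w E \<Phi> \<Longrightarrow> I \<in> ideals w \<Longrightarrow> transfer_index w \<Phi> \<Psi> (\<Phi> I) = \<Psi> I"
  by (simp add: transfer_index_def modelled_def bij_betw_def)

lemma modelled_nodes: "modelled w E \<Phi> \<Longrightarrow> nodes E = \<Phi> ` ideals w"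
  by (simp add: modelled_def bij_betw_def)

lemma transfer_index_expansion_iso:
  assumes E: "modelled w E \<Phi>" and F: "modelled w F \<Psi>" and v: "rank v = rank w" "rank v' = rank w"
  shows "expansion_iso v E v' F (transfer_index w \<Phi> \<Psi>)"
  unfolding expansion_iso_def
proof (intro conjI ballI)
  let ?f = "transfer_index w \<Phi> \<Psi>"
  have f: "?f (\<Phi> I) = \<Psi> I" if "I \<in> ideals w" for I using transfer_index_eq[OF E that] .
  have bij: "bij_betw ?f (nodes E) (nodes F)"
    unfolding transfer_index_def
    using E F by (auto simp: modelled_def intro!: bij_betw_trans[OF bij_betw_inv_into])
  show "lattice_iso (lattice_of v E) (lattice_of v' F) ?f"
  proof (rule lattice_iso_order_iso)
    show "bij_betw ?f (carrier (lattice_of v E)) (carrier (lattice_of v' F))"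
      using bij by (simp add: lattice_of_def cover_poset_def)
    show "x \<sqsubseteq>\<^bsub>lattice_of v E\<^esub> y \<longleftrightarrow> ?f x \<sqsubseteq>\<^bsub>lattice_of v' F\<^esub> ?f y"
      if xy: "x \<in> carrier (lattice_of v E)" "y \<in> carrier (lattice_of v E)" for x y
    proof -
      obtain I J where "I \<in> ideals w" "x = \<Phi> I" "J \<in> ideals w" "y = \<Phi> J"
        using xy modelled_nodes[OF E] by (auto simp: lattice_of_def cover_poset_def)
      then show ?thesis using modelled_le[OF E v(1)] modelled_le[OF F v(2)] f by simp
    qed
  qed (use modelled_distributive[OF E v(1)] in \<open>auto simp: lattice_of_def cover_poset_def\<close>)
  fix i x y assume i: "i \<in> {1..rank v}" and "x \<in> nodes E" "y \<in> nodes E"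
  then obtain I J where "I \<in> ideals w" "x = \<Phi> I" "J \<in> ideals w" "y = \<Phi> J"
    using modelled_nodes[OF E] by auto
  then show "(x, y) \<in> up E i \<longleftrightarrow> (?f x, ?f y) \<in> up F i"
    using E F f i v by (simp add: modelled_def)
qed

lemma transfer_index_inverse_isos:
  assumes E: "modelled w E \<Phi>" and F: "modelled w F \<Psi>" and v: "rank v = rank w"
  shows "inverse_expansion_isos v E F (transfer_index w \<Phi> \<Psi>) (transfer_index w \<Psi> \<Phi>)"
  unfolding inverse_expansion_isos_def
  using transfer_index_expansion_iso[OF E F v v] transfer_index_expansion_iso[OF F E v v]
    transfer_index_eq[OF E, of _ \<Psi>] transfer_index_eq[OF F, of _ \<Phi>] modelled_nodes[OF E] modelled_nodes[OF F] by auto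

lemma lattice_iso_inverse:
  assumes "lattice_iso L M f"
  shows "lattice_iso M L (inv_into (carrier L) f)"
proof (rule lattice_iso_order_iso)
  have bij: "bij_betw f (carrier L) (carrier M)" and L: "lattice L" using assms
    by (auto simp: lattice_iso_def distributive_lattice_def)
  then show "bij_betw (inv_into (carrier L) f) (carrier M) (carrier L)" by (simp add: bij_betw_inv_into)
  show "distributive_lattice M" using assms by (simp add: lattice_iso_def)
  show "eq L = (=)" using L partial_order.eq_is_equal by (auto simp: lattice_def upper_semilattice_def)
  fix x y assume xy: "x \<in> carrier M" "y \<in> carrier M"
  let ?g = "inv_into (carrier L) f"
  have g: "?g x \<in> carrier L" "?g y \<in> carrier L" "f (?g x) = x" "f (?g y) = y"
    using bij xy by (auto simp: bij_betw_def inv_into_into f_inv_into_f)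
  then have "?g x \<sqsubseteq>\<^bsub>L\<^esub> ?g y \<longleftrightarrow> f (?g x) \<sqsubseteq>\<^bsub>M\<^esub> f (?g y)" using assms unfolding lattice_iso_def by blast
  then show "x \<sqsubseteq>\<^bsub>M\<^esub> y \<longleftrightarrow> ?g x \<sqsubseteq>\<^bsub>L\<^esub> ?g y" using g by simp
qed

lemma isomorphic_lattices_refl: "distributive_lattice L \<Longrightarrow> isomorphic_lattices L L"
  unfolding isomorphic_lattices_def lattice_iso_def by (intro exI[of _ id]) auto

section \<open>Selections of edges indexed by order ideals\<close>

text \<open>The other resolution of the crossings, in which both parts of the arc are joined to the same end point,
  appears in the dual polygon: there the two vertices of a diagonal swap their roles in every other triangle.\<close>

definition path_side :: "nat set \<Rightarrow> nat \<Rightarrow> side" where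
  "path_side I k = (if odd k then side_of I k else opposite (side_of I k))"

context nonempty_word
begin

lemma selected_dual: "k \<le> n \<Longrightarrow> selected (dual w) I k = join w k (path_side I k) (path_side I (Suc k))"
  by (simp add: selected_def path_side_def join_dual)

lemma ideals_dual:
  "I \<in> ideals (dual w) \<longleftrightarrow> I \<subseteq> {1..n} \<and> (\<forall>k\<le>n. joinable w k (path_side I k) (path_side I (Suc k)))"
proof -
  have "joinable (dual w) k (opposite (side_of I k)) (side_of I (Suc k)) \<longleftrightarrow>
      (k \<le> n \<longrightarrow> joinable w k (path_side I k) (path_side I (Suc k)))" for k
    by (cases "k \<le> n") (simp add: path_side_def joinable_dual, simp add: joinable_def)
  then show ?thesis unfolding ideals_def by auto
qed

lemma selected_in_tri_edges: "k \<le> n \<Longrightarrow> selected w I k \<in> tri_edges w k"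
  by (simp add: selected_def join_in_tri_edges)

lemma selected_joinable: "I \<in> ideals w \<Longrightarrow> joinable w k (opposite (side_of I k)) (side_of I (Suc k))"
  by (simp add: ideals_def)

lemma selected_inject:
  assumes "I \<in> ideals w" "J \<in> ideals w" "\<And>k. k \<le> n \<Longrightarrow> selected w I k = selected w J k"
  shows "I = J"
proof -
  have "i \<in> I \<longleftrightarrow> i \<in> J" if "i \<in> {1..n}" for i
  proof -
    define k where "k = i - 1"
    then have k: "i = Suc k" "k < n" using that by auto
    have "side_of I i = side_of J i"
      using join_cancel(2)[OF _ selected_joinable[OF assms(1)] selected_joinable[OF assms(2)], of k]
        assms(3)[of k] k by (simp add: selected_def)
    then show ?thesis by (auto simp: side_of_def split: if_splits)
  qed
  then show ?thesis using assms(1,2) by (auto simp: ideals_def)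
qed

text \<open>Every description of the elements of an expansion reduces to one of two conditions on a
  sequence of edges: each edge starts at the end point of the diagonal at which the preceding one does not
  end, or at which it does end. The first condition is characteristic of ideals of \<open>w\<close>, the
  second one of ideals of the dual word.\<close>

lemma chain_ideal:
  assumes join: "\<And>k. k \<le> n \<Longrightarrow> joinable w k (s k) (t k)"
    and chain: "\<And>k. 0 < k \<Longrightarrow> k \<le> n \<Longrightarrow> s k = opposite (t (k - 1))"
  obtains I where "I \<in> ideals w" "\<And>k. k \<le> n \<Longrightarrow> selected w I k = join w k (s k) (t k)"
    "\<And>k. 0 < k \<Longrightarrow> k \<le> n \<Longrightarrow> side_of I k = t (k - 1)"
proof -
  define I where "I = {i \<in> {1..n}. t (i - 1) = Lft}"
  have side: "side_of I k = t (k - 1)" if "0 < k" "k \<le> n" for k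
    using that by (cases "t (k - 1)") (auto simp: side_of_def I_def)
  have sel: "selected w I k = join w k (s k) (t k)" if "k \<le> n" for k
  proof (cases "k = 0"; cases "k = n")
    assume "k \<noteq> 0" "k \<noteq> n" then show ?thesis using that side[of k] side[of "Suc k"] chain[of k]
      by (simp add: selected_def)
  next
    assume k: "k = 0" "k \<noteq> n"
    then have "side_of I (Suc 0) = t 0" using side[of 1] rank_ge_2 by simp
    then show ?thesis using k by (simp add: selected_def join_0)
  next
    assume k: "k \<noteq> 0" "k = n"
    then show ?thesis using side[of n] chain[of n] by (simp add: selected_def join_last)
  qed (use rank_ge_2 in simp)
  have "joinable w k (opposite (side_of I k)) (side_of I (Suc k))" for k
  proof (cases "0 < k \<and> k < n")
    case True then show ?thesis using join[of k] side[of k] side[of "Suc k"] chain[of k] by simp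
  qed (auto simp: joinable_def)
  then have "I \<in> ideals w" by (auto simp: ideals_def I_def)
  then show ?thesis using that sel side by blast
qed

lemma chain_ideal_dual:
  assumes join: "\<And>k. k \<le> n \<Longrightarrow> joinable w k (s k) (t k)"
    and chain: "\<And>k. 0 < k \<Longrightarrow> k \<le> n \<Longrightarrow> s k = t (k - 1)"
  obtains I where "I \<in> ideals (dual w)" "\<And>k. k \<le> n \<Longrightarrow> selected (dual w) I k = join w k (s k) (t k)"
    "\<And>k. 0 < k \<Longrightarrow> k \<le> n \<Longrightarrow> path_side I k = s k"
proof -
  let ?s = "\<lambda>k. if odd k then opposite (s k) else s k" and ?t = "\<lambda>k. if odd k then opposite (t k) else t k"
  have 1: "joinable (dual w) k (?s k) (?t k)" if "k \<le> rank (dual w)" for k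
    using join[of k] that by (simp add: joinable_dual)
  have 2: "?s k = opposite (?t (k - 1))" if "0 < k" "k \<le> rank (dual w)" for k
    using chain[of k] that by (cases k) auto
  obtain I where I: "I \<in> ideals (dual w)" "\<And>k. k \<le> rank (dual w) \<Longrightarrow> selected (dual w) I k = join (dual w) k (?s k) (?t k)"
    "\<And>k. 0 < k \<Longrightarrow> k \<le> rank (dual w) \<Longrightarrow> side_of I k = ?t (k - 1)"
    using nonempty_word.chain_ideal[OF nonempty_dual, of ?s ?t] 1 2 by blast
  have "selected (dual w) I k = join w k (s k) (t k)" if "k \<le> n" for k
    using I(2)[of k] that by (simp add: join_dual)
  moreover have "path_side I k = s k" if "0 < k" "k \<le> n" for k
    using I(3)[of k] chain[of k] that by (cases k) (auto simp: path_side_def)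
  ultimately show ?thesis using that I(1) by blast
qed

subsection \<open>Inserting a diagonal into an ideal\<close>

lemma side_before_neq: "0 < i \<Longrightarrow> i \<le> n \<Longrightarrow> side_before w i s \<noteq> i"
  and side_after_neq: "0 < i \<Longrightarrow> i \<le> n \<Longrightarrow> side_after w i s \<noteq> i"
  and side_before_cancel: "0 < i \<Longrightarrow> i \<le> n \<Longrightarrow> side_before w i s = side_before w i t \<longleftrightarrow> s = t"
  and side_after_cancel: "0 < i \<Longrightarrow> i \<le> n \<Longrightarrow> side_after w i s = side_after w i t \<longleftrightarrow> s = t"
  using nxt_prv_distinct[of "i - 1" i] nxt_prv_distinct[of i i] diagonal_in_tri_edges[of i]
    diagonal_in_tri_edges(2)[of "i - 1"]
  by (cases i; auto simp: side_before_def side_after_def split: side.splits)+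

lemma side_before_in: "0 < i \<Longrightarrow> i \<le> n \<Longrightarrow> side_before w i s \<in> tri_edges w (i - 1)"
  and side_after_in: "0 < i \<Longrightarrow> i \<le> n \<Longrightarrow> side_after w i s \<in> tri_edges w i"
  by (cases s; simp add: side_before_def side_after_def nxt_in_tri_edges prv_in_tri_edges)+

lemma join_eq_side_before: "0 < i \<Longrightarrow> i \<le> n \<Longrightarrow> joinable w (i - 1) s t \<Longrightarrow>
    join w (i - 1) s t = side_before w i u \<longleftrightarrow> (i = 1 \<or> s \<noteq> shared w (i - 1)) \<and> t = u"
  using side_before_neq[of i u] side_before_cancel[of i] by (cases "i = 1") (auto simp: join_def)

lemma join_eq_side_after: "0 < i \<Longrightarrow> i \<le> n \<Longrightarrow> joinable w i s t \<Longrightarrow>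
    join w i s t = side_after w i u \<longleftrightarrow> (i = n \<or> t \<noteq> shared w i) \<and> s = u"
  using side_after_neq[of i u] side_after_cancel[of i]
  by (cases "i = n"; cases "s = shared w i"; cases "u = shared w i")
    (auto simp: join_last join_mid side_after_mid joinable_mid, (metis neq_iff_opposite)+)

text \<open>The up-moves of all expansions replace these two opposite sides of the quadrilateral around
  the diagonal \<open>i\<close> by the other two. Hence they insert \<open>i\<close> into the
  ideal.\<close>

lemma insert_ideal_iff:
  assumes i: "0 < i" "i \<le> n" and I: "I \<in> ideals w"
  shows "selected w I (i - 1) = side_before w i Rgt \<and> selected w I i = side_after w i Lft \<longleftrightarrow>
    i \<notin> I \<and> insert i I \<in> ideals w" (is "?L \<longleftrightarrow> ?R")
    and "i \<notin> I \<Longrightarrow> insert i I \<in> ideals w \<Longrightarrow> selected w (insert i I) =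
      (selected w I)(i - 1 := side_before w i Lft, i := side_after w i Rgt)"
proof -
  let ?x = "opposite (side_of I (i - 1))" and ?y = "side_of I (Suc i)"
  have j: "joinable w (i - 1) ?x (side_of I i)" "joinable w i (opposite (side_of I i)) ?y"
    using selected_joinable[OF I, of "i - 1"] selected_joinable[OF I, of i] i by simp_all
  have L: "?L \<longleftrightarrow> (i = 1 \<or> ?x \<noteq> shared w (i - 1)) \<and> (i = n \<or> ?y \<noteq> shared w i) \<and> i \<notin> I"
    using join_eq_side_before[OF i j(1)] join_eq_side_after[OF i j(2)] i
    by (auto simp: selected_def side_of_def)
  have side: "side_of (insert i I) k = (if k = i then Lft else side_of I k)" for k
    by (simp add: side_of_def)
  have R: "insert i I \<in> ideals w \<longleftrightarrow> (i = 1 \<or> ?x \<noteq> shared w (i - 1)) \<and> (i = n \<or> ?y \<noteq> shared w i)" if "i \<notin> I"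
  proof
    assume *: "insert i I \<in> ideals w"
    have sI: "side_of I i = Rgt" using that by (simp add: side_of_def)
    have ne: "i - 1 \<noteq> i" using i by simp
    have "joinable w (i - 1) ?x Lft" "joinable w i (opposite Lft) ?y" "joinable w (i - 1) ?x Rgt" "joinable w i Lft ?y"
      using selected_joinable[OF *, of "i - 1"] selected_joinable[OF *, of i] j
      by (simp_all add: side sI ne ne[simplified] i(1))
    then show "(i = 1 \<or> ?x \<noteq> shared w (i - 1)) \<and> (i = n \<or> ?y \<noteq> shared w i)"
      using i by (cases "shared w (i - 1)"; cases "shared w i") (auto simp: joinable_def)
  next
    assume *: "(i = 1 \<or> ?x \<noteq> shared w (i - 1)) \<and> (i = n \<or> ?y \<noteq> shared w i)"
    have "joinable w k (opposite (side_of (insert i I) k)) (side_of (insert i I) (Suc k))" for k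
    proof -
      consider "Suc k = i" | "k = i" | "k \<noteq> i" "Suc k \<noteq> i" by blast
      then show ?thesis
      proof cases
        case 1
        then have "i - 1 = k" by simp
        then show ?thesis using * 1 by (simp add: joinable_def side) auto
      next
        case 2 then show ?thesis using * by (auto simp: joinable_def side)
      next
        case 3 then show ?thesis using selected_joinable[OF I, of k] by (simp add: side)
      qed
    qed
    then show "insert i I \<in> ideals w" using I i by (auto simp: ideals_def)
  qed
  show "?L \<longleftrightarrow> ?R" using L R by blast
  assume *: "i \<notin> I" "insert i I \<in> ideals w"
  note j' = selected_joinable[OF *(2), of "i - 1"] selected_joinable[OF *(2), of i]
  have ne: "i - Suc 0 \<noteq> i" using i by simp
  have "selected w (insert i I) (i - 1) = side_before w i Lft" "selected w (insert i I) i = side_after w i Rgt"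
    using join_eq_side_before[OF i, of ?x Lft Lft] join_eq_side_after[OF i, of Rgt ?y Rgt] R[OF *(1)] *(2) j' i
    by (simp_all add: selected_def side ne)
  moreover have "selected w (insert i I) k = selected w I k" if "k \<noteq> i" "k \<noteq> i - 1" for k
  proof -
    have "Suc k \<noteq> i" using that by auto
    then show ?thesis using that by (simp add: selected_def side)
  qed
  ultimately show "selected w (insert i I) = (selected w I)(i - 1 := side_before w i Lft, i := side_after w i Rgt)"
    using i by (auto simp: fun_eq_iff)
qed

section \<open>Angles\<close>

lemma (in -) pair_set_eqI: "(\<And>x y. (x, y) \<in> A \<longleftrightarrow> (x, y) \<in> B) \<Longrightarrow> A = B"
  by auto

lemma (in -) ex_side: "(\<exists>s. P s) \<longleftrightarrow> P Lft \<or> P Rgt"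
  by (metis side.exhaust)

definition angle_set :: "nat set \<Rightarrow> angle set" where
  "angle_set I = {(k, selected w I k) | k. k \<le> n}"

definition angle_move :: "nat \<Rightarrow> (angle set \<times> angle set) set" where
  "angle_move i = {(A, A - {(i - 1, side_before w i Rgt), (i, side_after w i Lft)} \<union>
      {(i - 1, side_before w i Lft), (i, side_after w i Rgt)}) | A.
      {(i - 1, side_before w i Rgt), (i, side_after w i Lft)} \<subseteq> A}"

lemma angle_set_iff: "(k, e) \<in> angle_set I \<longleftrightarrow> k \<le> n \<and> e = selected w I k"
  by (auto simp: angle_set_def)

lemma inj_angle_set: "inj_on angle_set (ideals w)"
proof (rule inj_onI)
  fix I J assume *: "I \<in> ideals w" "J \<in> ideals w" "angle_set I = angle_set J"
  have "selected w I k = selected w J k" if "k \<le> n" for k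
    using *(3) that angle_set_iff by metis
  then show "I = J" using selected_inject * by blast
qed

lemma angle_move_iff:
  assumes i: "i \<in> {1..n}" and IJ: "I \<in> ideals w" "J \<in> ideals w"
  shows "(angle_set I, angle_set J) \<in> angle_move i \<longleftrightarrow> i \<notin> I \<and> J = insert i I"
proof -
  let ?old = "{(i - 1, side_before w i Rgt), (i, side_after w i Lft)}"
  let ?new = "{(i - 1, side_before w i Lft), (i, side_after w i Rgt)}"
  have i': "0 < i" "i \<le> n" using i by auto
  have old: "?old \<subseteq> angle_set I \<longleftrightarrow> i \<notin> I \<and> insert i I \<in> ideals w"
    using insert_ideal_iff(1)[OF i' IJ(1)] i' by (auto simp: angle_set_iff)
  have new: "angle_set (insert i I) = angle_set I - ?old \<union> ?new" if "i \<notin> I" "insert i I \<in> ideals w"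
  proof -
    have sub: "?old \<subseteq> angle_set I" using old that by blast
    show ?thesis
    proof (rule pair_set_eqI)
      fix k e
      show "(k, e) \<in> angle_set (insert i I) \<longleftrightarrow> (k, e) \<in> angle_set I - ?old \<union> ?new"
        using sub i' unfolding angle_set_iff insert_ideal_iff(2)[OF i' IJ(1) that]
        by (auto simp: angle_set_iff)
    qed
  qed
  show ?thesis
  proof
    assume "(angle_set I, angle_set J) \<in> angle_move i"
    then have *: "?old \<subseteq> angle_set I" "angle_set J = angle_set I - ?old \<union> ?new" by (auto simp: angle_move_def)
    then have "angle_set J = angle_set (insert i I)" using old new by auto
    then show "i \<notin> I \<and> J = insert i I" using inj_angle_set old * IJ by (auto dest: inj_onD)
  next
    assume "i \<notin> I \<and> J = insert i I"
    then show "(angle_set I, angle_set J) \<in> angle_move i" using old new IJ by (auto simp: angle_move_def)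
  qed
qed

text \<open>Only the angles at \<open>a\<close> and \<open>b\<close> are not at an end point of an
  internal diagonal.\<close>

lemma angles_iff: "(k, e) \<in> angles w \<longleftrightarrow> k \<le> n \<and> e \<in> tri_edges w k \<and> \<not> (k = 0 \<and> e = 1) \<and> \<not> (k = n \<and> e = n)"
proof (cases "k \<le> n \<and> e \<in> tri_edges w k")
  case True
  have "(\<exists>i\<in>{1..n}. vertex_at w (k, e) \<in> ends w i) \<longleftrightarrow> (\<exists>i s. 0 < i \<and> i \<le> n \<and> angle_pos w (k, e) = pt w i s)"
  proof -
    have "vertex_at w (k, e) \<in> ends w i \<longleftrightarrow> (\<exists>s. angle_pos w (k, e) = pt w i s)" if "0 < i" "i \<le> n" for i
    proof -
      have "angle_pos w (k, e) \<in> positions w" using True angle_pos_in_positions by (simp add: valid_angle_def)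
      then have "vertex_at w (k, e) \<in> ends w i \<longleftrightarrow> angle_pos w (k, e) \<in> {pt w i Lft, pt w i Rgt}"
        using True that pt_in_positions[of i] vert_eq_iff[of "angle_pos w (k, e)" "pt w i _"]
        by (simp add: ends_diagonal vertex_at_eq_vert)
      then show ?thesis by (simp add: ex_side)
    qed
    then show ?thesis by (metis One_nat_def Suc_le_eq atLeastAtMost_iff)
  qed
  also have "\<dots> \<longleftrightarrow> \<not> (k = 0 \<and> e = 1) \<and> \<not> (k = n \<and> e = n)"
  proof -
    have ne: "pt w i s \<noteq> 0" "pt w i s \<noteq> int n + 1" if "0 < i" "i \<le> n" for i s
      using pt_bounds[of i] that by (cases s; auto)+
    have n: "angle_pos w (n, n) = int n + 1" "n \<noteq> 0" using rank_ge_2 by (simp_all add: angle_pos_after)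
    from True have "k \<le> n" "e \<in> tri_edges w k" by auto
    then show ?thesis
    proof (rule angle_pos_cases)
      assume "0 < k" "e = k"
      note * = this
      show ?thesis
      proof (cases "k = n")
        case True
        have "\<not> (\<exists>i s. 0 < i \<and> i \<le> n \<and> angle_pos w (n, n) = pt w i s)" using ne(2) unfolding n(1) by metis
        then show ?thesis using True * by simp
      next
        case False
        then have "0 < Suc k" "Suc k \<le> n" "angle_pos w (k, e) = pt w (Suc k) (opposite (shared w k))"
          using angle_pos_after(1)[of k] * \<open>k \<le> n\<close> by (simp_all del: pt.simps)
        then have "\<exists>i s. 0 < i \<and> i \<le> n \<and> angle_pos w (k, e) = pt w i s" by blast
        then show ?thesis using False * by simp
      qed
    next
      assume *: "0 < k" "e = prv w k k"
      then show ?thesis using nxt_prv_distinct[of k k] True diagonal_in_tri_edges(1)[of k] angle_pos_after(2)[of k]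
        by auto
    next
      assume *: "0 < k" "e = nxt w k k"
      then show ?thesis using nxt_prv_distinct[of k k] True diagonal_in_tri_edges(1)[of k] angle_pos_after(3)[of k]
        by auto
    next
      assume "k = 0" "e = 1" then show ?thesis using ne n by (auto simp: angle_pos_0)
    next
      assume *: "k = 0" "e = 2 * n"
      then have "angle_pos w (k, e) = pt w 1 Lft" using rank_ge_2 by (simp add: angle_pos_0)
      then have "\<exists>i s. 0 < i \<and> i \<le> n \<and> angle_pos w (k, e) = pt w i s" using rank_ge_2
        by (intro exI[of _ 1] exI[of _ Lft]) auto
      then show ?thesis using * rank_ge_2 by auto
    next
      assume *: "k = 0" "e = 2 * n + 1"
      then have "angle_pos w (k, e) = pt w 1 Rgt" using rank_ge_2 by (simp add: angle_pos_0)
      then have "\<exists>i s. 0 < i \<and> i \<le> n \<and> angle_pos w (k, e) = pt w i s" using rank_ge_2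
        by (intro exI[of _ 1] exI[of _ Rgt]) auto
      then show ?thesis using * rank_ge_2 by auto
    qed
  qed
  finally show ?thesis using True by (simp add: angles_def)
qed (auto simp: angles_def)

lemma angles_join: "(k, e) \<in> angles w \<longleftrightarrow> k \<le> n \<and> (\<exists>s t. joinable w k s t \<and> e = join w k s t)"
proof
  assume "(k, e) \<in> angles w"
  then show "k \<le> n \<and> (\<exists>s t. joinable w k s t \<and> e = join w k s t)"
    using exists_join[of k e] unfolding angles_iff by metis
next
  assume *: "k \<le> n \<and> (\<exists>s t. joinable w k s t \<and> e = join w k s t)"
  have "join w 0 s t \<noteq> 1" "join w n s t \<noteq> n" for s t
    using rank_ge_2 side_after_neq[of n] by (simp_all add: join_0 join_last)
  then show "(k, e) \<in> angles w" using * join_in_tri_edges unfolding angles_iff by auto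
qed

lemma angle_at_eq: "k \<le> n \<Longrightarrow> e \<in> tri_edges w k \<Longrightarrow> angle_at w k (vertex_at w (k, e)) = (k, e)"
proof -
  assume *: "k \<le> n" "e \<in> tri_edges w k"
  have "f = e" if "f \<in> tri_edges w k" "vertex_at w (k, f) = vertex_at w (k, e)" for f
  proof -
    have "angle_pos w (k, f) = angle_pos w (k, e)"
      using that * vert_eq_iff angle_pos_in_positions by (simp add: vertex_at_eq_vert valid_angle_def)
    then show ?thesis using tri_edges_nxt_prv[OF *] that(1) turn_distinct[OF triangle_turn[OF *]] by auto
  qed
  then have "(THE f. f \<in> tri_edges w k \<and> vertex_at w (k, f) = vertex_at w (k, e)) = e"
    using *(2) by (intro the_equality) auto
  then show ?thesis by (simp add: angle_at_def)
qed

lemma angle_at_before: "0 < i \<Longrightarrow> i \<le> n \<Longrightarrow>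
    angle_at w (i - 1) (diag_end w i s) = (i - 1, side_before w i (opposite s))"
  using angle_at_eq[of "i - 1" "nxt w (i - 1) i"] angle_at_eq[of "i - 1" "prv w (i - 1) i"]
  by (cases s) (simp_all add: diag_end_def left_end_def right_end_def side_before_def nxt_in_tri_edges prv_in_tri_edges)

lemma diag_end_after: "0 < i \<Longrightarrow> i \<le> n \<Longrightarrow> diag_end w i s = vertex_at w (i, side_after w i (opposite s))"
  using vertex_at_glue[OF glue_intros(1)[of "i - 1"]] vertex_at_glue[OF glue_intros(2)[of "i - 1"]]
  by (cases s) (simp_all add: diag_end_def left_end_def right_end_def side_after_def)

lemma angle_at_after: "0 < i \<Longrightarrow> i \<le> n \<Longrightarrow>
    angle_at w i (diag_end w i s) = (i, side_after w i (opposite s))"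
  using angle_at_eq[of i "side_after w i (opposite s)"] diag_end_after[of i s] side_after_in[of i "opposite s"] by simp

lemma up_AM: "i \<in> {1..n} \<Longrightarrow> up (AM w) i = angle_move i"
  using angle_at_before[of i Lft] angle_at_before[of i Rgt] angle_at_after[of i Lft] angle_at_after[of i Rgt]
  by (simp add: AM_def Let_def angle_exchange_def angle_move_def diag_end_def)

lemma up_AP: "i \<in> {1..n} \<Longrightarrow> up (AP w) i = nonempty_word.angle_move (dual w) i"
  using angle_at_before[of i Lft] angle_at_before[of i Rgt] angle_at_after[of i Lft] angle_at_after[of i Rgt]
  by (simp add: AP_def Let_def angle_exchange_def nonempty_word.angle_move_def[OF nonempty_dual] diag_end_def
      side_before_dual side_after_dual)

lemma angle_weight_angle_set: "angle_weight (angle_set I) = (\<Prod>k\<le>n. X (selected w I k))"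
proof -
  have "angle_set I = (\<lambda>k. (k, selected w I k)) ` {..n}" by (auto simp: angle_set_def)
  then show ?thesis unfolding angle_weight_def by (simp add: prod.reindex inj_on_def)
qed

lemma angle_set_subset: "I \<in> ideals w \<Longrightarrow> angle_set I \<subseteq> angles w"
proof (rule subrelI)
  fix k e assume "I \<in> ideals w" "(k, e) \<in> angle_set I"
  then have "k \<le> n" "e = join w k (opposite (side_of I k)) (side_of I (Suc k))"
    "joinable w k (opposite (side_of I k)) (side_of I (Suc k))"
    by (auto simp: angle_set_def selected_def selected_joinable)
  then show "(k, e) \<in> angles w" unfolding angles_join by blast
qed

text \<open>A selection of angles amounts to a choice of an edge in each triangle, joining the adjacent diagonals.\<close>

lemma angle_selection_join:
  assumes "angle_selection w A"
  obtains s t where "\<And>k. k \<le> n \<Longrightarrow> joinable w k (s k) (t k)" "A = {(k, join w k (s k) (t k)) | k. k \<le> n}"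
proof -
  have sub: "A \<subseteq> angles w" and ex: "\<And>k. k \<le> n \<Longrightarrow> \<exists>!e. (k, e) \<in> A"
    using assms by (auto simp: angle_selection_def)
  have "\<exists>s t. joinable w k s t \<and> (k, join w k s t) \<in> A" if "k \<le> n" for k
  proof -
    obtain e where "(k, e) \<in> A" using ex[OF \<open>k \<le> n\<close>] by blast
    moreover from this obtain s t where "joinable w k s t" "e = join w k s t" using sub angles_join by blast
    ultimately show ?thesis by blast
  qed
  then obtain s t where st: "\<And>k. k \<le> n \<Longrightarrow> joinable w k (s k) (t k) \<and> (k, join w k (s k) (t k)) \<in> A"
    by metis
  have "A = {(k, join w k (s k) (t k)) | k. k \<le> n}"
  proof (rule pair_set_eqI)
    fix k e
    have "(k, e) \<in> A \<Longrightarrow> k \<le> n" using sub angles_iff by blast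
    then show "(k, e) \<in> A \<longleftrightarrow> (k, e) \<in> {(k, join w k (s k) (t k)) | k. k \<le> n}"
      using ex[of k] st[of k] by auto
  qed
  then show ?thesis using that st by blast
qed

lemma angle_selection_joins:
  assumes "\<And>k. k \<le> n \<Longrightarrow> joinable w k (s k) (t k)"
  shows "angle_selection w {(k, join w k (s k) (t k)) | k. k \<le> n}"
  using assms unfolding angle_selection_def by (auto simp: angles_join) blast

end

context nonempty_word
begin

section \<open>Matchings of angles and lattice paths of angles\<close>

lemma angle_pos_join:
  assumes "k \<le> n" "joinable w k s t"
  shows "angle_pos w (k, join w k s t) =
    (if k = n \<or> 0 < k \<and> s = shared w k then pt w k (opposite s) else pt w (Suc k) (opposite t))"
proof -
  consider "k = 0" | "0 < k" "k < n" | "k = n" using assms(1) by linarith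
  then show ?thesis
  proof cases
    case 1 then show ?thesis using rank_ge_2 by (cases t) (simp_all add: join_0 angle_pos_0 del: pt.simps)
  next
    case 2
    have "angle_pos w (k, n + k) = pt w k (shared w k)"
      using 2 by (cases "shared w k") (simp_all add: angle_pos_def prv_mid)
    then show ?thesis
      using 2 assms(2) angle_pos_after(1)[of k] angle_pos_before(3)[of k] pt_shared[of k]
      by (cases "shared w k"; cases s; cases t) (simp_all add: join_mid joinable_mid del: pt.simps)
  next
    case 3 then show ?thesis using angle_pos_after[of n] rank_ge_2
      by (cases s) (simp_all add: join_last side_after_def)
  qed
qed

lemma angle_pos_bound: "k < n \<Longrightarrow> e \<in> tri_edges w k \<Longrightarrow> \<bar>angle_pos w (k, e)\<bar> \<le> int k + 1"
proof -
  assume k: "k < n" and "e \<in> tri_edges w k"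
  then have "k \<le> n" "e \<in> tri_edges w k" by auto
  then show ?thesis
    by (rule angle_pos_cases)
      (use k pt_bounds[of k] pt_new[of k] in \<open>auto simp: angle_pos_0 angle_pos_after simp del: pt.simps\<close>)
qed

text \<open>This vertex of the diagonal \<open>k\<close> lies strictly between the end points of the next diagonal, which
  separates it from all later triangles.\<close>

lemma dead_vertex:
  assumes "0 < k" "k < n" "k < j" "j \<le> n + 1"
  shows "pt w j u \<noteq> pt w k (opposite (shared w k))"
  using pt_outside[of "Suc k" j u] pt_bounds[of k] pt_bounds[of "Suc k"] pt_new[of k] assms
  by (cases "shared w k") (auto simp del: pt.simps)

text \<open>In an initial part of a matching of angles, exactly one end point of each diagonal is occupied by an angle
  before this diagonal: the one at which the next edge starts.\<close>

lemma occupied: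
  assumes "0 < k" "k \<le> n" "\<And>j. j < k \<Longrightarrow> joinable w j (s j) (t j)"
    and "\<And>j. 0 < j \<Longrightarrow> j < k \<Longrightarrow> s j = opposite (t (j - 1))"
  shows "(\<exists>j<k. angle_pos w (j, join w j (s j) (t j)) = pt w k (opposite (t (k - 1)))) \<and>
    (\<forall>j<k. angle_pos w (j, join w j (s j) (t j)) \<noteq> pt w k (t (k - 1)))"
  using assms
proof (induction k)
  case (Suc k)
  let ?p = "\<lambda>j. angle_pos w (j, join w j (s j) (t j))" and ?sh = "shared w k"
  show ?case
  proof (cases "k = 0")
    case True
    have "?p 0 = pt w 1 (opposite (t 0))" using rank_ge_2 by (subst angle_pos_join) simp_all
    then show ?thesis using True pt_side_cancel[of 1] Suc.prems(2) by (auto simp del: pt.simps)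
  next
    case False
    then have k: "0 < k" "k < n" using Suc.prems by auto
    have IH: "\<exists>j<k. ?p j = pt w k (opposite (t (k - 1)))" "\<And>j. j < k \<Longrightarrow> ?p j \<noteq> pt w k (t (k - 1))"
      using Suc k by auto
    have s: "s k = opposite (t (k - 1))" "joinable w k (s k) (t k)"
      using Suc.prems(4)[of k] Suc.prems(3)[of k] k by simp_all
    have p: "?p k = (if s k = ?sh then pt w k (opposite (s k)) else pt w (Suc k) (opposite (t k)))"
      using angle_pos_join[OF _ s(2)] k by simp
    have new: "?p j \<noteq> pt w (Suc k) (opposite ?sh)" if "j < k" for j
    proof -
      have "\<bar>?p j\<bar> \<le> int j + 1" using that k by (intro angle_pos_bound join_in_tri_edges) auto
      then show ?thesis using that pt_new[OF k] by (auto simp del: pt.simps split: if_splits)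
    qed
    note sh = pt_shared[OF k]
    show ?thesis
    proof (cases "t (k - 1) = ?sh")
      case True
      then have p': "?p k = pt w (Suc k) (opposite (t k))" using p s(1) by simp
      have "?p j \<noteq> pt w (Suc k) (t k)" if "j < Suc k" for j
      proof (cases "j = k")
        case True then show ?thesis using p' pt_side_cancel[of "Suc k"] k by (simp del: pt.simps)
      next
        case False
        then have j: "j < k" using that by simp
        show ?thesis
        proof (cases "t k = ?sh")
          case t: True then show ?thesis using IH(2)[OF j] sh True by (simp del: pt.simps)
        next
          case False
          then have "t k = opposite ?sh" using neq_iff_opposite by blast
          then show ?thesis using new[OF j] by (simp del: pt.simps)
        qed
      qed
      then show ?thesis using p' by (simp del: pt.simps) blast
    next
      case False
      then have t1: "t (k - 1) = opposite ?sh" using neq_iff_opposite by blast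
      then have sk: "s k = ?sh" using s(1) by simp
      then have tk: "t k = opposite ?sh" using s(2) k neq_iff_opposite by (auto simp: joinable_mid)
      have ex: "\<exists>j<Suc k. ?p j = pt w (Suc k) (opposite (t k))"
        using IH(1) t1 tk sh by (auto simp del: pt.simps intro: less_SucI)
      have "pt w (Suc k) (opposite ?sh) \<noteq> pt w k (opposite ?sh)"
        using k by (intro dead_vertex) auto
      moreover have "?p k = pt w k (opposite ?sh)" unfolding p using sk by (simp only: if_True HOL.refl simp_thms)
      ultimately have "?p k \<noteq> pt w (Suc k) (t k)" using tk by metis
      then have "?p j \<noteq> pt w (Suc k) (t k)" if "j < Suc k" for j
        using new[of j] that tk by (cases "j = k") auto
      with ex show ?thesis by (simp del: pt.simps)
    qed
  qed
qed simp

text \<open>The end point at which the edge \<open>k\<close> does not start is free by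
  \<open>occupied\<close>, and a vertex added later is always free.\<close>

lemma chain_distinct:
  assumes join: "\<And>k. k \<le> n \<Longrightarrow> joinable w k (s k) (t k)"
    and chain: "\<And>k. 0 < k \<Longrightarrow> k \<le> n \<Longrightarrow> s k = opposite (t (k - 1))"
    and jk: "j < k" "k \<le> n"
  shows "angle_pos w (j, join w j (s j) (t j)) \<noteq> angle_pos w (k, join w k (s k) (t k))"
proof -
  let ?p = "\<lambda>j. angle_pos w (j, join w j (s j) (t j))"
  have free: "?p j \<noteq> pt w k (t (k - 1))" using occupied[of k s t] assms by auto
  have s: "s k = opposite (t (k - 1))" using chain jk by simp
  have p: "?p k = (if k = n \<or> s k = shared w k then pt w k (opposite (s k)) else pt w (Suc k) (opposite (t k)))"
    using angle_pos_join[OF jk(2) join[OF jk(2)]] jk by simp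
  show ?thesis
  proof (cases "k = n \<or> s k = shared w k")
    case True then show ?thesis using p free s by (simp del: pt.simps)
  next
    case False
    then have k: "0 < k" "k < n" "t (k - 1) = shared w k" using jk s neq_iff_opposite by force+
    show ?thesis
    proof (cases "t k = shared w k")
      case True
      have "\<bar>?p j\<bar> \<le> int j + 1" using jk k by (intro angle_pos_bound join_in_tri_edges) auto
      then show ?thesis using p False True pt_new[OF k(1,2)] jk by (auto simp del: pt.simps split: if_splits)
    next
      case F: False
      then have "t k = opposite (shared w k)" using neq_iff_opposite by blast
      then show ?thesis using p False free k pt_shared[OF k(1,2)] by (simp del: pt.simps)
    qed
  qed
qed

lemma pt_inner: "0 < k \<Longrightarrow> k \<le> n \<Longrightarrow>
    pt w k s \<in> {pt w 1 Lft, pt w 1 Rgt} \<union> (\<lambda>k. pt w (Suc k) (opposite (shared w k))) ` {1..<n}"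
proof (induction k arbitrary: s)
  case (Suc k)
  show ?case
  proof (cases "k = 0")
    case True then show ?thesis by (cases s) (auto simp del: pt.simps)
  next
    case False
    show ?thesis
    proof (cases "s = shared w k")
      case True then show ?thesis using Suc False pt_shared[of k] by (simp del: pt.simps)
    next
      case F: False
      then have "s = opposite (shared w k)" using neq_iff_opposite by blast
      then show ?thesis using Suc.prems False by (auto simp del: pt.simps)
    qed
  qed
qed simp

lemma card_inner_positions: "card (positions w - {0, int n + 1}) \<le> n + 1"
proof -
  let ?N = "(\<lambda>k. pt w (Suc k) (opposite (shared w k))) ` {1..<n}"
  have "positions w - {0, int n + 1} \<subseteq> {pt w 1 Lft, pt w 1 Rgt} \<union> ?N"
  proof
    fix p assume p: "p \<in> positions w - {0, int n + 1}"
    then obtain k s where k: "p = pt w k s" "k \<le> n + 1" by (auto simp: positions_def)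
    then have "k \<noteq> 0" "k \<noteq> Suc n" using p by (cases k; auto)+
    then show "p \<in> {pt w 1 Lft, pt w 1 Rgt} \<union> ?N" using pt_inner[of k s] k by simp
  qed
  then have "card (positions w - {0, int n + 1}) \<le> card ({pt w 1 Lft, pt w 1 Rgt} \<union> ?N)"
    by (intro card_mono) auto
  also have "\<dots> \<le> card {pt w 1 Lft, pt w 1 Rgt} + card ?N" by (rule card_Un_le)
  also have "\<dots> \<le> 2 + (n - 1)"
    by (intro add_mono order_trans[OF card_image_le]) (auto simp: card_insert_if)
  finally show ?thesis using rank_ge_2 by simp
qed

lemma angle_pos_join_inner:
  assumes "k \<le> n" "joinable w k s t"
  shows "\<exists>i u. 0 < i \<and> i \<le> n \<and> k \<le> i \<and> angle_pos w (k, join w k s t) = pt w i u"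
proof (cases "k = n \<or> 0 < k \<and> s = shared w k")
  case True
  then show ?thesis using angle_pos_join[OF assms] rank_ge_2 assms(1)
    by (intro exI[of _ k] exI[of _ "opposite s"]) auto
next
  case False
  then show ?thesis using angle_pos_join[OF assms] assms(1)
    by (intro exI[of _ "Suc k"] exI[of _ "opposite t"]) auto
qed

text \<open>There are as many selected angles as vertices other than \<open>a\<close> and
  \<open>b\<close>, so distinct vertices leave none of them out. In particular the end point of the
  diagonal \<open>k\<close> that belongs to no later triangle has to be occupied by one of the first
  angles, and this decides where the edge \<open>k\<close> starts.\<close>

lemma distinct_chain:
  assumes join: "\<And>k. k \<le> n \<Longrightarrow> joinable w k (s k) (t k)"
    and inj: "inj_on (\<lambda>k. angle_pos w (k, join w k (s k) (t k))) {..n}"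
    and k: "0 < k" "k \<le> n"
  shows "s k = opposite (t (k - 1))"
  using k
proof (induction k rule: less_induct)
  case (less k)
  let ?p = "\<lambda>j. angle_pos w (j, join w j (s j) (t j))"
  have neq: "?p i \<noteq> ?p j" if "i < j" "j \<le> n" for i j using inj that by (auto dest: inj_onD)
  have "?p ` {..n} \<subseteq> positions w - {0, int n + 1}"
  proof
    fix q assume "q \<in> ?p ` {..n}"
    then obtain i u where i: "0 < i" "i \<le> n" "q = pt w i u" using angle_pos_join_inner join by blast
    then show "q \<in> positions w - {0, int n + 1}"
      using pt_in_positions[of i u] pt_bounds[of i] by (cases u) auto
  qed
  moreover have "card (?p ` {..n}) = n + 1" using inj by (simp add: card_image)
  ultimately have surj: "?p ` {..n} = positions w - {0, int n + 1}"
    using card_inner_positions finite_positions by (intro card_seteq) auto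
  have occ: "\<exists>j<k. ?p j = pt w k (opposite (t (k - 1)))" "\<And>j. j < k \<Longrightarrow> ?p j \<noteq> pt w k (t (k - 1))"
    using occupied[of k s t] less join by auto
  show ?case
  proof (cases "k = n")
    case True
    have "?p n = pt w n (opposite (s n))" using angle_pos_join[OF _ join[of n]] by simp
    then have "opposite (s n) \<noteq> opposite (t (n - 1))" using occ(1) neq True by force
    then show ?thesis using True neq_iff_opposite by simp
  next
    case False
    then have k: "0 < k" "k < n" using less by auto
    let ?P = "pt w k (opposite (shared w k))"
    \<comment> \<open>The vertex of the diagonal \<open>k\<close> that no later triangle contains is
      occupied by some angle.\<close>
    have "?P \<in> positions w - {0, int n + 1}" using k pt_in_positions[of k] pt_bounds[of k]
      by (cases "shared w k") auto
    then obtain j where j: "j \<le> n" "?p j = ?P" using surj by (metis (no_types, lifting) atMost_iff imageE)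
    have jk: "j \<le> k"
    proof (rule ccontr)
      assume "\<not> j \<le> k"
      moreover obtain i u where "j \<le> i" "i \<le> n" "?p j = pt w i u"
        using angle_pos_join_inner[OF j(1) join[OF j(1)]] by blast
      ultimately show False using dead_vertex[OF k, of i u] j(2) by simp
    qed
    have p: "?p k = (if s k = shared w k then ?P else pt w (Suc k) (opposite (t k)))"
      using angle_pos_join[OF less.prems(2) join[OF less.prems(2)]] k by simp
    have dead: "pt w (Suc k) (opposite (t k)) \<noteq> ?P" using dead_vertex[OF k] k by (simp del: pt.simps)
    show ?thesis
    proof (cases "t (k - 1) = shared w k")
      case True
      then obtain i where "i < k" "?p i = ?P" using occ(1) by auto
      then have "?p k \<noteq> ?P" using neq[of i k] k by simp
      then have "s k \<noteq> shared w k" using p by auto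
      then have "s k = opposite (shared w k)" by (simp only: neq_iff_opposite[of "s k" "shared w k"] simp_thms)
      then show ?thesis using True by simp
    next
      case False
      then have t: "t (k - 1) = opposite (shared w k)" using neq_iff_opposite by blast
      then have "\<not> j < k" using occ(2) j(2) by auto
      then have "?p k = ?P" using j jk by simp
      then have "s k = shared w k" using p dead by (auto split: if_splits)
      then show ?thesis using t by simp
    qed
  qed
qed

lemma nodes_AM: "nodes (AM w) = angle_set ` ideals w"
proof
  show "angle_set ` ideals w \<subseteq> nodes (AM w)"
  proof
    fix A assume "A \<in> angle_set ` ideals w"
    then obtain I where I: "I \<in> ideals w" "A = angle_set I" by blast
    let ?s = "\<lambda>k. opposite (side_of I k)" and ?t = "\<lambda>k. side_of I (Suc k)"
    have A: "A = {(k, join w k (?s k) (?t k)) | k. k \<le> n}" using I(2) by (simp add: angle_set_def selected_def)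
    have dist: "angle_pos w (j, join w j (?s j) (?t j)) \<noteq> angle_pos w (k, join w k (?s k) (?t k))"
      if "j < k" "k \<le> n" for j k
      by (rule chain_distinct) (use that selected_joinable[OF I(1)] in auto)
    have "inj_on (vertex_at w) A"
    proof (rule inj_onI)
      fix x y assume xy: "x \<in> A" "y \<in> A" "vertex_at w x = vertex_at w y"
      then obtain j k where jk: "x = (j, join w j (?s j) (?t j))" "y = (k, join w k (?s k) (?t k))" "j \<le> n" "k \<le> n"
        unfolding A by blast
      then have "angle_pos w x = angle_pos w y" using xy(3) vertex_at_eq_vert vert_eq_iff angle_pos_in_positions
        by (metis fst_conv join_in_tri_edges snd_conv valid_angle_def)
      then show "x = y" using dist[of j k] dist[of k j] jk by (cases j k rule: linorder_cases) auto
    qed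
    moreover have "angle_selection w A"
      unfolding A by (rule angle_selection_joins) (rule selected_joinable[OF I(1)])
    ultimately show "A \<in> nodes (AM w)" by (simp add: AM_def)
  qed
  show "nodes (AM w) \<subseteq> angle_set ` ideals w"
  proof
    fix A assume "A \<in> nodes (AM w)"
    then have A: "angle_selection w A" "inj_on (vertex_at w) A" by (auto simp: AM_def)
    obtain s t where st: "\<And>k. k \<le> n \<Longrightarrow> joinable w k (s k) (t k)" "A = {(k, join w k (s k) (t k)) | k. k \<le> n}"
      using angle_selection_join[OF A(1)] by blast
    have "inj_on (\<lambda>k. angle_pos w (k, join w k (s k) (t k))) {..n}"
    proof (rule inj_onI)
      fix j k assume *: "j \<in> {..n}" "k \<in> {..n}"
        "angle_pos w (j, join w j (s j) (t j)) = angle_pos w (k, join w k (s k) (t k))"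
      then have "vertex_at w (j, join w j (s j) (t j)) = vertex_at w (k, join w k (s k) (t k))"
        by (simp add: vertex_at_eq_vert join_in_tri_edges)
      moreover have "(j, join w j (s j) (t j)) \<in> A" "(k, join w k (s k) (t k)) \<in> A" using * st(2) by auto
      ultimately show "j = k" using A(2) by (auto dest: inj_onD)
    qed
    from distinct_chain[OF st(1) this] st(1) obtain I where
      "I \<in> ideals w" "\<And>k. k \<le> n \<Longrightarrow> selected w I k = join w k (s k) (t k)"
      using chain_ideal[of s t] by metis
    then show "A \<in> angle_set ` ideals w" unfolding st(2) angle_set_def by (intro image_eqI[of _ _ I]) auto
  qed
qed

theorem AM_modelled: "modelled w (AM w) angle_set"
  unfolding modelled_def
  using inj_angle_set nodes_AM up_AM angle_move_iff by (simp add: bij_betw_def)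

lemma AM_weight: "weight (AM w) (angle_set I) = (\<Prod>k\<le>n. X (selected w I k))"
  by (simp add: AM_def angle_weight_angle_set)

subsection \<open>Parity\<close>

text \<open>An angle is not selected exactly if its vertex is an end point of the selected edge.  The parity condition
  thus says that the selected edges form a graph in which all vertices but \<open>a\<close> and \<open>b\<close> have even degree.\<close>

definition degree :: "(nat \<Rightarrow> side) \<Rightarrow> (nat \<Rightarrow> side) \<Rightarrow> nat \<Rightarrow> int \<Rightarrow> nat" where
  "degree s t k p = card {j. j < k \<and> (p = pt w j (s j) \<or> p = pt w (Suc j) (t j))}"

lemma degree_Suc: "degree s t (Suc k) p = degree s t k p + of_bool (p = pt w k (s k) \<or> p = pt w (Suc k) (t k))"
proof -
  have "{j. j < Suc k \<and> (p = pt w j (s j) \<or> p = pt w (Suc j) (t j))} =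
    {j. j < k \<and> (p = pt w j (s j) \<or> p = pt w (Suc j) (t j))} \<union>
    (if p = pt w k (s k) \<or> p = pt w (Suc k) (t k) then {k} else {})" by (auto simp: less_Suc_eq simp del: pt.simps)
  then show ?thesis by (simp add: degree_def del: pt.simps)
qed

lemma degree_0: "degree s t 0 p = 0"
  by (simp add: degree_def)

lemma even_selected_iff_degree:
  assumes join: "\<And>k. k \<le> n \<Longrightarrow> joinable w k (s k) (t k)" and p: "p \<in> positions w"
    and A: "A = {(k, join w k (s k) (t k)) | k. k \<le> n}"
  shows "(even (card {\<alpha> \<in> A. vertex_at w \<alpha> = vert w p}) \<longleftrightarrow>
      even (card {k. k \<le> n \<and> (\<exists>e\<in>tri_edges w k. vertex_at w (k, e) = vert w p)})) \<longleftrightarrow>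
    even (degree s t (Suc n) p)"
proof -
  let ?e = "\<lambda>k. join w k (s k) (t k)"
  let ?S = "{k. k \<le> n \<and> angle_pos w (k, ?e k) = p}"
  let ?K = "{k. k \<le> n \<and> (\<exists>e\<in>tri_edges w k. angle_pos w (k, e) = p)}"
  have v: "vertex_at w (k, e) = vert w p \<longleftrightarrow> angle_pos w (k, e) = p" if "k \<le> n" "e \<in> tri_edges w k" for k e
    using that p vert_eq_iff angle_pos_in_positions by (simp add: vertex_at_eq_vert valid_angle_def)
  have "{\<alpha> \<in> A. vertex_at w \<alpha> = vert w p} = (\<lambda>k. (k, ?e k)) ` ?S"
    unfolding A using v[OF _ join_in_tri_edges] by blast
  then have cS: "card {\<alpha> \<in> A. vertex_at w \<alpha> = vert w p} = card ?S" by (simp add: card_image inj_on_def)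
  have K: "{k. k \<le> n \<and> (\<exists>e\<in>tri_edges w k. vertex_at w (k, e) = vert w p)} = ?K" using v by auto
  have sub: "?S \<subseteq> ?K" using join_in_tri_edges by blast
  have fin: "finite ?K" by simp
  have "?K - ?S = {j. j < Suc n \<and> (p = pt w j (s j) \<or> p = pt w (Suc j) (t j))}"
  proof (rule Set.set_eqI)
    fix k
    show "k \<in> ?K - ?S \<longleftrightarrow> k \<in> {j. j < Suc n \<and> (p = pt w j (s j) \<or> p = pt w (Suc j) (t j))}"
    proof (cases "k \<le> n")
      case True
      have tri: "?e k \<in> tri_edges w k" using True by (rule join_in_tri_edges)
      have ne: "angle_pos w (k, f) \<noteq> angle_pos w (k, ?e k)" if "f \<in> tri_edges w k" "f \<noteq> ?e k" for f
        using that tri_edges_nxt_prv[OF True tri] turn_distinct[OF triangle_turn[OF True tri]] by auto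
      have "k \<in> ?K - ?S \<longleftrightarrow> (\<exists>f\<in>tri_edges w k. f \<noteq> ?e k \<and> angle_pos w (k, f) = p)"
      proof
        assume "k \<in> ?K - ?S"
        then obtain f where f: "f \<in> tri_edges w k" "angle_pos w (k, f) = p" "angle_pos w (k, ?e k) \<noteq> p"
          using True by auto
        then have "f \<noteq> ?e k" by (intro notI) simp
        then show "\<exists>f\<in>tri_edges w k. f \<noteq> ?e k \<and> angle_pos w (k, f) = p" using f by blast
      next
        assume "\<exists>f\<in>tri_edges w k. f \<noteq> ?e k \<and> angle_pos w (k, f) = p"
        then obtain f where f: "f \<in> tri_edges w k" "f \<noteq> ?e k" "angle_pos w (k, f) = p" by blast
        then show "k \<in> ?K - ?S" using ne[OF f(1,2)] True by force
      qed
      also have "\<dots> \<longleftrightarrow> p \<in> edge_pos w k (?e k)" unfolding edge_pos_def by auto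
      finally have "k \<in> ?K - ?S \<longleftrightarrow> p \<in> edge_pos w k (?e k)" .
      then show ?thesis using edge_pos_join[OF True join[OF True]] True by (auto simp del: pt.simps)
    qed auto
  qed
  then have "card ?K = card ?S + degree s t (Suc n) p"
    using card_Diff_subset[OF finite_subset[OF sub fin] sub] card_mono[OF fin sub] by (simp add: degree_def del: pt.simps)
  then show ?thesis unfolding cS K by auto
qed

text \<open>The first \<open>k\<close> edges form a walk starting at \<open>a\<close>, so apart from
  \<open>a\<close> only its last vertex can have odd degree.\<close>

lemma odd_degree_iff:
  assumes "0 < k" "k \<le> n + 1" "\<And>j. j < k \<Longrightarrow> joinable w j (s j) (t j)"
    "\<And>j. 0 < j \<Longrightarrow> j < k \<Longrightarrow> s j = t (j - 1)" "p \<noteq> 0"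
  shows "odd (degree s t k p) \<longleftrightarrow> p = pt w k (t (k - 1))"
  using assms(1-4)
proof (induction k)
  case (Suc k)
  show ?case
  proof (cases "k = 0")
    case True then show ?thesis using assms(5) by (simp add: degree_Suc degree_0 del: pt.simps(2))
  next
    case False
    then have "odd (degree s t k p) \<longleftrightarrow> p = pt w k (s k)" using Suc by simp
    moreover have "pt w k (s k) \<noteq> pt w (Suc k) (t k)" using Suc.prems by (intro pt_step_neq) auto
    ultimately show ?thesis by (auto simp: degree_Suc simp del: pt.simps)
  qed
qed simp

text \<open>The end point of the diagonal \<open>k\<close> that belongs to no later triangle already has
  its final degree after the edge \<open>k\<close>, so its parity tells whether this edge continues the
  walk.\<close>

lemma even_degree_chain:
  assumes join: "\<And>k. k \<le> n \<Longrightarrow> joinable w k (s k) (t k)"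
    and even: "\<And>p. p \<in> positions w \<Longrightarrow> p \<noteq> 0 \<Longrightarrow> p \<noteq> int n + 1 \<Longrightarrow> even (degree s t (Suc n) p)"
    and k: "0 < k" "k \<le> n"
  shows "s k = t (k - 1)"
  using k
proof (induction k rule: less_induct)
  case (less k)
  have pos: "pt w k u \<in> positions w" "pt w k u \<noteq> 0" "pt w k u \<noteq> int n + 1" for u
    using pt_in_positions[of k u] pt_bounds[of k] less.prems by (cases u; auto)+
  have odd: "odd (degree s t k (pt w k u)) \<longleftrightarrow> u = t (k - 1)" for u
    using odd_degree_iff[of k s t "pt w k u"] less join pos(2) pt_side_cancel[of k u] by auto
  show ?case
  proof (cases "k = n")
    case True
    have "degree s t (Suc n) (pt w n u) = degree s t n (pt w n u) + of_bool (u = s n)" for u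
      using degree_Suc[of s t n "pt w n u"] pos(3)[of u] pt_side_cancel[of n u "s n"] True less.prems
      by (simp del: pt.simps(2))
    then have "even (degree s t n (pt w n (s n)) + 1)" using even[OF pos(1-3)[of "s n"]] True by simp
    then show ?thesis using odd[of "s n"] True by simp
  next
    case False
    then have k: "0 < k" "k < n" using less by auto
    let ?u = "opposite (shared w k)"
    let ?P = "pt w k ?u"
    have "{j. j < Suc n \<and> (?P = pt w j (s j) \<or> ?P = pt w (Suc j) (t j))} =
        {j. j < Suc k \<and> (?P = pt w j (s j) \<or> ?P = pt w (Suc j) (t j))}"
    proof (rule Collect_cong)
      fix j
      show "j < Suc n \<and> (?P = pt w j (s j) \<or> ?P = pt w (Suc j) (t j)) \<longleftrightarrow>
          j < Suc k \<and> (?P = pt w j (s j) \<or> ?P = pt w (Suc j) (t j))"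
      proof (cases "j < Suc k")
        case True then show ?thesis using k by (simp del: pt.simps)
      next
        case False
        then have "j < Suc n \<Longrightarrow> ?P \<noteq> pt w j (s j) \<and> ?P \<noteq> pt w (Suc j) (t j)"
          using dead_vertex[OF k, of j "s j"] dead_vertex[OF k, of "Suc j" "t j"] by (auto simp del: pt.simps)
        then show ?thesis using False by blast
      qed
    qed
    then have "degree s t (Suc n) ?P = degree s t (Suc k) ?P" by (simp add: degree_def del: pt.simps)
    also have "\<dots> = degree s t k ?P + of_bool (?u = s k)"
      using degree_Suc[of s t k ?P] dead_vertex[OF k, of "Suc k" "t k"] pt_side_cancel[of k ?u "s k"] k
      by (simp del: pt.simps)
    finally have eq: "degree s t (Suc n) ?P = degree s t k ?P + of_bool (?u = s k)" .
    have "even (degree s t k ?P + of_bool (?u = s k))"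
      using even[OF pos(1)[of ?u] pos(2)[of ?u] pos(3)[of ?u]] unfolding eq .
    then have "?u = s k \<longleftrightarrow> ?u = t (k - 1)" using odd[of ?u] by (auto split: if_splits)
    then show ?thesis using neq_iff_opposite by metis
  qed
qed

lemma angle_set_dual: "nonempty_word.angle_set (dual w) I =
    {(k, join w k (path_side I k) (path_side I (Suc k))) | k. k \<le> n}"
  using selected_dual by (auto simp: nonempty_word.angle_set_def[OF nonempty_dual])

lemma nodes_AP: "nodes (AP w) = nonempty_word.angle_set (dual w) ` ideals (dual w)"
proof
  have ab: "vertices w - {vertex_a w, vertex_b w} = vert w ` (positions w - {0, int n + 1})"
  proof -
    have "{0, int n + 1} \<subseteq> positions w"
      using pt_in_positions[of 0 Lft] pt_in_positions[of "Suc n" Lft] by (simp add: add.commute)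
    then show ?thesis using inj_on_image_set_diff[OF inj_vert, of "positions w" "{0, int n + 1}"]
      by (simp add: vertices_eq vertex_a_eq vertex_b_eq)
  qed
  show "nonempty_word.angle_set (dual w) ` ideals (dual w) \<subseteq> nodes (AP w)"
  proof
    fix A assume "A \<in> nonempty_word.angle_set (dual w) ` ideals (dual w)"
    then obtain I where I: "I \<in> ideals (dual w)" "A = nonempty_word.angle_set (dual w) I" by blast
    let ?s = "path_side I" and ?t = "\<lambda>k. path_side I (Suc k)"
    have join: "joinable w k (?s k) (?t k)" if "k \<le> n" for k using I(1) that by (simp add: ideals_dual)
    have A: "A = {(k, join w k (?s k) (?t k)) | k. k \<le> n}" using I(2) by (simp add: angle_set_dual)
    have "even (degree ?s ?t (Suc n) p)" if "p \<noteq> 0" "p \<noteq> int n + 1" for p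
      using odd_degree_iff[of "Suc n" ?s ?t p] join that by (auto simp: add.commute)
    then have "\<forall>v\<in>vertices w - {vertex_a w, vertex_b w}. even (card {\<alpha> \<in> A. vertex_at w \<alpha> = v}) \<longleftrightarrow>
          even (card {k. k \<le> n \<and> (\<exists>e\<in>tri_edges w k. vertex_at w (k, e) = v)})"
      unfolding ab using even_selected_iff_degree[OF join _ A] by auto
    moreover have "angle_selection w A" unfolding A by (rule angle_selection_joins) (rule join)
    ultimately show "A \<in> nodes (AP w)" by (simp add: AP_def)
  qed
  show "nodes (AP w) \<subseteq> nonempty_word.angle_set (dual w) ` ideals (dual w)"
  proof
    fix A assume "A \<in> nodes (AP w)"
    then have A: "angle_selection w A" "\<forall>v\<in>vertices w - {vertex_a w, vertex_b w}.
          even (card {\<alpha> \<in> A. vertex_at w \<alpha> = v}) \<longleftrightarrow>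
          even (card {k. k \<le> n \<and> (\<exists>e\<in>tri_edges w k. vertex_at w (k, e) = v)})" by (auto simp: AP_def)
    obtain s t where st: "\<And>k. k \<le> n \<Longrightarrow> joinable w k (s k) (t k)" "A = {(k, join w k (s k) (t k)) | k. k \<le> n}"
      using angle_selection_join[OF A(1)] by blast
    have "even (degree s t (Suc n) p)" if "p \<in> positions w" "p \<noteq> 0" "p \<noteq> int n + 1" for p
      using A(2) that even_selected_iff_degree[OF st(1) that(1) st(2)] unfolding ab by blast
    then have "s k = t (k - 1)" if "0 < k" "k \<le> n" for k
      using even_degree_chain[OF st(1)] that by blast
    then obtain I where "I \<in> ideals (dual w)" "\<And>k. k \<le> n \<Longrightarrow> selected (dual w) I k = join w k (s k) (t k)"
      using chain_ideal_dual[of s t] st(1) by metis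
    then show "A \<in> nonempty_word.angle_set (dual w) ` ideals (dual w)"
      unfolding st(2) nonempty_word.angle_set_def[OF nonempty_dual] by (intro image_eqI[of _ _ I]) auto
  qed
qed

theorem AP_modelled: "modelled (dual w) (AP w) (nonempty_word.angle_set (dual w))"
  unfolding modelled_def
  using nonempty_word.inj_angle_set[OF nonempty_dual] nodes_AP up_AP nonempty_word.angle_move_iff[OF nonempty_dual]
  by (simp add: bij_betw_def)

lemma AP_weight: "weight (AP w) (nonempty_word.angle_set (dual w) I) = (\<Prod>k\<le>n. X (selected (dual w) I k))"
  using nonempty_word.angle_weight_angle_set[OF nonempty_dual, of I] by (simp add: AP_def)

end

section \<open>Paths of edges\<close>

text \<open>The recursive form of the existence of a sequence of vertices in
  \<open>edge_path\<close>.\<close>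

fun walk :: "word \<Rightarrow> vertex \<Rightarrow> nat list \<Rightarrow> vertex \<Rightarrow> bool" where
  "walk w u [] v \<longleftrightarrow> u = v"
| "walk w u (e # es) v \<longleftrightarrow> (\<exists>u'. ends w e = {u, u'} \<and> walk w u' es v)"

lemma walk_iff:
  "walk w u es v \<longleftrightarrow> (\<exists>vs. length vs = length es + 1 \<and> hd vs = u \<and> last vs = v \<and>
     (\<forall>j<length es. ends w (es ! j) = {vs ! j, vs ! (j + 1)}))"
proof (induction es arbitrary: u)
  case Nil
  show ?case by (auto simp: length_Suc_conv intro: exI[of _ "[u]"])
next
  case (Cons e es)
  show ?case
  proof
    assume "walk w u (e # es) v"
    then obtain u' where u': "ends w e = {u, u'}" "walk w u' es v" by auto
    obtain vs where vs: "length vs = length es + 1" "hd vs = u'" "last vs = v"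
      "\<And>j. j < length es \<Longrightarrow> ends w (es ! j) = {vs ! j, vs ! (j + 1)}" using Cons u'(2) by blast
    have "vs \<noteq> []" "vs ! 0 = u'" using vs(1,2) by (cases vs; simp)+
    then show "\<exists>vs. length vs = length (e # es) + 1 \<and> hd vs = u \<and> last vs = v \<and>
       (\<forall>j<length (e # es). ends w ((e # es) ! j) = {vs ! j, vs ! (j + 1)})"
      using vs u'(1) by (intro exI[of _ "u # vs"]) (auto simp: less_Suc_eq_0_disj)
  next
    assume "\<exists>vs. length vs = length (e # es) + 1 \<and> hd vs = u \<and> last vs = v \<and>
       (\<forall>j<length (e # es). ends w ((e # es) ! j) = {vs ! j, vs ! (j + 1)})"
    then obtain vs where vs: "length vs = length (e # es) + 1" "hd vs = u" "last vs = v"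
      "\<And>j. j < length (e # es) \<Longrightarrow> ends w ((e # es) ! j) = {vs ! j, vs ! (j + 1)}" by blast
    obtain vs' where vs': "vs = u # vs'" "vs' \<noteq> []" using vs(1,2) by (cases vs; cases "tl vs") auto
    have "ends w e = {u, hd vs'}" using vs(4)[of 0] vs' by (simp add: hd_conv_nth)
    moreover have "ends w (es ! j) = {vs' ! j, vs' ! (j + 1)}" if "j < length es" for j
      using vs(4)[of "Suc j"] vs' that by simp
    then have "walk w (hd vs') es v" unfolding Cons using vs(1,3) vs' by (intro exI[of _ vs']) simp
    ultimately show "walk w u (e # es) v" by auto
  qed
qed

lemma edge_path_iff_walk: "edge_path w es \<longleftrightarrow>
    set es \<subseteq> {1..2 * rank w + 3} \<and> walk w (vertex_a w) es (vertex_b w)"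
  by (simp add: edge_path_def walk_iff)

context nonempty_word
begin

lemma angle_pos_inject: "k \<le> n \<Longrightarrow> e \<in> tri_edges w k \<Longrightarrow> f \<in> tri_edges w k \<Longrightarrow>
    angle_pos w (k, f) = angle_pos w (k, e) \<longleftrightarrow> f = e"
  using tri_edges_nxt_prv[of k e] turn_distinct[OF triangle_turn[of k e]] by auto

lemma vertex_in_ends_iff:
  assumes "k \<le> n" "e \<in> tri_edges w k" "f \<in> tri_edges w k"
  shows "vertex_at w (k, f) \<in> ends w e \<longleftrightarrow> f \<noteq> e"
proof -
  have pos: "angle_pos w (k, g) \<in> positions w" if "g \<in> tri_edges w k" for g
    using that assms(1) angle_pos_in_positions by (simp add: valid_angle_def)
  have "vertex_at w (k, f) \<in> ends w e \<longleftrightarrow> (\<exists>g\<in>tri_edges w k - {e}. angle_pos w (k, f) = angle_pos w (k, g))"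
    using assms pos vert_eq_iff by (auto simp: ends_eq edge_pos_def vertex_at_eq_vert)
  then show ?thesis using assms angle_pos_inject by auto
qed

lemma diag_end_before: "0 < i \<Longrightarrow> i \<le> n \<Longrightarrow> diag_end w i s = vertex_at w (i - 1, side_before w i (opposite s))"
  by (cases s) (simp_all add: diag_end_def left_end_def right_end_def side_before_def)

lemma the_side_before:
  assumes "0 < i" "i \<le> n"
  shows "(THE e. e \<in> tri_edges w (i - 1) - {i} \<and> diag_end w i s \<in> ends w e) = side_before w i s"
proof (rule the_equality)
  have tri: "tri_edges w (i - 1) = {i, side_before w i s, side_before w i (opposite s)}"
    using tri_edges_nxt_prv[of "i - 1" i] diagonal_in_tri_edges(2)[of "i - 1"] assms
    by (cases s) (auto simp: side_before_def)
  have in_ends: "diag_end w i s \<in> ends w e \<longleftrightarrow> side_before w i (opposite s) \<noteq> e" if "e \<in> tri_edges w (i - 1)" for e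
    using vertex_in_ends_iff[of "i - 1" e "side_before w i (opposite s)"] that assms side_before_in diag_end_before
    by simp
  show "side_before w i s \<in> tri_edges w (i - 1) - {i} \<and> diag_end w i s \<in> ends w (side_before w i s)"
    using in_ends[of "side_before w i s"] side_before_in[OF assms] side_before_neq[OF assms] side_before_cancel[OF assms]
    by simp
  show "e = side_before w i s" if "e \<in> tri_edges w (i - 1) - {i} \<and> diag_end w i s \<in> ends w e" for e
    using that in_ends[of e] tri by auto
qed

lemma the_side_after:
  assumes "0 < i" "i \<le> n"
  shows "(THE e. e \<in> tri_edges w i - {i} \<and> diag_end w i s \<in> ends w e) = side_after w i s"
proof (rule the_equality)
  have tri: "tri_edges w i = {i, side_after w i s, side_after w i (opposite s)}"
    using tri_edges_nxt_prv[of i i] diagonal_in_tri_edges(1)[of i] assms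
    by (cases s) (auto simp: side_after_def)
  have in_ends: "diag_end w i s \<in> ends w e \<longleftrightarrow> side_after w i (opposite s) \<noteq> e" if "e \<in> tri_edges w i" for e
    using vertex_in_ends_iff[of i e "side_after w i (opposite s)"] that assms side_after_in diag_end_after
    by simp
  show "side_after w i s \<in> tri_edges w i - {i} \<and> diag_end w i s \<in> ends w (side_after w i s)"
    using in_ends[of "side_after w i s"] side_after_in[OF assms] side_after_neq[OF assms] side_after_cancel[OF assms]
    by simp
  show "e = side_after w i s" if "e \<in> tri_edges w i - {i} \<and> diag_end w i s \<in> ends w e" for e
    using that in_ends[of e] tri by auto
qed

lemma u_d_sides:
  assumes "0 < i" "i \<le> n"
  shows "u_side w i (i - 1) = side_before w i Lft" "d_side w i (i - 1) = side_before w i Rgt"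
    "u_side w i i = side_after w i Lft" "d_side w i i = side_after w i Rgt"
  using the_side_before[OF assms, of Lft] the_side_before[OF assms, of Rgt]
    the_side_after[OF assms, of Lft] the_side_after[OF assms, of Rgt]
  by (simp_all add: u_side_def d_side_def diag_end_def)

lemma side_before_after_neq: "0 < i \<Longrightarrow> i \<le> n \<Longrightarrow> side_before w i s \<noteq> side_after w i t"
  using tri_edges_disjoint[of "i - 1" i "side_before w i s"] side_before_in[of i s] side_after_in[of i t]
    side_before_neq[of i s] by auto

subsection \<open>S-paths\<close>

definition S_list :: "nat set \<Rightarrow> nat list" where
  "S_list I = map (selected w I) [0..<Suc n]"

lemma not_joinable_eq: "\<not> joinable w k s t \<Longrightarrow> pt w k s = pt w (Suc k) t"
  using pt_shared[of k] by (auto simp: joinable_def simp del: pt.simps)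

lemma nth_S_list: "k \<le> n \<Longrightarrow> S_list I ! k = selected w I k"
  using nth_map_upt[of k "Suc n" 0 "selected w I"] by (simp add: S_list_def del: upt_Suc)

lemma length_S_list: "length (S_list I) = Suc n"
  by (simp add: S_list_def)

lemma inj_S_list: "inj_on S_list (ideals w)"
  by (rule inj_onI) (metis nth_S_list selected_inject)

lemma S_list_update:
  assumes "0 < i" "i \<le> n" "I \<in> ideals w" "i \<notin> I" "insert i I \<in> ideals w"
  shows "S_list (insert i I) = (S_list I)[i - 1 := side_before w i Lft, i := side_after w i Rgt]"
  using assms(1,2) insert_ideal_iff(2)[OF assms]
  by (intro nth_equalityI) (auto simp: length_S_list nth_S_list nth_list_update)

lemma S_list_move_iff:
  assumes i: "0 < i" "i \<le> n" and IJ: "I \<in> ideals w" "J \<in> ideals w"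
  shows "(\<exists>xs ys. S_list I = xs @ [side_before w i Rgt, side_after w i Lft] @ ys \<and>
      S_list J = xs @ [side_before w i Lft, side_after w i Rgt] @ ys) \<longleftrightarrow> i \<notin> I \<and> J = insert i I"
    (is "?L \<longleftrightarrow> ?R")
proof
  assume ?L
  then obtain xs ys where S: "S_list I = xs @ [side_before w i Rgt, side_after w i Lft] @ ys"
      "S_list J = xs @ [side_before w i Lft, side_after w i Rgt] @ ys" by blast
  let ?j = "length xs"
  have len: "Suc ?j \<le> n" using length_S_list[of I] S(1) by simp
  have at: "selected w I ?j = side_before w i Rgt" "selected w I (Suc ?j) = side_after w i Lft"
    using nth_S_list[of ?j I] nth_S_list[of "Suc ?j" I] S(1) len by (simp_all add: nth_append)
  then have tri: "side_before w i Rgt \<in> tri_edges w ?j" "side_after w i Lft \<in> tri_edges w (Suc ?j)"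
    using selected_in_tri_edges[of ?j I] selected_in_tri_edges[of "Suc ?j" I] len by auto
  have "?j = i - 1"
  proof (cases ?j "i - 1" rule: linorder_cases)
    case less
    then have "Suc ?j < i" by simp
    then show ?thesis using tri_edges_disjoint[of "Suc ?j" i "side_after w i Lft"] tri(2) side_after_in[OF i] side_after_neq[OF i] i by auto
  next
    case greater
    then show ?thesis
      using tri_edges_disjoint[of "i - 1" ?j] tri(1) side_before_in[OF i] side_before_neq[OF i] i len by fastforce
  qed
  then have *: "i \<notin> I" "insert i I \<in> ideals w" using insert_ideal_iff(1)[OF i IJ(1)] at i by auto
  have "\<not> i < i - Suc 0" by simp
  have "S_list (insert i I) = S_list J"
    unfolding S_list_update[OF i IJ(1) *] using S \<open>?j = i - 1\<close> i \<open>\<not> i < i - Suc 0\<close>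
    by (simp add: list_update_append)
  then show ?R using inj_S_list * IJ by (auto dest: inj_onD)
next
  assume R: ?R
  then have *: "i \<notin> I" "insert i I \<in> ideals w" using IJ by auto
  have at: "S_list I ! (i - 1) = side_before w i Rgt" "S_list I ! i = side_after w i Lft"
    using insert_ideal_iff(1)[OF i IJ(1)] * i by (simp_all add: nth_S_list)
  have "\<not> i < i - Suc 0" by simp
  define xs where "xs = take (i - 1) (S_list I)"
  define ys where "ys = drop (Suc i) (S_list I)"
  have len: "length xs = i - 1" using i by (simp add: xs_def length_S_list)
  have "S_list I = xs @ drop (i - 1) (S_list I)" by (simp add: xs_def)
  also have "drop (i - 1) (S_list I) = side_before w i Rgt # side_after w i Lft # ys"
    using i at Cons_nth_drop_Suc[of "i - 1" "S_list I"] Cons_nth_drop_Suc[of i "S_list I"]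
    by (simp add: length_S_list ys_def)
  finally have S: "S_list I = xs @ [side_before w i Rgt, side_after w i Lft] @ ys" by simp
  have "S_list J = xs @ [side_before w i Lft, side_after w i Rgt] @ ys"
    using S_list_update[OF i IJ(1) *] R len i \<open>\<not> i < i - Suc 0\<close> unfolding S by (simp add: list_update_append)
  then show ?L using S by blast
qed

lemma edge_pos_tri: "k \<le> n \<Longrightarrow> edge_pos w k e \<subseteq> {pt w k Lft, pt w k Rgt, pt w (Suc k) Lft, pt w (Suc k) Rgt}"
proof
  fix p assume k: "k \<le> n" and "p \<in> edge_pos w k e"
  then obtain f where f: "f \<in> tri_edges w k" "p = angle_pos w (k, f)" by (auto simp: edge_pos_def)
  from k f(1) show "p \<in> {pt w k Lft, pt w k Rgt, pt w (Suc k) Lft, pt w (Suc k) Rgt}"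
    by (rule angle_pos_cases) (use f k in \<open>cases "shared w k"; auto simp: angle_pos_0 angle_pos_after simp del: pt.simps(2)\<close>)+
qed

lemma S_path_S_list:
  assumes "I \<in> ideals (dual w)" shows "S_path w (nonempty_word.S_list (dual w) I)"
proof -
  let ?S = "nonempty_word.S_list (dual w) I"
  have nth: "?S ! k = join w k (path_side I k) (path_side I (Suc k))" if "k \<le> n" for k
    using nonempty_word.nth_S_list[OF nonempty_dual, of k I] that selected_dual by simp
  have len: "length ?S = Suc n" using nonempty_word.length_S_list[OF nonempty_dual] by simp
  have join: "joinable w k (path_side I k) (path_side I (Suc k))" if "k \<le> n" for k
    using assms that by (simp add: ideals_dual)
  define vs where "vs = map (\<lambda>k. vert w (pt w k (path_side I k))) [0..<Suc (Suc n)]"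
  have vs: "vs ! k = vert w (pt w k (path_side I k))" if "k \<le> Suc n" for k
    using that unfolding vs_def by (subst nth_map_upt) simp_all
  have lvs: "length vs = Suc (Suc n)" by (simp add: vs_def)
  have "walk w (vertex_a w) ?S (vertex_b w)"
    unfolding walk_iff
  proof (intro exI[of _ vs] conjI allI impI)
    show "length vs = length ?S + 1" using len lvs by simp
    show "hd vs = vertex_a w" using vs[of 0] lvs by (simp add: hd_conv_nth vertex_a_eq length_0_conv[symmetric] del: length_0_conv)
    show "last vs = vertex_b w" using vs[of "Suc n"] lvs
      by (simp add: last_conv_nth vertex_b_eq add.commute length_0_conv[symmetric] del: length_0_conv)
    fix j assume "j < length ?S"
    then have j: "j \<le> n" using len by simp
    then show "ends w (?S ! j) = {vs ! j, vs ! (j + 1)}"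
      using nth[OF j] ends_join[OF j join[OF j]] vs[of j] vs[of "Suc j"] by (simp del: pt.simps)
  qed
  moreover have "set ?S \<subseteq> labels"
  proof
    fix e assume "e \<in> set ?S"
    then obtain k where "k \<le> n" "e = ?S ! k" using len by (metis in_set_conv_nth less_Suc_eq_le)
    then show "e \<in> labels" using nth join_in_labels by simp
  qed
  ultimately show ?thesis unfolding S_path_def edge_path_iff_walk
    using len nth join_in_tri_edges by simp
qed

text \<open>Two consecutive triangles have only the end points of the diagonal between them in common, so
  the vertex between two edges of an S-path is one of these.\<close>

lemma S_path_sides:
  assumes "S_path w S"
  obtains I where "I \<in> ideals (dual w)" "S = nonempty_word.S_list (dual w) I"
proof -
  have S: "set S \<subseteq> labels" "length S = Suc n" "\<And>k. k \<le> n \<Longrightarrow> S ! k \<in> tri_edges w k"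
    and "walk w (vertex_a w) S (vertex_b w)" using assms by (auto simp: S_path_def edge_path_iff_walk)
  then obtain vs where vs: "length vs = Suc (Suc n)" "hd vs = vert w 0" "last vs = vert w (int n + 1)"
    "\<And>j. j \<le> n \<Longrightarrow> ends w (S ! j) = {vs ! j, vs ! (j + 1)}"
    unfolding walk_iff by (auto simp: vertex_a_eq vertex_b_eq less_Suc_eq_le)
  have in_tri: "\<exists>p\<in>edge_pos w k (S ! k). v = vert w p" if "k \<le> n" "v = vs ! k \<or> v = vs ! Suc k" for k v
  proof -
    have "v \<in> vert w ` edge_pos w k (S ! k)"
      using vs(4)[OF that(1)] ends_eq[OF that(1) S(3)[OF that(1)]] that(2) by simp
    then show ?thesis by blast
  qed
  have pos4: "pt w k u \<in> positions w" if "k \<le> n + 1" for k u using that by (rule pt_in_positions)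
  have "\<exists>u. vs ! k = vert w (pt w k u)" if k: "k \<le> n + 1" for k
  proof -
    consider "k = 0" | "k = Suc n" | "0 < k" "k \<le> n" using k by fastforce
    then show ?thesis
    proof cases
      case 1 then show ?thesis using vs(1,2) by (simp add: hd_conv_nth length_0_conv[symmetric] del: length_0_conv)
    next
      case 2 then show ?thesis using vs(1,3)
        by (simp add: last_conv_nth add.commute length_0_conv[symmetric] del: length_0_conv)
    next
      case 3
      obtain p where p: "p \<in> edge_pos w (k - 1) (S ! (k - 1))" "vs ! k = vert w p" using in_tri[of "k - 1" "vs ! k"] 3 le_trans[OF diff_le_self 3(2)] by auto
      obtain q where q: "q \<in> edge_pos w k (S ! k)" "vs ! k = vert w q" using in_tri[of k "vs ! k"] 3 by auto
      have sub: "p \<in> positions w" "q \<in> positions w" using p q edge_pos_subset 3 by (meson diff_le_self le_trans subsetD)+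
      then have pq: "p = q" using p(2) q(2) vert_eq_iff by simp
      have a: "p \<in> {pt w (k - 1) Lft, pt w (k - 1) Rgt, pt w k Lft, pt w k Rgt}"
        using p(1) edge_pos_tri[OF le_trans[OF diff_le_self 3(2)], of 1 "S ! (k - 1)"] 3 by auto
      have b: "p \<in> {pt w k Lft, pt w k Rgt, pt w (Suc k) Lft, pt w (Suc k) Rgt}"
        using q(1) edge_pos_tri[of k "S ! k"] 3 pq by (auto simp del: pt.simps)
      \<comment> \<open>A vertex of the diagonals \<open>k - 1\<close> and \<open>k + 1\<close> at the
        same time is also one of the diagonal \<open>k\<close>.\<close>
      have "p = pt w k Lft \<or> p = pt w k Rgt"
      proof (rule ccontr)
        assume no: "\<not> (p = pt w k Lft \<or> p = pt w k Rgt)"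
        then obtain u v where uv: "p = pt w (k - 1) u" "p = pt w (Suc k) v" using a b by blast
        then have "pt w k Lft \<le> p" "p \<le> pt w k Rgt" "p \<le> pt w k Lft \<or> pt w k Rgt \<le> p"
          using pt_inside[of k "k - 1" u] pt_outside[of k "Suc k" v] 3 by auto
        then show False using no by auto
      qed
      then show ?thesis using p(2) by blast
    qed
  qed
  then obtain \<sigma> where \<sigma>: "\<And>k. k \<le> n + 1 \<Longrightarrow> vs ! k = vert w (pt w k (\<sigma> k))" by metis
  have e: "ends w (S ! k) = {vert w (pt w k (\<sigma> k)), vert w (pt w (Suc k) (\<sigma> (Suc k)))}" if "k \<le> n" for k
    using vs(4)[OF that] \<sigma>[of k] \<sigma>[of "Suc k"] that by (simp del: pt.simps)
  have join: "joinable w k (\<sigma> k) (\<sigma> (Suc k))" if "k \<le> n" for k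
  proof (rule ccontr)
    assume "\<not> joinable w k (\<sigma> k) (\<sigma> (Suc k))"
    then have one: "ends w (S ! k) = {vert w (pt w k (\<sigma> k))}" using e[OF that] not_joinable_eq by auto
    have "k < length S" using S(2) that by simp
    then have l: "S ! k \<in> labels" using S(1) nth_mem by blast
    obtain p q where pq: "p \<noteq> q" "init_arc (S ! k) = {p, q}" using init_arc_doubleton[OF l] by blast
    then have "vert w p \<noteq> vert w q" using init_arc_subset[OF l] vert_eq_iff by auto
    then show False using one ends_init_arc[OF l] pq(2) by auto
  qed
  obtain I where I: "I \<in> ideals (dual w)" "\<And>k. k \<le> n \<Longrightarrow> selected (dual w) I k = join w k (\<sigma> k) (\<sigma> (Suc k))"
    by (rule chain_ideal_dual[of \<sigma> "\<lambda>k. \<sigma> (Suc k)"]) (use join in auto)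
  have "S ! k = join w k (\<sigma> k) (\<sigma> (Suc k))" if "k \<le> n" for k
  proof -
    have "k < length S" using S(2) that by simp
    then have "S ! k \<in> labels" using S(1) nth_mem by blast
    moreover have "ends w (S ! k) = ends w (join w k (\<sigma> k) (\<sigma> (Suc k)))"
      unfolding e[OF that] ends_join[OF that join[OF that]] ..
    ultimately show ?thesis using ends_inject join_in_labels[OF that] by metis
  qed
  then have "S = nonempty_word.S_list (dual w) I"
    using nonempty_word.nth_S_list[OF nonempty_dual, of _ I] nonempty_word.length_S_list[OF nonempty_dual, of I] S(2) I(2)
    by (intro nth_equalityI) auto
  then show ?thesis using that I(1) by blast
qed

lemma up_SP:
  assumes i: "i \<in> {1..n}"
  shows "up (SP w) i = {(xs @ [side_before (dual w) i Rgt, side_after (dual w) i Lft] @ ys,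
    xs @ [side_before (dual w) i Lft, side_after (dual w) i Rgt] @ ys) | xs ys. True}"
proof -
  have i': "0 < i" "i \<le> n" using i by auto
  show ?thesis unfolding SP_def SP_flip_def Let_def u_d_sides[OF i'] side_before_dual[OF i'] side_after_dual[OF i']
    by (simp add: u_d_sides[OF i', simplified])
qed

theorem SP_modelled: "modelled (dual w) (SP w) (nonempty_word.S_list (dual w))"
  unfolding modelled_def
proof (intro conjI ballI)
  let ?S = "nonempty_word.S_list (dual w)"
  have "nodes (SP w) = ?S ` ideals (dual w)"
    using S_path_S_list S_path_sides by (auto simp: SP_def) (metis image_eqI)
  then show "bij_betw ?S (ideals (dual w)) (nodes (SP w))"
    using nonempty_word.inj_S_list[OF nonempty_dual] by (simp add: bij_betw_def)
  fix i I J assume *: "i \<in> {1..rank (dual w)}" "I \<in> ideals (dual w)" "J \<in> ideals (dual w)"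
  then have i: "i \<in> {1..n}" by simp
  show "(?S I, ?S J) \<in> up (SP w) i \<longleftrightarrow> i \<notin> I \<and> J = insert i I"
    using nonempty_word.S_list_move_iff[OF nonempty_dual, of i I J] * unfolding up_SP[OF i] by simp
qed

lemma SP_weight: "weight (SP w) (nonempty_word.S_list (dual w) I) = (\<Prod>k\<le>n. X (selected (dual w) I k))"
proof -
  have "(\<Prod>j<Suc n. X (nonempty_word.S_list (dual w) I ! j)) = (\<Prod>k<Suc n. X (selected (dual w) I k))"
    using nonempty_word.nth_S_list[OF nonempty_dual, of _ I] by (intro prod.cong) auto
  then show ?thesis
    using nonempty_word.length_S_list[OF nonempty_dual, of I] by (simp add: SP_def lessThan_Suc_atMost)
qed

end

subsection \<open>T-paths\<close>

text \<open>The complete T-path of a resolution runs through the selected edges in turn and crosses every diagonal in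
  between.  It becomes a T-path when steps along an edge and directly back are cancelled; doing this
  from the end to the beginning, only the first edge of the path constructed so far can be
  affected.\<close>

definition cons_cancel :: "nat \<Rightarrow> nat \<Rightarrow> nat list \<Rightarrow> nat list" where
  "cons_cancel e d R = (if e = d then R else if hd R = d then e # tl R else e # d # R)"

primrec reduced_path :: "nat \<Rightarrow> (nat \<Rightarrow> nat) \<Rightarrow> nat \<Rightarrow> nat list" where
  "reduced_path m f 0 = [f m]"
| "reduced_path m f (Suc j) = cons_cancel (f (m - Suc j)) (m - j) (reduced_path m f j)"

lemma reduced_path_cong:
  "(\<And>k. m - j \<le> k \<Longrightarrow> k \<le> m \<Longrightarrow> f k = g k) \<Longrightarrow> reduced_path m f j = reduced_path m g j"
proof (induction j)
  case (Suc j)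
  then have "reduced_path m f j = reduced_path m g j" by (meson diff_le_mono2 le_trans lessI less_imp_le)
  then show ?case using Suc.prems[of "m - Suc j"] by simp
qed simp

lemma colour_Cons: "colour (a # T) x = of_bool (a = x) - colour T x"
proof -
  have even: "{j. j < length (a # T) \<and> even j \<and> (a # T) ! j = x} =
    (if a = x then {0} else {}) \<union> Suc ` {j. j < length T \<and> odd j \<and> T ! j = x}"
    by (auto simp: less_Suc_eq_0_disj image_iff)
  have odd: "{j. j < length (a # T) \<and> odd j \<and> (a # T) ! j = x} = Suc ` {j. j < length T \<and> even j \<and> T ! j = x}"
    by (auto simp: less_Suc_eq_0_disj image_iff)
  have "int (card {j. j < length (a # T) \<and> even j \<and> (a # T) ! j = x}) =
      of_bool (a = x) + int (card {j. j < length T \<and> odd j \<and> T ! j = x})"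
    unfolding even by (subst card_Un_disjoint) (auto simp: card_image)
  moreover have "card {j. j < length (a # T) \<and> odd j \<and> (a # T) ! j = x} = card {j. j < length T \<and> even j \<and> T ! j = x}"
    unfolding odd by (simp add: card_image)
  ultimately show ?thesis by (simp add: colour_def)
qed

lemma colour_Nil: "colour [] x = 0"
  by (simp add: colour_def)

lemma colour_cons_cancel: "R \<noteq> [] \<Longrightarrow>
    colour (cons_cancel e d R) x = of_bool (e = x) - of_bool (d = x) + colour R x"
  by (cases R) (auto simp: cons_cancel_def colour_Cons)

definition path_weight :: "nat list \<Rightarrow> ratfun" where
  "path_weight T = (\<Prod>j\<in>{j. j < length T \<and> even j}. X (T ! j)) / (\<Prod>j\<in>{j. j < length T \<and> odd j}. X (T ! j))"

lemma path_weight_Nil: "path_weight [] = 1"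
  by (simp add: path_weight_def)

lemma path_weight_Cons: "path_weight (a # T) = X a / path_weight T"
proof -
  have even: "{j. j < length (a # T) \<and> even j} = insert 0 (Suc ` {j. j < length T \<and> odd j})"
    by (auto simp: less_Suc_eq_0_disj image_iff)
  have odd: "{j. j < length (a # T) \<and> odd j} = Suc ` {j. j < length T \<and> even j}"
    by (auto simp: less_Suc_eq_0_disj image_iff)
  have "(\<Prod>j\<in>{j. j < length (a # T) \<and> even j}. X ((a # T) ! j)) = X a * (\<Prod>j\<in>{j. j < length T \<and> odd j}. X (T ! j))"
    unfolding even by (subst prod.insert) (auto simp: prod.reindex)
  moreover have "(\<Prod>j\<in>{j. j < length (a # T) \<and> odd j}. X ((a # T) ! j)) = (\<Prod>j\<in>{j. j < length T \<and> even j}. X (T ! j))"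
    unfolding odd by (simp add: prod.reindex)
  ultimately show ?thesis by (simp add: path_weight_def)
qed

lemma path_weight_neq_0: "path_weight T \<noteq> 0"
  by (simp add: path_weight_def)

lemma path_weight_cons_cancel: "R \<noteq> [] \<Longrightarrow>
    path_weight (cons_cancel e d R) = X e / X d * path_weight R"
  using path_weight_neq_0 by (cases R) (auto simp: cons_cancel_def path_weight_Cons)

context nonempty_word
begin

text \<open>Alternating paths from the vertex at \<open>p\<close> to \<open>b\<close>, where the even-indexed edges are diagonals with increasing
  labels above a bound.\<close>

fun alternating :: "int \<Rightarrow> nat \<Rightarrow> nat list \<Rightarrow> bool" where
  "alternating p m [] \<longleftrightarrow> False"
| "alternating p m [e] \<longleftrightarrow> e \<in> labels \<and> init_arc e = {p, int n + 1}"
| "alternating p m (e # d # T) \<longleftrightarrow> e \<in> labels \<and> m < d \<and> d \<le> n \<and>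
     (\<exists>q r. init_arc e = {p, q} \<and> init_arc d = {q, r} \<and> alternating r d T)"

lemma walk_step:
  assumes "e \<in> labels" "p \<in> positions w"
  shows "ends w e = {vert w p, v} \<longleftrightarrow> (\<exists>q\<in>positions w. init_arc e = {p, q} \<and> v = vert w q)"
proof
  assume "ends w e = {vert w p, v}"
  then have "vert w ` init_arc e = {vert w p, v}" using ends_init_arc[OF assms(1)] by simp
  then show "\<exists>q\<in>positions w. init_arc e = {p, q} \<and> v = vert w q"
    using cut_doubleton[OF inj_vert init_arc_subset[OF assms(1)] assms(2)] by metis
qed (use ends_init_arc[OF assms(1)] in auto)

lemma alternating_iff:
  assumes "p \<in> positions w"
  shows "alternating p m T \<longleftrightarrow> set T \<subseteq> labels \<and> walk w (vert w p) T (vert w (int n + 1)) \<and> odd (length T) \<and>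
     (\<forall>j<length T. odd j \<longrightarrow> m < T ! j \<and> T ! j \<le> n) \<and>
     (\<forall>j<length T. \<forall>k<length T. odd j \<and> odd k \<and> j < k \<longrightarrow> T ! j < T ! k)"
  using assms
proof (induction p m T rule: alternating.induct)
  case (1 p m) then show ?case by simp
next
  case (2 p m e)
  have b: "int n + 1 \<in> positions w" using pt_in_positions[of "Suc n" Lft] by (simp add: add.commute)
  show ?case
  proof (cases "e \<in> labels")
    case True
    have "walk w (vert w p) [e] (vert w (int n + 1)) \<longleftrightarrow> init_arc e = {p, int n + 1}"
      using walk_step[OF True 2] b vert_eq_iff by auto
    then show ?thesis using True by simp
  qed auto
next
  case (3 p m e d T)
  let ?b = "vert w (int n + 1)"
  show ?case
  proof (cases "e \<in> labels \<and> m < d \<and> d \<le> n")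
    case True
    then have ed: "e \<in> labels" "d \<in> labels" "m < d" "d \<le> n" by auto
    let ?red = "\<lambda>T m. odd (length T) \<and> (\<forall>j<length T. odd j \<longrightarrow> m < T ! j \<and> T ! j \<le> n) \<and>
      (\<forall>j<length T. \<forall>k<length T. odd j \<and> odd k \<and> j < k \<longrightarrow> T ! j < T ! k)"
    have red: "?red (e # d # T) m \<longleftrightarrow> ?red T d"
      using ed(3,4) by (auto simp: All_less_Suc2)
    have walk: "walk w (vert w p) (e # d # T) ?b \<longleftrightarrow>
        (\<exists>q r. r \<in> positions w \<and> init_arc e = {p, q} \<and> init_arc d = {q, r} \<and> walk w (vert w r) T ?b)"
    proof -
      have "walk w (vert w p) (e # d # T) ?b \<longleftrightarrow> (\<exists>q\<in>positions w. init_arc e = {p, q} \<and> walk w (vert w q) (d # T) ?b)"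
        using walk_step[OF ed(1) 3(2)] by auto
      also have "\<dots> \<longleftrightarrow> (\<exists>q\<in>positions w. init_arc e = {p, q} \<and> (\<exists>r\<in>positions w. init_arc d = {q, r} \<and> walk w (vert w r) T ?b))"
        using walk_step[OF ed(2)] by auto
      also have "\<dots> \<longleftrightarrow> (\<exists>q r. r \<in> positions w \<and> init_arc e = {p, q} \<and> init_arc d = {q, r} \<and> walk w (vert w r) T ?b)"
        using init_arc_in_positions[OF ed(1)] by blast
      finally show ?thesis .
    qed
    have IH: "alternating r d T \<longleftrightarrow> set T \<subseteq> labels \<and> walk w (vert w r) T ?b \<and> ?red T d" if "r \<in> positions w" for r
      using 3(1)[OF that] by simp
    have "alternating p m (e # d # T) \<longleftrightarrow> (\<exists>q r. r \<in> positions w \<and> init_arc e = {p, q} \<and> init_arc d = {q, r} \<and> alternating r d T)"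
      using ed init_arc_in_positions[OF ed(2)] by auto
    also have "\<dots> \<longleftrightarrow> set T \<subseteq> labels \<and> walk w (vert w p) (e # d # T) ?b \<and> ?red T d"
      unfolding walk using IH by blast
    also have "\<dots> \<longleftrightarrow> set (e # d # T) \<subseteq> labels \<and> walk w (vert w p) (e # d # T) ?b \<and> ?red (e # d # T) m"
      unfolding red using ed by auto
    finally show ?thesis .
  next
    case False
    then show ?thesis by (auto simp: All_less_Suc2)
  qed
qed

lemma T_path_iff: "T_path w T \<longleftrightarrow> alternating 0 0 T \<and> distinct T"
proof -
  have "0 \<in> positions w" using pt_in_positions[of 0 Lft] by simp
  then show ?thesis unfolding T_path_def edge_path_iff_walk
    by (auto simp: alternating_iff vertex_a_eq vertex_b_eq Suc_le_eq)
qed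

lemma alternating_mono: "alternating p m T \<Longrightarrow> m' \<le> m \<Longrightarrow> alternating p m' T"
  by (cases "(p, m, T)" rule: alternating.cases) auto

text \<open>Apart from its first vertex and \<open>b\<close>, all vertices of the path are end points of
  its diagonals.\<close>

lemma alternating_avoids_vertex:
  "alternating p m T \<Longrightarrow> p \<noteq> v \<Longrightarrow> v \<noteq> int n + 1 \<Longrightarrow> (\<And>i. m < i \<Longrightarrow> i \<le> n \<Longrightarrow> v \<notin> init_arc i) \<Longrightarrow>
    e \<in> set T \<Longrightarrow> v \<notin> init_arc e"
proof (induction p m T rule: alternating.induct)
  case (3 p m a d T)
  then obtain q r where *: "init_arc a = {p, q}" "init_arc d = {q, r}" "alternating r d T" "m < d" "d \<le> n" by auto
  have "v \<notin> init_arc d" using 3 * by blast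
  then have "v \<noteq> q" "v \<noteq> r" using * by auto
  then show ?case using 3 * by auto
qed auto

text \<open>The diagonals with a given end point form a fan, so their labels are consecutive.\<close>

lemma diagonal_between:
  assumes "0 < j" "j \<le> m" "m \<le> d" "d \<le> n" "p \<in> init_arc j" "p \<in> init_arc d"
  shows "p \<in> init_arc m"
proof -
  have "p \<in> {pt w j Lft, pt w j Rgt}" "p \<in> {pt w d Lft, pt w d Rgt}"
    using assms by (simp_all add: init_arc_diagonal)
  then obtain u v where uv: "p = pt w j u" "p = pt w d v" by blast
  have "u = v" using uv pt_bounds[of j] pt_bounds[of d] assms by (cases u; cases v) auto
  then have "p = pt w m u" using uv pt_mono[of j m] pt_mono[of m d] assms by (cases u) auto
  then show ?thesis using assms by (cases u) (simp_all add: init_arc_diagonal)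
qed

text \<open>If the path used an earlier diagonal, the fan property would put both end points of that
  diagonal on the diagonal \<open>m\<close>.\<close>

lemma alternating_avoids_diagonal:
  "alternating p m T \<Longrightarrow> 0 < j \<Longrightarrow> j < m \<Longrightarrow> m \<le> n \<Longrightarrow> p \<in> init_arc m \<Longrightarrow> j \<notin> set T"
proof (induction p m T rule: alternating.induct)
  case (2 p m e)
  have "int n + 1 \<notin> init_arc j" using pt_bounds[of j] 2 by (auto simp: init_arc_diagonal)
  then show ?case using 2 by auto
next
  case (3 p m e d T)
  then obtain q r where *: "init_arc e = {p, q}" "init_arc d = {q, r}" "alternating r d T" "m < d" "d \<le> n" by auto
  have "e \<noteq> j"
  proof
    assume e: "e = j"
    have jm: "j \<in> labels" "m \<in> labels" using 3 by auto
    have "q \<in> init_arc m" using diagonal_between[of j m d q] 3 * e by auto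
    then have "init_arc j = init_arc m" using 3 * e init_arc_doubleton[OF jm(1)] init_arc_doubleton[OF jm(2)]
      by (auto simp: doubleton_eq_iff)
    then show False using inj_init_arc jm 3 by (auto dest: inj_onD)
  qed
  then show ?case using 3 * by auto
qed auto

definition later_edges :: "nat \<Rightarrow> nat set" where
  "later_edges k = (\<Union>l\<in>{k..n}. tri_edges w l)"

lemma later_edges_Suc: "k \<le> n \<Longrightarrow> later_edges k = tri_edges w k \<union> later_edges (Suc k)"
proof -
  assume "k \<le> n"
  then have "{k..n} = insert k {Suc k..n}" by auto
  then show ?thesis by (simp add: later_edges_def)
qed

lemma later_edges_common: "k \<le> n \<Longrightarrow> e \<in> tri_edges w k \<Longrightarrow> e \<in> later_edges (Suc k) \<Longrightarrow> e = Suc k \<and> k < n"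
proof -
  assume k: "k \<le> n" "e \<in> tri_edges w k" and "e \<in> later_edges (Suc k)"
  then obtain l where "Suc k \<le> l" "l \<le> n" "e \<in> tri_edges w l" unfolding later_edges_def by auto
  then show ?thesis using tri_edges_disjoint[of k l e] k by auto
qed

text \<open>The two hypotheses of \<open>chain_ideal\<close>, from the triangle \<open>k\<close> on.\<close>

definition chain_from :: "nat \<Rightarrow> (nat \<Rightarrow> side) \<Rightarrow> (nat \<Rightarrow> side) \<Rightarrow> bool" where
  "chain_from k s t \<longleftrightarrow> (\<forall>l. k \<le> l \<and> l \<le> n \<longrightarrow> joinable w l (s l) (t l)) \<and>
     (\<forall>l. k < l \<and> l \<le> n \<longrightarrow> s l = opposite (t (l - 1)))"

lemma chain_from_Suc: "chain_from k s t \<Longrightarrow> chain_from (Suc k) s t"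
  unfolding chain_from_def using Suc_leD Suc_lessD by blast

abbreviation join_path :: "(nat \<Rightarrow> side) \<Rightarrow> (nat \<Rightarrow> side) \<Rightarrow> nat \<Rightarrow> nat list" where
  "join_path s t \<equiv> reduced_path n (\<lambda>l. join w l (s l) (t l))"

text \<open>That the diagonal \<open>k\<close> can occur in such a suffix only as its first edge makes it
  sufficient to cancel at the beginning when the suffix is extended.\<close>

lemma join_path_alternating:
  assumes "j \<le> n" "k = n - j" "chain_from k s t"
  shows "alternating (pt w k (s k)) k (join_path s t j) \<and> distinct (join_path s t j) \<and>
    set (join_path s t j) \<subseteq> later_edges k \<and> (k \<in> set (join_path s t j) \<and> 0 < k \<longrightarrow> hd (join_path s t j) = k)"
  using assms
proof (induction j arbitrary: k)
  case 0
  have "init_arc (join w n (s n) (t n)) = {pt w n (s n), int n + 1}"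
    using init_arc_join[of n "s n" "t n"] by (simp add: add.commute)
  then show ?case using 0 join_in_labels[of n "s n" "t n"] join_in_tri_edges[of n "s n" "t n"]
    by (auto simp: later_edges_def)
next
  case (Suc j)
  have k: "k < n" "n - j = Suc k" using Suc.prems by auto
  let ?R = "join_path s t j" and ?e = "join w k (s k) (t k)" and ?T = "join_path s t (Suc j)"
  have T: "?T = cons_cancel ?e (Suc k) ?R" using Suc.prems k by simp
  have "chain_from (Suc k) s t" using Suc.prems(3) by (rule chain_from_Suc)
  then have IH: "alternating (pt w (Suc k) (s (Suc k))) (Suc k) ?R" "distinct ?R" "set ?R \<subseteq> later_edges (Suc k)"
    "Suc k \<in> set ?R \<Longrightarrow> hd ?R = Suc k" using Suc.IH[of "Suc k"] Suc.prems k by auto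
  have s: "s (Suc k) = opposite (t k)" and jn: "joinable w k (s k) (t k)"
    using Suc.prems(3) k unfolding chain_from_def by auto
  have e: "?e \<in> labels" "init_arc ?e = {pt w k (s k), pt w (Suc k) (t k)}" "?e \<in> tri_edges w k"
    using k join_in_labels[of k] init_arc_join[OF _ jn] join_in_tri_edges[of k] by auto
  have d: "init_arc (Suc k) = {pt w (Suc k) (t k), pt w (Suc k) (opposite (t k))}"
    using k init_arc_diagonal[of "Suc k"] by (cases "t k") auto
  have e_R: "?e \<in> set ?R \<Longrightarrow> ?e = Suc k" using later_edges_common[of k ?e] e(3) IH(3) k by auto
  have k_R: "k \<notin> set ?R" if "0 < k" using later_edges_common[of k k] diagonal_in_tri_edges(1)[of k] IH(3) k that by auto
  have d_in: "Suc k \<in> later_edges k" using k diagonal_in_tri_edges(2)[of k] by (auto simp: later_edges_def)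
  have sub: "later_edges (Suc k) \<subseteq> later_edges k" using later_edges_Suc[of k] k by auto
  have e_in: "?e \<in> later_edges k" using e(3) k by (auto simp: later_edges_def)
  obtain a R' where R: "?R = a # R'" using IH(1) by (cases ?R) auto
  consider "?e = Suc k" | "?e \<noteq> Suc k" "a = Suc k" | "?e \<noteq> Suc k" "a \<noteq> Suc k" by blast
  then show ?case
  proof cases
    case 1
    have "pt w k (s k) \<in> init_arc (Suc k)" using e(2) 1 by simp
    moreover have "pt w k (s k) \<noteq> pt w (Suc k) (t k)" using pt_step_neq[OF _ jn] k by (simp del: pt.simps)
    ultimately have "pt w k (s k) = pt w (Suc k) (opposite (t k))" using d by auto
    moreover have "?T = ?R" using T 1 by (simp add: cons_cancel_def)
    ultimately show ?thesis using IH sub alternating_mono[OF IH(1), of k] k_R by (auto simp: s)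
  next
    case 2
    then have T': "?T = ?e # R'" using T R by (simp add: cons_cancel_def)
    have "R' \<noteq> []"
    proof
      assume "R' = []"
      then have "int n + 1 \<in> init_arc (Suc k)" using IH(1) R 2 by auto
      then show False using d pt_bounds[of "Suc k"] k by (cases "t k") auto
    qed
    then obtain b R'' where R': "R' = b # R''" by (cases R') auto
    obtain q r where qr: "init_arc (Suc k) = {pt w (Suc k) (opposite (t k)), q}" "init_arc b = {q, r}"
      "alternating r b R''" "Suc k < b" "b \<le> n" using IH(1) R R' 2 s by auto
    have "q = pt w (Suc k) (t k)" using qr(1) d pt_side_cancel[of "Suc k"] k by (auto simp: doubleton_eq_iff simp del: pt.simps)
    then have "alternating (pt w k (s k)) k ?T" using T' R' qr e(1,2) by auto
    then show ?thesis using T' R R' IH(2,3) e_R 2 sub e_in k_R by auto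
  next
    case 3
    then have T': "?T = ?e # Suc k # ?R" using T R by (simp add: cons_cancel_def)
    have "alternating (pt w k (s k)) k ?T"
      unfolding T' alternating.simps(3)
      by (intro conjI exI[of _ "pt w (Suc k) (t k)"] exI[of _ "pt w (Suc k) (opposite (t k))"])
        (use e(1,2) d IH(1)[unfolded s] k in \<open>simp_all del: pt.simps\<close>)
    moreover have "Suc k \<notin> set ?R" using IH(4) R 3(2) by auto
    ultimately show ?thesis unfolding T' using IH(2,3) e_R 3 sub e_in k_R d_in by auto
  qed
qed

lemma join_path_colour:
  assumes "j \<le> n" "chain_from (n - j) s t"
  shows "colour (join_path s t j) x =
    (\<Sum>k\<in>{n - j..n}. of_bool (join w k (s k) (t k) = x)) - of_bool (n - j < x \<and> x \<le> n)"
  using assms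
proof (induction j)
  case 0 then show ?case by (simp add: colour_Cons colour_Nil)
next
  case (Suc j)
  let ?k = "n - Suc j"
  have k: "?k < n" "n - j = Suc ?k" using Suc.prems by auto
  have "chain_from (Suc ?k) s t" using Suc.prems(2) by (rule chain_from_Suc)
  then have "join_path s t j \<noteq> []" "colour (join_path s t j) x =
      (\<Sum>k\<in>{Suc ?k..n}. of_bool (join w k (s k) (t k) = x)) - of_bool (Suc ?k < x \<and> x \<le> n)"
    using Suc join_path_alternating[of j "Suc ?k" s t] k by (auto simp del: reduced_path.simps)
  moreover have "{?k..n} = insert ?k {Suc ?k..n}" using k by auto
  ultimately show ?case using k by (auto simp: colour_cons_cancel)
qed

lemma join_path_weight:
  assumes "j \<le> n" "chain_from (n - j) s t"
  shows "path_weight (join_path s t j) = (\<Prod>k\<in>{n - j..n}. X (join w k (s k) (t k))) / (\<Prod>k\<in>{n - j<..n}. X k)"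
  using assms
proof (induction j)
  case 0 then show ?case by (simp add: path_weight_Cons path_weight_Nil)
next
  case (Suc j)
  let ?k = "n - Suc j"
  have k: "?k < n" "n - j = Suc ?k" using Suc.prems by auto
  have "chain_from (Suc ?k) s t" using Suc.prems(2) by (rule chain_from_Suc)
  then have "join_path s t j \<noteq> []" "path_weight (join_path s t j) =
      (\<Prod>k\<in>{Suc ?k..n}. X (join w k (s k) (t k))) / (\<Prod>k\<in>{Suc ?k<..n}. X k)"
    using Suc join_path_alternating[of j "Suc ?k" s t] k by (auto simp del: reduced_path.simps)
  moreover have "{?k..n} = insert ?k {Suc ?k..n}" "{?k<..n} = insert (Suc ?k) {Suc ?k<..n}" using k by auto
  ultimately show ?case using k by (simp add: path_weight_cons_cancel)
qed

text \<open>The path starts at a vertex that belongs to no triangle after \<open>k\<close>.\<close>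

lemma alternating_edge:
  assumes k: "k < n" and s: "0 < k \<Longrightarrow> s = opposite (shared w k)"
    and b: "b \<in> labels" "init_arc b = {pt w k s, q}" "b \<in> later_edges k"
  obtains t where "joinable w k s t" "b = join w k s t" "q = pt w (Suc k) t" "b \<in> tri_edges w k"
proof -
  have p: "pt w k s \<noteq> pt w j u" if "k < j" "j \<le> n + 1" for j u
  proof (cases "k = 0")
    case True then show ?thesis using pt_bounds[of j] that by (cases "j = n + 1"; cases u) auto
  next
    case False then show ?thesis using dead_vertex[of k j u] that s k by auto
  qed
  have tri: "b \<in> tri_edges w k"
  proof (rule ccontr)
    assume "b \<notin> tri_edges w k"
    then obtain l where l: "k < l" "l \<le> n" "b \<in> tri_edges w l"
      using b(3) by (metis UN_E atLeastAtMost_iff later_edges_def le_neq_implies_less)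
    then have "pt w k s \<in> edge_pos w l b" using b init_arc_eq by auto
    then show False using edge_pos_tri[of l b] l p[of l] p[of "Suc l"] by auto
  qed
  have "b \<noteq> 1" if "k = 0" using b(2) that init_arc_diagonal[of 1] rank_ge_2
    by (auto simp: doubleton_eq_iff)
  then obtain u t where ut: "joinable w k u t" "join w k u t = b"
    using exists_join[of k b] tri k by auto
  then have i: "init_arc b = {pt w k u, pt w (Suc k) t}" using init_arc_join k by auto
  then have u: "pt w k u = pt w k s" "q = pt w (Suc k) t"
    using b(2) p[of "Suc k" t] k by (auto simp: doubleton_eq_iff simp del: pt.simps)
  then have "0 < k \<Longrightarrow> u = s" using pt_side_cancel[of k u s] k by simp
  then show ?thesis using that[of t] ut tri u(2) by (cases "k = 0") (auto simp: join_0)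
qed

text \<open>All edges of the triangle \<open>k\<close> but the diagonal \<open>k + 1\<close> contain a
  vertex that the path has left for good.\<close>

lemma alternating_avoids_past:
  assumes "k < n" "alternating r m T" "k \<le> m" "r \<noteq> p" "set T \<subseteq> later_edges k"
    and p: "p = pt w k s" "0 < k \<Longrightarrow> s = opposite (shared w k)"
  shows "set T \<subseteq> later_edges (Suc k)"
proof
  fix e assume e: "e \<in> set T"
  have dead: "pt w k s \<noteq> pt w j u" if "k < j" "j \<le> n + 1" for j u
  proof (cases "k = 0")
    case True then show ?thesis using pt_bounds[of j] that by (cases "j = n + 1"; cases u) auto
  next
    case False then show ?thesis using dead_vertex[of k j u] that p assms(1) by auto
  qed
  have "p \<notin> init_arc i" if "m < i" "i \<le> n" for i
    using dead[of i] that assms(3) p(1) by (auto simp: init_arc_diagonal)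
  moreover have "p \<noteq> int n + 1" using dead[of "Suc n" Lft] assms(1) p(1) by (simp add: add.commute)
  ultimately have p_e: "p \<notin> init_arc e" using alternating_avoids_vertex[OF assms(2,4)] e by blast
  show "e \<in> later_edges (Suc k)"
  proof (rule ccontr)
    assume *: "e \<notin> later_edges (Suc k)"
    then have tri: "e \<in> tri_edges w k" using assms(1,5) e later_edges_Suc[of k] by auto
    have "1 \<in> later_edges (Suc 0)" using rank_ge_2 diagonal_in_tri_edges(1)[of 1] by (force simp: later_edges_def)
    then have "e \<noteq> 1" if "k = 0" using * that by auto
    then obtain u t where ut: "joinable w k u t" "join w k u t = e"
      using exists_join[of k e] tri assms(1) by auto
    then have i: "init_arc e = {pt w k u, pt w (Suc k) t}" using init_arc_join assms(1) by auto
    have "Suc k \<in> later_edges (Suc k)" using assms(1) diagonal_in_tri_edges(1)[of "Suc k"] by (force simp: later_edges_def)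
    then have "e \<noteq> Suc k" using * by auto
    then have "k = 0 \<or> u = s"
      using ut(2) p(2) join_mid[of k u t] assms(1) neq_iff_opposite[of u s] by (cases "k = 0") auto
    then have "pt w k u = pt w k s" by (elim disjE) simp_all
    then show False using p_e unfolding i p(1) by simp
  qed
qed

text \<open>The selected edges can be recovered from the beginning of the path. If the path starts at the
  vertex shared by the diagonals \<open>k\<close> and \<open>k + 1\<close>, the selected edge is the
  diagonal \<open>k + 1\<close>, which has been cancelled. Otherwise the first edge of the path is the
  selected one, and if the path does not continue along the diagonal \<open>k + 1\<close>, then this
  diagonal has been cancelled against the first edge of the remaining suffix.\<close>

lemma alternating_join_path:
  assumes "j \<le> n" "k = n - j" "alternating (pt w k s0) k T" "distinct T" "set T \<subseteq> later_edges k"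
  shows "\<exists>s t. chain_from k s t \<and> s k = s0 \<and> T = join_path s t j"
  using assms
proof (induction j arbitrary: k s0 T)
  case 0
  then have k: "k = n" by simp
  have "\<exists>e. T = [e] \<and> e \<in> labels \<and> init_arc e = {pt w n s0, int n + 1}"
    using 0(3) k by (cases "(pt w k s0, k, T)" rule: alternating.cases) auto
  then obtain e where e: "T = [e]" "e \<in> labels" "init_arc e = {pt w n s0, int n + 1}" by blast
  have "init_arc (join w n s0 s0) = {pt w n s0, int n + 1}"
    using init_arc_join[of n s0 s0] by (simp add: add.commute)
  then have "e = join w n s0 s0" using e(3)
    by (intro inj_onD[OF inj_init_arc _ e(2) join_in_labels]) simp_all
  then have "chain_from k (\<lambda>_. s0) (\<lambda>_. s0) \<and> s0 = s0 \<and> T = join_path (\<lambda>_. s0) (\<lambda>_. s0) 0"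
    using e k by (simp add: chain_from_def joinable_def)
  then show ?case by blast
next
  case (Suc j)
  have k: "k < n" "n - j = Suc k" using Suc.prems by auto
  have d: "Suc k \<in> labels" "init_arc (Suc k) = {pt w (Suc k) t, pt w (Suc k) (opposite t)}" for t
    using k init_arc_diagonal[of "Suc k"] by (cases t; auto simp: insert_commute)+
  have d_in: "Suc k \<in> later_edges (Suc k)" using k diagonal_in_tri_edges(1)[of "Suc k"] by (force simp: later_edges_def)
  have extend: "\<exists>s t. chain_from k s t \<and> s k = s0 \<and> T = join_path s t (Suc j)"
    if R: "alternating (pt w (Suc k) (opposite t0)) (Suc k) R" "distinct R" "set R \<subseteq> later_edges (Suc k)"
      and T: "T = cons_cancel (join w k s0 t0) (Suc k) R" and jn: "joinable w k s0 t0" for R t0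
  proof -
    obtain s t where st: "chain_from (Suc k) s t" "s (Suc k) = opposite t0" "R = join_path s t j"
      using Suc.IH[OF _ _ R] k Suc.prems by auto
    let ?s = "s(k := s0)" and ?t = "t(k := t0)"
    have "join_path ?s ?t j = join_path s t j" using k by (intro reduced_path_cong) auto
    then have "T = join_path ?s ?t (Suc j)" using T st(3) Suc.prems(2) k by simp
    moreover have "chain_from k ?s ?t"
      unfolding chain_from_def
    proof (intro conjI allI impI)
      fix l assume "k \<le> l \<and> l \<le> n"
      then show "joinable w l (?s l) (?t l)" using st(1) jn by (auto simp: chain_from_def)
    next
      fix l assume "k < l \<and> l \<le> n"
      then show "?s l = opposite (?t (l - 1))" using st(1,2) by (cases "l = Suc k") (auto simp: chain_from_def)
    qed
    ultimately show ?thesis by (intro exI[of _ ?s] exI[of _ ?t]) simp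
  qed
  show ?case
  proof (cases "0 < k \<and> s0 = shared w k")
    case True
    let ?t = "opposite (shared w k)"
    have start: "pt w (Suc k) (opposite ?t) = pt w k s0" using True pt_shared[of k] k by (simp del: pt.simps)
    have P: "pt w k s0 \<noteq> pt w k ?t" using pt_side_cancel[of k] True k by (simp del: pt.simps)
    have sub: "set T \<subseteq> later_edges (Suc k)"
      using alternating_avoids_past[OF k(1) Suc.prems(3) _ P Suc.prems(5), of ?t] by simp
    have "alternating (pt w k s0) (Suc k) T"
    proof (cases "(pt w k s0, k, T)" rule: alternating.cases)
      case (3 p m e a R)
      then obtain q r where qr: "e \<in> labels" "k < a" "a \<le> n" "init_arc e = {pt w k s0, q}" "init_arc a = {q, r}"
        "alternating r a R" using Suc.prems(3) by auto
      have "a \<noteq> Suc k"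
      proof
        assume a: "a = Suc k"
        have "pt w k s0 \<noteq> q" using init_arc_doubleton[OF qr(1)] qr(4) by (auto simp: doubleton_eq_iff)
        then have "q = pt w (Suc k) ?t" using qr(5) d(2)[of ?t] start a by (auto simp: doubleton_eq_iff simp del: pt.simps)
        then have "init_arc e = init_arc (Suc k)" using qr(4) d(2)[of ?t] start by (auto simp del: pt.simps)
        then have "e = a" using inj_init_arc qr(1) d(1) a by (auto dest: inj_onD)
        then show False using Suc.prems(4) 3 by simp
      qed
      then show ?thesis using 3 qr by auto
    qed (use Suc.prems(3) in auto)
    then have R: "alternating (pt w (Suc k) (opposite ?t)) (Suc k) T" using start by simp
    have "join w k s0 ?t = Suc k" "joinable w k s0 ?t" using True k by (auto simp: join_mid joinable_mid)
    then show ?thesis using extend[OF R Suc.prems(4) sub] by (simp add: cons_cancel_def)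
  next
    case False
    then have s0: "0 < k \<Longrightarrow> s0 = opposite (shared w k)" using neq_iff_opposite by blast
    have dead: "pt w k s0 \<noteq> pt w i u" if "k < i" "i \<le> n + 1" for i u
    proof (cases "k = 0")
      case True then show ?thesis using pt_bounds[of i] that by (cases "i = n + 1"; cases u) auto
    next
      case False then show ?thesis using dead_vertex[of k i u] that s0 k by auto
    qed
    obtain b rest where T: "T = b # rest" using Suc.prems(3) by (cases T) auto
    have b_in: "b \<in> later_edges k" using Suc.prems(5) T by simp
    have "rest \<noteq> []"
    proof
      assume "rest = []"
      then have *: "b \<in> labels" "init_arc b = {pt w k s0, int n + 1}" using Suc.prems(3) T by auto
      obtain t where "int n + 1 = pt w (Suc k) t" using alternating_edge[OF k(1) s0 * b_in] by blast
      then show False using pt_bounds[of "Suc k"] k by (cases t) auto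
    qed
    then obtain a R where rest: "rest = a # R" by (cases rest) auto
    obtain q r where qr: "b \<in> labels" "k < a" "a \<le> n" "init_arc b = {pt w k s0, q}" "init_arc a = {q, r}"
      "alternating r a R" using Suc.prems(3) T rest by auto
    obtain t where t: "joinable w k s0 t" "b = join w k s0 t" "q = pt w (Suc k) t" "b \<in> tri_edges w k"
      using alternating_edge[OF k(1) s0 qr(1,4) b_in] by blast
    have "pt w k s0 \<notin> init_arc (Suc k)" using d(2)[of t] dead[of "Suc k"] k by auto
    then have b_d: "b \<noteq> Suc k" using qr(4) by auto
    have "r \<in> {pt w a Lft, pt w a Rgt}" using qr(2,3,5) by (simp add: init_arc_diagonal)
    then have "r \<noteq> pt w k s0" using dead[of a] qr(2,3) by auto
    then have R_in: "set R \<subseteq> later_edges (Suc k)"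
      using alternating_avoids_past[OF k(1) qr(6) _ _ _ refl s0] qr(2) Suc.prems(5) T rest by auto
    have q_opp: "init_arc (Suc k) = {q, pt w (Suc k) (opposite t)}" using d(2)[of t] t(3) by simp
    show ?thesis
    proof (cases "a = Suc k")
      case True
      have "q \<noteq> r" using init_arc_doubleton[OF d(1)] qr(5) True by (auto simp: doubleton_eq_iff)
      then have "r = pt w (Suc k) (opposite t)" using qr(5) q_opp True by (auto simp: doubleton_eq_iff)
      then have "alternating (pt w (Suc k) (opposite t)) (Suc k) R" using qr(6) True by simp
      moreover have "hd R \<noteq> Suc k" using Suc.prems(4) T rest True qr(6) by (cases R) auto
      ultimately show ?thesis
        using extend[of t R] Suc.prems(4) T rest R_in t(1,2) b_d True by (simp add: cons_cancel_def)
    next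
      case a: False
      let ?R = "Suc k # rest"
      have alt: "alternating (pt w (Suc k) (opposite t)) (Suc k) ?R"
        using d(1) qr q_opp a rest by (auto simp: insert_commute)
      have "r \<in> init_arc a" using qr(5) by simp
      then have "Suc k \<notin> set R" using alternating_avoids_diagonal[OF qr(6), of "Suc k"] qr(2,3) a by simp
      then have "distinct ?R" using Suc.prems(4) T rest a by simp
      moreover have "a \<in> later_edges (Suc k)" using qr(2,3) diagonal_in_tri_edges(1)[of a] by (force simp: later_edges_def)
      then have "set ?R \<subseteq> later_edges (Suc k)" using R_in d_in rest by simp
      moreover have "T = cons_cancel b (Suc k) ?R" using b_d T by (simp add: cons_cancel_def)
      ultimately show ?thesis using extend[OF alt] t(1,2) by simp
    qed
  qed
qed

definition T_list :: "nat set \<Rightarrow> nat list" where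
  "T_list I = reduced_path n (selected w I) n"

lemma T_list_join_path:
  "T_list I = join_path (\<lambda>k. opposite (side_of I k)) (\<lambda>k. side_of I (Suc k)) n"
  unfolding T_list_def by (intro reduced_path_cong) (simp add: selected_def)

lemma chain_from_ideal: "I \<in> ideals w \<Longrightarrow> chain_from 0 (\<lambda>k. opposite (side_of I k)) (\<lambda>k. side_of I (Suc k))"
  by (simp add: chain_from_def selected_joinable)

lemma nodes_TP: "nodes (TP w) = T_list ` ideals w"
proof
  show "T_list ` ideals w \<subseteq> nodes (TP w)"
    using join_path_alternating[of n 0] chain_from_ideal by (auto simp: TP_def T_path_iff T_list_join_path)
  show "nodes (TP w) \<subseteq> T_list ` ideals w"
  proof
    fix T assume "T \<in> nodes (TP w)"
    then have T: "alternating (pt w 0 Lft) 0 T" "distinct T" by (auto simp: TP_def T_path_iff)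
    have "0 \<in> positions w" using pt_in_positions[of 0 Lft] by simp
    then have "set T \<subseteq> labels" using T(1) alternating_iff[of 0 0 T] by simp
    have "set T \<subseteq> later_edges 0"
    proof
      fix e assume "e \<in> set T"
      then have "e \<in> labels" using \<open>set T \<subseteq> labels\<close> by blast
      then obtain k where "k \<le> n" "e \<in> tri_edges w k" by (rule exists_tri_edges)
      then show "e \<in> later_edges 0" by (auto simp: later_edges_def)
    qed
    then obtain s t where st: "chain_from 0 s t" "T = join_path s t n"
      using alternating_join_path[of n 0 Lft T] T by auto
    obtain I where I: "I \<in> ideals w" "\<And>k. k \<le> n \<Longrightarrow> selected w I k = join w k (s k) (t k)"
    proof (rule chain_ideal[of s t])
      show "joinable w k (s k) (t k)" if "k \<le> n" for k
        using st(1) that le0[of k] unfolding chain_from_def by blast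
      show "s k = opposite (t (k - 1))" if "0 < k" "k \<le> n" for k
        using st(1) that unfolding chain_from_def by blast
    qed blast
    have "T_list I = T" unfolding T_list_def st(2) using I(2) by (intro reduced_path_cong) auto
    then show "T \<in> T_list ` ideals w" using I(1) by blast
  qed
qed

subsection \<open>Counting selected edges\<close>

definition multiplicity :: "nat set \<Rightarrow> nat \<Rightarrow> int" where
  "multiplicity I x = (\<Sum>k\<le>n. of_bool (selected w I k = x))"

lemma colour_T_list: "I \<in> ideals w \<Longrightarrow> colour (T_list I) x = multiplicity I x - of_bool (x \<in> {1..n})"
  using join_path_colour[of n _ _ x, OF _ chain_from_ideal[simplified, of I, folded diff_self_eq_0[of n]]]
  by (simp add: T_list_join_path multiplicity_def selected_def atLeast0AtMost Suc_le_eq)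

lemma TP_weight: "I \<in> ideals w \<Longrightarrow> weight (TP w) (T_list I) = 1 / x_diagonals w * (\<Prod>k\<le>n. X (selected w I k))"
proof -
  assume I: "I \<in> ideals w"
  have "{0<..n} = {1..n}" by auto
  then show ?thesis
    using join_path_weight[of n] chain_from_ideal[OF I]
    by (simp add: TP_def path_weight_def[symmetric] T_list_join_path x_diagonals_def selected_def atLeast0AtMost)
qed

lemma count_list_S_list: "int (count_list (S_list I) x) = multiplicity I x"
proof -
  have "int (count_list (map f [0..<m]) x) = (\<Sum>k<m. of_bool (f k = x))" for f :: "nat \<Rightarrow> nat" and m
    by (induction m) auto
  then show ?thesis by (simp add: S_list_def multiplicity_def lessThan_Suc_atMost del: upt_Suc)
qed

lemma sum_atMost_split:
  fixes f :: "nat \<Rightarrow> 'a :: comm_monoid_add"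
  assumes "k \<le> m" shows "(\<Sum>j\<le>m. f j) = (\<Sum>j<k. f j) + f k + (\<Sum>j\<in>{k<..m}. f j)"
proof -
  have "{..m} = {..<k} \<union> insert k {k<..m}" using assms by auto
  moreover have "{..<k} \<inter> insert k {k<..m} = {}" by auto
  ultimately show ?thesis by (simp add: sum.union_disjoint ac_simps)
qed

text \<open>The edges of a triangle other than the last diagonal do not occur in later triangles, so the
  selected edges can be read off from their multiplicities one after the other.\<close>

lemma multiplicity_determines_initial:
  assumes "\<And>k x. k < m \<Longrightarrow> x \<in> tri_edges w k \<Longrightarrow> x \<noteq> Suc k \<Longrightarrow> multiplicity I x = multiplicity J x"
    and "k < m" "k \<le> n"
  shows "selected w I k = selected w J k"
  using assms(2,3)
proof (induction k rule: less_induct)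
  case (less k)
  have split: "multiplicity K x = (\<Sum>j<k. of_bool (selected w K j = x)) + of_bool (selected w K k = x)"
    if "x \<in> tri_edges w k" "x \<noteq> Suc k" for K x
  proof -
    have "of_bool (selected w K j = x) = (0 :: int)" if "j \<in> {k<..n}" for j
      using that tri_edges_disjoint[of k j x] selected_in_tri_edges[of j K] \<open>x \<in> tri_edges w k\<close> \<open>x \<noteq> Suc k\<close> by auto
    then have zero: "(\<Sum>j\<in>{k<..n}. of_bool (selected w K j = x)) = (0 :: int)" by (intro sum.neutral) blast
    show ?thesis unfolding multiplicity_def sum_atMost_split[OF less.prems(2)] zero by (simp only: add_0_right)
  qed
  have "(\<Sum>j<k. of_bool (selected w I j = x)) = (\<Sum>j<k. of_bool (selected w J j = x) :: int)" for x
    using less by (intro sum.cong) auto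
  then have eq: "selected w I k = x \<longleftrightarrow> selected w J k = x" if "x \<in> tri_edges w k" "x \<noteq> Suc k" for x
    using split[OF that, of I] split[OF that, of J] assms(1)[OF less.prems(1) that]
    by (auto simp: of_bool_def split: if_splits)
  show ?case
    using eq[of "selected w I k"] eq[of "selected w J k"] selected_in_tri_edges[OF less.prems(2)] by metis
qed

lemma multiplicity_determines_final:
  assumes "\<And>k x. m < k \<Longrightarrow> k \<le> n \<Longrightarrow> x \<in> tri_edges w k \<Longrightarrow> x \<noteq> k \<Longrightarrow> multiplicity I x = multiplicity J x"
    and "m < k" "k \<le> n"
  shows "selected w I k = selected w J k"
  using assms(2,3)
proof (induction "n - k" arbitrary: k rule: less_induct)
  case less
  have split: "multiplicity K x = (\<Sum>j\<in>{k<..n}. of_bool (selected w K j = x)) + of_bool (selected w K k = x)"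
    if "x \<in> tri_edges w k" "x \<noteq> k" for K x
  proof -
    have "of_bool (selected w K j = x) = (0 :: int)" if "j \<in> {..<k}" for j
      using that tri_edges_disjoint[of j k x] selected_in_tri_edges[of j K] less.prems \<open>x \<in> tri_edges w k\<close> \<open>x \<noteq> k\<close> by auto
    then have zero: "(\<Sum>j\<in>{..<k}. of_bool (selected w K j = x)) = (0 :: int)" by (intro sum.neutral) blast
    show ?thesis unfolding multiplicity_def sum_atMost_split[OF less.prems(2)] zero
      by (simp only: add_0_left add.commute)
  qed
  have "(\<Sum>j\<in>{k<..n}. of_bool (selected w I j = x)) = (\<Sum>j\<in>{k<..n}. of_bool (selected w J j = x) :: int)" for x
    using less by (intro sum.cong) auto
  then have eq: "selected w I k = x \<longleftrightarrow> selected w J k = x" if "x \<in> tri_edges w k" "x \<noteq> k" for x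
    using split[OF that, of I] split[OF that, of J] assms(1)[OF less.prems that]
    by (auto simp: of_bool_def split: if_splits)
  show ?case
    using eq[of "selected w I k"] eq[of "selected w J k"] selected_in_tri_edges[OF less.prems(2)] by metis
qed

lemma multiplicity_inject:
  "I \<in> ideals w \<Longrightarrow> J \<in> ideals w \<Longrightarrow> (\<And>x. multiplicity I x = multiplicity J x) \<Longrightarrow> I = J"
  using multiplicity_determines_initial[of "Suc n" I J] by (intro selected_inject) auto

lemma inj_T_list: "inj_on T_list (ideals w)"
  using colour_T_list multiplicity_inject by (intro inj_onI) (metis diff_add_cancel)

lemma multiplicity_insert:
  assumes "0 < i" "i \<le> n" "I \<in> ideals w" "i \<notin> I" "insert i I \<in> ideals w"
  shows "multiplicity (insert i I) x = multiplicity I x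
     + of_bool (x \<in> {side_after w i Rgt, side_before w i Lft}) - of_bool (x \<in> {side_before w i Rgt, side_after w i Lft})"
proof -
  have old: "selected w I (i - 1) = side_before w i Rgt" "selected w I i = side_after w i Lft"
    using insert_ideal_iff(1)[OF assms(1-3)] assms(4,5) by auto
  have new: "selected w (insert i I) = (selected w I)(i - 1 := side_before w i Lft, i := side_after w i Rgt)"
    using insert_ideal_iff(2)[OF assms] .
  have split: "multiplicity K x = (\<Sum>k\<in>{..n} - {i - 1, i}. of_bool (selected w K k = x))
      + of_bool (selected w K (i - 1) = x) + of_bool (selected w K i = x)" for K
    unfolding multiplicity_def using assms(1,2)
    by (subst sum.subset_diff[of "{i - 1, i}"]) auto
  have "(\<Sum>k\<in>{..n} - {i - 1, i}. of_bool (selected w (insert i I) k = x)) =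
      (\<Sum>k\<in>{..n} - {i - 1, i}. of_bool (selected w I k = x) :: int)"
    by (intro sum.cong) (auto simp: new)
  moreover have "of_bool (x = a \<or> x = b) = of_bool (a = x) + (of_bool (b = x) :: int)" if "a \<noteq> b" for a b :: nat
    using that by auto
  ultimately show ?thesis
    using old assms(1) side_before_after_neq[OF assms(1,2)] unfolding split[of I] split[of "insert i I"]
    by (simp add: new) metis
qed

lemma T_list_twist_iff:
  assumes i: "0 < i" "i \<le> n" and IJ: "I \<in> ideals w" "J \<in> ideals w"
  shows "(T_list I, T_list J) \<in> TP_twist w i \<longleftrightarrow> i \<notin> I \<and> J = insert i I"
proof -
  let ?new = "{side_after w i Rgt, side_before w i Lft}" and ?old = "{side_before w i Rgt, side_after w i Lft}"
  have tw: "(T_list I, T_list J) \<in> TP_twist w i \<longleftrightarrow>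
      (\<forall>x. multiplicity J x = multiplicity I x + of_bool (x \<in> ?new) - of_bool (x \<in> ?old))"
  proof -
    have "colour (T_list J) x = colour (T_list I) x + of_bool (x \<in> ?new) - of_bool (x \<in> ?old) \<longleftrightarrow>
        multiplicity J x = multiplicity I x + of_bool (x \<in> ?new) - of_bool (x \<in> ?old)" for x
      unfolding colour_T_list[OF IJ(1)] colour_T_list[OF IJ(2)] by linarith
    then show ?thesis unfolding TP_twist_def u_d_sides[OF i] by simp
  qed
  have disj: "side_before w i Lft \<notin> ?old"
    using side_before_after_neq[OF i] side_before_cancel[OF i] by simp
  show ?thesis
  proof
    assume "(T_list I, T_list J) \<in> TP_twist w i"
    then have m: "multiplicity J x = multiplicity I x + of_bool (x \<in> ?new) - of_bool (x \<in> ?old)" for x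
      using tw by blast
    have same: "multiplicity I x = multiplicity J x" if "x \<notin> tri_edges w (i - 1) - {i}" "x \<notin> tri_edges w i - {i}" for x
    proof -
      have "side_before w i s \<in> tri_edges w (i - 1) - {i}" "side_after w i s \<in> tri_edges w i - {i}" for s
        using side_before_in[OF i] side_after_in[OF i] side_before_neq[OF i] side_after_neq[OF i] by simp_all
      then have "x \<noteq> side_before w i s" "x \<noteq> side_after w i s" for s using that by blast+
      then show ?thesis using m[of x] by simp
    qed
    \<comment> \<open>Outside of the triangles at the diagonal \<open>i\<close>, all labels occur equally
      often, so the selections agree.\<close>
    have left: "selected w I k = selected w J k" if "k < i - 1" for k
    proof (rule multiplicity_determines_initial[of "i - 1"])
      fix k x assume *: "k < i - 1" "x \<in> tri_edges w k" "x \<noteq> Suc k"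
      show "multiplicity I x = multiplicity J x"
        by (rule same) (use * tri_edges_disjoint[of k "i - 1" x] tri_edges_disjoint[of k i x] i in auto)
    qed (use that i in auto)
    have right: "selected w I k = selected w J k" if "i < k" "k \<le> n" for k
    proof (rule multiplicity_determines_final[of i])
      fix k x assume *: "i < k" "k \<le> n" "x \<in> tri_edges w k" "x \<noteq> k"
      show "multiplicity I x = multiplicity J x"
        by (rule same) (use * tri_edges_disjoint[of "i - 1" k x] tri_edges_disjoint[of i k x] i less_imp_diff_less[OF *(1), of 1] in auto)
    qed (use that in auto)
    note jI = selected_joinable[OF IJ(1)] and jJ = selected_joinable[OF IJ(2)]
    have agree: "side_of I l = side_of J l" if l: "0 < l" "l \<le> n" "l \<noteq> i" for l
    proof (cases "l < i")
      case True
      define k where "k = l - 1"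
      have k: "l = Suc k" "k < i - 1" "k < n" using l True i by (auto simp: k_def)
      show ?thesis using left[OF k(2)] join_cancel(2)[OF _ jI[of k] jJ[of k]] k by (simp add: selected_def)
    next
      case False
      then have "i < l" using l by simp
      then show ?thesis using right[of l] join_cancel(1)[OF _ jI[of l] jJ[of l]] l by (simp add: selected_def)
    qed
    have iff: "l \<in> I \<longleftrightarrow> l \<in> J" if "l \<noteq> i" for l
    proof (cases "0 < l \<and> l \<le> n")
      case True then show ?thesis using agree[of l] that by (auto simp: side_of_def split: if_splits)
    next
      case False then show ?thesis using IJ by (auto simp: ideals_def)
    qed
    have "I \<noteq> J" using m[of "side_before w i Lft"] disj by auto
    have "I = J" if "i \<in> I \<longleftrightarrow> i \<in> J"
    proof (rule Set.set_eqI)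
      fix l show "l \<in> I \<longleftrightarrow> l \<in> J" using iff[of l] that by (cases "l = i") simp_all
    qed
    then have one: "i \<in> I \<longleftrightarrow> i \<notin> J" using \<open>I \<noteq> J\<close> by blast
    have "i \<notin> I"
    proof
      assume "i \<in> I"
      then have "i \<notin> J" using one by simp
      moreover have "I = insert i J"
      proof (rule Set.set_eqI)
        fix l show "l \<in> I \<longleftrightarrow> l \<in> insert i J" using iff[of l] \<open>i \<in> I\<close> by (cases "l = i") simp_all
      qed
      ultimately have "multiplicity I x = multiplicity J x + of_bool (x \<in> ?new) - of_bool (x \<in> ?old)" for x
        using multiplicity_insert[OF i IJ(2)] IJ(1) by simp
      then show False using m[of "side_before w i Lft"] disj by (simp only: of_bool_def) force
    qed
    moreover have "J = insert i I"
    proof (rule Set.set_eqI)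
      fix l show "l \<in> J \<longleftrightarrow> l \<in> insert i I" using iff[of l] one \<open>i \<notin> I\<close> by (cases "l = i") simp_all
    qed
    ultimately show "i \<notin> I \<and> J = insert i I" ..
  next
    assume "i \<notin> I \<and> J = insert i I"
    then show "(T_list I, T_list J) \<in> TP_twist w i" unfolding tw using multiplicity_insert[OF i IJ(1)] IJ(2) by simp
  qed
qed

theorem TP_modelled: "modelled w (TP w) T_list"
  unfolding modelled_def
  using inj_T_list nodes_TP T_list_twist_iff by (simp add: bij_betw_def) (simp add: TP_def Suc_le_eq)

end

section \<open>The snake graph\<close>

text \<open>The end point of the diagonal of a tile at its north-west corner lies on the left of the arc for odd tiles and,
  because even tiles are reflected, on the right for even ones.\<close>

definition nw_side :: "nat \<Rightarrow> side" where
  "nw_side i = (if odd i then Lft else Rgt)"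

text \<open>The corner of the tile \<open>k\<close> at which an end point of the diagonal \<open>k\<close> is drawn; again there are degenerate
  tiles \<open>0\<close> and \<open>n + 1\<close>.\<close>

definition corner :: "word \<Rightarrow> nat \<Rightarrow> side \<Rightarrow> point" where
  "corner w k s = (if k = 0 then (0, 0)
     else let (x, y) = tile_pos w (min k (rank w)) in
       if rank w < k then (x + 1, y + 1) else if s = nw_side k then (x, y + 1) else (x + 1, y))"

definition grid_edge :: "word \<Rightarrow> nat \<Rightarrow> side \<Rightarrow> side \<Rightarrow> point set" where
  "grid_edge w k s t = {corner w k s, corner w (Suc k) t}"

text \<open>The corners of the tile \<open>k\<close> on its diagonal have level \<open>k\<close>, so every
  edge leads from one level to the next.\<close>

definition level :: "point \<Rightarrow> int" where
  "level p = fst p + snd p"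

lemma side_label_eq:
  "side_label w i South = side_before w i (opposite (nw_side i))" "side_label w i West = side_before w i (nw_side i)"
  "side_label w i North = side_after w i (nw_side i)" "side_label w i East = side_after w i (opposite (nw_side i))"
  by (auto simp: side_label_def side_before_def side_after_def nw_side_def)

lemma nw_side_Suc: "nw_side (Suc k) = opposite (nw_side k)"
  by (simp add: nw_side_def)

lemma inj_exchange_iff:
  assumes "inj_on f U" "A \<subseteq> U" "B \<subseteq> U" "C \<subseteq> U" "D \<subseteq> U"
  shows "f ` C \<subseteq> f ` A \<and> f ` B = f ` A - f ` C \<union> f ` D \<longleftrightarrow> C \<subseteq> A \<and> B = A - C \<union> D"
proof -
  have "f ` A - f ` C \<union> f ` D = f ` (A - C \<union> D)"
    using inj_on_image_set_diff[OF assms(1), of A C] assms by (auto simp: image_Un)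
  then have "f ` B = f ` A - f ` C \<union> f ` D \<longleftrightarrow> B = A - C \<union> D"
    using inj_on_image_eq_iff[OF assms(1), of B "A - C \<union> D"] assms by auto
  moreover have "x \<in> A" if "x \<in> C" "f ` C \<subseteq> f ` A" for x
    using inj_on_image_mem_iff[OF assms(1), of x A] that assms by blast
  then have "f ` C \<subseteq> f ` A \<longleftrightarrow> C \<subseteq> A" by blast
  ultimately show ?thesis by blast
qed

context nonempty_word
begin

lemma tile_pos_step:
  assumes "0 < k" "k < n"
  shows "tile_pos w (Suc k) = corner w k (opposite (shared w k))"
    "(fst (tile_pos w k) + 1, snd (tile_pos w k) + 1) = corner w (Suc k) (opposite (shared w k))"
proof -
  obtain x y where xy: "tile_pos w k = (x, y)" by fastforce
  have "side_label w k North = n + k \<longleftrightarrow> nw_side k \<noteq> shared w k"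
    using assms rank_ge_2 by (simp add: side_label_eq side_after_mid)
  then have step: "tile_pos w (Suc k) = (if nw_side k \<noteq> shared w k then (x, y + 1) else (x + 1, y))"
    using assms xy by simp
  have min: "min k n = k" "min (Suc k) n = Suc k" using assms by auto
  show "tile_pos w (Suc k) = corner w k (opposite (shared w k))"
    unfolding step corner_def min xy using assms by (cases "nw_side k"; cases "shared w k") auto
  show "(fst (tile_pos w k) + 1, snd (tile_pos w k) + 1) = corner w (Suc k) (opposite (shared w k))"
    unfolding corner_def min step using assms xy
    by (cases "nw_side k"; cases "shared w k") (auto simp: nw_side_Suc simp del: tile_pos.simps)
qed

lemma tile_sw: "0 < i \<Longrightarrow> i \<le> n \<Longrightarrow> tile_pos w i = corner w (i - 1) (opposite (shared w (i - 1)))"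
proof -
  assume i: "0 < i" "i \<le> n"
  show ?thesis
  proof (cases "i = 1")
    case True then show ?thesis by (simp add: corner_def)
  next
    case False
    then have "0 < i - 1" "i - 1 < n" "Suc (i - 1) = i" using i by auto
    then show ?thesis using tile_pos_step(1)[of "i - 1"] by simp
  qed
qed

lemma tile_ne: "0 < i \<Longrightarrow> i \<le> n \<Longrightarrow>
    (fst (tile_pos w i) + 1, snd (tile_pos w i) + 1) = corner w (Suc i) (opposite (shared w i))"
proof (cases "i = n")
  case True then show ?thesis by (simp add: corner_def split: prod.splits)
qed (use tile_pos_step(2)[of i] in simp)

lemma corner_tile: "0 < i \<Longrightarrow> i \<le> n \<Longrightarrow> corner w i s =
    (if s = nw_side i then (fst (tile_pos w i), snd (tile_pos w i) + 1) else (fst (tile_pos w i) + 1, snd (tile_pos w i)))"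
  by (simp add: corner_def min_def split: prod.splits)

lemma corner_ends: "corner w 0 s = (0, 0)" "corner w (Suc n) s = (fst (tile_pos w n) + 1, snd (tile_pos w n) + 1)"
  by (simp_all add: corner_def split: prod.splits)

lemma tile_edge_before: "0 < i \<Longrightarrow> i \<le> n \<Longrightarrow>
    tile_edge w i (if u = nw_side i then West else South) = grid_edge w (i - 1) (opposite (shared w (i - 1))) u"
  using tile_sw[of i] corner_tile[of i u] by (auto simp: tile_edge_def grid_edge_def split: prod.splits)

lemma tile_edge_after: "0 < i \<Longrightarrow> i \<le> n \<Longrightarrow>
    tile_edge w i (if u = nw_side i then North else East) = grid_edge w i u (opposite (shared w i))"
  using tile_ne[symmetric, of i] corner_tile[of i u] by (auto simp: tile_edge_def grid_edge_def split: prod.splits)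

lemma joinable_opposite: "joinable w k (opposite (shared w k)) t" "joinable w k s (opposite (shared w k))"
  by (simp_all add: joinable_def)

lemma join_before: "0 < i \<Longrightarrow> i \<le> n \<Longrightarrow> join w (i - 1) (opposite (shared w (i - 1))) u = side_before w i u"
  by (cases i) (simp_all add: join_def)

lemma join_after: "0 < i \<Longrightarrow> i \<le> n \<Longrightarrow> join w i u (opposite (shared w i)) = side_after w i u"
  using join_eq_side_after[of i u "opposite (shared w i)" u] joinable_opposite(2)[of i u] by simp

text \<open>The south-west half of the tile \<open>i\<close> shows the triangle \<open>i - 1\<close>, and
  its north-east half the triangle \<open>i\<close>.\<close>

definition drawn :: "nat \<Rightarrow> nat \<Rightarrow> compass \<Rightarrow> bool" where
  "drawn k i d \<longleftrightarrow> i = k \<and> d \<in> {North, East} \<or> i = k + 1 \<and> d \<in> {South, West}"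

lemma tile_edge_grid:
  assumes "i \<in> {1..n}"
  obtains k s t where "k \<le> n" "joinable w k s t" "tile_edge w i d = grid_edge w k s t"
    "side_label w i d = join w k s t" "drawn k i d"
proof -
  have i: "0 < i" "i \<le> n" using assms by auto
  let ?nw = "nw_side i"
  show thesis
  proof (cases d)
    case South
    then show ?thesis using that[OF _ joinable_opposite(1), of "i - 1" "opposite ?nw"]
        tile_edge_before[OF i, of "opposite ?nw"] join_before[OF i, of "opposite ?nw"] i
      by (simp add: side_label_eq drawn_def)
  next
    case West
    then show ?thesis using that[OF _ joinable_opposite(1), of "i - 1" ?nw]
        tile_edge_before[OF i, of ?nw] join_before[OF i, of ?nw] i by (simp add: side_label_eq drawn_def)
  next
    case North
    then show ?thesis using that[OF _ joinable_opposite(2), of i ?nw]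
        tile_edge_after[OF i, of ?nw] join_after[OF i, of ?nw] i by (simp add: side_label_eq drawn_def)
  next
    case East
    then show ?thesis using that[OF _ joinable_opposite(2), of i "opposite ?nw"]
        tile_edge_after[OF i, of "opposite ?nw"] join_after[OF i, of "opposite ?nw"] i
      by (simp add: side_label_eq drawn_def)
  qed
qed

lemma grid_edge_tile:
  assumes "k \<le> n" "joinable w k s t"
  obtains i d where "i \<in> {1..n}" "tile_edge w i d = grid_edge w k s t" "side_label w i d = join w k s t" "drawn k i d"
proof -
  let ?o = "opposite (shared w k)"
  have "k < n \<and> (k = 0 \<or> s = ?o) \<or> 0 < k \<and> (k = n \<or> t = ?o)"
    using assms rank_ge_2 neq_iff_opposite[of s "shared w k"] neq_iff_opposite[of t "shared w k"]
    unfolding joinable_def by (cases "k = 0"; cases "k = n") auto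
  then consider "k < n" "k = 0 \<or> s = ?o" | "0 < k" "k = n \<or> t = ?o" by (elim disjE conjE) blast+
  then show thesis
  proof cases
    case 1
    let ?d = "if t = nw_side (Suc k) then West else South"
    have "grid_edge w k s t = grid_edge w k ?o t" using 1 corner_ends(1) by (auto simp: grid_edge_def)
    moreover have "join w k s t = join w k ?o t" using 1 by (auto simp: join_0)
    moreover have "side_label w (Suc k) ?d = side_before w (Suc k) t"
      using neq_iff_opposite by (auto simp: side_label_eq)
    ultimately show ?thesis using that[of "Suc k" ?d] tile_edge_before[of "Suc k" t] join_before[of "Suc k" t] 1
      by (simp add: drawn_def)
  next
    case 2
    let ?d = "if s = nw_side k then North else East"
    have "grid_edge w k s t = grid_edge w k s ?o" using 2 corner_ends(2) by (auto simp: grid_edge_def)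
    moreover have "join w k s t = join w k s ?o" using 2 by (auto simp: join_last)
    moreover have "side_label w k ?d = side_after w k s"
      using neq_iff_opposite by (auto simp: side_label_eq)
    ultimately show ?thesis using that[of k ?d] tile_edge_after[of k s] join_after[of k s] 2 assms(1)
      by (simp add: drawn_def)
  qed
qed

lemma level_tile_pos: "0 < k \<Longrightarrow> k \<le> n \<Longrightarrow> level (tile_pos w k) = int k - 1"
proof (induction k)
  case (Suc k)
  then show ?case
    by (cases "k = 0"; cases "tile_pos w k") (auto simp: level_def)
qed simp

lemma level_corner: "k \<le> n + 1 \<Longrightarrow> level (corner w k s) = int k"
proof -
  assume k: "k \<le> n + 1"
  consider "k = 0" | "0 < k" "k \<le> n" | "k = Suc n" using k by fastforce
  then show ?thesis
  proof cases
    case 2 then show ?thesis using level_tile_pos[of k] by (simp add: corner_tile level_def)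
  next
    case 3 then show ?thesis using level_tile_pos[of n] rank_ge_2 by (simp add: corner_ends level_def)
  qed (simp add: corner_ends level_def)
qed

lemma corner_cancel: "0 < k \<Longrightarrow> k \<le> n \<Longrightarrow> corner w k s = corner w k t \<longleftrightarrow> s = t"
  using neq_iff_opposite by (auto simp: corner_tile)

lemma corner_in_grid_edge:
  assumes "j \<le> n" "k \<le> n + 1"
  shows "corner w k u \<in> grid_edge w j s t \<longleftrightarrow>
    j = k \<and> corner w k u = corner w k s \<or> Suc j = k \<and> corner w k u = corner w k t"
proof -
  have level: "level (corner w j s) = int j" "level (corner w (Suc j) t) = int (Suc j)" "level (corner w k u) = int k"
    using level_corner[of j s] level_corner[of "Suc j" t] level_corner[of k u] assms by simp_all
  have "j = k" if "corner w k u = corner w j s" using that level by (metis of_nat_eq_iff)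
  moreover have "Suc j = k" if "corner w k u = corner w (Suc j) t" using that level by (metis of_nat_eq_iff)
  ultimately show ?thesis by (auto simp: grid_edge_def)
qed

lemma grid_edge_eq:
  assumes "grid_edge w j s t = grid_edge w k u v" "j \<le> n" "k \<le> n"
  shows "j = k" "corner w k s = corner w k u" "corner w (Suc k) t = corner w (Suc k) v"
    "0 < k \<Longrightarrow> s = u" "k < n \<Longrightarrow> t = v"
proof -
  have l: "level (corner w j s) = int j" "level (corner w (Suc j) t) = int j + 1"
    "level (corner w k u) = int k" "level (corner w (Suc k) v) = int k + 1"
    using level_corner assms by auto
  have "corner w j s = corner w k u \<and> corner w (Suc j) t = corner w (Suc k) v \<or>
      corner w j s = corner w (Suc k) v \<and> corner w (Suc j) t = corner w k u"
    using assms(1) by (simp add: grid_edge_def doubleton_eq_iff)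
  then have *: "j = k \<and> corner w j s = corner w k u \<and> corner w (Suc j) t = corner w (Suc k) v" using l by force
  then show "j = k" "corner w k s = corner w k u" "corner w (Suc k) t = corner w (Suc k) v" by auto
  then show "0 < k \<Longrightarrow> s = u" "k < n \<Longrightarrow> t = v"
    using corner_cancel[of k s u] corner_cancel[of "Suc k" t v] assms by auto
qed

lemma grid_edge_join: "grid_edge w j s t = grid_edge w k u v \<Longrightarrow> j \<le> n \<Longrightarrow> k \<le> n \<Longrightarrow> join w j s t = join w k u v"
  using grid_edge_eq[of j s t k u v] rank_ge_2 by (cases "k = 0"; cases "k = n") (auto simp: join_0 join_last)

lemma snake_edges_eq: "snake_edges w = {grid_edge w k s t | k s t. k \<le> n \<and> joinable w k s t}"
proof (intro subset_antisym subsetI)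
  fix E assume "E \<in> snake_edges w"
  then obtain i d where i: "i \<in> {1..n}" "E = tile_edge w i d" unfolding snake_edges_def by blast
  obtain k s t where "k \<le> n" "joinable w k s t" "tile_edge w i d = grid_edge w k s t"
    using tile_edge_grid[OF i(1), of d] by metis
  then show "E \<in> {grid_edge w k s t | k s t. k \<le> n \<and> joinable w k s t}" unfolding i(2) by (intro CollectI exI conjI)
next
  fix E assume "E \<in> {grid_edge w k s t | k s t. k \<le> n \<and> joinable w k s t}"
  then obtain k s t where k: "k \<le> n" "joinable w k s t" "E = grid_edge w k s t" by blast
  obtain i d where "i \<in> {1..n}" "tile_edge w i d = grid_edge w k s t" using grid_edge_tile[OF k(1,2)] by metis
  then show "E \<in> snake_edges w" unfolding snake_edges_def k(3) by (intro CollectI exI conjI) auto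
qed

lemma edge_label_grid:
  assumes "k \<le> n" "joinable w k s t"
  shows "edge_label w (grid_edge w k s t) = join w k s t"
  unfolding edge_label_def
proof (rule the_equality)
  show "\<exists>i d. i \<in> {1..n} \<and> grid_edge w k s t = tile_edge w i d \<and> join w k s t = side_label w i d"
    using grid_edge_tile[OF assms] by metis
  fix e assume "\<exists>i d. i \<in> {1..n} \<and> grid_edge w k s t = tile_edge w i d \<and> e = side_label w i d"
  then obtain i d where *: "i \<in> {1..n}" "grid_edge w k s t = tile_edge w i d" "e = side_label w i d" by blast
  obtain j u v where "j \<le> n" "tile_edge w i d = grid_edge w j u v" "side_label w i d = join w j u v"
    using tile_edge_grid[OF *(1)] by metis
  then show "e = join w k s t" using * grid_edge_join assms(1) by metis
qed

lemma snake_edge_join: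
  assumes "k \<le> n" "joinable w k s t"
  shows "snake_edge w (k, join w k s t) = grid_edge w k s t"
  unfolding snake_edge_def
proof (rule the_equality)
  show "\<exists>i d. i \<in> {1..n} \<and> grid_edge w k s t = tile_edge w i d \<and> side_label w i d = snd (k, join w k s t) \<and>
     (i = fst (k, join w k s t) \<and> d \<in> {North, East} \<or> i = fst (k, join w k s t) + 1 \<and> d \<in> {South, West})"
    using grid_edge_tile[OF assms] unfolding drawn_def fst_conv snd_conv by metis
  fix E assume "\<exists>i d. i \<in> {1..n} \<and> E = tile_edge w i d \<and> side_label w i d = snd (k, join w k s t) \<and>
     (i = fst (k, join w k s t) \<and> d \<in> {North, East} \<or> i = fst (k, join w k s t) + 1 \<and> d \<in> {South, West})"
  then obtain i d where *: "i \<in> {1..n}" "E = tile_edge w i d" "side_label w i d = join w k s t" "drawn k i d"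
    by (auto simp: drawn_def)
  obtain j u v where j: "j \<le> n" "joinable w j u v" "tile_edge w i d = grid_edge w j u v"
    "side_label w i d = join w j u v" "drawn j i d" using tile_edge_grid[OF *(1)] by metis
  have "j = k" using j(5) *(4) by (auto simp: drawn_def)
  then have "0 < k \<Longrightarrow> u = s" "k < n \<Longrightarrow> v = t" using join_cancel[of k u v s t] assms j * by auto
  then have "corner w k u = corner w k s" "corner w (Suc k) v = corner w (Suc k) t"
    using assms(1) corner_ends by (cases "k = 0"; cases "k = n"; auto)+
  then show "E = grid_edge w k s t" using j(3) *(2) \<open>j = k\<close> by (simp add: grid_edge_def)
qed

lemma inj_snake_edge: "inj_on (snake_edge w) (angles w)"
proof (rule inj_onI)
  fix x y assume "x \<in> angles w" "y \<in> angles w" "snake_edge w x = snake_edge w y"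
  moreover obtain j e k f where "x = (j, e)" "y = (k, f)" by fastforce
  ultimately obtain s t u v where *: "x = (j, join w j s t)" "j \<le> n" "joinable w j s t"
    "y = (k, join w k u v)" "k \<le> n" "joinable w k u v" "snake_edge w x = snake_edge w y"
    using angles_join by blast
  then have eq: "grid_edge w j s t = grid_edge w k u v" by (simp add: snake_edge_join)
  then show "x = y" using grid_edge_eq(1)[OF eq] grid_edge_join[OF eq] * by simp
qed

lemma edge_label_snake_edge: "(k, e) \<in> angles w \<Longrightarrow> edge_label w (snake_edge w (k, e)) = e"
  unfolding angles_join by (auto simp: snake_edge_join edge_label_grid)

lemma snake_edge_before: "0 < i \<Longrightarrow> i \<le> n \<Longrightarrow>
    snake_edge w (i - 1, side_before w i u) = tile_edge w i (if u = nw_side i then West else South)"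
  using snake_edge_join[OF _ joinable_opposite(1), of "i - 1" u] tile_edge_before[of i u] join_before[of i u] by simp

lemma snake_edge_after: "0 < i \<Longrightarrow> i \<le> n \<Longrightarrow>
    snake_edge w (i, side_after w i u) = tile_edge w i (if u = nw_side i then North else East)"
  using snake_edge_join[OF _ joinable_opposite(2), of i u] tile_edge_after[of i u] join_after[of i u] by simp

lemma side_angles:
  assumes "0 < i" "i \<le> n"
  shows "(i - 1, side_before w i u) \<in> angles w" "(i, side_after w i u) \<in> angles w"
proof -
  show "(i - 1, side_before w i u) \<in> angles w" unfolding angles_join join_before[OF assms, of u, symmetric]
    using joinable_opposite(1)[of "i - 1" u] assms by (intro conjI exI) auto
  show "(i, side_after w i u) \<in> angles w" unfolding angles_join join_after[OF assms, of u, symmetric]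
    using joinable_opposite(2)[of i u] assms by (intro conjI exI) auto
qed

subsection \<open>Perfect matchings\<close>

definition matching :: "nat set \<Rightarrow> point set set" where
  "matching I = snake_edge w ` angle_set I"

lemma matching_eq: "I \<in> ideals w \<Longrightarrow>
    matching I = {grid_edge w k (opposite (side_of I k)) (side_of I (Suc k)) | k. k \<le> n}"
proof -
  assume I: "I \<in> ideals w"
  have "matching I = (\<lambda>k. snake_edge w (k, selected w I k)) ` {..n}" by (auto simp: matching_def angle_set_def)
  also have "\<dots> = (\<lambda>k. grid_edge w k (opposite (side_of I k)) (side_of I (Suc k))) ` {..n}"
    by (intro image_cong refl) (simp add: selected_def snake_edge_join selected_joinable[OF I])
  finally show ?thesis by auto
qed

lemma snake_vertices: "\<Union>(snake_edges w) = {corner w k s | k s. k \<le> n + 1}"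
proof (intro subset_antisym subsetI)
  fix v assume "v \<in> \<Union>(snake_edges w)"
  then show "v \<in> {corner w k s | k s. k \<le> n + 1}" unfolding snake_edges_eq grid_edge_def by fastforce
next
  fix v assume "v \<in> {corner w k s | k s. k \<le> n + 1}"
  then obtain k s where k: "v = corner w k s" "k \<le> n + 1" by blast
  show "v \<in> \<Union>(snake_edges w)"
  proof (cases "k \<le> n")
    case True
    then show ?thesis unfolding snake_edges_eq k(1) grid_edge_def using joinable_opposite(2)[of k s] by blast
  next
    case False
    then have "k = Suc n" using k by simp
    then show ?thesis unfolding snake_edges_eq k(1) grid_edge_def using joinable_last[of s s] by blast
  qed
qed

lemma perfect_matching_matching:
  assumes I: "I \<in> ideals w" shows "perfect_matching w (matching I)"
  unfolding perfect_matching_def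
proof (intro conjI ballI)
  let ?s = "\<lambda>k. opposite (side_of I k)" and ?t = "\<lambda>k. side_of I (Suc k)"
  show "matching I \<subseteq> snake_edges w" unfolding matching_eq[OF I] snake_edges_eq using selected_joinable[OF I] by blast
  fix v assume "v \<in> \<Union>(snake_edges w)"
  then obtain k u where v: "v = corner w k u" "k \<le> n + 1" unfolding snake_vertices by blast
  \<comment> \<open>Of the two edges at the level of \<open>v\<close>, one ends at the corner selected by
    \<open>I\<close> and one starts at the other corner.\<close>
  define j where "j = (if k = 0 \<or> k \<le> n \<and> u \<noteq> side_of I k then k else k - 1)"
  have j: "j \<le> n" using v(2) by (auto simp: j_def)
  show "\<exists>!e. e \<in> matching I \<and> v \<in> e"
  proof (rule ex1I[of _ "grid_edge w j (?s j) (?t j)"])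
    have "v \<in> grid_edge w j (?s j) (?t j)"
    proof (cases "k = 0 \<or> k = Suc n")
      case True then show ?thesis using v corner_ends by (auto simp: j_def grid_edge_def)
    next
      case False
      then have "u \<noteq> side_of I k \<Longrightarrow> u = ?s k" using neq_iff_opposite by blast
      then show ?thesis using False v by (cases "u = side_of I k"; cases k) (auto simp: j_def grid_edge_def)
    qed
    then show "grid_edge w j (?s j) (?t j) \<in> matching I \<and> v \<in> grid_edge w j (?s j) (?t j)"
      using j matching_eq[OF I] by blast
    fix e assume e: "e \<in> matching I \<and> v \<in> e"
    then obtain l where l: "l \<le> n" "e = grid_edge w l (?s l) (?t l)" using matching_eq[OF I] by blast
    then have "l = k \<and> corner w k u = corner w k (?s k) \<or> Suc l = k \<and> corner w k u = corner w k (side_of I k)"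
      using e corner_in_grid_edge[OF l(1) v(2)] v(1) by auto
    then have "l = j" using corner_cancel[of k u] l(1) v(2) by (cases "k = 0"; cases "k = Suc n") (auto simp: j_def)
    then show "e = grid_edge w j (?s j) (?t j)" using l by simp
  qed
qed

text \<open>The corners come in pairs, one pair for each diagonal. If exactly one edge of the matching is
  drawn for the triangle \<open>k\<close>, it covers one of the two corners of the diagonal \<open>k +
  1\<close>, and the other corner forces exactly one edge for the triangle \<open>k + 1\<close>.\<close>

lemma perfect_matching_ideal:
  assumes P: "perfect_matching w P"
  obtains I where "I \<in> ideals w" "P = matching I"
proof -
  have sub: "\<And>E. E \<in> P \<Longrightarrow> \<exists>k s t. k \<le> n \<and> joinable w k s t \<and> E = grid_edge w k s t"
    using P unfolding perfect_matching_def snake_edges_eq by blast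
  have unique: "\<exists>!E. E \<in> P \<and> corner w k u \<in> E" if "k \<le> n + 1" for k u
    using P that unfolding perfect_matching_def snake_vertices by blast
  have unique_eq: "E = F" if "E \<in> P" "F \<in> P" "corner w k u \<in> E" "corner w k u \<in> F" "k \<le> n + 1" for E F k u
    using unique[OF that(5), of u] that(1-4) by (elim ex1E) blast
  let ?only = "\<lambda>k s t. joinable w k s t \<and> grid_edge w k s t \<in> P \<and>
    (\<forall>u v. joinable w k u v \<and> grid_edge w k u v \<in> P \<longrightarrow> grid_edge w k u v = grid_edge w k s t)"
  have ex: "k \<le> n \<Longrightarrow> \<exists>s t. ?only k s t" for k
  proof (induction k)
    case 0
    obtain E where E: "E \<in> P" "corner w 0 Lft \<in> E" "\<And>F. F \<in> P \<Longrightarrow> corner w 0 Lft \<in> F \<Longrightarrow> F = E"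
      using unique[of 0 Lft] by auto
    obtain k s t where k: "k \<le> n" "joinable w k s t" "E = grid_edge w k s t" using sub[OF E(1)] by blast
    then have "k = 0" using corner_in_grid_edge[of k 0 Lft s t] E(2) by auto
    moreover have "corner w 0 Lft \<in> grid_edge w 0 u v" for u v by (simp add: grid_edge_def corner_ends)
    ultimately show ?case using E k by metis
  next
    case (Suc k)
    then obtain s t where st: "?only k s t" by auto
    let ?o = "opposite t"
    obtain E where E: "E \<in> P" "corner w (Suc k) ?o \<in> E" "\<And>F. F \<in> P \<Longrightarrow> corner w (Suc k) ?o \<in> F \<Longrightarrow> F = E"
      using unique[of "Suc k" ?o] Suc.prems by auto
    obtain j u v where j: "j \<le> n" "joinable w j u v" "E = grid_edge w j u v" using sub[OF E(1)] by blast
    have "j \<noteq> k"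
    proof
      assume "j = k"
      then have eq: "grid_edge w k u v = grid_edge w k s t" using st j E(1) by blast
      have "v = t" using grid_edge_eq(5)[OF eq] Suc.prems by simp
      then show False using corner_in_grid_edge[of j "Suc k" ?o u v] corner_cancel[of "Suc k" ?o t] E(2) j \<open>j = k\<close> Suc.prems by auto
    qed
    then have ju: "j = Suc k" "u = ?o"
      using corner_in_grid_edge[of j "Suc k" ?o u v] corner_cancel[of "Suc k" ?o u] E(2) j Suc.prems by auto
    have only: "grid_edge w (Suc k) u' v' = E" if "joinable w (Suc k) u' v'" "grid_edge w (Suc k) u' v' \<in> P" for u' v'
    proof (cases "u' = ?o")
      case True then show ?thesis using E(3) that(2) by (simp add: grid_edge_def)
    next
      case False
      then have "u' = t" using neq_iff_opposite[of u' ?o] by simp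
      then have at: "corner w (Suc k) t \<in> grid_edge w (Suc k) u' v'" "corner w (Suc k) t \<in> grid_edge w k s t"
        by (simp_all add: grid_edge_def)
      have "grid_edge w k s t \<in> P" using st by (elim conjE)
      then have "grid_edge w (Suc k) u' v' = grid_edge w k s t" using unique_eq[OF that(2) _ at] Suc.prems by simp
      then show ?thesis using grid_edge_eq(1)[of "Suc k" u' v' k s t] Suc.prems by simp
    qed
    have E_eq: "E = grid_edge w (Suc k) u v" using j(3) ju(1) by simp
    have "joinable w (Suc k) u v" using j(2) ju(1) by simp
    moreover have "grid_edge w (Suc k) u v \<in> P" using E(1) unfolding E_eq .
    moreover have "grid_edge w (Suc k) u' v' = grid_edge w (Suc k) u v"
      if "joinable w (Suc k) u' v' \<and> grid_edge w (Suc k) u' v' \<in> P" for u' v'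
      using only[of u' v'] that unfolding E_eq by (elim conjE)
    ultimately show ?case by (intro exI[of _ u] exI[of _ v] conjI allI impI)
  qed
  obtain s t where st: "\<And>k. k \<le> n \<Longrightarrow> ?only k (s k) (t k)" using ex by metis
  have chain: "s k = opposite (t (k - 1))" if k: "0 < k" "k \<le> n" for k
  proof (rule ccontr)
    assume "s k \<noteq> opposite (t (k - 1))"
    then have "s k = t (k - 1)" using neq_iff_opposite[of "s k" "opposite (t (k - 1))"] by simp
    then have at: "corner w k (s k) \<in> grid_edge w k (s k) (t k)" "corner w k (s k) \<in> grid_edge w (k - 1) (s (k - 1)) (t (k - 1))"
      using k by (simp_all add: grid_edge_def)
    have k1: "k - 1 \<le> n" using k by simp
    have "grid_edge w k (s k) (t k) \<in> P" using st[OF k(2)] by (elim conjE)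
    moreover have "grid_edge w (k - 1) (s (k - 1)) (t (k - 1)) \<in> P" using st[OF k1] by (elim conjE)
    ultimately have "grid_edge w k (s k) (t k) = grid_edge w (k - 1) (s (k - 1)) (t (k - 1))"
      using unique_eq[OF _ _ at] k by simp
    then show False using grid_edge_eq(1)[OF _ k(2) k1] k(1) by (metis Suc_pred' n_not_Suc_n)
  qed
  have P_eq: "P = {grid_edge w k (s k) (t k) | k. k \<le> n}"
  proof (intro subset_antisym subsetI)
    fix E assume E: "E \<in> P"
    then obtain k u v where "k \<le> n" "joinable w k u v" "E = grid_edge w k u v" using sub by blast
    then have "E = grid_edge w k (s k) (t k)" using st[of k] E by blast
    then show "E \<in> {grid_edge w k (s k) (t k) | k. k \<le> n}" using \<open>k \<le> n\<close> by blast
  qed (use st in blast)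
  obtain I where I: "I \<in> ideals w" "\<And>k. k \<le> n \<Longrightarrow> selected w I k = join w k (s k) (t k)"
  proof (rule chain_ideal[of s t])
    show "joinable w k (s k) (t k)" if "k \<le> n" for k using st[OF that] by (elim conjE)
    show "s k = opposite (t (k - 1))" if "0 < k" "k \<le> n" for k using chain[OF that] .
  qed blast
  have "matching I = (\<lambda>k. snake_edge w (k, selected w I k)) ` {..n}" by (auto simp: matching_def angle_set_def)
  also have "\<dots> = (\<lambda>k. grid_edge w k (s k) (t k)) ` {..n}"
    using I(2) st by (intro image_cong) (auto simp: snake_edge_join)
  also have "\<dots> = P" unfolding P_eq by auto
  finally show ?thesis using that I(1) by metis
qed

lemma inj_matching: "inj_on matching (ideals w)"
proof (rule inj_onI)
  fix I J assume *: "I \<in> ideals w" "J \<in> ideals w" "matching I = matching J"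
  have "snake_edge w ` angle_set I = snake_edge w ` angle_set J" using *(3) by (simp only: matching_def)
  then have "angle_set I = angle_set J"
    by (rule iffD1[OF inj_on_image_eq_iff[OF inj_snake_edge angle_set_subset[OF *(1)] angle_set_subset[OF *(2)]]])
  then show "I = J" using inj_angle_set * by (auto dest: inj_onD)
qed

lemma up_PM:
  assumes i: "0 < i" "i \<le> n"
  shows "up (PM w) i = {(P, P - snake_edge w ` {(i - 1, side_before w i Rgt), (i, side_after w i Lft)} \<union>
      snake_edge w ` {(i - 1, side_before w i Lft), (i, side_after w i Rgt)}) | P.
      snake_edge w ` {(i - 1, side_before w i Rgt), (i, side_after w i Lft)} \<subseteq> P}"
  unfolding PM_def PM_twist_def Let_def image_insert image_empty snake_edge_before[OF i] snake_edge_after[OF i]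
  by (auto simp: nw_side_def)

theorem PM_modelled: "modelled w (PM w) matching"
  unfolding modelled_def
proof (intro conjI ballI)
  have "nodes (PM w) = matching ` ideals w"
    using perfect_matching_matching perfect_matching_ideal by (auto simp: PM_def) (metis image_eqI)
  then show "bij_betw matching (ideals w) (nodes (PM w))" using inj_matching by (simp add: bij_betw_def)
  fix i I J assume *: "i \<in> {1..n}" "I \<in> ideals w" "J \<in> ideals w"
  then have i: "0 < i" "i \<le> n" by auto
  let ?old = "{(i - 1, side_before w i Rgt), (i, side_after w i Lft)}"
  let ?new = "{(i - 1, side_before w i Lft), (i, side_after w i Rgt)}"
  have "(matching I, matching J) \<in> up (PM w) i \<longleftrightarrow>
      snake_edge w ` ?old \<subseteq> matching I \<and> matching J = matching I - snake_edge w ` ?old \<union> snake_edge w ` ?new"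
    unfolding up_PM[OF i] by blast
  also have "\<dots> \<longleftrightarrow> ?old \<subseteq> angle_set I \<and> angle_set J = angle_set I - ?old \<union> ?new"
    unfolding matching_def using side_angles[OF i] angle_set_subset *(2,3)
    by (intro inj_exchange_iff[OF inj_snake_edge]) auto
  also have "\<dots> \<longleftrightarrow> (angle_set I, angle_set J) \<in> angle_move i" by (auto simp: angle_move_def)
  finally show "(matching I, matching J) \<in> up (PM w) i \<longleftrightarrow> i \<notin> I \<and> J = insert i I"
    using angle_move_iff * by simp
qed

lemma prod_snake_edges:
  assumes "A \<subseteq> angles w"
  shows "(\<Prod>E\<in>snake_edge w ` A. X (edge_label w E)) = angle_weight A"
proof -
  have inj: "inj_on (snake_edge w) A" using inj_snake_edge assms by (rule inj_on_subset)
  have "(\<Prod>E\<in>snake_edge w ` A. X (edge_label w E)) = (\<Prod>\<alpha>\<in>A. X (edge_label w (snake_edge w \<alpha>)))"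
    using prod.reindex[OF inj] by simp
  also have "\<dots> = angle_weight A" unfolding angle_weight_def
    using assms edge_label_snake_edge by (intro prod.cong) auto
  finally show ?thesis .
qed

lemma PM_weight: "I \<in> ideals w \<Longrightarrow> weight (PM w) (matching I) = (\<Prod>k\<le>n. X (selected w I k))"
  using prod_snake_edges[OF angle_set_subset] angle_weight_angle_set by (simp add: PM_def matching_def)

subsection \<open>Lattice paths\<close>

definition grid_path :: "nat set \<Rightarrow> point list" where
  "grid_path I = map (\<lambda>k. corner w k (path_side I k)) [0..<Suc (Suc n)]"

lemma nth_grid_path: "k \<le> Suc n \<Longrightarrow> grid_path I ! k = corner w k (path_side I k)"
  unfolding grid_path_def by (subst nth_map_upt) simp_all

lemma length_grid_path: "length (grid_path I) = Suc (Suc n)"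
  by (simp add: grid_path_def)

lemma angles_dual: "angles (dual w) = angles w"
proof (rule pair_set_eqI)
  fix k e show "(k, e) \<in> angles (dual w) \<longleftrightarrow> (k, e) \<in> angles w"
    using tri_edges_dual[of k] by (auto simp: angles_iff nonempty_word.angles_iff[OF nonempty_dual])
qed

lemma path_edges_grid_path:
  assumes "I \<in> ideals (dual w)"
  shows "path_edges (grid_path I) = snake_edge w ` nonempty_word.angle_set (dual w) I"
proof -
  have join: "joinable w k (path_side I k) (path_side I (Suc k))" if "k \<le> n" for k
    using assms that by (simp add: ideals_dual)
  have "path_edges (grid_path I) = (\<lambda>k. {grid_path I ! k, grid_path I ! (k + 1)}) ` {..n}"
    by (auto simp: path_edges_def length_grid_path)
  also have "\<dots> = (\<lambda>k. snake_edge w (k, join w k (path_side I k) (path_side I (Suc k)))) ` {..n}"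
    using join by (intro image_cong) (auto simp: snake_edge_join nth_grid_path grid_edge_def)
  also have "\<dots> = snake_edge w ` nonempty_word.angle_set (dual w) I" unfolding angle_set_dual by auto
  finally show ?thesis .
qed

lemma grid_step:
  assumes "k \<le> n" "joinable w k s t"
  shows "let (x, y) = corner w k s in corner w (Suc k) t = (x + 1, y) \<or> corner w (Suc k) t = (x, y + 1)"
proof -
  obtain i d where tile: "grid_edge w k s t = tile_edge w i d" using grid_edge_tile[OF assms] by metis
  obtain x y where xy: "tile_pos w i = (x, y)" by fastforce
  obtain p q where pq: "grid_edge w k s t = {p, q}" "q = (fst p + 1, snd p) \<or> q = (fst p, snd p + 1)"
    using that[of "(x, y + 1)" "(x + 1, y + 1)"] that[of "(x + 1, y)" "(x + 1, y + 1)"]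
      that[of "(x, y)" "(x + 1, y)"] that[of "(x, y)" "(x, y + 1)"]
    unfolding tile tile_edge_def xy by (cases d) simp_all
  then have "level q = level p + 1" by (auto simp: level_def)
  moreover have "level (corner w k s) = int k" "level (corner w (Suc k) t) = int k + 1"
    using level_corner assms(1) by auto
  ultimately have "corner w k s = p \<and> corner w (Suc k) t = q"
    using pq(1) by (auto simp: grid_edge_def doubleton_eq_iff)
  then show ?thesis using pq(2) by (auto split: prod.splits)
qed

lemma lattice_path_grid_path:
  assumes I: "I \<in> ideals (dual w)" shows "lattice_path w (grid_path I)"
proof -
  have join: "joinable w k (path_side I k) (path_side I (Suc k))" if "k \<le> n" for k
    using I that by (simp add: ideals_dual)
  have ne: "grid_path I \<noteq> []" using length_grid_path[of I] by auto
  have "hd (grid_path I) = (0, 0)" using ne nth_grid_path[of 0 I] by (simp add: hd_conv_nth corner_ends)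
  moreover have "last (grid_path I) = (fst (tile_pos w n) + 1, snd (tile_pos w n) + 1)"
    using ne nth_grid_path[of "Suc n" I] by (simp add: last_conv_nth length_grid_path corner_ends)
  moreover have "{grid_path I ! k, grid_path I ! (k + 1)} \<in> snake_edges w \<and>
     (let (x, y) = grid_path I ! k in grid_path I ! (k + 1) = (x + 1, y) \<or> grid_path I ! (k + 1) = (x, y + 1))"
    if "k < n + 1" for k
  proof -
    have k: "k \<le> n" using that by simp
    have "grid_edge w k (path_side I k) (path_side I (Suc k)) \<in> snake_edges w"
      unfolding snake_edges_eq using join[OF k] k by blast
    then show ?thesis using grid_step[OF k join[OF k]] k by (simp add: nth_grid_path grid_edge_def)
  qed
  ultimately show ?thesis by (auto simp: lattice_path_def length_grid_path split: prod.splits)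
qed

lemma lattice_path_ideal:
  assumes L: "lattice_path w L"
  obtains I where "I \<in> ideals (dual w)" "L = grid_path I"
proof -
  have len: "length L = Suc (Suc n)" using L by (simp add: lattice_path_def)
  then have "L \<noteq> []" by auto
  then have start: "L ! 0 = (0, 0)" using L by (simp add: lattice_path_def hd_conv_nth)
  have step: "{L ! k, L ! Suc k} \<in> snake_edges w" "level (L ! Suc k) = level (L ! k) + 1" if "k \<le> n" for k
  proof -
    have "{L ! k, L ! (k + 1)} \<in> snake_edges w \<and>
       (let (x, y) = L ! k in L ! (k + 1) = (x + 1, y) \<or> L ! (k + 1) = (x, y + 1))"
      using L that by (simp add: lattice_path_def)
    then show "{L ! k, L ! Suc k} \<in> snake_edges w" "level (L ! Suc k) = level (L ! k) + 1"
      by (auto simp: level_def split: prod.splits)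
  qed
  have level: "k \<le> Suc n \<Longrightarrow> level (L ! k) = int k" for k
    by (induction k) (use start step in \<open>auto simp: level_def\<close>)
  have "\<exists>s t. joinable w k s t \<and> L ! k = corner w k s \<and> L ! Suc k = corner w (Suc k) t" if k: "k \<le> n" for k
  proof -
    obtain j s t where j: "j \<le> n" "joinable w j s t" "{L ! k, L ! Suc k} = grid_edge w j s t"
      using step(1)[OF k] unfolding snake_edges_eq by blast
    have l: "level (corner w j s) = int j" "level (corner w (Suc j) t) = int j + 1"
      "level (L ! k) = int k" "level (L ! Suc k) = int k + 1" using level_corner level j k by auto
    have "L ! k = corner w j s \<and> L ! Suc k = corner w (Suc j) t \<or> L ! k = corner w (Suc j) t \<and> L ! Suc k = corner w j s"
      using j(3) by (simp add: grid_edge_def doubleton_eq_iff)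
    then have "j = k \<and> L ! k = corner w j s \<and> L ! Suc k = corner w (Suc j) t" using l by force
    then show ?thesis using j by blast
  qed
  then obtain s t where st: "\<And>k. k \<le> n \<Longrightarrow> joinable w k (s k) (t k) \<and> L ! k = corner w k (s k) \<and> L ! Suc k = corner w (Suc k) (t k)"
    by metis
  have chain: "s k = t (k - 1)" if "0 < k" "k \<le> n" for k
    using st[of k] st[of "k - 1"] corner_cancel[of k "s k" "t (k - 1)"] that by simp
  obtain I where I: "I \<in> ideals (dual w)" "\<And>k. 0 < k \<Longrightarrow> k \<le> n \<Longrightarrow> path_side I k = s k"
  proof (rule chain_ideal_dual[of s t])
    show "joinable w k (s k) (t k)" if "k \<le> n" for k using st[OF that] by blast
    show "s k = t (k - 1)" if "0 < k" "k \<le> n" for k using chain[OF that] .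
  qed blast
  have "L ! k = grid_path I ! k" if k: "k < length L" for k
  proof -
    consider "k = 0" | "0 < k" "k \<le> n" | "k = Suc n" using k len by fastforce
    then show ?thesis
    proof cases
      case 1 then show ?thesis using start by (simp add: nth_grid_path corner_ends)
    next
      case 2 then show ?thesis using st[of k] I(2) by (simp add: nth_grid_path)
    next
      case 3 then show ?thesis using st[of n] by (simp add: nth_grid_path corner_ends)
    qed
  qed
  then have "L = grid_path I" using len length_grid_path by (intro nth_equalityI) auto
  then show ?thesis using that I(1) by blast
qed

lemma side_labels_dual:
  assumes "0 < i" "i \<le> n"
  shows "snake_edge w (i - 1, side_before (dual w) i Rgt) = tile_edge w i South"
    "snake_edge w (i, side_after (dual w) i Lft) = tile_edge w i East"
    "snake_edge w (i - 1, side_before (dual w) i Lft) = tile_edge w i West"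
    "snake_edge w (i, side_after (dual w) i Rgt) = tile_edge w i North"
  unfolding side_before_dual[OF assms] side_after_dual[OF assms] snake_edge_before[OF assms] snake_edge_after[OF assms]
  by (simp_all add: nw_side_def)

theorem LP_modelled: "modelled (dual w) (LP w) grid_path"
  unfolding modelled_def
proof (intro conjI ballI)
  interpret D: nonempty_word "dual w" by (rule nonempty_dual)
  have sub: "D.angle_set I \<subseteq> angles w" if "I \<in> ideals (dual w)" for I
    using D.angle_set_subset[OF that] angles_dual by simp
  have "inj_on grid_path (ideals (dual w))"
  proof (rule inj_onI)
    fix I J assume *: "I \<in> ideals (dual w)" "J \<in> ideals (dual w)" "grid_path I = grid_path J"
    then have "snake_edge w ` D.angle_set I = snake_edge w ` D.angle_set J" by (metis path_edges_grid_path)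
    then have "D.angle_set I = D.angle_set J"
      by (rule iffD1[OF inj_on_image_eq_iff[OF inj_snake_edge sub[OF *(1)] sub[OF *(2)]]])
    then show "I = J" using D.inj_angle_set * by (auto dest: inj_onD)
  qed
  moreover have "nodes (LP w) = grid_path ` ideals (dual w)"
    using lattice_path_grid_path lattice_path_ideal by (auto simp: LP_def) (metis image_eqI)
  ultimately show "bij_betw grid_path (ideals (dual w)) (nodes (LP w))" by (simp add: bij_betw_def)
  fix i I J assume *: "i \<in> {1..rank (dual w)}" "I \<in> ideals (dual w)" "J \<in> ideals (dual w)"
  then have i: "0 < i" "i \<le> n" by auto
  let ?old = "{(i - 1, side_before (dual w) i Rgt), (i, side_after (dual w) i Lft)}"
  let ?new = "{(i - 1, side_before (dual w) i Lft), (i, side_after (dual w) i Rgt)}"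
  have "(grid_path I, grid_path J) \<in> up (LP w) i \<longleftrightarrow>
      snake_edge w ` ?old \<subseteq> snake_edge w ` D.angle_set I \<and>
      snake_edge w ` D.angle_set J = snake_edge w ` D.angle_set I - snake_edge w ` ?old \<union> snake_edge w ` ?new"
    unfolding LP_def LP_move_def Let_def image_insert image_empty side_labels_dual[OF i]
    by (simp add: path_edges_grid_path * insert_commute)
  also have "\<dots> \<longleftrightarrow> ?old \<subseteq> D.angle_set I \<and> D.angle_set J = D.angle_set I - ?old \<union> ?new"
    using D.side_angles[of i] i sub *(2,3) angles_dual
    by (intro inj_exchange_iff[OF inj_snake_edge]) auto
  also have "\<dots> \<longleftrightarrow> (D.angle_set I, D.angle_set J) \<in> D.angle_move i" by (auto simp: D.angle_move_def)
  finally show "(grid_path I, grid_path J) \<in> up (LP w) i \<longleftrightarrow> i \<notin> I \<and> J = insert i I"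
    using D.angle_move_iff * by simp
qed

lemma LP_weight: "I \<in> ideals (dual w) \<Longrightarrow> weight (LP w) (grid_path I) = (\<Prod>k\<le>n. X (selected (dual w) I k))"
  using prod_snake_edges[of "nonempty_word.angle_set (dual w) I"] nonempty_word.angle_set_subset[OF nonempty_dual, of I]
    nonempty_word.angle_weight_angle_set[OF nonempty_dual, of I] angles_dual
  by (simp add: LP_def path_edges_grid_path)

end

section \<open>The triangle map on diagrams\<close>

definition triangle_vertices :: "word \<Rightarrow> nat \<Rightarrow> vertex set" where
  "triangle_vertices w k = (\<lambda>e. vertex_at w (k, e)) ` tri_edges w k"

text \<open>The properties of the diagrams obtained from the arc by cuts: every curve begins and ends at a vertex of
  its first and last triangle, and the diagonals between them are the ones not yet resolved.  Only for such diagrams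
  is the triangle map an involution.\<close>

definition valid_curve :: "word \<Rightarrow> nat set \<Rightarrow> curve \<Rightarrow> bool" where
  "valid_curve w U c \<longleftrightarrow> (case c of (p, j, k, q) \<Rightarrow> j \<le> k \<and> k \<le> rank w \<and> {j<..k} \<subseteq> U \<and>
     p \<in> triangle_vertices w j \<and> q \<in> triangle_vertices w k)"

definition valid_diagram :: "word \<Rightarrow> diagram \<Rightarrow> bool" where
  "valid_diagram w D \<longleftrightarrow> fst D \<subseteq> {1..rank w} \<and> (\<forall>c\<in>snd D. valid_curve w (fst D) c)"

definition crosses :: "nat \<Rightarrow> curve \<Rightarrow> bool" where
  "crosses i c \<longleftrightarrow> (case c of (p, j, k, q) \<Rightarrow> j < i \<and> i \<le> k)"

definition part_before :: "nat \<Rightarrow> vertex \<Rightarrow> curve \<Rightarrow> curve" where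
  "part_before i v c = (case c of (p, j, k, q) \<Rightarrow> (p, j, i - 1, v))"

definition part_after :: "nat \<Rightarrow> vertex \<Rightarrow> curve \<Rightarrow> curve" where
  "part_after i v c = (case c of (p, j, k, q) \<Rightarrow> (v, i, k, q))"

lemma cut_eq: "cut i v v' D = (fst D - {i}, {c \<in> snd D. \<not> crosses i c} \<union>
    part_before i v ` {c \<in> snd D. crosses i c} \<union> part_after i v' ` {c \<in> snd D. crosses i c})"
  unfolding cut_def prod.inject
proof (intro conjI refl arg_cong2[where f = "(\<union>)"])
  show "{(p, j, k, q) | p j k q. (p, j, k, q) \<in> snd D \<and> \<not> (j < i \<and> i \<le> k)} = {c \<in> snd D. \<not> crosses i c}"
    by (auto simp: crosses_def)
  show "{(p, j, i - 1, v) | p j k q. (p, j, k, q) \<in> snd D \<and> j < i \<and> i \<le> k} = part_before i v ` {c \<in> snd D. crosses i c}"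
    by (force simp: crosses_def part_before_def image_iff)
  show "{(v', i, k, q) | p j k q. (p, j, k, q) \<in> snd D \<and> j < i \<and> i \<le> k} = part_after i v' ` {c \<in> snd D. crosses i c}"
    by (force simp: crosses_def part_after_def image_iff)
qed

lemma crosses_tri_curve: "crosses i (tri_curve w c) \<longleftrightarrow> crosses i c"
  by (simp add: crosses_def tri_curve_def split: prod.splits)

lemma tri_diagram_cut:
  "tri_diagram w (cut i v v' D) = cut i (tri_vertex w (i - 1) v) (tri_vertex w i v') (tri_diagram w D)"
proof -
  let ?f = "tri_curve w"
  have filter: "{c \<in> ?f ` snd D. Q c} = ?f ` {c \<in> snd D. Q (?f c)}" for Q by blast
  have "?f (part_before i v c) = part_before i (tri_vertex w (i - 1) v) (?f c)"
    "?f (part_after i v' c) = part_after i (tri_vertex w i v') (?f c)" for c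
    by (simp_all add: part_before_def part_after_def tri_curve_def split: prod.splits)
  then show ?thesis
    unfolding cut_eq tri_diagram_def fst_conv snd_conv filter crosses_tri_curve image_Un image_image by simp
qed

lemma valid_cut:
  assumes "valid_diagram w D" "i \<in> fst D" "v \<in> triangle_vertices w (i - 1)" "v' \<in> triangle_vertices w i"
  shows "valid_diagram w (cut i v v' D)"
  unfolding valid_diagram_def
proof (intro conjI ballI)
  have i: "i \<in> {1..rank w}" using assms(1,2) by (auto simp: valid_diagram_def)
  show "fst (cut i v v' D) \<subseteq> {1..rank w}" using assms(1) by (auto simp: valid_diagram_def cut_eq)
  fix c assume "c \<in> snd (cut i v v' D)"
  then consider "c \<in> snd D" "\<not> crosses i c"
    | c' where "c' \<in> snd D" "crosses i c'" "c = part_before i v c'"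
    | c' where "c' \<in> snd D" "crosses i c'" "c = part_after i v' c'" unfolding cut_eq by auto
  then show "valid_curve w (fst (cut i v v' D)) c"
  proof cases
    case 1
    then have "valid_curve w (fst D) c" using assms(1) by (auto simp: valid_diagram_def)
    then show ?thesis using 1(2) by (auto simp: valid_curve_def crosses_def cut_eq split: prod.splits)
  next
    case 2
    then have valid: "valid_curve w (fst D) c'" using assms(1) by (auto simp: valid_diagram_def)
    obtain p j k q where c': "c' = (p, j, k, q)" by (cases c')
    have "{j<..i - 1} \<subseteq> {j<..k} - {i}" using 2(2) i unfolding c' by (auto simp: crosses_def)
    then show ?thesis using valid 2(2) assms(3) i unfolding 2(3) c'
      by (simp add: valid_curve_def crosses_def cut_eq part_before_def, elim conjE, intro conjI) (arith | blast)+
  next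
    case 3
    then have "valid_curve w (fst D) c'" using assms(1) by (auto simp: valid_diagram_def)
    then show ?thesis using 3(2) assms(4) i unfolding 3(3)
      by (cases c') (auto simp: valid_curve_def crosses_def cut_eq part_after_def)
  qed
qed

text \<open>A slide at \<open>\<delta>\<^sub>i\<close> becomes a resolution because the triangle map reflects exactly one of the two triangles
  at \<open>\<delta>\<^sub>i\<close>.  If \<open>i\<close> is odd, the triangle before the diagonal is preserved, and otherwise the one after it.\<close>

definition dual_choice :: "nat \<Rightarrow> side \<Rightarrow> side" where
  "dual_choice i s = (if odd i then s else opposite s)"

lemma dual_choice_simps: "dual_choice i (dual_choice i s) = s" "dual_choice i (opposite s) = opposite (dual_choice i s)"
  "dual_choice i Lft \<noteq> dual_choice i Rgt"
  by (simp_all add: dual_choice_def)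

context nonempty_word
begin

lemma tri_vertex_at:
  "k \<le> n \<Longrightarrow> e \<in> tri_edges w k \<Longrightarrow> tri_vertex w k (vertex_at w (k, e)) = vertex_at (dual w) (k, e)"
  by (simp add: tri_vertex_def angle_at_eq tri_angle_def)

lemma tri_vertex_involution:
  assumes "k \<le> n" "p \<in> triangle_vertices w k" shows "tri_vertex (dual w) k (tri_vertex w k p) = p"
proof -
  obtain e where "e \<in> tri_edges w k" "p = vertex_at w (k, e)" using assms(2) by (auto simp: triangle_vertices_def)
  then show ?thesis
    using assms(1) nonempty_word.tri_vertex_at[OF nonempty_dual, of k e] by (simp add: tri_vertex_at tri_edges_dual)
qed

lemma tri_vertex_inject: "k \<le> n \<Longrightarrow> p \<in> triangle_vertices w k \<Longrightarrow> q \<in> triangle_vertices w k \<Longrightarrow>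
    tri_vertex w k p = tri_vertex w k q \<longleftrightarrow> p = q"
  by (metis tri_vertex_involution)

lemma tri_curve_involution: "valid_curve w U c \<Longrightarrow> tri_curve (dual w) (tri_curve w c) = c"
  by (auto simp: valid_curve_def tri_curve_def tri_vertex_involution split: prod.splits)

lemma tri_diagram_involution: "valid_diagram w D \<Longrightarrow> tri_diagram (dual w) (tri_diagram w D) = D"
proof -
  assume D: "valid_diagram w D"
  have "(\<lambda>c. tri_curve (dual w) (tri_curve w c)) ` snd D = (\<lambda>c. c) ` snd D"
    using D tri_curve_involution by (intro image_cong) (auto simp: valid_diagram_def)
  then show ?thesis by (simp add: tri_diagram_def image_image)
qed

lemma inj_tri_curve: "valid_diagram w D \<Longrightarrow> inj_on (tri_curve w) (snd D)"
  by (rule inj_on_inverseI[of _ "tri_curve (dual w)"]) (auto simp: valid_diagram_def tri_curve_involution)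

lemma gamma_valid: "valid_diagram w (gamma_diagram w)"
  using rank_ge_2
  by (auto simp: valid_diagram_def gamma_diagram_def valid_curve_def triangle_vertices_def vertex_a_def vertex_b_def
      tri_edges_0 tri_edges_last)

lemma tri_gamma: "tri_diagram w (gamma_diagram w) = gamma_diagram (dual w)"
  using tri_vertex_at[of 0 1] tri_vertex_at[of n n]
  by (simp add: tri_diagram_def gamma_diagram_def tri_curve_def vertex_a_def vertex_b_def tri_edges_0 tri_edges_last)

lemma diag_end_in:
  assumes "0 < i" "i \<le> n"
  shows "diag_end w i s \<in> triangle_vertices w (i - 1)" "diag_end w i s \<in> triangle_vertices w i"
  unfolding triangle_vertices_def
  using diag_end_before[OF assms, of s] side_before_in[OF assms] diag_end_after[OF assms, of s] side_after_in[OF assms]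
  by auto

lemma tri_vertex_diag_end:
  assumes i: "0 < i" "i \<le> n"
  shows "tri_vertex w (i - 1) (diag_end w i s) = diag_end (dual w) i (dual_choice i s)"
    "tri_vertex w i (diag_end w i s) = diag_end (dual w) i (opposite (dual_choice i s))"
proof -
  interpret D: nonempty_word "dual w" by (rule nonempty_dual)
  have i': "0 < i" "i \<le> rank (dual w)" using i by auto
  have "tri_vertex w (i - 1) (diag_end w i s) = vertex_at (dual w) (i - 1, side_before w i (opposite s))"
    unfolding diag_end_before[OF i] using side_before_in[OF i] i by (intro tri_vertex_at) auto
  then show "tri_vertex w (i - 1) (diag_end w i s) = diag_end (dual w) i (dual_choice i s)"
    unfolding D.diag_end_before[OF i'] side_before_dual[OF i] by (simp add: dual_choice_def)
  have "tri_vertex w i (diag_end w i s) = vertex_at (dual w) (i, side_after w i (opposite s))"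
    unfolding diag_end_after[OF i] using side_after_in[OF i] i by (intro tri_vertex_at) auto
  then show "tri_vertex w i (diag_end w i s) = diag_end (dual w) i (opposite (dual_choice i s))"
    unfolding D.diag_end_after[OF i'] side_after_dual[OF i] by (simp add: dual_choice_def)
qed

lemma unresolved_index: "valid_diagram w D \<Longrightarrow> i \<in> fst D \<Longrightarrow> 0 < i \<and> i \<le> n"
  by (force simp: valid_diagram_def)

lemma slide_step:
  assumes "valid_diagram w D" "i \<in> fst D"
  shows "valid_diagram w (slide w i s D)" "fst (slide w i s D) = fst D - {i}"
    "tri_diagram w (slide w i s D) = resolve (dual w) i (dual_choice i s) (tri_diagram w D)"
proof -
  have i: "0 < i" "i \<le> n" using unresolved_index[OF assms] by auto
  show "valid_diagram w (slide w i s D)" unfolding slide_def using assms diag_end_in[OF i] by (intro valid_cut)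
  show "fst (slide w i s D) = fst D - {i}" by (simp add: slide_def cut_eq)
  show "tri_diagram w (slide w i s D) = resolve (dual w) i (dual_choice i s) (tri_diagram w D)"
    unfolding slide_def resolve_def tri_diagram_cut tri_vertex_diag_end[OF i] ..
qed

lemma resolve_step:
  assumes "valid_diagram w D" "i \<in> fst D"
  shows "valid_diagram w (resolve w i s D)" "fst (resolve w i s D) = fst D - {i}"
    "tri_diagram w (resolve w i s D) = slide (dual w) i (dual_choice i s) (tri_diagram w D)"
proof -
  have i: "0 < i" "i \<le> n" using unresolved_index[OF assms] by auto
  show "valid_diagram w (resolve w i s D)" unfolding resolve_def using assms diag_end_in[OF i] by (intro valid_cut)
  show "fst (resolve w i s D) = fst D - {i}" by (simp add: resolve_def cut_eq)
  show "tri_diagram w (resolve w i s D) = slide (dual w) i (dual_choice i s) (tri_diagram w D)"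
    unfolding slide_def resolve_def tri_diagram_cut tri_vertex_diag_end[OF i] dual_choice_simps opposite_opposite ..
qed

lemma tri_curve_closed_iff:
  "valid_curve w U (p, k, k, q) \<Longrightarrow> tri_vertex w k p = tri_vertex w k q \<longleftrightarrow> p = q"
  by (auto simp: valid_curve_def tri_vertex_inject)

lemma halted_tri_diagram:
  assumes "valid_diagram w D" shows "halted h (tri_diagram w D) \<longleftrightarrow> halted h D"
proof -
  have "(\<exists>p i. (p, i, i, p) \<in> tri_curve w ` snd D) \<longleftrightarrow> (\<exists>p i. (p, i, i, p) \<in> snd D)"
  proof
    assume "\<exists>p i. (p, i, i, p) \<in> tri_curve w ` snd D"
    then obtain p i where "(p, i, i, p) \<in> tri_curve w ` snd D" by blast
    then obtain c where c: "(p, i, i, p) = tri_curve w c" "c \<in> snd D" by (rule imageE)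
    from c(1) obtain p' q' where c': "c = (p', i, i, q')" "tri_vertex w i p' = tri_vertex w i q'"
      by (cases c) (auto simp: tri_curve_def)
    then have "valid_curve w (fst D) (p', i, i, q')" using c(2) assms by (auto simp: valid_diagram_def)
    then have "p' = q'" using tri_curve_closed_iff c'(2) by blast
    then show "\<exists>p i. (p, i, i, p) \<in> snd D" using c(2) c'(1) by blast
  next
    assume "\<exists>p i. (p, i, i, p) \<in> snd D"
    then obtain p i where "(p, i, i, p) \<in> snd D" by blast
    then have "tri_curve w (p, i, i, p) \<in> tri_curve w ` snd D" by (rule imageI)
    then have "(tri_vertex w i p, i, i, tri_vertex w i p) \<in> tri_curve w ` snd D"
      by (simp add: tri_curve_def[of w "(p, i, i, p)"])
    then show "\<exists>p i. (p, i, i, p) \<in> tri_curve w ` snd D" by blast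
  qed
  then show ?thesis by (simp add: halted_def tri_diagram_def)
qed

lemma ends_triangle: "k \<le> n \<Longrightarrow> e \<in> tri_edges w k \<Longrightarrow> ends w e = (\<lambda>f. vertex_at w (k, f)) ` (tri_edges w k - {e})"
  by (auto simp: ends_eq edge_pos_def vertex_at_eq_vert image_image)

lemma third_edge:
  assumes "k \<le> n" "e \<in> tri_edges w k" "f \<in> tri_edges w k" "e \<noteq> f"
  obtains g where "g \<in> tri_edges w k" "tri_edges w k - {g} = {e, f}"
proof -
  obtain x y z where t: "tri w k = (x, y, z)" by (cases "tri w k")
  then have "tri_edges w k = {x, y, z}" "x \<noteq> y" "y \<noteq> z" "z \<noteq> x" using tri_distinct[OF assms(1) t]
    by (auto simp: tri_edges_def)
  then have "\<exists>g\<in>tri_edges w k. tri_edges w k - {g} = {e, f}" using assms(2-4) by auto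
  then show ?thesis using that by blast
qed

text \<open>A curve inside one triangle is the edge opposite to the remaining angle, and this angle is preserved.\<close>

lemma tri_curve_edge:
  assumes "k \<le> n" "p \<in> triangle_vertices w k" "q \<in> triangle_vertices w k" "p \<noteq> q"
  obtains e where "e \<in> labels" "ends w e = {p, q}" "ends (dual w) e = {tri_vertex w k p, tri_vertex w k q}"
proof -
  interpret D: nonempty_word "dual w" by (rule nonempty_dual)
  obtain e f where ef: "e \<in> tri_edges w k" "f \<in> tri_edges w k" "p = vertex_at w (k, e)" "q = vertex_at w (k, f)"
    using assms(2,3) by (auto simp: triangle_vertices_def)
  then have "e \<noteq> f" using assms(4) by auto
  then obtain g where g: "g \<in> tri_edges w k" "tri_edges w k - {g} = {e, f}" using third_edge[OF assms(1) ef(1,2)] by blast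
  show ?thesis
  proof (rule that)
    show "g \<in> labels" using tri_edges_range[OF assms(1) g(1)] .
    show "ends w g = {p, q}" using ends_triangle[OF assms(1) g(1)] g(2) ef(3,4) by simp
    show "ends (dual w) g = {tri_vertex w k p, tri_vertex w k q}"
      using D.ends_triangle[of k g] assms(1) g ef by (simp add: tri_edges_dual tri_vertex_at)
  qed
qed

lemma curve_weight_ends: "e \<in> labels \<Longrightarrow> ends w e = {p, q} \<Longrightarrow> p \<noteq> q \<Longrightarrow> curve_weight w (p, j, k, q) = X e"
proof -
  assume *: "e \<in> labels" "ends w e = {p, q}" "p \<noteq> q"
  then have "(THE f. f \<in> labels \<and> ends w f = {p, q}) = e" using ends_inject by (intro the_equality) auto
  then show ?thesis using *(3) by (simp add: curve_weight_def)
qed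

lemma resolved_curve_weight:
  assumes "valid_curve w {} c"
  shows "curve_weight (dual w) (tri_curve w c) = curve_weight w c"
proof -
  obtain p k q where c: "c = (p, k, k, q)" "k \<le> n" "p \<in> triangle_vertices w k" "q \<in> triangle_vertices w k"
    using assms by (cases c) (auto simp: valid_curve_def)
  show ?thesis
  proof (cases "p = q")
    case True then show ?thesis using c by (simp add: curve_weight_def tri_curve_def)
  next
    case False
    then have ne: "tri_vertex w k p \<noteq> tri_vertex w k q" using tri_vertex_inject c by simp
    obtain e where e: "e \<in> labels" "ends w e = {p, q}" "ends (dual w) e = {tri_vertex w k p, tri_vertex w k q}"
      using tri_curve_edge[OF c(2-4) False] by blast
    show ?thesis
      using curve_weight_ends[OF e(1,2) False] nonempty_word.curve_weight_ends[OF nonempty_dual _ e(3) ne] e(1) c(1)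
      by (simp add: tri_curve_def)
  qed
qed

lemma res_weight_tri_diagram:
  assumes "valid_diagram w r" "fst r = {}" shows "res_weight (dual w) (tri_diagram w r) = res_weight w r"
proof -
  have "(\<Prod>c\<in>snd r. curve_weight (dual w) (tri_curve w c)) = (\<Prod>c\<in>snd r. curve_weight w c)"
    using assms resolved_curve_weight by (intro prod.cong) (auto simp: valid_diagram_def)
  then show ?thesis using inj_tri_curve[OF assms(1)] by (simp add: res_weight_def tri_diagram_def prod.reindex)
qed

lemma node_weight_tri_diagram:
  assumes D: "valid_diagram w D" "halted h D" shows "node_weight (dual w) (tri_diagram w D) = node_weight w D"
proof (cases "\<exists>p i. (p, i, i, p) \<in> snd D")
  case True
  then have loop: "\<exists>p j k. (p, j, k, p) \<in> snd D" by blast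
  obtain p i where "(p, i, i, p) \<in> snd D" using True by blast
  then have "tri_curve w (p, i, i, p) \<in> snd (tri_diagram w D)" by (simp add: tri_diagram_def)
  then have "\<exists>p j k. (p, j, k, p) \<in> snd (tri_diagram w D)" by (auto simp: tri_curve_def)
  with loop show ?thesis by (simp add: node_weight_def)
next
  case False
  then have U: "fst D = {}" using D(2) by (auto simp: halted_def)
  have curve: "\<exists>p k q. c = (p, k, k, q) \<and> k \<le> n \<and> p \<in> triangle_vertices w k \<and> q \<in> triangle_vertices w k \<and> p \<noteq> q"
    if "c \<in> snd D" for c
  proof -
    have "valid_curve w {} c" using that D(1) U by (auto simp: valid_diagram_def)
    then show ?thesis using that False by (cases c) (auto simp: valid_curve_def)
  qed
  let ?g = "\<lambda>v (p, j, k, q). arc_variable v {p, q}"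
  have "\<not> (\<exists>p j k. (p, j, k, p) \<in> snd D)" using curve by blast
  moreover have "\<not> (\<exists>p j k. (p, j, k, p) \<in> snd (tri_diagram w D))"
  proof
    assume "\<exists>p j k. (p, j, k, p) \<in> snd (tri_diagram w D)"
    then obtain x j k where "(x, j, k, x) \<in> tri_curve w ` snd D" by (auto simp: tri_diagram_def)
    then obtain c where c: "(x, j, k, x) = tri_curve w c" "c \<in> snd D" by (rule imageE)
    then show False using curve[OF c(2)] tri_vertex_inject by (auto simp: tri_curve_def)
  qed
  moreover have "(\<Prod>c\<in>snd (tri_diagram w D). ?g (dual w) c) = (\<Prod>c\<in>snd D. ?g w c)"
  proof -
    have "?g (dual w) (tri_curve w c) = ?g w c" if cD: "c \<in> snd D" for c
    proof -
      obtain p k q where c: "c = (p, k, k, q)" "k \<le> n" "p \<in> triangle_vertices w k" "q \<in> triangle_vertices w k" "p \<noteq> q"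
        using curve[OF cD] by blast
      obtain e where e: "e \<in> labels" "ends w e = {p, q}" "ends (dual w) e = {tri_vertex w k p, tri_vertex w k q}"
        using tri_curve_edge[OF c(2-5)] by blast
      show ?thesis
        using arc_variable_ends[OF e(1)] nonempty_word.arc_variable_ends[OF nonempty_dual, of e] e c(1)
        by (simp add: tri_curve_def)
    qed
    then have "(\<Prod>c\<in>snd D. ?g (dual w) (tri_curve w c)) = (\<Prod>c\<in>snd D. ?g w c)" by (intro prod.cong refl)
    then show ?thesis using inj_tri_curve[OF D(1)] by (simp add: tri_diagram_def prod.reindex)
  qed
  ultimately show ?thesis using U by (simp add: node_weight_def tri_diagram_def)
qed

end

subsection \<open>Trees of diagrams\<close>

lemma leaves_subset: "leaves t \<subseteq> set_dtree t"
proof (induction t)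
  case (DNode D ts)
  then show ?case by (auto simp: fimage.rep_eq)
qed

text \<open>The map may exchange the two resolutions of a crossing since the children of a node are not
  ordered.\<close>

lemma map_dtree_diagram_trees:
  assumes "t \<in> diagram_trees h F" "P (tree_root t)"
    and step: "\<And>D i s. P D \<Longrightarrow> i \<in> fst D \<Longrightarrow> P (F i s D) \<and> g (F i s D) = G i (\<sigma> i s) (g D)"
    and choices: "\<And>i. \<sigma> i Lft \<noteq> \<sigma> i Rgt"
    and compat: "\<And>D. P D \<Longrightarrow> fst (g D) = fst D \<and> halted h (g D) = halted h D"
  shows "map_dtree g t \<in> diagram_trees h G \<and> set_dtree t \<subseteq> {D. P D} \<and> (\<forall>D\<in>leaves t. halted h D)"
  using assms(1,2)
proof (induction rule: diagram_trees.induct)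
  case (leaf D)
  then show ?case using compat[of D] by (auto intro: diagram_trees.leaf)
next
  case (node D i t t')
  have D: "P D" using node.prems by simp
  have t: "P (tree_root t)" "P (tree_root t')" using step[OF D node.hyps(2)] node.hyps by auto
  note IH = node.IH(1)[OF t(1)] node.IH(2)[OF t(2)]
  have root: "tree_root (map_dtree g t) = G i (\<sigma> i Lft) (g D)" "tree_root (map_dtree g t') = G i (\<sigma> i Rgt) (g D)"
    using step[OF D node.hyps(2)] node.hyps by (simp_all add: dtree.map_sel)
  have gD: "\<not> halted h (g D)" "i \<in> fst (g D)" using compat[OF D] node.hyps by auto
  have "DNode (g D) {|map_dtree g t, map_dtree g t'|} \<in> diagram_trees h G"
  proof (cases "\<sigma> i Lft")
    case Lft
    then have "\<sigma> i Rgt = Rgt" using choices[of i] by (cases "\<sigma> i Rgt") auto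
    then show ?thesis using root Lft IH gD by (intro diagram_trees.node[of h "g D" i]) auto
  next
    case Rgt
    then have "\<sigma> i Rgt = Lft" using choices[of i] by (cases "\<sigma> i Rgt") auto
    then have "DNode (g D) {|map_dtree g t', map_dtree g t|} \<in> diagram_trees h G"
      using root Rgt IH gD by (intro diagram_trees.node[of h "g D" i]) auto
    then show ?thesis by (simp add: finsert_commute)
  qed
  then show ?case using IH D by auto
qed

lemma map_dtree_inverse:
  assumes "\<And>D. D \<in> set_dtree t \<Longrightarrow> g' (g D) = D" shows "map_dtree g' (map_dtree g t) = t"
proof -
  have "map_dtree g' (map_dtree g t) = map_dtree id t"
    unfolding dtree.map_comp using assms by (intro dtree.map_cong refl) auto
  then show ?thesis by (simp add: dtree.map_id)
qed

context nonempty_word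
begin

lemma tree_map:
  assumes "t \<in> Tree_dual h w"
  shows "map_dtree (tri_diagram w) t \<in> Tree h (dual w)" "set_dtree t \<subseteq> {D. valid_diagram w D}" "\<forall>D\<in>leaves t. halted h D"
proof -
  have t: "t \<in> diagram_trees h (slide w)" "tree_root t = gamma_diagram w" using assms by (auto simp: Tree_dual_def)
  have "map_dtree (tri_diagram w) t \<in> diagram_trees h (resolve (dual w)) \<and> set_dtree t \<subseteq> {D. valid_diagram w D} \<and>
      (\<forall>D\<in>leaves t. halted h D)"
    by (rule map_dtree_diagram_trees[OF t(1), where \<sigma> = dual_choice])
      (simp_all add: t(2) gamma_valid slide_step dual_choice_simps halted_tri_diagram, simp add: tri_diagram_def)
  then show "map_dtree (tri_diagram w) t \<in> Tree h (dual w)" "set_dtree t \<subseteq> {D. valid_diagram w D}" "\<forall>D\<in>leaves t. halted h D"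
    using t(2) by (auto simp: Tree_def dtree.map_sel tri_gamma)
qed

lemma tree_map_dual:
  assumes "t \<in> Tree h w"
  shows "map_dtree (tri_diagram w) t \<in> Tree_dual h (dual w)" "set_dtree t \<subseteq> {D. valid_diagram w D}"
proof -
  have t: "t \<in> diagram_trees h (resolve w)" "tree_root t = gamma_diagram w" using assms by (auto simp: Tree_def)
  have "map_dtree (tri_diagram w) t \<in> diagram_trees h (slide (dual w)) \<and> set_dtree t \<subseteq> {D. valid_diagram w D} \<and>
      (\<forall>D\<in>leaves t. halted h D)"
    by (rule map_dtree_diagram_trees[OF t(1), where \<sigma> = dual_choice])
      (simp_all add: t(2) gamma_valid resolve_step dual_choice_simps halted_tri_diagram, simp add: tri_diagram_def)
  then show "map_dtree (tri_diagram w) t \<in> Tree_dual h (dual w)" "set_dtree t \<subseteq> {D. valid_diagram w D}"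
    using t(2) by (auto simp: Tree_dual_def dtree.map_sel tri_gamma)
qed

theorem Tree_dual_bij: "bij_betw (map_dtree (tri_diagram w)) (Tree_dual h w) (Tree h (dual w))"
proof (rule bij_betw_byWitness[where f' = "map_dtree (tri_diagram (dual w))"])
  interpret D: nonempty_word "dual w" by (rule nonempty_dual)
  show "\<forall>t\<in>Tree_dual h w. map_dtree (tri_diagram (dual w)) (map_dtree (tri_diagram w) t) = t"
    using tree_map(2) tri_diagram_involution by (intro ballI map_dtree_inverse) blast
  show "\<forall>t\<in>Tree h (dual w). map_dtree (tri_diagram w) (map_dtree (tri_diagram (dual w)) t) = t"
    using D.tree_map_dual(2) D.tri_diagram_involution unfolding dual_dual by (intro ballI map_dtree_inverse) blast
  show "map_dtree (tri_diagram w) ` Tree_dual h w \<subseteq> Tree h (dual w)" using tree_map(1) by blast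
  show "map_dtree (tri_diagram (dual w)) ` Tree h (dual w) \<subseteq> Tree_dual h w"
    using D.tree_map_dual(1) unfolding dual_dual by blast
qed

lemma Tree_dual_leaf_weight:
  "t \<in> Tree_dual h w \<Longrightarrow> D \<in> leaves t \<Longrightarrow> node_weight (dual w) (tri_diagram w D) = node_weight w D"
  using tree_map[of t h] leaves_subset[of t] node_weight_tri_diagram[of D h] by blast

subsection \<open>Complete resolutions\<close>

lemma fold_slide:
  assumes "valid_diagram w D" "distinct is" "set is \<subseteq> fst D"
  shows "valid_diagram w (fold (\<lambda>i. slide w i (c i)) is D) \<and> fst (fold (\<lambda>i. slide w i (c i)) is D) = fst D - set is \<and>
    tri_diagram w (fold (\<lambda>i. slide w i (c i)) is D) =
      fold (\<lambda>i. resolve (dual w) i (dual_choice i (c i))) is (tri_diagram w D)"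
  using assms
proof (induction "is" arbitrary: D)
  case (Cons i "is")
  then have i: "i \<in> fst D" by simp
  note step = slide_step[OF Cons.prems(1) i, of "c i"]
  have "set is \<subseteq> fst (slide w i (c i) D)" using step(2) Cons.prems by auto
  then show ?case using Cons.IH[OF step(1)] Cons.prems(2) step(2,3) by auto
qed simp

lemma fold_resolve:
  assumes "valid_diagram w D" "distinct is" "set is \<subseteq> fst D"
  shows "valid_diagram w (fold (\<lambda>i. resolve w i (c i)) is D) \<and>
    tri_diagram w (fold (\<lambda>i. resolve w i (c i)) is D) =
      fold (\<lambda>i. slide (dual w) i (dual_choice i (c i))) is (tri_diagram w D)"
  using assms
proof (induction "is" arbitrary: D)
  case (Cons i "is")
  then have i: "i \<in> fst D" by simp
  note step = resolve_step[OF Cons.prems(1) i, of "c i"]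
  have "set is \<subseteq> fst (resolve w i (c i) D)" using step(2) Cons.prems by auto
  then show ?case using Cons.IH[OF step(1)] Cons.prems(2) step(3) by auto
qed simp

lemma Res_dual_map:
  assumes "r \<in> Res_dual w"
  shows "valid_diagram w r" "fst r = {}" "tri_diagram w r \<in> Res (dual w)"
proof -
  obtain c where r: "r = fold (\<lambda>i. slide w i (c i)) [1..<n + 1] (gamma_diagram w)"
    using assms by (auto simp: Res_dual_def)
  have g: "fst (gamma_diagram w) = {1..n}" by (simp add: gamma_diagram_def)
  have s: "set [1..<n + 1] = {1..n}" by auto
  note f = fold_slide[OF gamma_valid, of "[1..<n + 1]" c, unfolded g s tri_gamma, folded r]
  then show "valid_diagram w r" "fst r = {}" by auto
  have "tri_diagram w r = fold (\<lambda>i. resolve (dual w) i (dual_choice i (c i))) [1..<n + 1] (gamma_diagram (dual w))"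
    using f by auto
  then show "tri_diagram w r \<in> Res (dual w)" unfolding Res_def by auto
qed

lemma Res_map:
  assumes "r \<in> Res w"
  shows "valid_diagram w r" "tri_diagram w r \<in> Res_dual (dual w)"
proof -
  obtain c where r: "r = fold (\<lambda>i. resolve w i (c i)) [1..<n + 1] (gamma_diagram w)"
    using assms by (auto simp: Res_def)
  have g: "fst (gamma_diagram w) = {1..n}" by (simp add: gamma_diagram_def)
  have s: "set [1..<n + 1] = {1..n}" by auto
  note f = fold_resolve[OF gamma_valid, of "[1..<n + 1]" c, unfolded g s tri_gamma, folded r]
  then show "valid_diagram w r" by auto
  have "tri_diagram w r = fold (\<lambda>i. slide (dual w) i (dual_choice i (c i))) [1..<n + 1] (gamma_diagram (dual w))"
    using f by auto
  then show "tri_diagram w r \<in> Res_dual (dual w)" unfolding Res_dual_def by auto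
qed

theorem Res_dual_bij: "bij_betw (tri_diagram w) (Res_dual w) (Res (dual w))"
proof (rule bij_betw_byWitness[where f' = "tri_diagram (dual w)"])
  interpret D: nonempty_word "dual w" by (rule nonempty_dual)
  show "\<forall>r\<in>Res_dual w. tri_diagram (dual w) (tri_diagram w r) = r"
    using Res_dual_map(1) tri_diagram_involution by blast
  show "\<forall>r\<in>Res (dual w). tri_diagram w (tri_diagram (dual w) r) = r"
    using D.Res_map(1) D.tri_diagram_involution unfolding dual_dual by blast
  show "tri_diagram w ` Res_dual w \<subseteq> Res (dual w)" using Res_dual_map(3) by blast
  show "tri_diagram (dual w) ` Res (dual w) \<subseteq> Res_dual w" using D.Res_map(2) unfolding dual_dual by blast
qed

lemma Res_dual_weight: "r \<in> Res_dual w \<Longrightarrow> res_weight (dual w) (tri_diagram w r) = res_weight w r"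
  using Res_dual_map res_weight_tri_diagram by blast

end

section \<open>Resolutions and the expansion formula\<close>

text \<open>The weight of the curve that a resolution leaves in a triangle; it is a loop if both ends are at the
  shared vertex.\<close>

definition piece :: "word \<Rightarrow> nat \<Rightarrow> side \<Rightarrow> side \<Rightarrow> ratfun" where
  "piece w k s t = (if joinable w k s t then X (join w k s t) else 0)"

definition partial_weight :: "word \<Rightarrow> nat set \<Rightarrow> nat \<Rightarrow> ratfun" where
  "partial_weight w I k = (\<Prod>j<k. piece w j (opposite (side_of I j)) (side_of I (Suc j)))"

text \<open>The choice at the diagonal \<open>k\<close> is prescribed because it decides where the arc
  continues in the triangle \<open>k\<close>.\<close>

definition partial_sum :: "word \<Rightarrow> nat \<Rightarrow> side \<Rightarrow> ratfun" where
  "partial_sum w k t = (\<Sum>I\<in>{I. I \<subseteq> {1..k} \<and> side_of I k = t}. partial_weight w I k)"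

lemma partial_weight_cong:
  assumes "I \<inter> {1..k} = J \<inter> {1..k}" shows "piece w 0 (opposite (side_of I 0)) = piece w 0 (opposite (side_of J 0)) \<Longrightarrow>
    partial_weight w I k = partial_weight w J k"
proof -
  assume 0: "piece w 0 (opposite (side_of I 0)) = piece w 0 (opposite (side_of J 0))"
  have "side_of I i = side_of J i" if "0 < i" "i \<le> k" for i
  proof -
    have "i \<in> I \<longleftrightarrow> i \<in> J" using assms that by (metis IntD1 IntI One_nat_def Suc_leI atLeastAtMost_iff)
    then show ?thesis by (simp add: side_of_def)
  qed
  note side = this
  have "piece w j (opposite (side_of I j)) (side_of I (Suc j)) = piece w j (opposite (side_of J j)) (side_of J (Suc j))"
    if "j < k" for j
    using side[of j] side[of "Suc j"] that 0 by (cases "j = 0") simp_all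
  then show ?thesis unfolding partial_weight_def by (intro prod.cong) auto
qed

lemma sum_by_side:
  assumes "finite \<I>"
  shows "(\<Sum>I\<in>\<I>. f I) = (\<Sum>I\<in>{I \<in> \<I>. side_of I k = Lft}. f I) + (\<Sum>I\<in>{I \<in> \<I>. side_of I k = Rgt}. (f I :: ratfun))"
proof -
  have "\<I> = {I \<in> \<I>. side_of I k = Lft} \<union> {I \<in> \<I>. side_of I k = Rgt}" using side.exhaust by auto
  moreover have "(\<Sum>I\<in>{I \<in> \<I>. side_of I k = Lft} \<union> {I \<in> \<I>. side_of I k = Rgt}. f I) =
      (\<Sum>I\<in>{I \<in> \<I>. side_of I k = Lft}. f I) + (\<Sum>I\<in>{I \<in> \<I>. side_of I k = Rgt}. f I)"
    using assms by (intro sum.union_disjoint) auto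
  ultimately show ?thesis by simp
qed

context nonempty_word
begin

lemma piece_0: "piece w 0 s t = piece w 0 s' t"
  by (simp add: piece_def join_0)

lemma partial_weight_restrict: "I \<inter> {1..k} = J \<inter> {1..k} \<Longrightarrow> partial_weight w I k = partial_weight w J k"
  by (rule partial_weight_cong) (auto intro: piece_0)

lemma partial_sum_1: "partial_sum w 1 t = piece w 0 Lft t"
proof -
  have "{I. I \<subseteq> {1..1::nat} \<and> side_of I 1 = t} = {if t = Lft then {1} else {}}"
  proof (rule Set.set_eqI)
    fix I :: "nat set"
    have "I \<subseteq> {1..1::nat} \<longleftrightarrow> I = {} \<or> I = {1}" by auto
    then show "I \<in> {I. I \<subseteq> {1..1::nat} \<and> side_of I 1 = t} \<longleftrightarrow> I \<in> {if t = Lft then {1} else {}}"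
      by (cases t) (auto simp: side_of_def)
  qed
  then show ?thesis
    by (cases t) (auto simp: partial_sum_def partial_weight_def side_of_def intro: piece_0)
qed

lemma partial_sum_Suc:
  assumes "0 < k"
  shows "partial_sum w (Suc k) t = partial_sum w k Lft * piece w k Rgt t + partial_sum w k Rgt * piece w k Lft t"
proof -
  let ?f = "\<lambda>I. partial_weight w I k * piece w k (opposite (side_of I k)) t"
  let ?ext = "\<lambda>I. if t = Lft then insert (Suc k) I else I"
  have "partial_sum w (Suc k) t = (\<Sum>I\<in>{I. I \<subseteq> {1..k}}. ?f I)"
    unfolding partial_sum_def
  proof (rule sum.reindex_bij_witness[where i = ?ext and j = "\<lambda>I. I - {Suc k}"])
    fix I assume I: "I \<in> {I. I \<subseteq> {1..Suc k} \<and> side_of I (Suc k) = t}"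
    then have mem: "Suc k \<in> I \<longleftrightarrow> t = Lft" by (auto simp: side_of_def split: if_splits)
    then show "?ext (I - {Suc k}) = I" "I - {Suc k} \<in> {I. I \<subseteq> {1..k}}"
      using I by (auto simp: atLeastAtMostSuc_conv)
    have "partial_weight w (I - {Suc k}) k = partial_weight w I k" by (rule partial_weight_restrict) auto
    moreover have "side_of (I - {Suc k}) k = side_of I k" by (simp add: side_of_def)
    ultimately show "partial_weight w (I - {Suc k}) k * piece w k (opposite (side_of (I - {Suc k}) k)) t =
        partial_weight w I (Suc k)" using I by (simp add: partial_weight_def)
  next
    fix I assume I: "I \<in> {I. I \<subseteq> {1..k}}"
    then have "Suc k \<notin> I" by auto
    then show "?ext I - {Suc k} = I" "?ext I \<in> {I. I \<subseteq> {1..Suc k} \<and> side_of I (Suc k) = t}"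
      using I by (cases t; auto simp: side_of_def)+
  qed
  also have "\<dots> = (\<Sum>I\<in>{I \<in> {I. I \<subseteq> {1..k}}. side_of I k = Lft}. ?f I) + (\<Sum>I\<in>{I \<in> {I. I \<subseteq> {1..k}}. side_of I k = Rgt}. ?f I)"
    by (rule sum_by_side) (simp flip: Pow_def)
  also have "(\<Sum>I\<in>{I \<in> {I. I \<subseteq> {1..k}}. side_of I k = Lft}. ?f I) = partial_sum w k Lft * piece w k Rgt t"
    unfolding partial_sum_def sum_distrib_right by (intro sum.cong) auto
  also have "(\<Sum>I\<in>{I \<in> {I. I \<subseteq> {1..k}}. side_of I k = Rgt}. ?f I) = partial_sum w k Rgt * piece w k Lft t"
    unfolding partial_sum_def sum_distrib_right by (intro sum.cong) auto
  finally show ?thesis .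
qed

text \<open>The Ptolemy relation for \<open>a\<close>, the vertex added by the triangle \<open>k\<close>, and the two end points of the diagonal
  \<open>k\<close>.\<close>

lemma ptolemy_fan:
  assumes k: "0 < k" "k \<le> n" and t: "k < n \<Longrightarrow> t = opposite (shared w k)"
  shows "lambda_length w {0, pt w (Suc k) t} * X k =
    lambda_length w {0, pt w k Lft} * X (side_after w k Rgt) + lambda_length w {0, pt w k Rgt} * X (side_after w k Lft)"
proof -
  let ?v = "pt w (Suc k) t"
  have "?v < pt w k Lft \<or> pt w k Rgt < ?v"
  proof (cases "k = n")
    case True then show ?thesis using pt_bounds[of n] rank_ge_2 by auto
  next
    case False then show ?thesis using t pt_bounds[of k] pt_new[of k] k by (auto simp del: pt.simps split: if_splits)
  qed
  then have "turn 0 (pt w k Lft) ?v" "turn ?v (pt w k Rgt) 0" using pt_bounds[OF k] by (auto simp: turn_def simp del: pt.simps)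
  from ptolemy[OF this, of w] show ?thesis
    using lambda_length_diagonal[OF k] lambda_length_side_after[OF k t, of Lft] lambda_length_side_after[OF k t, of Rgt]
    by (simp add: insert_commute algebra_simps del: pt.simps)
qed

lemma piece_after:
  assumes k: "0 < k" "k \<le> n" and t: "k < n \<Longrightarrow> t = opposite (shared w k)"
  shows "piece w k s t = X (side_after w k s)"
proof (cases "k = n")
  case True then show ?thesis by (simp add: piece_def join_last)
next
  case False
  then show ?thesis using join_after[OF k, of s] joinable_opposite(2)[of k s] t k by (simp add: piece_def)
qed

text \<open>The contributions of the triangles up to \<open>k\<close> telescope to the lambda length of
  the arc from \<open>a\<close> to an end point of the diagonal \<open>k\<close>: a vertex shared with the
  preceding diagonal only contributes a factor, and for a new vertex the two terms are those of a Ptolemy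
  relation.\<close>

lemma partial_sum_eq:
  "0 < k \<Longrightarrow> k \<le> n \<Longrightarrow> partial_sum w k t = (\<Prod>i\<in>{1..<k}. X i) * lambda_length w {0, pt w k t}"
proof (induction k arbitrary: t)
  case (Suc k)
  show ?case
  proof (cases "k = 0")
    case True
    have "piece w 0 Lft t = lambda_length w {pt w 0 Lft, pt w (Suc 0) t}"
      using lambda_length_join[of 0 Lft t] by (simp add: piece_def)
    then show ?thesis using True partial_sum_1[of t] by simp
  next
    case False
    then have k: "0 < k" "k < n" using Suc.prems by auto
    let ?sh = "shared w k"
    have IH: "partial_sum w k u = (\<Prod>i\<in>{1..<k}. X i) * lambda_length w {0, pt w k u}" for u
      using Suc.IH k by simp
    have prod: "(\<Prod>i\<in>{1..<Suc k}. X i) = (\<Prod>i\<in>{1..<k}. X i) * X k"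
      using k by (simp add: prod.atLeastLessThan_Suc)
    show ?thesis
    proof (cases "t = ?sh")
      case True
      have "piece w k ?sh t = 0" "piece w k (opposite ?sh) t = X k"
        using True k by (auto simp: piece_def joinable_mid join_mid)
      then have "partial_sum w (Suc k) t = partial_sum w k ?sh * X k"
        unfolding partial_sum_Suc[OF k(1)] using True by (cases ?sh) auto
      then show ?thesis using IH prod pt_shared[OF k] True by (simp add: algebra_simps del: pt.simps)
    next
      case False
      then have t: "t = opposite ?sh" using neq_iff_opposite by blast
      have "partial_sum w (Suc k) t = (\<Prod>i\<in>{1..<k}. X i) * (lambda_length w {0, pt w (Suc k) t} * X k)"
        unfolding partial_sum_Suc[OF k(1)] IH using ptolemy_fan[of k t] piece_after[of k t] t k
        by (simp add: algebra_simps del: pt.simps)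
      then show ?thesis unfolding prod by (simp add: algebra_simps del: pt.simps)
    qed
  qed
qed simp

definition resolution_weight :: "nat set \<Rightarrow> ratfun" where
  "resolution_weight I = (\<Prod>k\<le>n. piece w k (opposite (side_of I k)) (side_of I (Suc k)))"

theorem sum_resolutions: "(\<Sum>I\<in>Pow {1..n}. resolution_weight I) = x_diagonals w * x_word w"
proof -
  have n: "0 < n" "n \<le> n" using rank_ge_2 by auto
  \<comment> \<open>The last edge ends at \<open>b\<close>, so it does not depend on \<open>n +
    1\<close>.\<close>
  have irr: "piece w n s t = X (side_after w n s)" for s t using piece_after[of n t s] n by simp
  have w: "resolution_weight I = partial_weight w I n * piece w n (opposite (side_of I n)) (side_of I (Suc n))" for I
    unfolding resolution_weight_def partial_weight_def lessThan_Suc_atMost[symmetric] by simp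
  have "(\<Sum>I\<in>Pow {1..n}. resolution_weight I) =
      (\<Sum>I\<in>{I \<in> Pow {1..n}. side_of I n = Lft}. resolution_weight I) + (\<Sum>I\<in>{I \<in> Pow {1..n}. side_of I n = Rgt}. resolution_weight I)"
    by (rule sum_by_side) simp
  also have "(\<Sum>I\<in>{I \<in> Pow {1..n}. side_of I n = Lft}. resolution_weight I) = partial_sum w n Lft * X (side_after w n Rgt)"
    unfolding partial_sum_def sum_distrib_right by (intro sum.cong) (auto simp: w irr)
  also have "(\<Sum>I\<in>{I \<in> Pow {1..n}. side_of I n = Rgt}. resolution_weight I) = partial_sum w n Rgt * X (side_after w n Lft)"
    unfolding partial_sum_def sum_distrib_right by (intro sum.cong) (auto simp: w irr)
  also have "partial_sum w n Lft * X (side_after w n Rgt) + partial_sum w n Rgt * X (side_after w n Lft) =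
      (\<Prod>i\<in>{1..<n}. X i) * (lambda_length w {0, pt w (Suc n) Lft} * X n)"
    unfolding partial_sum_eq[OF n] using ptolemy_fan[of n Lft] n by (simp add: algebra_simps del: pt.simps)
  also have "\<dots> = x_diagonals w * x_word w"
  proof -
    have "{1..n} = insert n {1..<n}" using n by auto
    then show ?thesis by (simp add: x_diagonals_def x_word_eq algebra_simps)
  qed
  finally show ?thesis .
qed

text \<open>A resolution that is not given by an ideal contains a loop and has weight 0.\<close>

theorem x_word_expansion: "x_word w = 1 / x_diagonals w * (\<Sum>I\<in>ideals w. \<Prod>k\<le>n. X (selected w I k))"
proof -
  have "(\<Sum>I\<in>ideals w. \<Prod>k\<le>n. X (selected w I k)) = (\<Sum>I\<in>Pow {1..n}. resolution_weight I)"
  proof (rule sum.mono_neutral_cong_left)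
    show "ideals w \<subseteq> Pow {1..n}" by (auto simp: ideals_def)
    show "\<forall>I\<in>Pow {1..n} - ideals w. resolution_weight I = 0"
    proof
      fix I assume "I \<in> Pow {1..n} - ideals w"
      then obtain k where k: "\<not> joinable w k (opposite (side_of I k)) (side_of I (Suc k))" by (auto simp: ideals_def)
      then have "k \<in> {..n}" by (auto simp: joinable_def)
      then show "resolution_weight I = 0" using k unfolding resolution_weight_def
        by (intro prod_zero) (auto simp: piece_def)
    qed
    fix I assume "I \<in> ideals w"
    then show "(\<Prod>k\<le>n. X (selected w I k)) = resolution_weight I"
      by (simp add: resolution_weight_def piece_def selected_joinable selected_def)
  qed simp
  moreover have "x_diagonals w \<noteq> 0" by (simp add: x_diagonals_def)
  ultimately show ?thesis using sum_resolutions by simp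
qed

subsection \<open>Diagrams\<close>

lemma fold_cut:
  assumes "m \<le> n"
  shows "fold (\<lambda>i. cut i (v i) (v' i)) [1..<Suc m] (gamma_diagram w) =
    ({Suc m..n}, (\<lambda>k. (if k = 0 then vertex_a w else v' k, k, k, v (Suc k))) ` {..<m} \<union>
      {(if m = 0 then vertex_a w else v' m, m, n, vertex_b w)})"
  using assms
proof (induction m)
  case 0
  have "{Suc 0..n} = {1..n}" by simp
  then show ?case by (simp add: gamma_diagram_def)
next
  case (Suc m)
  let ?c = "\<lambda>k. if k = 0 then vertex_a w else v' k"
  let ?f = "\<lambda>k. (?c k, k, k, v (Suc k))"
  let ?A = "?f ` {..<m}" and ?x = "(?c m, m, n, vertex_b w)"
  have no: "\<not> crosses (Suc m) c" if "c \<in> ?A" for c using that by (elim imageE) (simp add: crosses_def)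
  have yes: "crosses (Suc m) ?x" using Suc.prems by (simp add: crosses_def)
  have filter: "{c \<in> ?A \<union> {?x}. \<not> crosses (Suc m) c} = ?A" "{c \<in> ?A \<union> {?x}. crosses (Suc m) c} = {?x}"
    using no yes by blast+
  have "fold (\<lambda>i. cut i (v i) (v' i)) [1..<Suc (Suc m)] (gamma_diagram w) =
      cut (Suc m) (v (Suc m)) (v' (Suc m)) ({Suc m..n}, ?A \<union> {?x})"
    using Suc by simp
  also have "\<dots> = ({Suc m..n} - {Suc m}, ?A \<union> {?f m} \<union> {(?c (Suc m), Suc m, n, vertex_b w)})"
    unfolding cut_eq fst_conv snd_conv filter by (simp add: part_before_def part_after_def)
  also have "{Suc m..n} - {Suc m} = {Suc (Suc m)..n}" by auto
  also have "?A \<union> {?f m} = ?f ` {..<Suc m}" by (simp only: lessThan_Suc image_insert Un_insert_right Un_empty_right)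
  finally show ?case .
qed

definition resolved :: "nat set \<Rightarrow> diagram" where
  "resolved I = fold (\<lambda>i. resolve w i (side_of I i)) [1..<n + 1] (gamma_diagram w)"

definition resolved_curve :: "nat set \<Rightarrow> nat \<Rightarrow> curve" where
  "resolved_curve I k = (vert w (pt w k (opposite (side_of I k))), k, k, vert w (pt w (Suc k) (side_of I (Suc k))))"

lemma resolved_eq: "resolved I = ({}, resolved_curve I ` {..n})"
proof -
  let ?v = "\<lambda>i. diag_end w i (side_of I i)" and ?v' = "\<lambda>i. diag_end w i (opposite (side_of I i))"
  let ?c = "\<lambda>k. (if k = 0 then vertex_a w else ?v' k, k, k, if k = n then vertex_b w else ?v (Suc k))"
  have "resolved I = ({}, (\<lambda>k. (if k = 0 then vertex_a w else ?v' k, k, k, ?v (Suc k))) ` {..<n} \<union>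
      {(if n = 0 then vertex_a w else ?v' n, n, n, vertex_b w)})"
    using fold_cut[of n ?v ?v'] by (simp add: resolved_def resolve_def)
  also have "(\<lambda>k. (if k = 0 then vertex_a w else ?v' k, k, k, ?v (Suc k))) ` {..<n} = ?c ` {..<n}"
    by (intro image_cong) auto
  also have "\<dots> \<union> {(if n = 0 then vertex_a w else ?v' n, n, n, vertex_b w)} = ?c ` {..n}"
    by (simp add: lessThan_Suc lessThan_Suc_atMost[symmetric])
  also have "?c ` {..n} = resolved_curve I ` {..n}"
  proof (rule image_cong[OF refl])
    fix k assume "k \<in> {..n}"
    then show "?c k = resolved_curve I k"
      using diag_end_eq[of k] diag_end_eq[of "Suc k"]
      by (auto simp: resolved_curve_def vertex_a_eq vertex_b_eq add.commute simp del: pt.simps(2))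
  qed
  finally show ?thesis .
qed

lemma curve_weight_piece:
  assumes "k \<le> n"
  shows "curve_weight w (vert w (pt w k s), k, k, vert w (pt w (Suc k) t)) = piece w k s t"
proof (cases "joinable w k s t")
  case True
  let ?p = "vert w (pt w k s)" and ?q = "vert w (pt w (Suc k) t)"
  have "?p \<noteq> ?q" using pt_step_neq[OF assms True] vert_eq_iff pt_in_positions assms
    by (simp del: pt.simps)
  moreover have "(THE e. e \<in> labels \<and> ends w e = {?p, ?q}) = join w k s t"
    using ends_join[OF assms True] join_in_labels[OF assms, of s t] ends_inject by (intro the_equality) auto
  ultimately show ?thesis using True by (simp add: curve_weight_def piece_def)
next
  case False
  then show ?thesis using not_joinable_eq[OF False] by (simp add: curve_weight_def piece_def)
qed

lemma res_weight_resolved: "res_weight w (resolved I) = resolution_weight I"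
proof -
  have inj: "inj_on (resolved_curve I) {..n}" by (auto simp: inj_on_def resolved_curve_def)
  have "res_weight w (resolved I) = (\<Prod>k\<le>n. curve_weight w (resolved_curve I k))"
    unfolding res_weight_def resolved_eq snd_conv by (simp add: prod.reindex[OF inj])
  also have "\<dots> = resolution_weight I" unfolding resolution_weight_def
    using curve_weight_piece by (intro prod.cong) (auto simp: resolved_curve_def)
  finally show ?thesis .
qed

lemma Res_eq: "Res w = resolved ` Pow {1..n}"
proof -
  have eq: "fold (\<lambda>i. resolve w i (c i)) [1..<n + 1] (gamma_diagram w) = resolved {i \<in> {1..n}. c i = Lft}" for c
    unfolding resolved_def
  proof (rule fold_cong)
    fix i assume "i \<in> set [1..<n + 1]"
    then have "c i = side_of {i \<in> {1..n}. c i = Lft} i" by (cases "c i") (auto simp: side_of_def)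
    then show "resolve w i (c i) = resolve w i (side_of {i \<in> {1..n}. c i = Lft} i)" by simp
  qed auto
  show ?thesis
  proof (intro subset_antisym subsetI)
    fix r assume "r \<in> Res w"
    then obtain c where "r = fold (\<lambda>i. resolve w i (c i)) [1..<n + 1] (gamma_diagram w)" unfolding Res_def by blast
    then have "r = resolved {i \<in> {1..n}. c i = Lft}" unfolding eq .
    then show "r \<in> resolved ` Pow {1..n}" by (rule image_eqI) blast
  next
    fix r assume "r \<in> resolved ` Pow {1..n}"
    then show "r \<in> Res w" unfolding Res_def by (elim imageE) (simp only: resolved_def, blast)
  qed
qed

lemma inj_resolved: "inj_on resolved (Pow {1..n})"
proof (rule inj_onI)
  fix I J assume *: "I \<in> Pow {1..n}" "J \<in> Pow {1..n}" "resolved I = resolved J"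
  have "i \<in> I \<longleftrightarrow> i \<in> J" if i: "i \<in> {1..n}" for i
  proof -
    define k where "k = i - 1"
    have k: "i = Suc k" "k < n" using i by (auto simp: k_def)
    have "resolved_curve I k \<in> resolved_curve J ` {..n}" using *(3) k unfolding resolved_eq by auto
    then have "resolved_curve I k = resolved_curve J k" by (auto simp: resolved_curve_def)
    then have "vert w (pt w i (side_of I i)) = vert w (pt w i (side_of J i))" using k by (simp add: resolved_curve_def)
    then have "side_of I i = side_of J i" using vert_eq_iff pt_in_positions[of i] pt_side_cancel[of i] i by simp
    then show ?thesis by (auto simp: side_of_def split: if_splits)
  qed
  then show "I = J" using *(1,2) by blast
qed

theorem sum_Res: "(\<Sum>r\<in>Res w. res_weight w r) = x_diagonals w * x_word w"
  unfolding Res_eq sum.reindex[OF inj_resolved] comp_def res_weight_resolved by (rule sum_resolutions)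

end

section \<open>The six expansions and their lattices\<close>

context nonempty_word
begin

theorem x_dual_eq: "x_dual w = x_word (dual w)"
proof -
  have "(\<Sum>r\<in>Res_dual w. res_weight w r) = (\<Sum>r\<in>Res_dual w. res_weight (dual w) (tri_diagram w r))"
    by (intro sum.cong refl) (simp add: Res_dual_weight)
  also have "\<dots> = (\<Sum>r\<in>Res (dual w). res_weight (dual w) r)" by (rule sum.reindex_bij_betw[OF Res_dual_bij])
  also have "\<dots> = x_diagonals w * x_word (dual w)"
    using nonempty_word.sum_Res[OF nonempty_dual] by (simp add: x_diagonals_def)
  finally have "(\<Sum>r\<in>Res_dual w. res_weight w r) = x_diagonals w * x_word (dual w)" .
  moreover have "x_diagonals w \<noteq> 0" by (simp add: x_diagonals_def)
  ultimately show ?thesis by (simp add: x_dual_def)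
qed

lemma sum_modelled:
  assumes "modelled v E \<Phi>" "\<And>I. I \<in> ideals v \<Longrightarrow> weight E (\<Phi> I) = f I"
  shows "(\<Sum>x\<in>nodes E. weight E x) = (\<Sum>I\<in>ideals v. f I)"
proof -
  have "(\<Sum>I\<in>ideals v. weight E (\<Phi> I)) = (\<Sum>x\<in>nodes E. weight E x)"
    using assms(1) by (intro sum.reindex_bij_betw) (simp add: modelled_def)
  then show ?thesis using assms(2) by (simp cong: sum.cong)
qed

lemma modelled_isomorphic:
  "modelled v E \<Phi> \<Longrightarrow> rank u = rank v \<Longrightarrow>
    isomorphic_lattices (order_ideals (C_poset v)) (lattice_of u E) \<and>
    isomorphic_lattices (lattice_of u E) (order_ideals (C_poset v))"
  unfolding isomorphic_lattices_def using modelled_lattice_iso lattice_iso_inverse by blast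

text \<open>Matchings for \<open>w\<close> and lattice paths for the dual word with the same index are
  drawn by the same angles.\<close>

lemma snake_edge_matching_iff:
  assumes "I \<in> ideals w" "\<alpha> \<in> angles w"
  shows "snake_edge w \<alpha> \<in> matching I \<longleftrightarrow> \<alpha> \<in> angle_set I"
  unfolding matching_def using assms angle_set_subset by (intro inj_on_image_mem_iff[OF inj_snake_edge])

lemma snake_edge_path_iff:
  assumes "I \<in> ideals (dual w)" "\<alpha> \<in> angles w"
  shows "snake_edge w \<alpha> \<in> path_edges (grid_path I) \<longleftrightarrow> \<alpha> \<in> nonempty_word.angle_set (dual w) I"
  unfolding path_edges_grid_path[OF assms(1)]
  using assms nonempty_word.angle_set_subset[OF nonempty_dual, of I]
  by (intro inj_on_image_mem_iff[OF inj_snake_edge]) (simp_all add: angles_dual)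

end

theorem theorem6p22:
  fixes w :: word
  assumes "w \<noteq> []"
  shows
    "\<comment> \<open>(a)\<close>
     (\<forall>h. bij_betw (map_dtree (tri_diagram w)) (Tree_dual h w) (Tree h (dual w)) \<and>
       (\<forall>t\<in>Tree_dual h w. \<forall>D\<in>leaves t.
          node_weight (dual w) (tri_diagram w D) = node_weight w D)) \<and>
    \<comment> \<open>(b)\<close>
     (bij_betw (tri_diagram w) (Res_dual w) (Res (dual w)) \<and>
       (\<forall>r\<in>Res_dual w. res_weight (dual w) (tri_diagram w r) = res_weight w r)) \<and>
    \<comment> \<open>(c)\<close>
     (x_dual w \<in> cluster_variables (dual w) \<and> x_dual w = x_word (dual w)) \<and>
    \<comment> \<open>(d)\<close>
     (\<exists>fPA fAP fAT fTA fPT fTP fLB fBL fBS fSB fLS fSL fPL fAB fTS.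
        inverse_expansion_isos w (PM w) (AM w) fPA fAP \<and>
        inverse_expansion_isos w (AM w) (TP w) fAT fTA \<and>
        inverse_expansion_isos w (PM w) (TP w) fPT fTP \<and>
        inverse_expansion_isos (dual w) (LP (dual w)) (AP (dual w)) fLB fBL \<and>
        inverse_expansion_isos (dual w) (AP (dual w)) (SP (dual w)) fBS fSB \<and>
        inverse_expansion_isos (dual w) (LP (dual w)) (SP (dual w)) fLS fSL \<and>
        expansion_iso w (PM w) (dual w) (LP (dual w)) fPL \<and>
        expansion_iso w (AM w) (dual w) (AP (dual w)) fAB \<and>
        expansion_iso w (TP w) (dual w) (SP (dual w)) fTS \<and>
        (\<forall>P\<in>nodes (PM w). \<forall>\<alpha>\<in>angles w.
           snake_edge w \<alpha> \<in> P \<longleftrightarrow> snake_edge (dual w) (tri_angle \<alpha>) \<in> path_edges (fPL P)) \<and>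
        (\<forall>A\<in>nodes (AM w). fAB A = tri_angle ` A) \<and>
        (\<forall>T\<in>nodes (TP w). \<forall>e.
           int (count_list (fTS T) e) = colour T e + of_bool (e \<in> {1..rank w})) \<and>
        (\<forall>P\<in>nodes (PM w).
           fAT (fPA P) = fPT P \<and> fAB (fPA P) = fLB (fPL P) \<and> fTS (fPT P) = fLS (fPL P)) \<and>
        (\<forall>A\<in>nodes (AM w). fTS (fAT A) = fBS (fAB A)) \<and>
        (\<forall>L\<in>nodes (LP (dual w)). fBS (fLB L) = fLS L) \<and>
        (\<forall>P\<in>nodes (PM w).
           weight (AM w) (fPA P) = weight (PM w) P \<and>
           weight (TP w) (fPT P) = 1 / x_diagonals w * weight (PM w) P \<and>
           weight (LP (dual w)) (fPL P) = weight (PM w) P \<and>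
           weight (AP (dual w)) (fLB (fPL P)) = weight (PM w) P \<and>
           weight (SP (dual w)) (fLS (fPL P)) = weight (PM w) P)) \<and>
    \<comment> \<open>(e)\<close>
     (x_word w = 1 / x_diagonals w * (\<Sum>L\<in>nodes (LP (dual w)). weight (LP (dual w)) L) \<and>
      x_word w = 1 / x_diagonals w * (\<Sum>B\<in>nodes (AP (dual w)). weight (AP (dual w)) B) \<and>
      x_word w = 1 / x_diagonals w * (\<Sum>S\<in>nodes (SP (dual w)). weight (SP (dual w)) S)) \<and>
    \<comment> \<open>(f)\<close>
     (isomorphic_lattices (D_lattice w) (order_ideals (C_poset w)) \<and>
      isomorphic_lattices (order_ideals (C_poset w)) (lattice_of w (PM w)) \<and>
      isomorphic_lattices (D_lattice (dual w)) (order_ideals (C_star_poset w)) \<and>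
      isomorphic_lattices (order_ideals (C_star_poset w)) (lattice_of w (LP w)) \<and>
      isomorphic_lattices (lattice_of w (PM w)) (D_lattice w) \<and>
      isomorphic_lattices (lattice_of w (LP w)) (D_lattice (dual w)))"
proof -
  interpret W: nonempty_word w using assms by unfold_locales
  interpret D: nonempty_word "dual w" by (rule W.nonempty_dual)
  have rank: "rank w = rank w" "rank (dual w) = rank w" by simp_all
  note PM = W.PM_modelled and AM = W.AM_modelled and TP = W.TP_modelled
  note LP = D.LP_modelled[unfolded dual_dual] and AP = D.AP_modelled[unfolded dual_dual]
    and SP = D.SP_modelled[unfolded dual_dual]
  let ?t = "transfer_index w"
  note weights = W.PM_weight W.AM_weight W.TP_weight D.LP_weight[unfolded dual_dual]
    D.AP_weight[unfolded dual_dual] D.SP_weight[unfolded dual_dual]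
  have x_word: "x_word w = 1 / x_diagonals w * (\<Sum>I\<in>ideals w. \<Prod>k\<le>rank w. X (selected w I k))"
    by (rule W.x_word_expansion)
  have a: "\<forall>h. bij_betw (map_dtree (tri_diagram w)) (Tree_dual h w) (Tree h (dual w)) \<and>
       (\<forall>t\<in>Tree_dual h w. \<forall>D\<in>leaves t.
          node_weight (dual w) (tri_diagram w D) = node_weight w D)"
    using W.Tree_dual_bij W.Tree_dual_leaf_weight by simp
  have b: "bij_betw (tri_diagram w) (Res_dual w) (Res (dual w)) \<and>
       (\<forall>r\<in>Res_dual w. res_weight (dual w) (tri_diagram w r) = res_weight w r)"
    using W.Res_dual_bij W.Res_dual_weight by simp
  have c: "x_dual w \<in> cluster_variables (dual w) \<and> x_dual w = x_word (dual w)"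
    using W.x_dual_eq D.x_word_cluster_variable by simp
  have e: "x_word w = 1 / x_diagonals w * (\<Sum>L\<in>nodes (LP (dual w)). weight (LP (dual w)) L) \<and>
      x_word w = 1 / x_diagonals w * (\<Sum>B\<in>nodes (AP (dual w)). weight (AP (dual w)) B) \<and>
      x_word w = 1 / x_diagonals w * (\<Sum>S\<in>nodes (SP (dual w)). weight (SP (dual w)) S)"
    using W.sum_modelled[OF LP weights(4)] W.sum_modelled[OF AP weights(5)] W.sum_modelled[OF SP weights(6)] x_word by simp
  have lattice_refl: "isomorphic_lattices (order_ideals (C_poset v)) (order_ideals (C_poset v))" for v
    by (rule isomorphic_lattices_refl[OF order_ideals_distributive])
  have f: "isomorphic_lattices (D_lattice w) (order_ideals (C_poset w)) \<and>
      isomorphic_lattices (order_ideals (C_poset w)) (lattice_of w (PM w)) \<and>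
      isomorphic_lattices (D_lattice (dual w)) (order_ideals (C_star_poset w)) \<and>
      isomorphic_lattices (order_ideals (C_star_poset w)) (lattice_of w (LP w)) \<and>
      isomorphic_lattices (lattice_of w (PM w)) (D_lattice w) \<and>
      isomorphic_lattices (lattice_of w (LP w)) (D_lattice (dual w))"
    unfolding C_star_poset_eq D_lattice_def
    using lattice_refl[of w] lattice_refl[of "dual w"] W.modelled_isomorphic[OF PM rank(1)]
      W.modelled_isomorphic[OF W.LP_modelled rank(2)[symmetric]] by simp
  have nodes: "\<And>Q. (\<forall>P\<in>nodes (PM w). Q P) \<longleftrightarrow> (\<forall>I\<in>ideals w. Q (W.matching I))"
    "\<And>Q. (\<forall>A\<in>nodes (AM w). Q A) \<longleftrightarrow> (\<forall>I\<in>ideals w. Q (W.angle_set I))"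
    "\<And>Q. (\<forall>T\<in>nodes (TP w). Q T) \<longleftrightarrow> (\<forall>I\<in>ideals w. Q (W.T_list I))"
    "\<And>Q. (\<forall>L\<in>nodes (LP (dual w)). Q L) \<longleftrightarrow> (\<forall>I\<in>ideals w. Q (D.grid_path I))"
    unfolding modelled_nodes[OF PM] modelled_nodes[OF AM] modelled_nodes[OF TP] modelled_nodes[OF LP] by blast+
  note move = transfer_index_eq[OF PM] transfer_index_eq[OF AM] transfer_index_eq[OF TP]
    transfer_index_eq[OF LP] transfer_index_eq[OF AP] transfer_index_eq[OF SP]
  have tri_angle: "tri_angle = id" by (rule ext) (simp add: tri_angle_def)
  have snake: "snake_edge w \<alpha> \<in> W.matching I \<longleftrightarrow> snake_edge (dual w) \<alpha> \<in> path_edges (D.grid_path I)"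
    if "I \<in> ideals w" "\<alpha> \<in> angles w" for I \<alpha>
    using W.snake_edge_matching_iff[OF that] D.snake_edge_path_iff[unfolded dual_dual, of I \<alpha>] that W.angles_dual
    by simp
  have count: "int (count_list (W.S_list I) x) = colour (W.T_list I) x + of_bool (x \<in> {1..rank w})"
    if "I \<in> ideals w" for I x
    using W.count_list_S_list[of I x] W.colour_T_list[OF that, of x] by simp
  \<comment> \<open>All maps preserve the index, hence the diagram commutes.\<close>
  have d: "\<exists>fPA fAP fAT fTA fPT fTP fLB fBL fBS fSB fLS fSL fPL fAB fTS.
        inverse_expansion_isos w (PM w) (AM w) fPA fAP \<and>
        inverse_expansion_isos w (AM w) (TP w) fAT fTA \<and>
        inverse_expansion_isos w (PM w) (TP w) fPT fTP \<and>
        inverse_expansion_isos (dual w) (LP (dual w)) (AP (dual w)) fLB fBL \<and>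
        inverse_expansion_isos (dual w) (AP (dual w)) (SP (dual w)) fBS fSB \<and>
        inverse_expansion_isos (dual w) (LP (dual w)) (SP (dual w)) fLS fSL \<and>
        expansion_iso w (PM w) (dual w) (LP (dual w)) fPL \<and>
        expansion_iso w (AM w) (dual w) (AP (dual w)) fAB \<and>
        expansion_iso w (TP w) (dual w) (SP (dual w)) fTS \<and>
        (\<forall>P\<in>nodes (PM w). \<forall>\<alpha>\<in>angles w.
           snake_edge w \<alpha> \<in> P \<longleftrightarrow> snake_edge (dual w) (tri_angle \<alpha>) \<in> path_edges (fPL P)) \<and>
        (\<forall>A\<in>nodes (AM w). fAB A = tri_angle ` A) \<and>
        (\<forall>T\<in>nodes (TP w). \<forall>e.
           int (count_list (fTS T) e) = colour T e + of_bool (e \<in> {1..rank w})) \<and>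
        (\<forall>P\<in>nodes (PM w).
           fAT (fPA P) = fPT P \<and> fAB (fPA P) = fLB (fPL P) \<and> fTS (fPT P) = fLS (fPL P)) \<and>
        (\<forall>A\<in>nodes (AM w). fTS (fAT A) = fBS (fAB A)) \<and>
        (\<forall>L\<in>nodes (LP (dual w)). fBS (fLB L) = fLS L) \<and>
        (\<forall>P\<in>nodes (PM w).
           weight (AM w) (fPA P) = weight (PM w) P \<and>
           weight (TP w) (fPT P) = 1 / x_diagonals w * weight (PM w) P \<and>
           weight (LP (dual w)) (fPL P) = weight (PM w) P \<and>
           weight (AP (dual w)) (fLB (fPL P)) = weight (PM w) P \<and>
           weight (SP (dual w)) (fLS (fPL P)) = weight (PM w) P)"
    by (rule exI[of _ "?t W.matching W.angle_set"],
      rule exI[of _ "?t W.angle_set W.matching"],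
      rule exI[of _ "?t W.angle_set W.T_list"],
      rule exI[of _ "?t W.T_list W.angle_set"],
      rule exI[of _ "?t W.matching W.T_list"],
      rule exI[of _ "?t W.T_list W.matching"],
      rule exI[of _ "?t D.grid_path W.angle_set"],
      rule exI[of _ "?t W.angle_set D.grid_path"],
      rule exI[of _ "?t W.angle_set W.S_list"],
      rule exI[of _ "?t W.S_list W.angle_set"],
      rule exI[of _ "?t D.grid_path W.S_list"],
      rule exI[of _ "?t W.S_list D.grid_path"],
      rule exI[of _ "?t W.matching D.grid_path"],
      rule exI[of _ "?t W.angle_set W.angle_set"],
      rule exI[of _ "?t W.T_list W.S_list"],
      intro conjI)
      (use transfer_index_inverse_isos[OF PM AM] transfer_index_inverse_isos[OF AM TP]
        transfer_index_inverse_isos[OF PM TP] transfer_index_inverse_isos[OF LP AP] transfer_index_inverse_isos[OF AP SP]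
        transfer_index_inverse_isos[OF LP SP] transfer_index_expansion_iso[OF PM LP] transfer_index_expansion_iso[OF AM AP]
        transfer_index_expansion_iso[OF TP SP] in
        \<open>simp_all add: nodes move snake count weights tri_angle\<close>)
  show ?thesis
    by (rule conjI[OF a conjI[OF b conjI[OF c conjI[OF d conjI[OF e f]]]]])
qed

end
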